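(* Let $G(\beta)$ and $G^*(\beta)$, $0<\beta<1$, be the assertions about finitely generated infinite groups defined in the context. (i) $G(1/6)$ and, moreover, $G^*(1/6)$ hold for the class of right orderable groups. That is, every finitely generated infinite right orderable group $G$ with $\gamma_G(n)\prec e^{n^{1/6}}$ has polynomial growth, and moreover every finitely generated infinite right orderable group $G$ which is not virtually nilpotent satisfies $\gamma_G(n)\succeq e^{n^{1/6}}$. (ii) If $G(1/2)$ holds for the class of residually polycyclic groups, then $G(1/2)$ holds for the class of right orderable groups. If $G^*(1/2)$ holds for the class of residually polycyclic groups, then $G^*(1/2)$ holds for the class of right orderable groups.
   Context: All groups whose growth is considered are infinite and finitely generated, and generating sets are finite. For a group $G$ with finite generating set $A$, $|g|_A$ is the least length of an expression of $g$ as a product of elements of $A\cup A^{-1}$, and the growth function is $\gamma_G(n)=\gamma_G^A(n)=|\{g\in G:|g|_A\le n\}|$, $n\in\mathbb N$. Comparison of functions on the natural numbers: $\gamma_1\preceq\gamma_2$ (equivalently $\gamma_2\succeq\gamma_1$) means there is an integer $C>1$ with $\gamma_1(n)\le\gamma_2(Cn)$ for all $n\ge1$; $\gamma_1\prec\gamma_2$ is the strict version: $\gamma_1\preceq\gamma_2$ but not $\gamma_2\preceq\gamma_1$. The validity of these comparisons for $\gamma_G$ does not depend on the choice of $A$. $G$ has polynomial growth if there are $C,d>0$ with $\gamma_G(n)<Cn^d$ for all $n\ge1$. A group is virtually nilpotent if it has a nilpotent subgroup of finite index. For $0<\beta<1$ and a class $\mathcal C$ of groups: "$G(\beta)$ holds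 for $\mathcal C$" means: every finitely generated infinite group $G\in\mathcal C$ with $\gamma_G(n)\prec e^{n^\beta}$ has polynomial growth. "$G^*(\beta)$ holds for $\mathcal C$" means: every finitely generated infinite group $G\in\mathcal C$ which is not virtually nilpotent satisfies $\gamma_G(n)\succeq e^{n^\beta}$. The Gap Conjecture is $G(1/2)$. A group is right orderable if there is a linear order on the set of its elements invariant under multiplication on the right. A group $G$ is residually polycyclic if for every $1\ne g\in G$ there is a homomorphism from $G$ to a polycyclic group not killing $g$. *)

theory Defs
  imports Complex_Main "HOL-Algebra.Algebra"
begin

section \<open>Growth of finitely generated groups\<close>

definition finite_generating_set :: "('a, 'm) monoid_scheme \<Rightarrow> 'a set \<Rightarrow> bool"
  where "finite_generating_set G A \<longleftrightarrow>
    finite A \<and> A \<subseteq> carrier G \<and> generate G A = carrier G"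

text \<open>Only meaningful if \<open>A\<close> generates \<open>G\<close> and \<open>g \<in> carrier G\<close>; otherwise there may be
  no word for \<open>g\<close>.\<close>

definition word_length :: "('a, 'm) monoid_scheme \<Rightarrow> 'a set \<Rightarrow> 'a \<Rightarrow> nat"
  where "word_length G A g =
    (LEAST n. \<exists>ws. set ws \<subseteq> A \<union> m_inv G ` A \<and> length ws = n \<and>
                   foldr (\<otimes>\<^bsub>G\<^esub>) ws \<one>\<^bsub>G\<^esub> = g)"

definition growth :: "('a, 'm) monoid_scheme \<Rightarrow> 'a set \<Rightarrow> nat \<Rightarrow> nat"
  where "growth G A n = card {g \<in> carrier G. word_length G A g \<le> n}"

definition growth_le :: "(nat \<Rightarrow> real) \<Rightarrow> (nat \<Rightarrow> real) \<Rightarrow> bool"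
  where "growth_le f g \<longleftrightarrow> (\<exists>C>1. \<forall>n\<ge>1. f n \<le> g (C * n))"

definition growth_less :: "(nat \<Rightarrow> real) \<Rightarrow> (nat \<Rightarrow> real) \<Rightarrow> bool"
  where "growth_less f g \<longleftrightarrow> growth_le f g \<and> \<not> growth_le g f"

definition polynomial_growth :: "('a, 'm) monoid_scheme \<Rightarrow> 'a set \<Rightarrow> bool"
  where "polynomial_growth G A \<longleftrightarrow>
    (\<exists>C d :: real. C > 0 \<and> d > 0 \<and> (\<forall>n\<ge>1. real (growth G A n) < C * real n powr d))"


section \<open>Classes of groups\<close>

primrec lower_central_series :: "('a, 'm) monoid_scheme \<Rightarrow> nat \<Rightarrow> 'a set"
  where
    "lower_central_series G 0 = carrier G"
  | "lower_central_series G (Suc n) =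
       generate G {x \<otimes>\<^bsub>G\<^esub> y \<otimes>\<^bsub>G\<^esub> inv\<^bsub>G\<^esub> x \<otimes>\<^bsub>G\<^esub> inv\<^bsub>G\<^esub> y | x y.
                     x \<in> lower_central_series G n \<and> y \<in> carrier G}"

definition nilpotent_group :: "('a, 'm) monoid_scheme \<Rightarrow> bool"
  where "nilpotent_group G \<longleftrightarrow>
    group G \<and> (\<exists>n. lower_central_series G n = {\<one>\<^bsub>G\<^esub>})"

definition virtually_nilpotent :: "('a, 'm) monoid_scheme \<Rightarrow> bool"
  where "virtually_nilpotent G \<longleftrightarrow>
    group G \<and>
    (\<exists>H. subgroup H G \<and> finite (rcosets\<^bsub>G\<^esub> H) \<and> nilpotent_group (G\<lparr>carrier := H\<rparr>))"

text \<open>Polycyclic: there is a finite subnormal series from \<open>G\<close> down to the trivial subgroup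
  with cyclic factors. The inductive definition follows that of \<^const>\<open>solvable_seq\<close>.\<close>

inductive polycyclic_seq :: "('a, 'm) monoid_scheme \<Rightarrow> 'a set \<Rightarrow> bool"
  for G where
    unity: "polycyclic_seq G {\<one>\<^bsub>G\<^esub>}"
  | extension: "\<lbrakk> polycyclic_seq G K; K \<lhd> (G\<lparr>carrier := H\<rparr>); subgroup H G;
                  cyclic_group ((G\<lparr>carrier := H\<rparr>) Mod K) \<rbrakk> \<Longrightarrow> polycyclic_seq G H"

definition polycyclic :: "('a, 'm) monoid_scheme \<Rightarrow> bool"
  where "polycyclic G \<longleftrightarrow> group G \<and> polycyclic_seq G (carrier G)"

text \<open>Polycyclic groups are finitely generated, hence countable, so up to isomorphism each of
  them has its elements in \<^typ>\<open>nat\<close>: restricting the target \<open>P\<close> to this type loses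
  no homomorphism to a polycyclic group.\<close>

definition residually_polycyclic :: "('a, 'm) monoid_scheme \<Rightarrow> bool"
  where "residually_polycyclic G \<longleftrightarrow>
    group G \<and>
    (\<forall>g \<in> carrier G. g \<noteq> \<one>\<^bsub>G\<^esub> \<longrightarrow>
       (\<exists>(P :: nat monoid) h. polycyclic P \<and> h \<in> hom G P \<and> h g \<noteq> \<one>\<^bsub>P\<^esub>))"

definition right_orderable :: "('a, 'm) monoid_scheme \<Rightarrow> bool"
  where "right_orderable G \<longleftrightarrow>
    group G \<and>
    (\<exists>r. linear_order_on (carrier G) r \<and>
         (\<forall>x \<in> carrier G. \<forall>y \<in> carrier G. \<forall>z \<in> carrier G.
            (x, y) \<in> r \<longrightarrow> (x \<otimes>\<^bsub>G\<^esub> z, y \<otimes>\<^bsub>G\<^esub> z) \<in> r))"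


section \<open>The gap properties\<close>

text \<open>A class of groups is a predicate on groups with elements in a type \<open>'a\<close>. Infinite
  finitely generated groups are countably infinite, so \<open>'a = nat\<close> (or any infinite type)
  covers all of them up to isomorphism.

  Neither the comparisons nor polynomial growth depend on the finite generating set, so
  \<open>A\<close> is quantified together with \<open>G\<close>. The parameter \<open>\<beta>\<close> is meant to satisfy
  \<open>0 < \<beta> < 1\<close>.\<close>

definition gap_property :: "real \<Rightarrow> ('a monoid \<Rightarrow> bool) \<Rightarrow> bool"
  where "gap_property \<beta> \<C> \<longleftrightarrow>
    (\<forall>(G :: 'a monoid) A.
       group G \<and> infinite (carrier G) \<and> finite_generating_set G A \<and> \<C> G \<and>
       growth_less (\<lambda>n. real (growth G A n)) (\<lambda>n. exp (real n powr \<beta>)) \<longrightarrow>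
       polynomial_growth G A)"

definition strong_gap_property :: "real \<Rightarrow> ('a monoid \<Rightarrow> bool) \<Rightarrow> bool"
  where "strong_gap_property \<beta> \<C> \<longleftrightarrow>
    (\<forall>(G :: 'a monoid) A.
       group G \<and> infinite (carrier G) \<and> finite_generating_set G A \<and> \<C> G \<and>
       \<not> virtually_nilpotent G \<longrightarrow>
       growth_le (\<lambda>n. exp (real n powr \<beta>)) (\<lambda>n. real (growth G A n)))"

end

(* In a finitely generated right orderable group of growth below exp(n^(1/2)) there is no free semigroup, so the order
   has no crossings and every nontrivial finitely generated subgroup has infinite abelianization (Conrad). Choose M
   such that the ball of radius L M^6 has fewer than 2^M elements. Ascending chains of subgroups generated by short elements have length below M, so
   the j-th derived subgroup D_j is generated by elements of length about 4^j M, and its elementary abelian quotients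
   have rank below M as long as 4^j M^2 is below L M^6. A solvable group acting on a finite abelian group whose order has
   w prime factors, counted with multiplicity, acts through a quotient of derived length d with 2^d = O(w^2). Hence for
   2^k about M^2 the group D_k acts trivially on the torsion-free abelianizations of D_(k+1) and D_(k+2), which forces
   D_(k+2) to vanish: growth below exp(n^(1/6)) implies solvability. In a solvable group of growth below exp(n^(1/2)), a
   linear recurrence with coefficients -1, 0, 1 together with a congruence modulo 3 makes a subgroup of finite index act
   unipotently on the derived factors (Milnor, Wolf), so the group is virtually nilpotent. For the exponent 1/2, either
   the derived series terminates, or the quotient by its intersection is a residually polycyclic group of no larger
   growth that is neither of polynomial growth nor virtually nilpotent. *)
theory Submission
 imports Defs
begin

text \<open>The exponent 6 is a budget. A derivation multiplies the length of generators by about 4,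
  so with 2^k of order M^2 the generators of D_(k+2) have length of order 4^k M, that is M^5, and a
  chain of up to M of them needs a ball of radius of order M^6. The square in 2^d = O(w^2) thus
  dictates the exponent, and much of the work goes into it. The obstacle is the irreducible section:
  the acting group has a permutation part, a Galois part and a part of nilpotency class two. On a
  component of dimension e the last part leads to sections of order at most e^2, whose prime length
  is only logarithmic in e and is absorbed by induction; for small e a cruder bound by the order of
  the section steps in. Groups are written additively in the non-commutative class
  \<open>group_add\<close>, with \<open>x + - y\<close> kept as it stands so that associativity
  normalizes words. Subgroups are sets, and a quotient is the image of a homomorphism into the
  permutations of sets of group elements, so that one type serves all quotients of a group.
  Homomorphisms to the integers take the place of rational vector spaces.\<close>

declare add_uminus_conv_diff [simp del]

section \<open>Subgroups, words and commutators in additive notation\<close>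

definition cm :: "'g::group_add \<Rightarrow> 'g \<Rightarrow> 'g"
 where "cm x y = x + y + - x + - y"

definition sg :: "'g::group_add set \<Rightarrow> bool"
 where "sg H \<longleftrightarrow> 0 \<in> H \<and> (\<forall>x\<in>H. \<forall>y\<in>H. x + y \<in> H) \<and> (\<forall>x\<in>H. - x \<in> H)"

definition ball :: "'g::group_add set \<Rightarrow> nat \<Rightarrow> 'g set"
 where "ball S n = {sum_list ws | ws. set ws \<subseteq> S \<union> uminus ` S \<and> length ws \<le> n}"

definition gen :: "'g::group_add set \<Rightarrow> 'g set"
 where "gen S = (\<Union>n. ball S n)"

definition nm :: "nat \<Rightarrow> 'g::group_add \<Rightarrow> 'g"
 where "nm n x = sum_list (replicate n x)"

definition der :: "'g::group_add set \<Rightarrow> 'g set"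
 where "der H = gen {cm x y | x y. x \<in> H \<and> y \<in> H}"

definition dern :: "nat \<Rightarrow> 'g::group_add set \<Rightarrow> 'g set"
 where "dern n H = (der ^^ n) H"

definition nrm :: "'g::group_add set \<Rightarrow> 'g set \<Rightarrow> bool"
 where "nrm K U \<longleftrightarrow> (\<forall>k\<in>K. \<forall>u\<in>U. k + u + - k \<in> U)"

text \<open>Only sums inside \<open>H\<close> are constrained: quotient maps and integer characters
  live on a subgroup and have arbitrary values elsewhere.\<close>

definition hm :: "('g::group_add \<Rightarrow> 'h::group_add) \<Rightarrow> 'g set \<Rightarrow> bool"
 where "hm f H \<longleftrightarrow> (\<forall>x\<in>H. \<forall>y\<in>H. f (x + y) = f x + f y)"

lemma sgI: "\<lbrakk>0 \<in> H; \<And>x y. x \<in> H ==> y \<in> H ==> x + y \<in> H; \<And>x. x \<in> H ==> - x \<in> H\<rbrakk> \<Longrightarrow> sg H"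
 by (auto simp: sg_def)

lemma sg_zero: "sg H ==> 0 \<in> H" by (auto simp: sg_def)
lemma sg_add: "sg H ==> x \<in> H ==> y \<in> H ==> x + y \<in> H" by (auto simp: sg_def)
lemma sg_neg: "sg H ==> x \<in> H ==> - x \<in> H" by (auto simp: sg_def)
lemma sg_neg_iff: "sg H ==> - x \<in> H \<longleftrightarrow> x \<in> H" by (metis minus_minus sg_neg)
lemma sg_Int: "sg H ==> sg K ==> sg (H \<inter> K)" by (auto simp: sg_def)
lemma sg_cm: "sg H ==> x \<in> H ==> y \<in> H ==> cm x y \<in> H"
 by (simp add: cm_def sg_add sg_neg)
lemma sg_add_left: "sg H ==> x \<in> H ==> x + y \<in> H \<longleftrightarrow> y \<in> H"
 by (metis minus_add_cancel sg_add sg_neg)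
lemma sg_add_right: assumes "sg H" "y \<in> H" shows "x + y \<in> H \<longleftrightarrow> x \<in> H"
 using sg_add[OF assms(1), of "x + y" "- y"] sg_add[OF assms(1), of x y] sg_neg[OF assms] assms(2)
 by (auto simp: add.assoc)

lemma nrm_self: "sg H ==> nrm H H" by (simp add: nrm_def sg_add sg_neg)
lemma nrmD: "nrm K U ==> k \<in> K ==> u \<in> U ==> k + u + - k \<in> U" by (simp add: nrm_def)
lemma nrm_cm: "\<lbrakk>sg U; nrm K U; k \<in> K; u \<in> U\<rbrakk> \<Longrightarrow> cm k u \<in> U"
 unfolding cm_def by (intro sg_add sg_neg nrmD) auto
lemma nrm_cm': assumes "sg U" "nrm K U" "sg K" "k \<in> K" "u \<in> U" shows "cm u k \<in> U"
proof -
 have "u + (k + - u + - k) \<in> U" using assms by (intro sg_add nrmD) (auto simp: sg_neg)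
 then show ?thesis by (simp add: cm_def add.assoc)
qed
lemma nrm_sub: "nrm K U ==> L \<subseteq> K ==> nrm L U" by (auto simp: nrm_def)
lemma nrm_iff: assumes "sg K" "nrm K U" "k \<in> K" shows "k + u + - k \<in> U \<longleftrightarrow> u \<in> U"
proof
 assume "k + u + - k \<in> U"
 then have "- k + (k + u + - k) + - (- k) \<in> U" using assms by (rule_tac nrmD) (auto simp: sg_neg)
 then show "u \<in> U" by (simp add: add.assoc)
qed (use assms nrmD in auto)

lemma ball_zero: "0 \<in> ball S n"
 unfolding ball_def by (auto intro: exI[of _ "[]"])

lemma ball_mono: "m \<le> n ==> ball S m \<subseteq> ball S n"
 unfolding ball_def by fastforce

lemma ball_mono_set: "S \<subseteq> T ==> ball S n \<subseteq> ball T n"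
 unfolding ball_def by blast

lemma ball_add: assumes "x \<in> ball S m" "y \<in> ball S n" shows "x + y \<in> ball S (m + n)"
proof -
 obtain u v where "set u \<subseteq> S \<union> uminus ` S" "length u \<le> m" "x = sum_list u"
  "set v \<subseteq> S \<union> uminus ` S" "length v \<le> n" "y = sum_list v"
  using assms unfolding ball_def by auto
 then show ?thesis unfolding ball_def by (intro CollectI exI[of _ "u @ v"]) auto
qed

lemma sum_list_uminus: "- sum_list (ws :: 'g::group_add list) = sum_list (rev (map uminus ws))"
 by (induction ws) (auto simp: minus_add)

lemma ball_neg: assumes "x \<in> ball S m" shows "- x \<in> ball S m"
proof -
 obtain u where "set u \<subseteq> S \<union> uminus ` S" "length u \<le> m" "x = sum_list u"
  using assms unfolding ball_def by auto
 then show ?thesis unfolding ball_def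
  by (intro CollectI exI[of _ "rev (map uminus u)"]) (auto simp: sum_list_uminus)
qed

lemma ball_base: "x \<in> S ==> x \<in> ball S 1"
 unfolding ball_def by (auto intro!: exI[of _ "[x]"])

lemma ball_addI: "x \<in> ball S m ==> y \<in> ball S n ==> m + n \<le> k ==> x + y \<in> ball S k"
 using ball_add ball_mono by blast

lemma ball_cm: "x \<in> ball S m ==> y \<in> ball S n ==> cm x y \<in> ball S (2 * m + 2 * n)"
 unfolding cm_def by (rule ball_addI[OF ball_add[OF ball_add] _]) (auto intro: ball_neg)

lemma ball_conj: "x \<in> ball S m ==> g \<in> ball S n ==> g + x + - g \<in> ball S (m + 2 * n)"
 by (rule ball_addI[OF ball_add]) (auto intro: ball_neg)

lemma finite_ball: "finite S ==> finite (ball S n)"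
proof -
 assume "finite S"
 then have "finite {ws. set ws \<subseteq> S \<union> uminus ` S \<and> length ws \<le> n}"
  by (intro finite_lists_length_le) auto
 moreover have "ball S n = sum_list ` {ws. set ws \<subseteq> S \<union> uminus ` S \<and> length ws \<le> n}"
  unfolding ball_def by auto
 ultimately show ?thesis by simp
qed

lemma sg_sum_list: "sg H ==> set ws \<subseteq> H ==> sum_list ws \<in> H"
 by (induction ws) (auto simp: sg_zero sg_add)

lemma ball_sub_sg: assumes "sg H" "S \<subseteq> H" shows "ball S n \<subseteq> H"
proof -
 have "S \<union> uminus ` S \<subseteq> H" using assms by (auto simp: sg_neg)
 then show ?thesis unfolding ball_def using sg_sum_list[OF assms(1)] subset_trans by blast
qed

lemma gen_least: "sg H ==> S \<subseteq> H ==> gen S \<subseteq> H"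
 unfolding gen_def using ball_sub_sg by blast

lemma ball_gen: "ball S n \<subseteq> gen S" unfolding gen_def by auto

lemma gen_base: "S \<subseteq> gen S" using ball_base unfolding gen_def by blast

lemma sg_gen: "sg (gen S)"
 by (rule sgI) (auto simp: gen_def intro: ball_zero ball_add ball_neg)

lemma gen_mono: "S \<subseteq> T ==> gen S \<subseteq> gen T"
 by (meson gen_base gen_least order_trans sg_gen)

lemma gen_sg: "sg H ==> gen H = H"
 by (simp add: gen_base gen_least subset_antisym)

lemma gen_eqI: "sg H ==> S \<subseteq> H ==> H \<subseteq> gen S ==> gen S = H"
 using gen_least by blast

lemma gen_finite_ball:
 assumes "finite F" "F \<subseteq> gen S" obtains L where "F \<subseteq> ball S L" "L > 0"
proof -
 have "\<forall>x\<in>F. \<exists>n. x \<in> ball S n" using assms(2) unfolding gen_def by auto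
 then obtain f where f: "\<forall>x\<in>F. x \<in> ball S (f x)" by metis
 have "F \<subseteq> ball S (Suc (Max (insert 0 (f ` F))))"
 proof
  fix x assume x: "x \<in> F"
  then have "f x \<le> Max (insert 0 (f ` F))" using assms(1) by (intro Max_ge) auto
  then show "x \<in> ball S (Suc (Max (insert 0 (f ` F))))" using f x ball_mono[of "f x" "Suc (Max (insert 0 (f ` F)))" S] by auto
 qed
 then show ?thesis using that by blast
qed

lemma ball_ball: assumes "T \<subseteq> ball S L" shows "ball T n \<subseteq> ball S (L * n)"
proof
 fix x assume "x \<in> ball T n"
 then obtain ws where ws: "set ws \<subseteq> T \<union> uminus ` T" "length ws \<le> n" "x = sum_list ws"
  unfolding ball_def by auto
 have T: "T \<union> uminus ` T \<subseteq> ball S L" using assms ball_neg by blast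
 have "set ws \<subseteq> ball S L ==> sum_list ws \<in> ball S (L * length ws)" for ws
  by (induction ws) (auto simp: ball_zero intro: ball_addI)
 then have "x \<in> ball S (L * length ws)" using ws T subset_trans by blast
 then show "x \<in> ball S (L * n)" using ball_mono[of "L * length ws" "L * n"] ws(2) by auto
qed

lemma gen_ind [consumes 1, case_names zero add neg]:
 assumes "x \<in> gen S" "P 0" "\<And>s y. s \<in> S ==> y \<in> gen S ==> P y ==> P (s + y)"
  "\<And>s y. s \<in> S ==> y \<in> gen S ==> P y ==> P (- s + y)"
 shows "P x"
proof -
 obtain ws where ws: "set ws \<subseteq> S \<union> uminus ` S" "x = sum_list ws"
  using assms(1) unfolding gen_def ball_def by auto
 have "set ws \<subseteq> S \<union> uminus ` S ==> sum_list ws \<in> gen S \<and> P (sum_list ws)" for ws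
 proof (induction ws)
  case Nil then show ?case using assms(2) by (simp add: sg_zero sg_gen)
 next
  case (Cons w ws)
  then have IH: "sum_list ws \<in> gen S" "P (sum_list ws)" by auto
  consider "w \<in> S" | s where "s \<in> S" "w = - s" using Cons.prems by auto
  then show ?case
  proof cases
   case 1
   then have "w \<in> gen S" using gen_base by blast
   then show ?thesis using 1 IH assms(3) sg_add[OF sg_gen] by simp
  next
   case 2
   then have "w \<in> gen S" using gen_base sg_neg[OF sg_gen] by blast
   then show ?thesis using 2 IH assms(4) sg_add[OF sg_gen] by simp
  qed
 qed
 then show ?thesis using ws by blast
qed

lemma nm_0 [simp]: "nm 0 x = 0" by (simp add: nm_def)
lemma nm_Suc: "nm (Suc n) x = x + nm n x" by (simp add: nm_def)
lemma nm_add: "nm (m + n) x = nm m x + nm n x"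
 by (induction m) (auto simp: nm_Suc add.assoc)
lemma nm_1 [simp]: "nm (Suc 0) x = x" by (simp add: nm_Suc)
lemma nm_Suc2: "nm (Suc n) x = nm n x + x" using nm_add[of n 1 x] by simp
lemma nm_mult: "nm (m * n) x = nm m (nm n x)"
 by (induction m) (auto simp: nm_Suc nm_add)
lemma nm_zero [simp]: "nm n 0 = 0" by (induction n) (auto simp: nm_Suc)
lemma nm_neg: "nm n (- x) = - nm n x"
proof (induction n)
 case (Suc n)
 have "nm (Suc n) (- x) = - (nm n x + x)" by (simp add: nm_Suc Suc minus_add)
 then show ?case by (simp only: nm_Suc2)
qed simp
lemma nm_cj: "nm n (g + x + - g) = g + nm n x + - g"
 by (induction n) (auto simp: nm_Suc add.assoc)
lemma sg_nm: "sg H ==> x \<in> H ==> nm n x \<in> H"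
 by (induction n) (auto simp: nm_Suc sg_add sg_zero)
lemma nm_comm: assumes "x + y = y + x" shows "nm n (x + y) = nm n x + nm n y"
proof -
 have c: "nm n y + x = x + nm n y" for n
  by (induction n) (auto simp: nm_Suc add.assoc, metis add.assoc assms)
 show ?thesis
 proof (induction n)
  case (Suc n)
  have "nm (Suc n) (x + y) = nm n x + (nm n y + x) + y"
   by (simp add: nm_Suc2 Suc add.assoc)
  also have "\<dots> = nm (Suc n) x + nm (Suc n) y" by (simp only: c) (simp add: nm_Suc2 add.assoc)
  finally show ?case .
 qed simp
qed
lemma cm_zero_iff: "cm x y = 0 \<longleftrightarrow> x + y = y + (x::'g::group_add)"
proof
 assume "cm x y = 0"
 then have "x + y + - x + - y + y + x = y + x" by (simp add: cm_def)
 then show "x + y = y + x" by (simp add: add.assoc)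
next
 assume "x + y = y + x"
 then show "cm x y = 0" by (simp add: cm_def add.assoc)
qed

lemma neg_cm: "- cm x y = cm y x" by (simp add: cm_def minus_add add.assoc)
lemma cj_cm: "g + cm x y + - g = cm (g + x + - g) (g + y + - g)"
 by (simp add: cm_def minus_add add.assoc)
lemma cm_0 [simp]: "cm 0 x = 0" "cm x 0 = 0" "cm x x = 0" by (simp_all add: cm_def add.assoc)

lemma sg_der [simp]: "sg (der H)" by (simp add: der_def sg_gen)
lemma der_cm: "x \<in> H ==> y \<in> H ==> cm x y \<in> der H"
 unfolding der_def by (rule subsetD[OF gen_base]) auto
lemma der_sub: "sg H ==> der H \<subseteq> H"
 unfolding der_def by (rule gen_least) (auto simp: sg_cm)
lemma der_least: "sg K ==> (\<And>x y. x \<in> H ==> y \<in> H ==> cm x y \<in> K) ==> der H \<subseteq> K"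
 unfolding der_def by (rule gen_least) auto
lemma der_mono: "H \<subseteq> K ==> der H \<subseteq> der K"
 unfolding der_def by (rule gen_mono) auto

lemma sg_cj: "sg {x. k + x + - k \<in> H}" if "sg H" for k :: "'g::group_add"
proof (rule sgI)
 fix x y assume "x \<in> {x. k + x + - k \<in> H}" "y \<in> {x. k + x + - k \<in> H}"
 then have "(k + x + - k) + (k + y + - k) \<in> H" using that by (auto intro: sg_add)
 then show "x + y \<in> {x. k + x + - k \<in> H}" by (simp add: add.assoc)
next
 fix x assume "x \<in> {x. k + x + - k \<in> H}"
 then have "- (k + x + - k) \<in> H" using that by (auto intro: sg_neg)
 then show "- x \<in> {x. k + x + - k \<in> H}" by (simp add: add.assoc minus_add)
qed (use that sg_zero in auto)

lemma nrm_gen: assumes "\<And>k s. k \<in> K ==> s \<in> S ==> k + s + - k \<in> gen S" shows "nrm K (gen S)"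
 unfolding nrm_def
proof (intro ballI)
 fix k u assume "k \<in> K" "u \<in> gen S"
 then have "gen S \<subseteq> {x. k + x + - k \<in> gen S}" using assms by (intro gen_least sg_cj sg_gen) auto
 then show "k + u + - k \<in> gen S" using \<open>u \<in> gen S\<close> by auto
qed

lemma nrm_der: assumes "nrm K H" shows "nrm K (der H)"
 unfolding der_def
proof (rule nrm_gen)
 fix k s assume k: "k \<in> K" and "s \<in> {cm x y | x y. x \<in> H \<and> y \<in> H}"
 then obtain x y where "x \<in> H" "y \<in> H" "s = cm x y" by auto
 then have "k + s + - k = cm (k + x + - k) (k + y + - k)" "k + x + - k \<in> H" "k + y + - k \<in> H"
  using cj_cm[of k x y] nrmD[OF assms k] by auto
 then show "k + s + - k \<in> gen {cm x y | x y. x \<in> H \<and> y \<in> H}"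
  by (intro subsetD[OF gen_base]) blast
qed

text \<open>Both inclusions are imposed because conjugation may map an infinite \<open>U\<close>
  properly into itself, so that one inclusion alone need not be closed under negation.\<close>

lemma sg_normalizer: "sg {k. (\<forall>u\<in>U. k + u + - k \<in> U) \<and> (\<forall>u\<in>U. - k + u + k \<in> (U::'g::group_add set))}"
proof (rule sgI)
 fix a b assume ab: "a \<in> {k. (\<forall>u\<in>U. k + u + - k \<in> U) \<and> (\<forall>u\<in>U. - k + u + k \<in> U)}"
  "b \<in> {k. (\<forall>u\<in>U. k + u + - k \<in> U) \<and> (\<forall>u\<in>U. - k + u + k \<in> U)}"
 have "a + b + u + - (a + b) = a + (b + u + - b) + - a" "- (a + b) + u + (a + b) = - b + (- a + u + a) + b" for u
  by (simp_all add: add.assoc minus_add)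
 then show "a + b \<in> {k. (\<forall>u\<in>U. k + u + - k \<in> U) \<and> (\<forall>u\<in>U. - k + u + k \<in> U)}" using ab by auto
qed auto

lemma nrm_gen_left:
 assumes "\<And>s u. s \<in> S ==> u \<in> U ==> s + u + - s \<in> U" "\<And>s u. s \<in> S ==> u \<in> U ==> - s + u + s \<in> U"
 shows "nrm (gen S) U"
proof -
 have "gen S \<subseteq> {k. (\<forall>u\<in>U. k + u + - k \<in> U) \<and> (\<forall>u\<in>U. - k + u + k \<in> U)}"
  using assms by (intro gen_least sg_normalizer) auto
 then show ?thesis unfolding nrm_def by auto
qed

lemma dern_0 [simp]: "dern 0 H = H" by (simp add: dern_def)
lemma dern_Suc: "dern (Suc n) H = der (dern n H)" by (simp add: dern_def)
lemma dern_add: "dern (m + n) H = dern m (dern n H)" by (simp add: dern_def funpow_add)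
lemma sg_dern: "sg H ==> sg (dern n H)" by (cases n) (auto simp: dern_Suc)
lemma dern_anti: assumes "sg H" "m \<le> n" shows "dern n H \<subseteq> dern m H"
 using assms(2) by (induction rule: dec_induct) (use der_sub sg_dern[OF assms(1)] in \<open>auto simp: dern_Suc\<close>)
lemma dern_sub: "sg H ==> dern n H \<subseteq> H" using dern_anti[of H 0 n] by simp
lemma dern_mono: "H \<subseteq> K ==> dern n H \<subseteq> dern n K"
 by (induction n) (auto simp: dern_Suc dest: der_mono)
lemma nrm_dern: "nrm K H ==> nrm K (dern n H)"
 by (induction n) (auto simp: dern_Suc nrm_der)

lemma hmD: "hm f H ==> x \<in> H ==> y \<in> H ==> f (x + y) = f x + f y" by (simp add: hm_def)
lemma hm_zero: assumes "hm f H" "sg H" shows "f 0 = 0"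
proof -
 have "f (0 + 0) = f 0 + f 0" using assms by (intro hmD) (auto simp: sg_zero)
 then have "f 0 + 0 = f 0 + f 0" by simp
 then show ?thesis by (simp only: add_left_cancel)
qed
lemma hm_neg: assumes "hm f H" "sg H" "x \<in> H" shows "f (- x) = - f x"
proof -
 have "f (- x + x) = f (- x) + f x" using assms by (intro hmD) (auto simp: sg_neg)
 then have "f (- x) + f x = 0" using assms by (simp add: hm_zero[OF assms(1,2)])
 then show ?thesis by (simp add: eq_neg_iff_add_eq_0)
qed
lemma hm_cm: assumes "hm f H" "sg H" "x \<in> H" "y \<in> H" shows "f (cm x y) = cm (f x) (f y)"
 using assms by (simp add: cm_def hmD[OF assms(1)] hm_neg[OF assms(1)] sg_add sg_neg)
lemma hm_nm: assumes "hm f H" "sg H" "x \<in> H" shows "f (nm n x) = nm n (f x)"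
 using assms by (induction n) (auto simp: nm_Suc hm_zero hmD sg_nm)
lemma hm_sum_list: assumes "hm f H" "sg H" "set ws \<subseteq> H" shows "f (sum_list ws) = sum_list (map f ws)"
 using assms(3)
proof (induction ws)
 case (Cons a ws)
 then have "sum_list ws \<in> H" using sg_sum_list assms(2) by auto
 then show ?case using Cons hmD[OF assms(1)] by auto
qed (simp add: hm_zero[OF assms(1,2)])
lemma hm_sg_image: assumes "hm f H" "sg H" "sg K" "K \<subseteq> H" shows "sg (f ` K)"
proof (rule sgI)
 show "0 \<in> f ` K" using hm_zero[OF assms(1,2)] sg_zero[OF assms(3)] by force
 fix x y assume "x \<in> f ` K" "y \<in> f ` K"
 then obtain a b where "a \<in> K" "b \<in> K" "x = f a" "y = f b" by auto
 then show "x + y \<in> f ` K" using hmD[OF assms(1)] assms(4) sg_add[OF assms(3)]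
  by (metis image_eqI subsetD)
next
 fix x assume "x \<in> f ` K"
 then obtain a where "a \<in> K" "x = f a" by auto
 then show "- x \<in> f ` K" using hm_neg[OF assms(1,2)] assms(4) sg_neg[OF assms(3)]
  by (metis image_eqI subsetD)
qed
lemma hm_ball: assumes "hm f H" "sg H" "S \<subseteq> H" shows "f ` ball S n = ball (f ` S) n"
proof -
 have S: "S \<union> uminus ` S \<subseteq> H" using assms by (auto simp: sg_neg)
 have "f ` uminus ` S = uminus ` f ` S" unfolding image_image
  using hm_neg[OF assms(1,2)] assms(3) by (intro image_cong) auto
 then have f: "f ` (S \<union> uminus ` S) = f ` S \<union> uminus ` f ` S" by (simp add: image_Un)
 show ?thesis
 proof (intro equalityI subsetI)
  fix x assume "x \<in> f ` ball S n"
  then obtain ws where ws: "set ws \<subseteq> S \<union> uminus ` S" "length ws \<le> n" "x = f (sum_list ws)"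
   unfolding ball_def by auto
  then have "set (map f ws) \<subseteq> f ` S \<union> uminus ` f ` S" unfolding f[symmetric] by auto
  moreover have "x = sum_list (map f ws)" using ws S hm_sum_list[OF assms(1,2), of ws] by blast
  ultimately show "x \<in> ball (f ` S) n" unfolding ball_def using ws(2)
   by (intro CollectI exI[of _ "map f ws"]) auto
 next
  fix x assume "x \<in> ball (f ` S) n"
  then obtain vs where vs: "set vs \<subseteq> f ` (S \<union> uminus ` S)" "length vs \<le> n" "x = sum_list vs"
   unfolding ball_def f by auto
  then have "vs \<in> lists (f ` (S \<union> uminus ` S))" by auto
  then obtain ws where "ws \<in> lists (S \<union> uminus ` S)" "vs = map f ws" unfolding lists_image by auto
  then have "set ws \<subseteq> S \<union> uminus ` S" "vs = map f ws" by auto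
  moreover from this have "x = f (sum_list ws)" using S vs hm_sum_list[OF assms(1,2), of ws] by (metis subset_trans)
  ultimately show "x \<in> f ` ball S n" unfolding ball_def using vs
   by (intro image_eqI[of _ _ "sum_list ws"] CollectI exI[of _ ws]) auto
 qed
qed
lemma hm_gen: assumes "hm f H" "sg H" "S \<subseteq> H" shows "f ` gen S = gen (f ` S)"
 unfolding gen_def using hm_ball[OF assms] by blast
lemma hm_der: assumes "hm f H" "sg H" "K \<subseteq> H" shows "f ` der K = der (f ` K)"
proof -
 have "f ` {cm x y | x y. x \<in> K \<and> y \<in> K} = {cm x y | x y. x \<in> f ` K \<and> y \<in> f ` K}"
  using hm_cm[OF assms(1,2)] assms(3) by (force simp: image_iff subset_iff)
 then show ?thesis unfolding der_def
  using assms by (subst hm_gen[OF assms(1,2)]) (auto simp: sg_cm subset_iff)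
qed
lemma hm_dern: assumes "hm f H" "sg H" shows "f ` dern n H = dern n (f ` H)"
 by (induction n) (auto simp: dern_Suc hm_der[OF assms dern_sub[OF assms(2)]])

subsection \<open>Ascending chains\<close>

text \<open>The subgroups grow from the end of the list towards its head, so \<open>Cons\<close>
  adds the next link and every suffix is again a chain.\<close>

primrec asc :: "'g::group_add list \<Rightarrow> bool" where
 "asc [] = True"
| "asc (x # xs) = (x \<notin> gen (set xs) \<and> asc xs)"

primrec subsums :: "'g::group_add list \<Rightarrow> 'g set" where
 "subsums [] = {0}"
| "subsums (x # xs) = subsums xs \<union> (+) x ` subsums xs"

lemma subsums_gen: "subsums xs \<subseteq> gen (set xs)"
proof (induction xs)
 case (Cons x xs)
 have "gen (set xs) \<subseteq> gen (set (x # xs))" "x \<in> gen (set (x # xs))"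
  using gen_mono[of "set xs" "set (x # xs)"] gen_base[of "set (x # xs)"] by auto
 then show ?case using Cons by (auto intro!: sg_add[OF sg_gen])
qed (simp add: sg_zero sg_gen)

text \<open>If \<open>y = x + z\<close> with \<open>y\<close> and \<open>z\<close> subsums of the
  tail, then \<open>x\<close> lies in the subgroup generated by the tail. So the two halves are
  disjoint, and each link doubles the number of subsums.\<close>

lemma card_subsums: "asc xs ==> finite (subsums xs) \<and> card (subsums xs) = 2 ^ length xs"
proof (induction xs)
 case (Cons x xs)
 have "subsums xs \<inter> (+) x ` subsums xs = {}"
 proof (rule ccontr)
  assume "\<not> ?thesis"
  then obtain y z where "y \<in> subsums xs" "z \<in> subsums xs" "y = x + z" by auto
  then have "x = y + - z" "y \<in> gen (set xs)" "z \<in> gen (set xs)"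
   using subsums_gen by (auto simp: add.assoc)
  then show False using Cons.prems by (auto intro!: sg_add[OF sg_gen] sg_neg[OF sg_gen])
 qed
 moreover have "card ((+) x ` subsums xs) = card (subsums xs)"
  by (intro card_image) (auto simp: inj_on_def)
 ultimately show ?case using Cons by (auto simp: card_Un_disjoint)
qed auto

lemma subsums_ball: "set xs \<subseteq> ball S L ==> subsums xs \<subseteq> ball S (L * length xs)"
proof (induction xs)
 case (Cons x xs)
 then show ?case using ball_mono[of "L * length xs" "L + L * length xs" S]
  by (auto intro: ball_add)
qed (auto simp: ball_zero)

lemma asc_growth:
 assumes "finite S" "asc xs" "set xs \<subseteq> ball S L" "L * length xs \<le> n"
 shows "2 ^ length xs \<le> card (ball S n)"
proof -
 have "subsums xs \<subseteq> ball S n" using subsums_ball[OF assms(3)] ball_mono[OF assms(4)] by blast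
 then have "card (subsums xs) \<le> card (ball S n)" by (intro card_mono finite_ball assms(1))
 then show ?thesis using card_subsums[OF assms(2)] by simp
qed

subsection \<open>Indices and quotients\<close>

definition cos :: "'g::group_add set \<Rightarrow> 'g set \<Rightarrow> 'g set set"
 where "cos U W = (\<lambda>u. (+) u ` W) ` U"

text \<open>Infinite index is recorded as 0 by \<open>card\<close>, so finiteness of
  \<open>cos U W\<close> is carried along separately.\<close>

definition idx :: "'g::group_add set \<Rightarrow> 'g set \<Rightarrow> nat" where "idx U W = card (cos U W)"

lemma coset_eq: "sg W ==> (+) u ` W = (+) v ` W \<longleftrightarrow> - u + v \<in> W"
proof
 assume W: "sg W" "(+) u ` W = (+) v ` W"
 then have "v \<in> (+) u ` W" using sg_zero[OF W(1)] by (metis add.right_neutral image_eqI)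
 then show "- u + v \<in> W" by (auto simp: add.assoc)
next
 assume W: "sg W" "- u + v \<in> W"
 have e: "u + w = v + (- (- u + v) + w)" "v + w = u + ((- u + v) + w)" for w
  by (auto simp: add.assoc minus_add)
 show "(+) u ` W = (+) v ` W"
 proof (intro equalityI image_subsetI)
  fix w assume "w \<in> W"
  then show "u + w \<in> (+) v ` W" using W by (subst e(1)) (blast intro: sg_add sg_neg)
 next
  fix w assume "w \<in> W"
  then show "v + w \<in> (+) u ` W" using W by (subst e(2)) (blast intro: sg_add sg_neg)
 qed
qed

lemma idx_hom: assumes "hm f U" "sg U" "sg W" "W \<subseteq> U" "\<And>u. u \<in> U ==> f u = 0 \<longleftrightarrow> u \<in> W"
 shows "card (f ` U) = idx U W" "finite (f ` U) \<longleftrightarrow> finite (cos U W)"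
proof -
 have eq: "f u = f v \<longleftrightarrow> (+) u ` W = (+) v ` W" if "u \<in> U" "v \<in> U" for u v
 proof -
  have "f (- u + v) = - f u + f v" using that assms hm_neg hmD sg_neg by metis
  moreover have "- f u + f v = 0 \<longleftrightarrow> f u = f v" by (metis add.left_inverse add_left_cancel)
  ultimately show ?thesis using assms that by (metis coset_eq sg_add sg_neg)
 qed
 have "\<exists>g. bij_betw g (f ` U) (cos U W)"
 proof (intro exI bij_betw_imageI)
  let ?g = "\<lambda>y. (+) (SOME u. u \<in> U \<and> f u = y) ` W"
  have g: "?g (f u) = (+) u ` W" if "u \<in> U" for u
  proof -
   have "(SOME v. v \<in> U \<and> f v = f u) \<in> U \<and> f (SOME v. v \<in> U \<and> f v = f u) = f u"
    by (rule someI[of _ u]) (use that in auto)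
   then show ?thesis using eq that by blast
  qed
  show "inj_on ?g (f ` U)" using g eq by (auto simp: inj_on_def)
  show "?g ` f ` U = cos U W" unfolding cos_def image_image[of ?g f] by (rule image_cong[OF refl g])
 qed
 then obtain g where "bij_betw g (f ` U) (cos U W)" by blast
 then show "card (f ` U) = idx U W" "finite (f ` U) \<longleftrightarrow> finite (cos U W)"
  unfolding idx_def using bij_betw_same_card bij_betw_finite by blast+
qed

lemma idx_mult:
 assumes "sg U" "sg Q" "sg W" "W \<subseteq> Q" "Q \<subseteq> U" "finite (cos U W)"
 shows "idx U W = idx U Q * idx Q W" "finite (cos U Q)" "finite (cos Q W)"
proof -
 have QU: "(+) u ` Q \<in> cos U Q" if "u \<in> U" for u using that by (auto simp: cos_def)
 define r where "r C = (SOME u. u \<in> U \<and> (+) u ` Q = C)" for C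
 have r: "r C \<in> U" "(+) (r C) ` Q = C" if "C \<in> cos U Q" for C
 proof -
  have "\<exists>u. u \<in> U \<and> (+) u ` Q = C" using that by (auto simp: cos_def)
  then have "r C \<in> U \<and> (+) (r C) ` Q = C" unfolding r_def by (rule someI_ex)
  then show "r C \<in> U" "(+) (r C) ` Q = C" by auto
 qed
 have im: "(+) a ` (+) b ` W = (+) (a + b) ` W" for a b by (auto simp: image_image add.assoc)
 \<comment> \<open>Translating the cosets of \<open>W\<close> in \<open>Q\<close> by a chosen
   transversal \<open>r\<close> of \<open>Q\<close> in \<open>U\<close> lists every coset of
   \<open>W\<close> in \<open>U\<close> once.\<close>
 have "bij_betw (\<lambda>(C, D). (+) (r C) ` D) (cos U Q \<times> cos Q W) (cos U W)"
 proof (rule bij_betw_imageI)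
  show "inj_on (\<lambda>(C, D). (+) (r C) ` D) (cos U Q \<times> cos Q W)"
  proof (rule inj_onI, clarify)
   fix C D C' D' assume C: "C \<in> cos U Q" "C' \<in> cos U Q" and D: "D \<in> cos Q W" "D' \<in> cos Q W"
    and e: "(+) (r C) ` D = (+) (r C') ` D'"
   obtain d d' where d: "d \<in> Q" "d' \<in> Q" "D = (+) d ` W" "D' = (+) d' ` W"
    using D by (auto simp: cos_def)
   have m: "- (r C + d) + (r C' + d') \<in> W"
    using e d coset_eq[OF assms(3)] by (simp add: im)
   have "d + (- (r C + d) + (r C' + d')) + - d' \<in> Q"
    by (rule sg_add[OF assms(2) sg_add[OF assms(2) d(1) subsetD[OF assms(4) m]] sg_neg[OF assms(2) d(2)]])
   then have "- r C + r C' \<in> Q" by (simp add: add.assoc minus_add)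
   then have CC: "C = C'" using coset_eq[OF assms(2)] r C by metis
   then have "D = D'" using m d coset_eq[OF assms(3), of d d'] by (simp add: add.assoc minus_add)
   then show "C = C' \<and> D = D'" using CC by simp
  qed
  show "(\<lambda>(C, D). (+) (r C) ` D) ` (cos U Q \<times> cos Q W) = cos U W"
  proof (intro equalityI subsetI)
   fix E assume "E \<in> (\<lambda>(C, D). (+) (r C) ` D) ` (cos U Q \<times> cos Q W)"
   then obtain C d where "C \<in> cos U Q" "d \<in> Q" "E = (+) (r C) ` (+) d ` W" by (auto simp: cos_def)
   then have "E = (+) (r C + d) ` W" "r C + d \<in> U" using r sg_add[OF assms(1)] assms(5) by (auto simp: im)
   then show "E \<in> cos U W" by (auto simp: cos_def)
  next
   fix E assume "E \<in> cos U W"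
   then obtain u where u: "u \<in> U" "E = (+) u ` W" by (auto simp: cos_def)
   let ?C = "(+) u ` Q"
   have "- r ?C + u \<in> Q" using r(2)[OF QU[OF u(1)]] coset_eq[OF assms(2)] by blast
   moreover have "E = (+) (r ?C) ` (+) (- r ?C + u) ` W" unfolding im using u by (simp add: add.assoc)
   ultimately show "E \<in> (\<lambda>(C, D). (+) (r C) ` D) ` (cos U Q \<times> cos Q W)"
    using QU[OF u(1)] by (intro image_eqI[of _ _ "(?C, (+) (- r ?C + u) ` W)"]) (auto simp: cos_def)
  qed
 qed
 then have b: "card (cos U Q \<times> cos Q W) = card (cos U W)" "finite (cos U Q \<times> cos Q W)"
  using bij_betw_same_card bij_betw_finite assms(6) by blast+
 have ne: "cos U Q \<noteq> {}" "cos Q W \<noteq> {}" using sg_zero assms(1,2) by (auto simp: cos_def)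
 show "idx U W = idx U Q * idx Q W" using b by (simp add: idx_def card_cartesian_product)
 show "finite (cos U Q)" "finite (cos Q W)" using b(2) ne
  by (auto dest: finite_cartesian_productD1 finite_cartesian_productD2)
qed

lemma idx_self: "sg U ==> idx U U = 1"
proof -
 assume "sg U"
 then have "cos U U = {U}" using coset_eq[of U 0] sg_zero[of U] by (auto simp: cos_def)
 then show ?thesis by (simp add: idx_def)
qed

lemma idx_pos: "sg U ==> finite (cos U W) ==> idx U W \<ge> 1"
 using sg_zero[of U] by (auto simp: idx_def cos_def Suc_le_eq card_gt_0_iff)

lemma idx_1: assumes "sg U" "sg W" "W \<subseteq> U" "finite (cos U W)" "idx U W \<le> 1" shows "U = W"
proof -
 have "u \<in> W" if u: "u \<in> U" for u
 proof -
  have "card (cos U W) = 1" using idx_pos[OF assms(1,4)] assms(5) by (simp add: idx_def)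
  then obtain C where "cos U W = {C}" using card_1_singletonE by blast
  then have "(+) u ` W = (+) 0 ` W" using u sg_zero[OF assms(1)] unfolding cos_def by (metis image_eqI singletonD)
  then show ?thesis using coset_eq[OF assms(2), of 0 u] by auto
 qed
 then show ?thesis using assms by auto
qed

section \<open>Quotients as groups of permutations\<close>

typedef 'a bijn = "{f :: 'a \<Rightarrow> 'a. bij f}"
 by (rule exI[of _ id]) auto

setup_lifting type_definition_bijn

instantiation bijn :: (type) group_add
begin
lift_definition zero_bijn :: "'a bijn" is id by simp
lift_definition plus_bijn :: "'a bijn \<Rightarrow> 'a bijn \<Rightarrow> 'a bijn" is "(\<circ>)" by (rule bij_comp)
lift_definition uminus_bijn :: "'a bijn \<Rightarrow> 'a bijn" is "inv_into UNIV" by (rule bij_imp_bij_inv)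
definition minus_bijn :: "'a bijn \<Rightarrow> 'a bijn \<Rightarrow> 'a bijn" where "minus_bijn a b = a + - b"
instance
proof
 fix a b c :: "'a bijn"
 show "a + b + c = a + (b + c)" by transfer (simp add: comp_assoc)
 show "0 + a = a" by transfer simp
 show "a + 0 = a" by transfer simp
 show "- a + a = 0" by transfer (simp add: bij_is_inj)
 show "a + - b = a - b" by (simp add: minus_bijn_def)
qed
end

text \<open>\<open>U\<close> translates the left cosets of \<open>W\<close>, and the identity on all
  other sets extends this to a permutation of the whole type. The kernel is the intersection of the
  conjugates of \<open>W\<close>, which is \<open>W\<close> by normality.\<close>

lemma ex_quotient_hom:
 fixes U W :: "'g::group_add set"
 assumes "sg U" "sg W" "W \<subseteq> U" "nrm U W"
 obtains f :: "'g \<Rightarrow> 'g set bijn" where "hm f U" "\<And>u. u \<in> U ==> f u = 0 \<longleftrightarrow> u \<in> W"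
proof -
 define t where "t u C = (if C \<in> cos U W then (+) u ` C else C)" for u and C :: "'g set"
 have im: "(+) a ` (+) b ` W = (+) (a + b) ` W" for a b by (auto simp: image_image add.assoc)
 have tc: "t u ((+) v ` W) = (+) (u + v) ` W" if "v \<in> U" for u v
  using that unfolding t_def im[symmetric] by (auto simp: cos_def)
 have tt: "t u (t v C) = t (u + v) C" if "u \<in> U" "v \<in> U" for u v C
 proof (cases "C \<in> cos U W")
  case True
  then obtain x where "x \<in> U" "C = (+) x ` W" by (auto simp: cos_def)
  then show ?thesis using tc[of x v] tc[of "v + x" u] tc[of x "u + v"] that sg_add[OF assms(1), of v x]
   by (simp only: add.assoc)
 next
  case False
  then show ?thesis by (simp add: t_def)
 qed
 have t0: "t 0 C = C" for C by (auto simp: t_def)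
 have bij: "bij (t u)" if "u \<in> U" for u
  by (rule o_bij[of "t (- u)"]) (use tt[OF that sg_neg[OF assms(1) that]] tt[OF sg_neg[OF assms(1) that] that] t0 in \<open>auto simp: fun_eq_iff\<close>)
 define f where "f u = Abs_bijn (t u)" for u
 have Rep: "Rep_bijn (f u) = t u" if "u \<in> U" for u
  unfolding f_def using bij[OF that] by (simp add: Abs_bijn_inverse)
 have "hm f U" unfolding hm_def
 proof (intro ballI)
  fix u v assume uv: "u \<in> U" "v \<in> U"
  have "Rep_bijn (f (u + v)) = Rep_bijn (f u) \<circ> Rep_bijn (f v)"
   using Rep uv sg_add[OF assms(1) uv] tt[OF uv] by (auto simp: fun_eq_iff)
  then show "f (u + v) = f u + f v" by (simp add: plus_bijn.rep_eq flip: Rep_bijn_inject)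
 qed
 moreover have "f u = 0 \<longleftrightarrow> u \<in> W" if u: "u \<in> U" for u
 proof -
  have "f u = 0 \<longleftrightarrow> t u = id" using Rep[OF u] by (simp add: zero_bijn.rep_eq flip: Rep_bijn_inject)
  also have "\<dots> \<longleftrightarrow> u \<in> W"
  proof
   assume "t u = id"
   then have "(+) (u + 0) ` W = (+) 0 ` W" using tc[of 0 u] sg_zero[OF assms(1)] by (metis id_apply)
   then show "u \<in> W" using coset_eq[OF assms(2), of 0 u] by auto
  next
   assume uW: "u \<in> W"
   have "t u C = C" for C
   proof (cases "C \<in> cos U W")
    case True
    then obtain x where x: "x \<in> U" "C = (+) x ` W" by (auto simp: cos_def)
    have "- x + u + - (- x) \<in> W" using assms x uW by (intro nrmD[of U]) (auto simp: sg_neg)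
    then have "(+) x ` W = (+) (u + x) ` W" using coset_eq[OF assms(2), of x "u + x"] by (simp add: add.assoc)
    then show ?thesis using x tc[OF x(1), of u] by metis
   qed (simp add: t_def)
   then show "t u = id" by auto
  qed
  finally show ?thesis .
 qed
 ultimately show ?thesis using that by blast
qed

lemma sg_cm_left: assumes "sg K" "nrm K N" "sg N" shows "sg {x \<in> K. cm x b \<in> N}"
proof (rule sgI)
 fix x y assume a: "x \<in> {x \<in> K. cm x b \<in> N}" "y \<in> {x \<in> K. cm x b \<in> N}"
 have "cm (x + y) b = (x + cm y b + - x) + cm x b" by (simp add: cm_def add.assoc minus_add)
 then show "x + y \<in> {x \<in> K. cm x b \<in> N}" using a assms by (auto intro: sg_add nrmD)
next
 fix x assume a: "x \<in> {x \<in> K. cm x b \<in> N}"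
 have "cm (- x) b = - x + - cm x b + - (- x)" by (simp add: cm_def add.assoc minus_add)
 moreover have "- x + - cm x b + - (- x) \<in> N" using a assms by (intro nrmD[of K]) (auto intro: sg_neg)
 ultimately show "- x \<in> {x \<in> K. cm x b \<in> N}" using a assms by (auto intro: sg_neg)
qed (use assms sg_zero in auto)

text \<open>The elements that commute with a fixed element modulo \<open>N\<close> form a subgroup.
  This is applied in one argument and then, as \<open>cm y x\<close> is the negative of
  \<open>cm x y\<close>, in the other.\<close>

lemma cm_gen_closed:
 assumes "sg N" "nrm (gen A) N" "nrm (gen B) N" "\<And>a b. a \<in> A ==> b \<in> B ==> cm a b \<in> N"
  "x \<in> gen A" "y \<in> gen B"
 shows "cm x y \<in> N"
proof -
 have 1: "cm x b \<in> N" if "b \<in> B" for b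
  using gen_least[OF sg_cm_left[OF sg_gen assms(2,1)], of A b] gen_base assms(4)[OF _ that] assms(5) by blast
 have "cm b x \<in> N" if "b \<in> B" for b using 1[OF that] sg_neg[OF assms(1)] neg_cm by metis
 then have "cm y x \<in> N"
  using gen_least[OF sg_cm_left[OF sg_gen assms(3,1)], of B x] gen_base assms(6) by blast
 then show ?thesis using sg_neg[OF assms(1)] neg_cm by metis
qed

section \<open>Short generators of normal closures and derived subgroups\<close>

definition nochain :: "'g::group_add set \<Rightarrow> nat \<Rightarrow> nat \<Rightarrow> bool"
 where "nochain S M L \<longleftrightarrow> (\<forall>xs. asc xs --> set xs \<subseteq> ball S L --> length xs < M)"

lemma asc_drop: "asc xs ==> asc (drop n xs)"
 by (induction xs arbitrary: n) (auto simp: drop_Cons split: nat.split)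

lemma nochainI:
 assumes "finite S" "card (ball S n) < 2 ^ M" "L * M \<le> n" shows "nochain S M L"
 unfolding nochain_def
proof (intro allI impI, rule ccontr)
 fix xs assume xs: "asc xs" "set xs \<subseteq> ball S L" "\<not> length xs < M"
 \<comment> \<open>Exactly the last \<open>M\<close> entries are kept; a suffix of an ascending list
   is ascending.\<close>
 let ?ys = "drop (length xs - M) xs"
 have "2 ^ length ?ys \<le> card (ball S n)"
  using xs assms set_drop_subset[of _ xs] by (intro asc_growth[of S ?ys L]) (auto intro: asc_drop)
 then show False using assms xs by auto
qed

lemma nochain_mono: "nochain S M L ==> L' \<le> L ==> nochain S M L'"
 unfolding nochain_def using ball_mono by blast

text \<open>The subgroups generated by the conjugates of \<open>F\<close> by elements of length at most \<open>t\<close> increase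
 with \<open>t\<close>, and the first repetition is already the normal closure of \<open>F\<close>.\<close>

lemma short_normal_closure:
 assumes "nochain S M (l + 2 * M)" "F \<subseteq> ball S l"
 obtains Y where "Y \<subseteq> ball S (l + 2 * M)" "F \<subseteq> gen Y" "nrm (gen S) (gen Y)"
  "\<And>N. sg N ==> nrm (gen S) N ==> F \<subseteq> N ==> gen Y \<subseteq> N"
proof -
 define c where "c t = {g + f + - g | f g. f \<in> F \<and> g \<in> ball S t}" for t
 have cmono: "c s \<subseteq> c t" if "s \<le> t" for s t unfolding c_def using ball_mono[OF that] by blast
 have cb: "c t \<subseteq> ball S (l + 2 * t)" for t unfolding c_def using assms(2) ball_conj by blast
 \<comment> \<open>Otherwise one new conjugate per stage yields an ascending list of
   \<open>M\<close> elements of \<open>c M\<close>, all of length at most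
   \<open>l + 2 * M\<close>.\<close>
 have "\<exists>t<M. c (Suc t) \<subseteq> gen (c t)"
 proof (rule ccontr)
  assume "\<not> ?thesis"
  then have ex: "\<exists>x. x \<in> c (Suc t) \<and> x \<notin> gen (c t)" if "t < M" for t using that by blast
  have "t \<le> M ==> \<exists>xs. asc xs \<and> length xs = t \<and> set xs \<subseteq> c t" for t
  proof (induction t)
   case (Suc t)
   then obtain xs where xs: "asc xs" "length xs = t" "set xs \<subseteq> c t" by auto
   obtain x where x: "x \<in> c (Suc t)" "x \<notin> gen (c t)" using ex[of t] Suc by auto
   then have "asc (x # xs)" using xs gen_mono[OF xs(3)] by auto
   then show ?case using x xs cmono[of t "Suc t"] by (intro exI[of _ "x # xs"]) auto
  qed auto
  then obtain xs where "asc xs" "length xs = M" "set xs \<subseteq> c M" by blast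
  then show False using assms(1) cb[of M] unfolding nochain_def by blast
 qed
 then obtain t where t: "t < M" "c (Suc t) \<subseteq> gen (c t)" by blast
 have F: "F \<subseteq> c t"
 proof
  fix f assume "f \<in> F"
  moreover have "f = 0 + f + - 0" by simp
  ultimately show "f \<in> c t" unfolding c_def using ball_zero by blast
 qed
 \<comment> \<open>Conjugation by one more letter moves \<open>c t\<close> into
   \<open>c (Suc t)\<close>, which adds nothing to the generated subgroup.\<close>
 have step: "s + x + - s \<in> gen (c t)" if s: "s \<in> ball S 1" and x: "x \<in> gen (c t)" for s x
 proof -
  have "c t \<subseteq> {x. s + x + - s \<in> gen (c t)}"
  proof
   fix x assume "x \<in> c t"
   then obtain f g where fg: "f \<in> F" "g \<in> ball S t" "x = g + f + - g" unfolding c_def by blast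
   have "s + g \<in> ball S (Suc t)" using ball_add[OF s fg(2)] by simp
   moreover have "s + x + - s = (s + g) + f + - (s + g)" using fg by (simp add: add.assoc minus_add)
   ultimately have "s + x + - s \<in> c (Suc t)" unfolding c_def using fg(1) by blast
   then show "x \<in> {x. s + x + - s \<in> gen (c t)}" using t by auto
  qed
  then have "gen (c t) \<subseteq> {x. s + x + - s \<in> gen (c t)}" by (intro gen_least sg_cj sg_gen)
  then show ?thesis using x by auto
 qed
 have "nrm (gen S) (gen (c t))"
 proof (rule nrm_gen_left)
  fix s u assume s: "s \<in> S" and u: "u \<in> gen (c t)"
  show "s + u + - s \<in> gen (c t)" using step[OF ball_base[OF s] u] .
  show "- s + u + s \<in> gen (c t)" using step[OF ball_neg[OF ball_base[OF s]] u] by simp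
 qed
 moreover have "gen (c t) \<subseteq> N" if "sg N" "nrm (gen S) N" "F \<subseteq> N" for N
 proof (rule gen_least[OF that(1)])
  show "c t \<subseteq> N" unfolding c_def using that(2,3) ball_gen[of S t] by (auto intro!: nrmD)
 qed
 moreover have "c t \<subseteq> ball S (l + 2 * M)" using cb[of t] ball_mono[of "l + 2 * t" "l + 2 * M" S] t by auto
 ultimately show ?thesis using that F gen_base by blast
qed

text \<open>The generators \<open>Y\<close> commute modulo the normal closure of their commutators,
  so this closure is the whole derived subgroup. Commutators of elements of length \<open>l\<close>
  have length at most \<open>4 * l\<close>, and closing up under conjugation adds
  \<open>2 * M\<close>.\<close>

lemma short_der:
 assumes "nochain S M (4 * l + 2 * M)" "Y \<subseteq> ball S l" "nrm (gen S) (gen Y)"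
 obtains Y' where "Y' \<subseteq> ball S (4 * l + 2 * M)" "der (gen Y) = gen Y'"
proof -
 define F where "F = {cm x y | x y. x \<in> Y \<and> y \<in> Y}"
 have "F \<subseteq> ball S (4 * l)" unfolding F_def using assms(2) ball_cm[of _ S l _ l] by auto
 then obtain Y' where Y': "Y' \<subseteq> ball S (4 * l + 2 * M)" "F \<subseteq> gen Y'" "nrm (gen S) (gen Y')"
  "\<And>N. sg N ==> nrm (gen S) N ==> F \<subseteq> N ==> gen Y' \<subseteq> N"
  using short_normal_closure[OF assms(1)] by blast
 have YS: "gen Y \<subseteq> gen S" using gen_least[OF sg_gen] assms(2) ball_gen by (metis subset_trans)
 have "F \<subseteq> der (gen Y)" unfolding F_def using gen_base[of Y] by (auto intro: der_cm)
 then have "gen Y' \<subseteq> der (gen Y)" using Y'(4) nrm_der[OF assms(3)] by simp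
 moreover have "der (gen Y) \<subseteq> gen Y'"
 proof (rule der_least[OF sg_gen])
  fix x y assume "x \<in> gen Y" "y \<in> gen Y"
  moreover have "nrm (gen Y) (gen Y')" using nrm_sub[OF Y'(3) YS] .
  moreover have "cm a b \<in> gen Y'" if "a \<in> Y" "b \<in> Y" for a b using Y'(2) that unfolding F_def by blast
  ultimately show "cm x y \<in> gen Y'" using cm_gen_closed[OF sg_gen] by blast
 qed
 ultimately show ?thesis using that Y'(1) by blast
qed

text \<open>Growth below exp(n^(1/2)) in discrete form. The radius \<open>L * N * N\<close> holds
  the subsums of a chain of \<open>N\<close> elements of length \<open>L * N\<close>, and the
  arbitrary factor \<open>L\<close> absorbs a change of generators.\<close>

definition slow :: "'g::group_add set \<Rightarrow> bool"
 where "slow S \<longleftrightarrow> (\<forall>L. \<exists>N\<ge>1. card (ball S (L * N * N)) < 2 ^ N)"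

lemma slowD: assumes "finite S" "slow S"
 obtains N where "N \<ge> 1" "card (ball S (L * N * N)) < 2 ^ N"
 using assms unfolding slow_def by blast

lemma slow_sub: assumes "finite S" "slow S" "finite T" "T \<subseteq> gen S" shows "slow T"
 unfolding slow_def
proof
 fix L
 obtain c where c: "T \<subseteq> ball S c" using gen_finite_ball[OF assms(3,4)] by blast
 obtain N where N: "N \<ge> 1" "card (ball S (c * L * N * N)) < 2 ^ N" using slowD[OF assms(1,2)] by blast
 have "ball T (L * N * N) \<subseteq> ball S (c * L * N * N)" using ball_ball[OF c, of "L * N * N"] by (simp add: mult.assoc)
 then have "card (ball T (L * N * N)) \<le> card (ball S (c * L * N * N))" by (intro card_mono finite_ball assms)
 then show "\<exists>N\<ge>1. card (ball T (L * N * N)) < 2 ^ N" using N by (intro exI[of _ N]) auto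
qed

text \<open>Inductively the n-th derived subgroup has generators of some length \<open>l\<close>.
  Now \<open>M\<close> is chosen for this \<open>l\<close>: chains of \<open>M\<close> elements of
  length \<open>4 * l + 2 * M\<close> fit into radius \<open>(4 * l + 2) * M * M\<close>, so
  \<open>short_der\<close> applies.\<close>

lemma slow_dern_fg: assumes "finite S" "slow S"
 shows "\<exists>Y. finite Y \<and> dern n (gen S) = gen Y"
proof (induction n)
 case 0 show ?case using assms by auto
next
 case (Suc n)
 then obtain Y where Y: "finite Y" "dern n (gen S) = gen Y" by blast
 have "gen Y \<subseteq> gen S" using dern_sub[OF sg_gen[of S], of n] Y by simp
 then obtain l where l: "Y \<subseteq> ball S l" using gen_finite_ball[OF Y(1), of S] gen_base[of Y] by blast
 obtain M where M: "M \<ge> 1" "card (ball S ((4 * l + 2) * M * M)) < 2 ^ M" using slowD[OF assms] by blast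
 have "(4 * l + 2 * M) * M \<le> (4 * l + 2) * M * M" using M(1) by (simp add: algebra_simps)
 then have "nochain S M (4 * l + 2 * M)" using nochainI[OF assms(1) M(2)] by blast
 moreover have "nrm (gen S) (gen Y)" using nrm_dern[OF nrm_self[OF sg_gen[of S]], of n] Y by simp
 ultimately obtain Y' where Y': "Y' \<subseteq> ball S (4 * l + 2 * M)" "der (gen Y) = gen Y'" using short_der[OF _ l] by blast
 have "finite Y'" using finite_subset[OF Y'(1) finite_ball[OF assms(1)]] .
 then show ?case using Y Y' by (metis dern_Suc)
qed

subsection \<open>Orders\<close>

text \<open>The positive elements of a one-sided order. The conditions are the same for left and
  right invariance, so a right order of the theorem may be read here as the left invariant order
  \<open>lss\<close>.\<close>

definition cone :: "'g::group_add set \<Rightarrow> 'g set \<Rightarrow> bool"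
 where "cone P G \<longleftrightarrow> P \<subseteq> G \<and> 0 \<notin> P \<and> (\<forall>x\<in>P. \<forall>y\<in>P. x + y \<in> P) \<and> (\<forall>x\<in>G. x = 0 \<or> x \<in> P \<or> - x \<in> P)"

definition lss :: "'g::group_add set \<Rightarrow> 'g \<Rightarrow> 'g \<Rightarrow> bool" where "lss P x y \<longleftrightarrow> - x + y \<in> P"
definition leq :: "'g::group_add set \<Rightarrow> 'g \<Rightarrow> 'g \<Rightarrow> bool" where "leq P x y \<longleftrightarrow> x = y \<or> lss P x y"

lemma lt_left [simp]: "lss P (z + x) (z + y) \<longleftrightarrow> lss P x y"
 by (simp add: lss_def minus_add add.assoc)
lemma le_left [simp]: "leq P (z + x) (z + y) \<longleftrightarrow> leq P x y" by (simp add: leq_def)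
lemma lt_zero [simp]: "lss P 0 x \<longleftrightarrow> x \<in> P" by (simp add: lss_def)
lemma le_refl [simp]: "leq P x x" by (simp add: leq_def)

lemma cone_add: "cone P G ==> x \<in> P ==> y \<in> P ==> x + y \<in> P" by (simp add: cone_def)
lemma lt_irrefl: "cone P G ==> \<not> lss P x x" by (simp add: cone_def lss_def)
lemma lt_trans: "cone P G ==> lss P x y ==> lss P y z ==> lss P x z"
 using cone_add[of P G "- x + y" "- y + z"] by (simp add: lss_def add.assoc)
lemma le_lt_trans: "cone P G ==> leq P x y ==> lss P y z ==> lss P x z" using lt_trans by (auto simp: leq_def)
lemma lt_le_trans: "cone P G ==> lss P x y ==> leq P y z ==> lss P x z" using lt_trans by (auto simp: leq_def)
lemma le_trans': "cone P G ==> leq P x y ==> leq P y z ==> leq P x z" unfolding leq_def using lt_trans by blast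
lemma lt_imp_le: "lss P x y ==> leq P x y" by (simp add: leq_def)
lemma lt_total: assumes "cone P G" "sg G" "x \<in> G" "y \<in> G" shows "leq P x y \<or> lss P y x"
proof -
 have "- x + y \<in> G" using assms sg_add sg_neg by metis
 then consider "- x + y = 0" | "- x + y \<in> P" | "- (- x + y) \<in> P" using assms(1) by (auto simp: cone_def)
 then show ?thesis
 proof cases
  case 1
  then have "x + (- x + y) = x + 0" by simp
  then show ?thesis by (simp add: add.assoc leq_def)
 qed (auto simp: leq_def lss_def minus_add)
qed
lemma lt_not_le: "cone P G ==> lss P x y ==> \<not> leq P y x" using lt_le_trans lt_irrefl by metis

lemma nm_cone: assumes "cone P G" "y \<in> P" "n \<ge> 1" shows "nm n y \<in> P"
 using assms(3)
proof (induction n rule: dec_induct)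
 case (step n) then show ?case using assms cone_add by (simp add: nm_Suc)
qed (use assms in auto)

lemma nm_lt: assumes "cone P G" "y \<in> P" "m < n" shows "lss P (nm m y) (nm n y)"
proof -
 have "nm n y = nm m y + nm (n - m) y" using assms(3) by (simp flip: nm_add)
 then have "- nm m y + nm n y = nm (n - m) y" by (simp add: add.assoc[symmetric])
 then show ?thesis using nm_cone[OF assms(1,2), of "n - m"] assms(3) by (simp add: lss_def)
qed
lemma nm_le: assumes "cone P G" "y \<in> P" "m \<le> n" shows "leq P (nm m y) (nm n y)"
 using nm_lt[OF assms(1,2), of m n] assms(3) by (cases "m = n") (auto simp: leq_def)
lemma nm_neg_le: assumes "cone P G" "y \<in> P" "m \<le> n" shows "leq P (- nm n y) (- nm m y)"
proof (cases "m = n")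
 case False
 have "nm n y = nm (n - m) y + nm m y" using assms(3) by (simp flip: nm_add)
 then have "nm n y + - nm m y = nm (n - m) y" by (simp add: add.assoc)
 then show ?thesis using nm_cone[OF assms(1,2), of "n - m"] assms(3) False by (simp add: leq_def lss_def)
qed simp

text \<open>Reversing the order turns upper estimates by multiples of an element into lower
  ones.\<close>

lemma cone_rev: "cone P G ==> sg G ==> cone (uminus ` P) G"
 unfolding cone_def
proof (intro conjI ballI)
 assume a: "P \<subseteq> G \<and> 0 \<notin> P \<and> (\<forall>x\<in>P. \<forall>y\<in>P. x + y \<in> P) \<and> (\<forall>x\<in>G. x = 0 \<or> x \<in> P \<or> - x \<in> P)" "sg G"
 show "uminus ` P \<subseteq> G" using a by (auto intro: sg_neg)
 show "0 \<notin> uminus ` P" using a by auto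
 show "x + y \<in> uminus ` P" if xy: "x \<in> uminus ` P" "y \<in> uminus ` P" for x y
 proof -
  obtain a' b where "a' \<in> P" "b \<in> P" "x = - a'" "y = - b" using xy by auto
  then show ?thesis using a by (auto intro!: image_eqI[of _ _ "b + a'"] simp: minus_add)
 qed
 show "x = 0 \<or> x \<in> uminus ` P \<or> - x \<in> uminus ` P" if "x \<in> G" for x
  using a that by (metis image_eqI minus_minus)
qed

lemma lt_rev: "lss (uminus ` P) x y \<longleftrightarrow> lss P y x"
proof -
 have "- x + y \<in> uminus ` P \<longleftrightarrow> - (- x + y) \<in> P" by (metis image_iff minus_minus)
 then show ?thesis by (simp add: lss_def minus_add)
qed
lemma le_rev: "leq (uminus ` P) x y \<longleftrightarrow> leq P y x" by (auto simp: leq_def lt_rev)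

text \<open>The 2^N words of length \<open>N\<close> in two letters stay within radius
  \<open>L * N\<close>, hence in a ball with fewer than 2^N elements, and two of them must
  agree.\<close>

lemma no_free_semigroup:
 assumes "finite S" "slow S" "f \<in> gen S" "g \<in> gen S" "f \<noteq> g"
 obtains us vs where "us \<noteq> vs" "length us = length vs" "set us \<subseteq> {f, g}" "set vs \<subseteq> {f, g}" "sum_list us = sum_list vs"
proof -
 obtain L where L: "{f, g} \<subseteq> ball S L" using gen_finite_ball[of "{f, g}" S] assms by auto
 obtain N where N: "N \<ge> 1" "card (ball S (L * N * N)) < 2 ^ N" using slowD[OF assms(1,2)] by blast
 let ?A = "{us. set us \<subseteq> {f, g} \<and> length us = N}"
 have "sum_list ` ?A \<subseteq> ball S (L * N * N)"
 proof
  fix x assume "x \<in> sum_list ` ?A"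
  then have "x \<in> ball {f, g} N" unfolding ball_def by auto
  then show "x \<in> ball S (L * N * N)" using ball_ball[OF L, of N] ball_mono[of "L * N" "L * N * N" S] N(1) by auto
 qed
 then have "card (sum_list ` ?A) < 2 ^ N" using N(2) card_mono[OF finite_ball[OF assms(1)]] by (meson le_less_trans)
 moreover have "card ?A = 2 ^ N" using card_lists_length_eq[of "{f, g}" N] assms(5) by (simp add: numeral_2_eq_2)
 ultimately have "\<not> inj_on sum_list ?A" using card_image by fastforce
 then show ?thesis using that unfolding inj_on_def by blast
qed

text \<open>If \<open>f + n g < g\<close> for all \<open>n\<close>, then \<open>f\<close> and \<open>g\<close> play ping-pong on the convex hull of the
 multiples of \<open>g\<close> and generate a free semigroup.\<close>

lemma no_crossing:
 assumes "finite S" "slow S" "cone P (gen S)" "f \<in> P" "g \<in> P"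
 shows "\<exists>n. \<not> lss P (f + nm n g) g"
proof (rule ccontr)
 assume "\<not> ?thesis"
 then have all: "lss P (f + nm n g) g" for n by blast
 note C = assms(3)
 have PX: "f \<in> gen S" "g \<in> gen S" using C assms(4,5) by (auto simp: cone_def)
 have "lss P f g" using all[of 0] by simp
 then have ne: "f \<noteq> g" using lt_irrefl[OF C] by auto
 \<comment> \<open>The ping-pong table: the elements from 0 up to the multiples of \<open>g\<close>.
   Adding \<open>f\<close> on the left sends it below \<open>g\<close>, adding \<open>g\<close> on
   the left sends it to elements not below \<open>g\<close>.\<close>
 define J where "J = {x. leq P 0 x \<and> (\<exists>n. lss P x (nm n g))}"
 have Jf: "lss P (f + x) g \<and> f + x \<in> J" if x: "x \<in> J" for x
 proof -
  obtain n where n: "lss P x (nm n g)" "leq P 0 x" using x J_def by auto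
  have 1: "lss P (f + x) g" using lt_trans[OF C _ all[of n], of "f + x"] n by simp
  have "leq P (f + 0) (f + x)" using n by (simp only: le_left)
  then have "lss P 0 (f + x)" using assms(4) lt_le_trans[OF C, of 0 f] by simp
  then show ?thesis using 1 unfolding J_def by (auto simp: leq_def intro!: exI[of _ 1])
 qed
 have Jg: "leq P g (g + x) \<and> g + x \<in> J" if x: "x \<in> J" for x
 proof -
  obtain n where n: "lss P x (nm n g)" "leq P 0 x" using x J_def by auto
  have 1: "leq P (g + 0) (g + x)" using n by (simp only: le_left)
  then have "lss P 0 (g + x)" using assms(5) lt_le_trans[OF C, of 0 g] by simp
  moreover have "lss P (g + x) (nm (Suc n) g)" using n by (simp add: nm_Suc)
  ultimately show ?thesis using 1 unfolding J_def by (auto simp: leq_def simp del: lt_zero)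
 qed
 have 0: "0 \<in> J" unfolding J_def using assms(5) by (auto intro!: exI[of _ 1])
 have J: "set us \<subseteq> {f, g} ==> sum_list us \<in> J" for us
  by (induction us) (use 0 Jf Jg in auto)
 have "length us = length vs ==> set us \<subseteq> {f, g} ==> set vs \<subseteq> {f, g} ==> sum_list us = sum_list vs ==> us = vs" for us vs
 proof (induction us vs rule: list_induct2)
  case (Cons u us v vs)
  have Js: "sum_list us \<in> J" "sum_list vs \<in> J" using J Cons.prems by auto
  have e: "u + sum_list us = v + sum_list vs" using Cons.prems by simp
  \<comment> \<open>Whether the common value lies below \<open>g\<close> reveals the first
    letter.\<close>
  have "u = v"
  proof (rule ccontr)
   assume "u \<noteq> v"
   then consider "u = f" "v = g" | "u = g" "v = f" using Cons.prems by auto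
   then show False
   proof cases
    case 1
    then show False using e Jf[OF Js(1)] Jg[OF Js(2)] lt_not_le[OF C] by metis
   next
    case 2
    then show False using e Jf[OF Js(2)] Jg[OF Js(1)] lt_not_le[OF C] by metis
   qed
  qed
  then show ?case using e Cons by auto
 qed auto
 then show False using no_free_semigroup[OF assms(1,2) PX ne] by metis
qed


text \<open>Failure would produce a crossing. If \<open>z + nm n y\<close> exceeded all multiples of
  \<open>y\<close>, then \<open>f = - z + nm (Suc m) y\<close> and \<open>g = nm (Suc n) y\<close>
  would be positive with \<open>f + nm j g < g\<close> for every \<open>j\<close>. If
  \<open>- z\<close> exceeded them, then \<open>nm (Suc m) y + z\<close> and
  \<open>nm (Suc m) y\<close> would do the same.\<close>

lemma multiples_bounded:
 assumes "cone P G" "sg G" "\<And>f g. f \<in> P ==> g \<in> P ==> \<exists>n. \<not> lss P (f + nm n g) g"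
  "y \<in> P" "z \<in> G"
 shows "leq P z (nm m y) ==> \<exists>k. leq P (z + nm n y) (nm k y)"
  and "leq P (- nm m y) z ==> \<exists>k. leq P (- z) (nm k y)"
proof -
 note C = assms(1)
 have y: "y \<in> G" "nm k y \<in> G" for k using C assms(4) sg_nm[OF assms(2)] by (auto simp: cone_def)
 show "\<exists>k. leq P (z + nm n y) (nm k y)" if le: "leq P z (nm m y)"
 proof (rule ccontr)
  assume n: "\<nexists>k. leq P (z + nm n y) (nm k y)"
  have all: "lss P (nm k y) (z + nm n y)" for k
   using n lt_total[OF C assms(2), of "z + nm n y" "nm k y"] y assms(5) sg_add[OF assms(2)] by metis
  let ?f = "- z + nm (Suc m) y" and ?g = "nm (Suc n) y"
  have "lss P z (nm (Suc m) y)" using le_lt_trans[OF C le nm_lt[OF C assms(4)]] by auto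
  then have "?f \<in> P" by (simp add: lss_def)
  moreover have "?g \<in> P" using nm_cone[OF C assms(4)] by auto
  ultimately obtain j where j: "\<not> lss P (?f + nm j ?g) ?g" using assms(3) by blast
  have "?f + nm j ?g = - z + nm (Suc m + j * Suc n) y" by (simp only: nm_add nm_mult add.assoc)
  moreover have "lss P (- z + nm K y) (nm n y)" for K using all[of K] by (simp add: lss_def minus_add add.assoc)
  ultimately have "lss P (?f + nm j ?g) (nm n y)" by simp
  then show False using j lt_trans[OF C _ nm_lt[OF C assms(4), of n "Suc n"]] by auto
 qed
 show "\<exists>k. leq P (- z) (nm k y)" if le: "leq P (- nm m y) z"
 proof (rule ccontr)
  assume n: "\<nexists>k. leq P (- z) (nm k y)"
  have all: "lss P (nm k y) (- z)" for k
   using n lt_total[OF C assms(2), of "- z" "nm k y"] y assms(5) sg_neg[OF assms(2)] by metis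
  let ?g = "nm (Suc m) y"
  have "lss P (- nm (Suc m) y) (- nm m y)"
   using nm_lt[OF C assms(4), of m "Suc m"] nm_cone[OF C assms(4), of 1] by (simp add: lss_def nm_Suc add.assoc)
  then have "lss P (- ?g) z" using lt_le_trans[OF C _ le] by blast
  then have "?g + z \<in> P" by (simp add: lss_def)
  moreover have "?g \<in> P" using nm_cone[OF C assms(4)] by auto
  ultimately obtain j where j: "\<not> lss P (?g + z + nm j ?g) ?g" using assms(3) by blast
  have "lss P (?g + z + nm K y) ?g" for K using all[of K] by (simp add: lss_def minus_add add.assoc)
  then show False using j by (metis nm_mult)
 qed
qed

definition zm :: "int \<Rightarrow> 'g::group_add \<Rightarrow> 'g"
 where "zm i x = (if i \<ge> 0 then nm (nat i) x else - nm (nat (- i)) x)"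

lemma zm_diff: "zm (int a - int b) x = nm a x + - nm b x"
proof (cases "b \<le> a")
 case True
 then have "nm a x = nm (a - b) x + nm b x" by (simp flip: nm_add)
 then show ?thesis using True by (simp add: zm_def add.assoc nat_diff_distrib)
next
 case False
 then have "nm b x = nm (b - a) x + nm a x" by (simp flip: nm_add)
 moreover have "nat (int b - int a) = b - a" by simp
 ultimately show ?thesis using False by (simp add: zm_def minus_add add.assoc[symmetric])
qed
lemma nm_nm_comm: "nm a x + nm b x = nm b x + nm a x"
 by (metis add.commute nm_add)
lemma zm_add: "zm (i + j) x = zm i x + zm j x"
proof -
 obtain a b c d where ij: "i = int a - int b" "j = int c - int d"
  using int_diff_cases by metis
 have e: "- nm b x + nm c x = nm c x + - nm b x"
 proof -
  have "- nm b x + (nm c x + nm b x) + - nm b x = - nm b x + (nm b x + nm c x) + - nm b x"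
   by (simp only: nm_nm_comm)
  then show ?thesis by (simp add: add.assoc)
 qed
 have ij': "i + j = int (a + c) - int (b + d)" using ij by simp
 have "zm (i + j) x = nm a x + nm c x + - (nm d x + nm b x)"
  unfolding ij' zm_diff nm_add by (simp add: nm_nm_comm)
 also have "\<dots> = nm a x + (nm c x + - nm b x) + - nm d x"
  using nm_nm_comm[of d x b] by (simp add: minus_add add.assoc) (metis minus_add nm_nm_comm)
 also have "\<dots> = zm i x + zm j x" unfolding e[symmetric] by (simp add: ij zm_diff add.assoc)
 finally show ?thesis .
qed
lemma zm_0 [simp]: "zm 0 x = 0" by (simp add: zm_def)
lemma zm_1 [simp]: "zm 1 x = x" by (simp add: zm_def)
lemma zm_neg: "zm (- i) x = - zm i x"
 by (cases "i = 0") (auto simp: zm_def)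
lemma zm_int [simp]: "zm (int n) x = nm n x" by (simp add: zm_def)
lemma sg_zm: "sg H ==> x \<in> H ==> zm i x \<in> H" by (simp add: zm_def sg_nm sg_neg)
lemma hm_zm: "hm f H ==> sg H ==> x \<in> H ==> f (zm i x) = zm i (f x)"
 by (simp add: zm_def hm_nm hm_neg sg_nm)
lemma zm_zm_comm: "zm i x + zm j x = zm j x + zm i x" by (metis add.commute zm_add)

text \<open>Conrad's theorem: in the absence of crossings the elements \<open>g\<close> that are cofinal in both
 directions behave like the positive elements of an Archimedean bi-order, so they survive in the
 torsion-free part of the abelianization.\<close>

lemma cofinal_nontorsion:
 assumes C: "cone P G" and sgG: "sg G"
  and nc: "\<And>f g. f \<in> P ==> g \<in> P ==> \<exists>n. \<not> lss P (f + nm n g) g"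
  and nc': "\<And>f g. f \<in> uminus ` P ==> g \<in> uminus ` P ==> \<exists>n. \<not> lss (uminus ` P) (f + nm n g) g"
  and SG: "G = gen S" and g: "g \<in> P" "\<And>s. s \<in> S ==> leq P s g \<and> leq P (- s) g"
  and n: "n \<ge> 1"
 shows "nm n g \<notin> der G"
proof -
 \<comment> \<open>The convex hull of the multiples of \<open>y\<close>. That it is a subgroup is
   where the absence of crossings enters.\<close>
 define E where "E y = {z \<in> G. \<exists>k. leq P (- nm k y) z \<and> leq P z (nm k y)}" for y
 have PG: "x \<in> G" if "x \<in> P" for x using C that by (auto simp: cone_def)
 have nmG: "nm k y \<in> G" if "y \<in> P" for k y using PG[OF that] sg_nm[OF sgG] by blast
 have tot: "x \<in> G ==> y \<in> G ==> leq P x y \<or> lss P y x" for x y using lt_total[OF C sgG] .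
 have add_mem: "x \<in> G ==> y \<in> G ==> x + y \<in> G" for x y using sg_add[OF sgG] .
 have neg_mem: "x \<in> G ==> - x \<in> G" for x using sg_neg[OF sgG] .
 have up: "\<exists>k. leq P (z + nm n y) (nm k y)" if "y \<in> P" "z \<in> G" "leq P z (nm m y)" for y z m n
  using multiples_bounded(1)[OF C sgG nc that] .
 have invup: "\<exists>k. leq P (- z) (nm k y)" if "y \<in> P" "z \<in> G" "leq P (- nm m y) z" for y z m
  using multiples_bounded(2)[OF C sgG nc that] .
 note C' = cone_rev[OF C sgG]
 \<comment> \<open>The upper estimates for the reversed order, applied to the negative of
   \<open>y\<close>.\<close>
 have down: "\<exists>k. leq P (- nm k y) (z + - nm n y)" if "y \<in> P" "z \<in> G" "leq P (- nm m y) z" for y z m n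
  using multiples_bounded(1)[OF C' sgG nc', of "- y" z m n] that by (auto simp: le_rev nm_neg)
 have invdown: "\<exists>k. leq P (- nm k y) (- z)" if "y \<in> P" "z \<in> G" "leq P z (nm m y)" for y z m
  using multiples_bounded(2)[OF C' sgG nc', of "- y" z m] that by (auto simp: le_rev nm_neg)
 have EI: "z \<in> E y" if "y \<in> P" "z \<in> G" "leq P (- nm k y) z" "leq P z (nm l y)" for y z k l
 proof -
  have "leq P (- nm (max k l) y) z" using le_trans'[OF C nm_neg_le[OF C that(1), of k "max k l"] that(3)] by simp
  moreover have "leq P z (nm (max k l) y)" using le_trans'[OF C that(4) nm_le[OF C that(1), of l "max k l"]] by simp
  ultimately show ?thesis unfolding E_def using that(2) by blast
 qed
 have posle: "leq P (- nm k y) z" if "y \<in> P" "leq P 0 z" for k y z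
 proof -
  have "leq P (- nm k y) 0" using nm_neg_le[OF C that(1), of 0 k] by simp
  then show ?thesis using le_trans'[OF C _ that(2)] by blast
 qed
 have Esg: "sg (E y)" if y: "y \<in> P" for y
 proof (rule sgI)
  show "0 \<in> E y" using sg_zero[OF sgG] by (auto simp: E_def intro!: exI[of _ 0])
 next
  fix z w assume "z \<in> E y" "w \<in> E y"
  then obtain k l where kl: "z \<in> G" "w \<in> G" "leq P (- nm k y) z" "leq P z (nm k y)" "leq P (- nm l y) w" "leq P w (nm l y)"
   unfolding E_def by blast
  obtain a where a: "leq P (z + nm l y) (nm a y)" using up[OF y kl(1,4)] by blast
  obtain b where b: "leq P (- nm b y) (z + - nm l y)" using down[OF y kl(1,3)] by blast
  have "leq P (z + w) (z + nm l y)" "leq P (z + - nm l y) (z + w)" using kl by (simp_all only: le_left)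
  then show "z + w \<in> E y" using EI[OF y add_mem[OF kl(1,2)]] le_trans'[OF C _ a] le_trans'[OF C b] by blast
 next
  fix z assume "z \<in> E y"
  then obtain k where k: "z \<in> G" "leq P (- nm k y) z" "leq P z (nm k y)" unfolding E_def by blast
  obtain a where a: "leq P (- z) (nm a y)" using invup[OF y k(1,2)] by blast
  obtain b where b: "leq P (- nm b y) (- z)" using invdown[OF y k(1,3)] by blast
  show "- z \<in> E y" using EI[OF y neg_mem[OF k(1)] b a] .
 qed
 have Eself: "y \<in> E y" if "y \<in> P" for y
  using that PG by (auto intro!: EI[of y y 0 1] simp: leq_def)
 have Econv: "w \<in> E y" if w: "y \<in> P" "z \<in> E y" "w \<in> G" "leq P 0 w" "leq P w z" for w y z
 proof -
  obtain k where "leq P z (nm k y)" using w(2) by (auto simp: E_def)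
  then have "leq P w (nm k y)" using le_trans'[OF C w(5)] by blast
  then show ?thesis using EI[OF w(1,3) posle[OF w(1,4)]] by blast
 qed
 have EG: "E y \<subseteq> G" for y by (auto simp: E_def)
 have Eg: "E g = G"
 proof -
  have "s \<in> E g" if s: "s \<in> S" for s
  proof -
   have sG: "s \<in> G" using s gen_base SG by blast
   then consider "s = 0" | "s \<in> P" | "- s \<in> P" using C by (auto simp: cone_def)
   then show ?thesis
   proof cases
    case 1 then show ?thesis using sg_zero[OF Esg[OF g(1)]] by simp
   next
    case 2 then show ?thesis using Econv[OF g(1) Eself[OF g(1)] sG] g(2)[OF s] by (simp add: leq_def)
   next
    case 3 then have "- s \<in> E g" using Econv[OF g(1) Eself[OF g(1)] neg_mem[OF sG]] g(2)[OF s] by (simp add: leq_def)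
    then show ?thesis using sg_neg_iff[OF Esg[OF g(1)]] by blast
   qed
  qed
  then have "gen S \<subseteq> E g" by (intro gen_least Esg g(1)) auto
  then show ?thesis using EG SG by blast
 qed
 \<comment> \<open>The positive elements that are cofinal along with \<open>g\<close>. They will be
   the positive elements of the Archimedean quotient.\<close>
 define Q where "Q = {y \<in> P. \<exists>k. leq P g (nm k y)}"
 have QP: "y \<in> P" if "y \<in> Q" for y using that by (auto simp: Q_def)
 have EQ: "E y = G" if "y \<in> Q" for y
 proof -
  obtain k where y: "y \<in> P" "leq P g (nm k y)" using \<open>y \<in> Q\<close> by (auto simp: Q_def)
  have gE: "g \<in> E y" using g(1) by (intro EI[OF y(1) PG[OF g(1)] posle[OF y(1), of _ 0] y(2)]) (auto simp: leq_def)
  have "z \<in> E y" if z: "z \<in> G" for z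
  proof -
   obtain j where j: "leq P (- nm j g) z" "leq P z (nm j g)" using z Eg by (auto simp: E_def)
   have "nm j g \<in> E y" "- nm j g \<in> E y" using gE sg_nm[OF Esg[OF y(1)]] sg_neg[OF Esg[OF y(1)]] by auto
   then obtain a b where "leq P (nm j g) (nm a y)" "leq P (- nm b y) (- nm j g)" by (auto simp: E_def)
   then show ?thesis using EI[OF y(1) z] le_trans'[OF C] j by blast
  qed
  then show ?thesis using EG by blast
 qed
 have QI: "y \<in> Q" if "y \<in> P" "g \<in> E y" for y using that by (auto simp: Q_def E_def)
 have Qup: "z \<in> Q" if y: "y \<in> Q" "leq P y z" for y z
 proof -
  have z: "z \<in> P" using QP[OF y(1)] y(2) lt_le_trans[OF C, of 0 y z] by simp
  then have yE: "y \<in> E z" using Econv[OF z Eself[OF z], of y] PG[OF QP[OF y(1)]] QP[OF y(1)] y(2) by (simp add: leq_def)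
  obtain k where k: "leq P g (nm k y)" using y by (auto simp: Q_def)
  have "g \<in> E z" using Econv[OF z sg_nm[OF Esg[OF z] yE, of k], of g] g(1) PG k by (simp add: leq_def)
  then show ?thesis using QI z by blast
 qed
 have Qadd: "a + b \<in> Q" if "a \<in> Q" "b \<in> Q" for a b
  using Qup[OF that(1), of "a + b"] le_left[of P a 0 b] QP[OF that(2)] by (simp add: leq_def)
 have bd: "\<exists>k. leq P (- nm k y) z \<and> leq P z (nm k y)" if "y \<in> Q" "z \<in> G" for y z
  using EQ[OF that(1)] that(2) by (auto simp: E_def)
 have Qcj: "x + y + - x \<in> Q" if y: "y \<in> Q" and x: "x \<in> G" for x y
 proof -
  have yP: "y \<in> P" using QP y by blast
  obtain k where k: "leq P (- nm k y) (- x)" "leq P (- x) (nm k y)" using bd[OF y neg_mem[OF x]] by blast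
  have mem: "x + y + - x \<in> G" using x PG[OF yP] by (intro add_mem neg_mem)
  have pos: "x + y + - x \<in> P"
  proof (rule ccontr)
   assume "x + y + - x \<notin> P"
   then have "leq P (x + y + - x) 0" using tot[OF mem, of 0] sg_zero[OF sgG] by auto
   then have "leq P (- x + (x + y + - x)) (- x + 0)" by (simp only: le_left)
   then have l1: "leq P (y + - x) (- x)" by (simp add: add.assoc)
   have l2: "leq P (nm n y + - x) (- x)" for n
   proof (induction n)
    case (Suc n)
    have "leq P (nm n y + (y + - x)) (nm n y + - x)" using l1 by (simp only: le_left)
    then show ?case using le_trans'[OF C _ Suc] by (simp add: nm_Suc2 add.assoc)
   qed simp
   \<comment> \<open>The element \<open>- x\<close> lies between the \<open>k\<close>-th multiples
     of \<open>- y\<close> and \<open>y\<close>; after a loss of \<open>k\<close> on one side,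
     \<open>2 k + 1\<close> multiples still leave \<open>k + 1\<close>, more than the upper bound
     \<open>k\<close>.\<close>
   let ?n = "Suc (k + k)"
   have "leq P (nm ?n y + - nm k y) (nm ?n y + - x)" using k(1) by (simp only: le_left)
   moreover have "nm ?n y + - nm k y = nm (Suc k) y"
    using nm_add[of "Suc k" k y] by (simp add: add.assoc)
   ultimately have "leq P (nm (Suc k) y) (nm k y)" using le_trans'[OF C] l2[of ?n] k(2) by metis
   then show False using nm_lt[OF C yP, of k "Suc k"] lt_not_le[OF C] by auto
  qed
  have "\<exists>n. leq P g (nm n (x + y + - x))"
  proof (rule ccontr)
   assume "\<not> ?thesis"
   then have l: "lss P (nm n (x + y + - x)) g" for n using tot[OF PG[OF g(1)] sg_nm[OF sgG mem]] by blast
   have l2: "lss P (nm n y + - x) (- x + g)" for n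
   proof -
    have "lss P (- x + nm n (x + y + - x)) (- x + g)" using l by (simp only: lt_left)
    moreover have "- x + nm n (x + y + - x) = nm n y + - x" unfolding nm_cj by (simp add: add.assoc)
    ultimately show ?thesis by metis
   qed
   obtain j where j: "leq P (- x + g) (nm j y)" using bd[OF y, of "- x + g"] x PG[OF g(1)] neg_mem add_mem by blast
   have "leq P (nm (j + k) y + - nm k y) (nm (j + k) y + - x)" using k(1) by (simp only: le_left)
   moreover have "nm (j + k) y + - nm k y = nm j y" by (simp add: nm_add add.assoc)
   ultimately have "lss P (nm j y) (- x + g)" using le_lt_trans[OF C _ l2] by metis
   then show False using j lt_not_le[OF C] by blast
  qed
  then show ?thesis using pos by (auto simp: Q_def)
 qed
 have Qcj_iff: "x + y + - x \<in> Q \<longleftrightarrow> y \<in> Q" if "x \<in> G" for x y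
  using Qcj[OF _ that, of y] Qcj[OF _ neg_mem[OF that], of "x + y + - x"] by (auto simp: add.assoc)
 have Q0: "0 \<notin> Q" using QP C by (auto simp: cone_def)
 \<comment> \<open>Conjugation invariance puts \<open>b + a\<close> into \<open>Q\<close> as well,
   so both summands must be positive. The smaller one lies in the hull of the larger one, whose
   multiples then already reach \<open>g\<close>.\<close>
 have nQadd: "a + b \<notin> Q" if ab: "a \<notin> Q" "b \<notin> Q" and m: "a \<in> G" "b \<in> G" for a b
 proof
  assume c: "a + b \<in> Q"
  have c': "b + a \<in> Q" using Qcj[OF c neg_mem[OF m(1)]] by (simp add: add.assoc)
  have ap: "a \<in> P"
  proof (rule ccontr)
   assume "a \<notin> P"
   then have "leq P a 0" using tot[OF m(1), of 0] sg_zero[OF sgG] by auto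
   then have "leq P (b + a) (b + 0)" by (simp only: le_left)
   then show False using Qup[OF c'] ab by simp
  qed
  have bp: "b \<in> P"
  proof (rule ccontr)
   assume "b \<notin> P"
   then have "leq P b 0" using tot[OF m(2), of 0] sg_zero[OF sgG] by auto
   then have "leq P (a + b) (a + 0)" by (simp only: le_left)
   then show False using Qup[OF c] ab by simp
  qed
  have *: False if w: "a \<in> P" "b \<in> P" "leq P a b" "a + b \<in> Q" "b \<notin> Q" for a b
  proof -
   have "a \<in> E b" using Econv[OF w(2) Eself[OF w(2)] PG[OF w(1)]] w by (simp add: leq_def)
   then have "a + b \<in> E b" using sg_add[OF Esg[OF w(2)]] Eself[OF w(2)] by blast
   moreover obtain k where "leq P g (nm k (a + b))" using w(4) by (auto simp: Q_def)
   ultimately have "g \<in> E b" using Econv[OF w(2) sg_nm[OF Esg[OF w(2)]], of "a + b" g k] PG g(1) by (simp add: leq_def)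
   then show False using QI w by blast
  qed
  show False using tot[OF m] *[OF ap bp _ c ab(2)] *[OF bp ap _ c' ab(1)] by (auto simp: leq_def)
 qed
 \<comment> \<open>Division with remainder: \<open>x\<close> lies between the \<open>m\<close>-th
   and the next multiple of \<open>e\<close>, where order is measured by membership in
   \<open>Q\<close>.\<close>
 have floor: "\<exists>m. - x + zm m e \<notin> Q \<and> - x + zm (m + 1) e \<in> Q" if e: "e \<in> Q" and x: "x \<in> G" for e x
 proof -
  obtain k where k: "leq P (- nm k e) x" "leq P x (nm k e)" using bd[OF e x] by blast
  \<comment> \<open>Counting starts at the lower bound \<open>- nm k e\<close>, so that
    \<open>LEAST\<close> over the naturals finds the integer.\<close>
  let ?f = "\<lambda>m. - x + zm (int m - int k) e"
  have 0: "?f 0 \<notin> Q"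
  proof
   assume "?f 0 \<in> Q"
   then have "- x + - nm k e \<in> P" using QP by (auto simp: zm_neg)
   then have "lss P x (- nm k e)" by (simp add: lss_def)
   then show False using lt_not_le[OF C] k by blast
  qed
  have "leq P 0 (- x + nm k e)" using le_left[of P "- x" x "nm k e"] k by simp
  then have "leq P (e + 0) (e + (- x + nm k e))" by (simp only: le_left)
  then have "e + (- x + nm k e) \<in> Q" using Qup[OF e] by simp
  then have "- e + (e + (- x + nm k e)) + - (- e) \<in> Q" using Qcj neg_mem PG QP e by blast
  then have "- x + nm (Suc k) e \<in> Q" by (simp add: add.assoc nm_Suc2)
  moreover have "zm (int (Suc k + k) - int k) e = nm (Suc k) e" by (simp add: zm_def nat_add_distrib)
  ultimately have ex: "?f (Suc k + k) \<in> Q" by simp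
  define m where "m = (LEAST m. ?f m \<in> Q)"
  have m: "?f m \<in> Q" "\<And>j. j < m ==> ?f j \<notin> Q" unfolding m_def by (rule LeastI, rule ex) (use not_less_Least in blast)
  then obtain j where j: "m = Suc j" using 0 by (cases m) auto
  have "int m - int k = int j - int k + 1" using j by simp
  then have "- x + zm (int j - int k + 1) e \<in> Q" using m(1) by metis
  moreover have "- x + zm (int j - int k) e \<notin> Q" using m(2)[of j] j by blast
  ultimately show ?thesis by blast
 qed
 \<comment> \<open>The elements that are not cofinal in either direction. They form a normal
   subgroup, and the quotient by it is ordered by \<open>Q\<close>.\<close>
 define D where "D = {x \<in> G. x \<notin> Q \<and> - x \<notin> Q}"
 have Dsg: "sg D"
  by (rule sgI) (auto simp: D_def minus_add sg_zero[OF sgG] Q0 add_mem neg_mem nQadd)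
 have Dn: "nrm G D" unfolding nrm_def D_def
 proof (intro ballI CollectI conjI)
  fix x y assume x: "x \<in> G" and y: "y \<in> {x \<in> G. x \<notin> Q \<and> - x \<notin> Q}"
  show "x + y + - x \<in> G" using x y add_mem neg_mem by auto
  show "x + y + - x \<notin> Q" using Qcj_iff[OF x] y by auto
  have "- (x + y + - x) = x + - y + - x" by (simp add: minus_add add.assoc)
  then show "- (x + y + - x) \<notin> Q" using Qcj_iff[OF x] y by auto
 qed
 have key: "cm x z \<notin> Q" if x: "x \<in> G" and z: "z \<in> G" for x z
 proof
  let ?c = "cm x z"
  assume c: "?c \<in> Q"
  show False
  \<comment> \<open>Hoelder's two cases. If \<open>?c\<close> is at least twice some
    \<open>e\<close>, approximate \<open>x\<close> and \<open>z\<close> by multiples of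
    \<open>e\<close>: the two sums \<open>x + z\<close> and \<open>z + x\<close> then differ by less
    than \<open>e + e\<close>, a contradiction. Otherwise no element of \<open>Q\<close> is at most
    half of \<open>?c\<close>, and every element is a multiple of \<open>?c\<close> modulo
    \<open>D\<close>, so the quotient is cyclic and its commutators vanish.\<close>
  proof (cases "\<exists>e\<in>Q. - ?c + (e + e) \<notin> Q")
   case True
   then obtain e where e: "e \<in> Q" "- ?c + (e + e) \<notin> Q" by blast
   obtain a where a: "- x + zm a e \<notin> Q" "- x + zm (a + 1) e \<in> Q" using floor[OF e(1) x] by blast
   obtain b where b: "- z + zm b e \<notin> Q" "- z + zm (b + 1) e \<in> Q" using floor[OF e(1) z] by blast
   have eG: "zm i e \<in> G" for i using sg_zm[OF sgG PG[OF QP[OF e(1)]]] .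
   have q: "a + b + 2 = (a + 1) + (b + 1)" "a + b + 2 = 1 + (1 + (a + b))" by simp_all
   have zab: "zm (a + b + 2) e = zm (a + 1) e + zm (b + 1) e" unfolding q(1) by (rule zm_add)
   have zba: "zm (a + b) e = zm b e + zm a e" using zm_add[of a b e] zm_zm_comm[of a e b] by simp
   have ee: "zm (a + b + 2) e = e + e + zm (a + b) e"
    unfolding q(2) zm_add[of 1] zm_1 by (simp add: add.assoc)
   let ?p = "- (x + z) + zm (a + b + 2) e" and ?r = "- (z + x) + zm (a + b) e"
   have "?p = (- z + (- x + zm (a + 1) e) + - (- z)) + (- z + zm (b + 1) e)"
    unfolding zab by (simp add: minus_add add.assoc)
   then have p: "?p \<in> Q" using Qadd Qcj[OF a(2) neg_mem[OF z]] b(2) by simp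
   have r: "?r \<notin> Q"
   proof -
    have "?r = (- x + (- z + zm b e) + - (- x)) + (- x + zm a e)"
     unfolding zba by (simp add: minus_add add.assoc)
    moreover have "- x + (- z + zm b e) + - (- x) \<notin> Q" using Qcj_iff[OF neg_mem[OF x]] b(1) by blast
    ultimately show ?thesis using nQadd a(1) x z eG add_mem neg_mem by simp
   qed
   have rp: "- ?r + ?p \<in> Q"
   proof (rule ccontr)
    assume np: "- ?r + ?p \<notin> Q"
    have rG: "?r \<in> G" "?p \<in> G" by (intro add_mem neg_mem x z eG)+
    have "?r + (- ?r + ?p) \<notin> Q" using nQadd[OF r np rG(1) add_mem[OF neg_mem[OF rG(1)] rG(2)]] .
    moreover have "?r + (- ?r + ?p) = ?p" by (rule add_minus_cancel)
    ultimately show False using p by metis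
   qed
   have "zm (a + b) e + (- ?r + ?p) + - zm (a + b) e = - ?c + (e + e)"
    unfolding ee cm_def by (simp add: minus_add add.assoc)
   then show False using Qcj[OF rp eG[of "a + b"]] e(2) by simp
  next
   case False
   then have all: "- ?c + (e + e) \<in> Q" if "e \<in> Q" for e using that by blast
   have cG: "?c \<in> G" using PG QP c by blast
   have res: "\<exists>m r. r \<in> D \<and> w = zm m ?c + r" if w: "w \<in> G" for w
   proof -
    obtain m where m: "- w + zm m ?c \<notin> Q" "- w + zm (m + 1) ?c \<in> Q" using floor[OF c w] by blast
    let ?r = "- zm m ?c + w"
    have rG: "?r \<in> G" using sg_zm[OF sgG cG] w add_mem neg_mem by blast
    have 1: "- ?r \<notin> Q" using m(1) by (simp add: minus_add)
    have 2: "- ?r + ?c \<in> Q" using m(2) zm_add[of m 1 ?c] by (simp add: minus_add add.assoc)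
    \<comment> \<open>If the remainder \<open>?r\<close> were in \<open>Q\<close>, then both
      \<open>?r\<close> and \<open>?s\<close>, with \<open>?r + ?s = ?c\<close>, would exceed half
      of \<open>?c\<close>.\<close>
    have "?r \<notin> Q"
    proof
     assume r: "?r \<in> Q"
     let ?s = "- ?r + ?c"
     have a: "- ?s + ?r \<in> Q" using all[OF r] by (simp add: minus_add add.assoc)
     have "- ?c + (?s + ?s) = - ?s + (- ?r + ?s) + - (- ?s)" by (simp add: minus_add add.assoc)
     then have "- ?r + ?s \<in> Q" using all[OF 2] Qcj_iff[OF neg_mem[OF PG[OF QP[OF 2]]]] by simp
     then have "(- ?s + ?r) + (- ?r + ?s) \<in> Q" using Qadd a by blast
     then show False using Q0 by (simp add: add.assoc)
    qed
    then have "?r \<in> D" using 1 rG by (simp add: D_def)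
    moreover have "w = zm m ?c + ?r" by (simp add: add.assoc[symmetric])
    ultimately show ?thesis by blast
   qed
   obtain f :: "'a \<Rightarrow> 'a set bijn" where f: "hm f G" "\<And>u. u \<in> G ==> f u = 0 \<longleftrightarrow> u \<in> D"
    using ex_quotient_hom[OF sgG Dsg _ Dn] by (auto simp: D_def)
   have fz: "\<exists>m. f w = zm m (f ?c)" if w: "w \<in> G" for w
   proof -
    obtain m r where r: "r \<in> D" "w = zm m ?c + r" using res[OF w] by blast
    then have "r \<in> G" by (simp add: D_def)
    then have "f w = f (zm m ?c) + f r" using r hmD[OF f(1) sg_zm[OF sgG cG]] by simp
    moreover have "f r = 0" using f(2)[OF \<open>r \<in> G\<close>] r by blast
    ultimately show ?thesis using hm_zm[OF f(1) sgG cG] by auto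
   qed
   obtain i j where "f x = zm i (f ?c)" "f z = zm j (f ?c)" using fz x z by metis
   then have "cm (f x) (f z) = 0" unfolding cm_zero_iff by (simp add: zm_zm_comm)
   then have "f ?c = 0" using hm_cm[OF f(1) sgG x z] by simp
   then show False using f(2)[OF cG] c by (simp add: D_def)
  qed
 qed
 have "der G \<subseteq> D"
 proof (rule der_least[OF Dsg])
  fix x y assume "x \<in> G" "y \<in> G"
  then show "cm x y \<in> D" unfolding D_def using key[of x y] key[of y x] sg_cm[OF sgG] by (auto simp: neg_cm)
 qed
 moreover have "nm n g \<in> Q" using n
 proof (induction n rule: dec_induct)
  case base then show ?case using g(1) by (auto simp: Q_def intro!: exI[of _ 1])
 next
  case (step n)
  have "g \<in> Q" using g(1) by (auto simp: Q_def intro!: exI[of _ 1])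
  then show ?case using step Qadd by (simp add: nm_Suc)
 qed
 ultimately show ?thesis by (auto simp: D_def)
qed

text \<open>The greatest element among the generators and their negatives is positive, as the group
  is nontrivial, and it dominates all generators; so it is cofinal. Slow growth excludes crossings
  for the order and for its reverse.\<close>

lemma slow_nontorsion:
 assumes "finite S" "slow S" "cone P (gen S)" "gen S \<noteq> {0}"
 obtains g where "g \<in> gen S" "\<And>n. n \<ge> 1 ==> nm n g \<notin> der (gen S)"
proof -
 note C = assms(3)
 let ?A = "S \<union> uminus ` S"
 have AG: "?A \<subseteq> gen S" using gen_base[of S] by (auto intro: sg_neg[OF sg_gen])
 have max: "\<exists>g\<in>A. \<forall>s\<in>A. leq P s g" if "finite A" "A \<noteq> {}" "A \<subseteq> gen S" for A
  using that
 proof (induction A rule: finite_ne_induct)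
  case (insert x F)
  then obtain g where g: "g \<in> F" "\<forall>s\<in>F. leq P s g" by auto
  have "leq P x g \<or> lss P g x" using lt_total[OF C sg_gen, of x g] insert.prems g by blast
  then show ?case
  proof
   assume "lss P g x"
   then have "\<forall>s\<in>insert x F. leq P s x" using g le_trans'[OF C _ lt_imp_le] by auto
   then show ?thesis by blast
  qed (use g in auto)
 qed auto
 have "\<exists>s\<in>S. s \<noteq> 0"
 proof (rule ccontr)
  assume "\<not> ?thesis"
  then have "gen S \<subseteq> {0}" by (intro gen_least) (auto simp: sg_def)
  then show False using assms(4) sg_zero[OF sg_gen] by blast
 qed
 then obtain s where s: "s \<in> S" "s \<noteq> 0" by blast
 obtain g where g: "g \<in> ?A" "\<forall>s\<in>?A. leq P s g" using max[of ?A] AG assms(1) s by auto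
 have "s \<in> P \<or> - s \<in> P" using C s gen_base[of S] by (auto simp: cone_def)
 then have "lss P 0 g" using g(2) s(1) lt_le_trans[OF C, of 0 _ g] by (metis UnCI image_eqI lt_zero)
 then have gP: "g \<in> P" by simp
 have nc: "\<exists>n. \<not> lss P (f + nm n h) h" if "f \<in> P" "h \<in> P" for f h
  using no_crossing[OF assms(1-3)] that by blast
 have nc': "\<exists>n. \<not> lss (uminus ` P) (f + nm n h) h" if "f \<in> uminus ` P" "h \<in> uminus ` P" for f h
  using no_crossing[OF assms(1,2) cone_rev[OF C sg_gen]] that by blast
 have "nm n g \<notin> der (gen S)" if "n \<ge> 1" for n
  by (rule cofinal_nontorsion[OF C sg_gen nc nc' refl gP _ that]) (use g in auto)
 then show ?thesis using that g AG by blast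
qed

subsection \<open>Simple modules under a normal abelian group of operators\<close>

text \<open>The setting of Clifford's theorem: an irreducible finite \<open>H\<close>-module
  \<open>P\<close> and a normal subgroup \<open>A\<close> acting nontrivially through commuting
  operators. The value 0 outside \<open>P\<close> makes operators equal as functions when they agree
  on \<open>P\<close>.\<close>

locale simple_action =
 fixes H A :: "'g::group_add set" and P :: "'p::group_add set" and act :: "'g \<Rightarrow> 'p \<Rightarrow> 'p"
 assumes sgH: "sg H" and sgP: "sg P" and finP: "finite P"
  and comm: "\<And>x y. x \<in> P ==> y \<in> P ==> x + y = y + x"
  and act_in: "\<And>h x. h \<in> H ==> x \<in> P ==> act h x \<in> P"
  and act_out: "\<And>h x. x \<notin> P ==> act h x = 0"
  and act_add: "\<And>h x y. h \<in> H ==> x \<in> P ==> y \<in> P ==> act h (x + y) = act h x + act h y"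
  and act_plus: "\<And>h k x. h \<in> H ==> k \<in> H ==> x \<in> P ==> act (h + k) x = act h (act k x)"
  and act_0: "\<And>x. x \<in> P ==> act 0 x = x"
  and simple: "\<And>Q. sg Q ==> Q \<subseteq> P ==> Q \<noteq> {0} ==> (\<And>h x. h \<in> H ==> x \<in> Q ==> act h x \<in> Q) ==> Q = P"
  and sgA: "sg A" and AH: "A \<subseteq> H" and nA: "nrm H A"
  and A_comm: "\<And>a b x. a \<in> A ==> b \<in> A ==> x \<in> P ==> act a (act b x) = act b (act a x)"
  and A_nt: "\<exists>a\<in>A. \<exists>x\<in>P. act a x \<noteq> x"
begin

text \<open>The image of the integral group ring of \<open>A\<close> in the endomorphisms of
  \<open>P\<close>. An additive span suffices for a ring because \<open>A\<close> is closed under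
  composition.\<close>

inductive_set R :: "('p \<Rightarrow> 'p) set" where
 act: "a \<in> A ==> act a \<in> R"
| add: "f \<in> R ==> g \<in> R ==> (\<lambda>x. f x + g x) \<in> R"
| neg: "f \<in> R ==> (\<lambda>x. - f x) \<in> R"

lemma zP: "0 \<in> P" using sg_zero[OF sgP] .
lemma addP: "x \<in> P ==> y \<in> P ==> x + y \<in> P" using sg_add[OF sgP] .
lemma negP: "x \<in> P ==> - x \<in> P" using sg_neg[OF sgP] .
lemma shuffle: "w \<in> P ==> x \<in> P ==> y \<in> P ==> z \<in> P ==> (w + x) + (y + z) = (w + y) + (x + z)"
 using comm[of x y] by (metis add.assoc)
lemma neg_sum: "x \<in> P ==> y \<in> P ==> - (x + y) = - x + - y"
 using comm[of "- x" "- y"] negP by (simp add: minus_add)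

lemma AH': "a \<in> A ==> a \<in> H" using AH by blast
lemma act_z: "h \<in> H ==> act h 0 = 0"
 using act_add[of h 0 0] zP by (metis add_0_right add_left_cancel)
lemma act_neg: assumes "h \<in> H" "x \<in> P" shows "act h (- x) = - act h x"
proof -
 have "act h (- x) + act h x = 0" using act_add[OF assms(1) negP[OF assms(2)] assms(2)] act_z[OF assms(1)] by simp
 then show ?thesis by (simp add: eq_neg_iff_add_eq_0)
qed
lemma act_inv: "h \<in> H ==> x \<in> P ==> act h (act (- h) x) = x" "h \<in> H ==> x \<in> P ==> act (- h) (act h x) = x"
 using act_plus[of h "- h" x] act_plus[of "- h" h x] act_0 sg_neg[OF sgH] by auto
lemma Hneg: "h \<in> H ==> - h \<in> H" using sg_neg[OF sgH] .
lemma Hadd: "h \<in> H ==> k \<in> H ==> h + k \<in> H" using sg_add[OF sgH] .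
lemma act_cj: "h \<in> H ==> k \<in> H ==> x \<in> P ==> act (h + k + - h) (act h x) = act h (act k x)"
 using act_plus[of "h + k + - h" h x] act_plus[of h k x] Hadd Hneg by (simp add: add.assoc)
lemma act_cm: "h \<in> H ==> k \<in> H ==> x \<in> P ==> act (cm h k) (act (k + h) x) = act (h + k) x"
 using act_plus[of "cm h k" "k + h" x] sg_cm[OF sgH, of h k] Hadd by (simp add: cm_def add.assoc)

lemma R_in: "f \<in> R ==> x \<in> P ==> f x \<in> P"
 by (induction rule: R.induct) (auto intro: act_in AH' addP negP)
lemma R_out: "f \<in> R ==> x \<notin> P ==> f x = 0"
 by (induction rule: R.induct) (auto simp: act_out)
lemma R_add: "f \<in> R ==> x \<in> P ==> y \<in> P ==> f (x + y) = f x + f y"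
proof (induction rule: R.induct)
 case (add f g) then show ?case using shuffle[of "f x" "f y" "g x" "g y"] R_in by simp
next
 case (neg f) then show ?case using neg_sum[of "f x" "f y"] R_in by simp
qed (use act_add AH' in auto)
lemma R_hm: "f \<in> R ==> hm f P" by (simp add: hm_def R_add)
lemma R_z: "f \<in> R ==> f 0 = 0" using hm_zero[OF R_hm sgP] .
lemma R_neg: "f \<in> R ==> x \<in> P ==> f (- x) = - f x" using hm_neg[OF R_hm sgP] .
lemma R_comm_act:
 assumes "f \<in> R" "h \<in> H" "\<And>a x. a \<in> A ==> x \<in> P ==> act a (act h x) = act h (act a x)" "x \<in> P"
 shows "f (act h x) = act h (f x)"
 using assms by (induction rule: R.induct) (auto simp: act_add act_neg R_in)
lemma R_comm: "g \<in> R ==> f \<in> R ==> x \<in> P ==> f (g x) = g (f x)"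
proof (induction rule: R.induct)
 case (act a) then show ?case using R_comm_act AH' A_comm by auto
qed (auto simp: R_add R_neg R_in)
lemma R_act_comp: "g \<in> R ==> a \<in> A ==> (\<lambda>x. act a (g x)) \<in> R"
proof (induction rule: R.induct)
 case (act b)
 have "act (a + b) = (\<lambda>x. act a (act b x))"
 proof
  show "act (a + b) x = act a (act b x)" for x
   using act_plus[of a b x] AH' act act_out act_z by (cases "x \<in> P") auto
 qed
 then show ?case using R.act[OF sg_add[OF sgA act(2,1)]] by simp
next
 case (add f g)
 have "(\<lambda>x. act a (f x + g x)) = (\<lambda>x. act a (f x) + act a (g x))"
 proof
  show "act a (f x + g x) = act a (f x) + act a (g x)" for x
   using add act_add[of a "f x" "g x"] AH' R_in R_out[of f x] R_out[of g x] act_z[of a] by (cases "x \<in> P") auto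
 qed
 then show ?case using R.add[of "\<lambda>x. act a (f x)" "\<lambda>x. act a (g x)"] add by simp
next
 case (neg f)
 have "(\<lambda>x. act a (- f x)) = (\<lambda>x. - act a (f x))"
 proof
  show "act a (- f x) = - act a (f x)" for x
   using neg act_neg[of a "f x"] AH' R_in R_out[of f x] act_z[of a] by (cases "x \<in> P") auto
 qed
 then show ?case using R.neg[of "\<lambda>x. act a (f x)"] neg by simp
qed
lemma R_comp: "f \<in> R ==> g \<in> R ==> (\<lambda>x. f (g x)) \<in> R"
 by (induction rule: R.induct) (auto intro: R_act_comp R.intros)
lemma R_one: "act 0 \<in> R" using R.act sg_zero[OF sgA] .
lemma R_zero: "(\<lambda>x. 0) \<in> R" using R.add[OF R_one R.neg[OF R_one]] by simp
lemma R_diff: "f \<in> R ==> g \<in> R ==> (\<lambda>x. f x + - g x) \<in> R" using R.add R.neg by blast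
lemma R_conj: "f \<in> R ==> h \<in> H ==> \<exists>f'\<in>R. \<forall>x\<in>P. act h (f x) = f' (act h x)"
proof (induction rule: R.induct)
 case (act a)
 then show ?case using act_cj[of h a] AH' nrmD[OF nA, of h a] R.act by metis
next
 case (add f g)
 then obtain f' g' where "f' \<in> R" "g' \<in> R" "\<forall>x\<in>P. act h (f x) = f' (act h x)" "\<forall>x\<in>P. act h (g x) = g' (act h x)" by blast
 then show ?case using add act_add R_in by (intro bexI[of _ "\<lambda>x. f' x + g' x"]) (auto intro: R.add)
next
 case (neg f)
 then obtain f' where "f' \<in> R" "\<forall>x\<in>P. act h (f x) = f' (act h x)" by blast
 then show ?case using neg act_neg R_in by (intro bexI[of _ "\<lambda>x. - f' x"]) (auto intro: R.neg)
qed
lemma finR: "finite R"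
proof (rule finite_subset)
 show "R \<subseteq> {f. \<forall>x. (x \<in> P --> f x \<in> P) \<and> (x \<notin> P --> f x = 0)}" using R_in R_out by auto
 show "finite {f. \<forall>x. (x \<in> P --> f x \<in> P) \<and> (x \<notin> P --> f x = 0)}"
  using finite_set_of_finite_funs[OF finP finP, of 0] by simp
qed

definition sub :: "'p set \<Rightarrow> bool"
 where "sub Q \<longleftrightarrow> sg Q \<and> Q \<subseteq> P \<and> (\<forall>f\<in>R. \<forall>x\<in>Q. f x \<in> Q)"
definition minS :: "'p set \<Rightarrow> bool"
 where "minS S \<longleftrightarrow> sub S \<and> S \<noteq> {0} \<and> (\<forall>Q. sub Q --> Q \<subseteq> S --> Q \<noteq> {0} --> Q = S)"
definition ann :: "'p set \<Rightarrow> ('p \<Rightarrow> 'p) set" where "ann S = {f \<in> R. \<forall>x\<in>S. f x = 0}"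
text \<open>The isotypic component of a minimal \<open>S\<close>: the annihilator of
  \<open>S\<close> is a maximal ideal of the commutative ring \<open>R\<close>, and
  \<open>V S\<close> is the largest submodule on which \<open>R\<close> acts through the residue
  field.\<close>

definition V :: "'p set \<Rightarrow> 'p set" where "V S = {v \<in> P. \<forall>f\<in>ann S. f v = 0}"

lemma subP: "sub P" using sgP R_in by (auto simp: sub_def)
lemma P_nz: "P \<noteq> {0}" using A_nt act_z AH' zP by auto
lemma ex_minS: "\<exists>S. minS S"
proof -
 define Z where "Z = {Q. sub Q \<and> Q \<noteq> {0}}"
 have "finite Z" by (rule finite_subset[of _ "Pow P"]) (auto simp: Z_def sub_def finP)
 then obtain S where S: "S \<in> Z" "\<forall>Q\<in>Z. Q \<subseteq> S --> S = Q"
  using finite_has_minimal[of Z] subP P_nz unfolding Z_def by blast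
 then show ?thesis unfolding minS_def Z_def by blast
qed
lemma sub_orbit: "s \<in> P ==> sub {f s | f. f \<in> R}"
 unfolding sub_def
proof (intro conjI ballI)
 assume s: "s \<in> P"
 show "sg {f s | f. f \<in> R}"
 proof (rule sgI)
  show "0 \<in> {f s | f. f \<in> R}" using R_zero by (intro CollectI exI[of _ "\<lambda>x. 0"]) auto
 next
  fix x y assume "x \<in> {f s | f. f \<in> R}" "y \<in> {f s | f. f \<in> R}"
  then obtain f g where "f \<in> R" "g \<in> R" "x = f s" "y = g s" by blast
  then show "x + y \<in> {f s | f. f \<in> R}" using R.add by (intro CollectI exI[of _ "\<lambda>x. f x + g x"]) auto
 next
  fix x assume "x \<in> {f s | f. f \<in> R}"
  then obtain f where "f \<in> R" "x = f s" by blast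
  then show "- x \<in> {f s | f. f \<in> R}" using R.neg by (intro CollectI exI[of _ "\<lambda>x. - f x"]) auto
 qed
 show "{f s | f. f \<in> R} \<subseteq> P" using R_in s by auto
 fix f x assume f: "f \<in> R" and "x \<in> {f s | f. f \<in> R}"
 then obtain g where "g \<in> R" "x = g s" by blast
 then show "f x \<in> {f s | f. f \<in> R}" using R_comp[OF f] by (intro CollectI exI[of _ "\<lambda>x. f (g x)"]) auto
qed
lemma sub_kernel: "sub Q ==> f \<in> R ==> sub {x \<in> Q. f x = 0}"
 unfolding sub_def
proof (intro conjI ballI)
 assume Q: "sg Q \<and> Q \<subseteq> P \<and> (\<forall>f\<in>R. \<forall>x\<in>Q. f x \<in> Q)" and f: "f \<in> R"
 have QP: "x \<in> P" if "x \<in> Q" for x using that Q by auto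
 show "sg {x \<in> Q. f x = 0}"
  by (rule sgI) (use Q sg_zero[of Q] sg_add[of Q] sg_neg[of Q] in \<open>auto simp: R_add[OF f] R_neg[OF f] R_z[OF f] QP\<close>)
 show "{x \<in> Q. f x = 0} \<subseteq> P" using Q by auto
 show "g x \<in> {x \<in> Q. f x = 0}" if "g \<in> R" "x \<in> {x \<in> Q. f x = 0}" for g x
  using that Q R_comm[of g f x] f R_z by auto
qed
lemma minSP: "minS S ==> S \<subseteq> P" by (auto simp: minS_def sub_def)
lemma minS_nz: assumes "minS S" obtains s where "s \<in> S" "s \<noteq> 0" "s \<in> P"
proof -
 have "0 \<in> S" using assms sg_zero by (auto simp: minS_def sub_def)
 then show ?thesis using assms that minSP[OF assms] by (auto simp: minS_def)
qed
lemma V_sub: "sub (V S)" unfolding sub_def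
proof (intro conjI ballI)
 show "sg (V S)"
  by (rule sgI) (auto simp: V_def ann_def zP addP negP R_z R_add R_neg)
 show "V S \<subseteq> P" by (auto simp: V_def)
 fix f x assume f: "f \<in> R" "x \<in> V S"
 then have xP: "x \<in> P" by (simp add: V_def)
 have "g (f x) = 0" if "g \<in> ann S" for g
  using that f R_comm[of f g x] xP R_z[OF f(1)] by (auto simp: V_def ann_def)
 then show "f x \<in> V S" using R_in f xP by (auto simp: V_def)
qed
lemma VP: "v \<in> V S ==> v \<in> P" by (simp add: V_def)
lemma V_R: "v \<in> V S ==> f \<in> R ==> f v \<in> V S" using V_sub by (auto simp: sub_def)
lemma V_sg: "sg (V S)" using V_sub by (simp add: sub_def)
lemma S_V: "minS S ==> S \<subseteq> V S" using minSP by (auto simp: V_def ann_def)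

lemma minSD: "minS S ==> sub Q ==> Q \<subseteq> S ==> s \<in> Q ==> s \<noteq> 0 ==> Q = S"
 unfolding minS_def by blast
lemma minS_R: "minS S ==> s \<in> S ==> f \<in> R ==> f s \<in> S"
 unfolding minS_def sub_def by blast
lemma orbit_S: assumes "minS S" "s \<in> S" "s \<noteq> 0" shows "{f s | f. f \<in> R} = S"
proof (rule minSD[OF assms(1) _ _ _ assms(3)])
 have sP: "s \<in> P" using assms minSP by blast
 show "sub {f s | f. f \<in> R}" using sub_orbit[OF sP] .
 show "{f s | f. f \<in> R} \<subseteq> S" using minS_R[OF assms(1,2)] by auto
 show "s \<in> {f s | f. f \<in> R}" using R_one act_0[OF sP] by (intro CollectI exI[of _ "act 0"]) auto
qed

text \<open>Pick \<open>s\<close> in \<open>S\<close> with \<open>f s\<close> nonzero. By minimality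
  some \<open>g\<close> sends \<open>f s\<close> back to \<open>s\<close>; then
  \<open>g f - 1\<close> kills \<open>s\<close>, hence by commutativity a nonzero submodule of
  \<open>S\<close>, hence \<open>S\<close>, hence \<open>V S\<close>.\<close>

lemma R_inv: assumes S: "minS S" and f: "f \<in> R" "f \<notin> ann S"
 obtains g where "g \<in> R" "\<And>v. v \<in> V S ==> g (f v) = v"
proof -
 obtain s where s: "s \<in> S" "f s \<noteq> 0" using f by (auto simp: ann_def)
 have sP: "s \<in> P" "f s \<in> P" using s minSP[OF S] R_in f by auto
 have "s \<in> {h (f s) | h. h \<in> R}" using orbit_S[OF S minS_R[OF S s(1) f(1)] s(2)] s(1) by simp
 then obtain g where g: "g \<in> R" "g (f s) = s" by auto
 let ?d = "\<lambda>x. g (f x) + - act 0 x"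
 have d: "?d \<in> R" using R_diff[OF R_comp[OF g(1) f(1)] R_one] .
 have "sub {x \<in> S. ?d x = 0}" using sub_kernel[OF _ d] S by (auto simp: minS_def)
 moreover have "s \<in> {x \<in> S. ?d x = 0}" "s \<noteq> 0" using s g act_0[OF sP(1)] R_z[OF f(1)] by auto
 ultimately have "{x \<in> S. ?d x = 0} = S" by (intro minSD[OF S]) auto
 then have "?d \<in> ann S" using d by (auto simp: ann_def)
 then have "?d v = 0" if "v \<in> V S" for v using that by (auto simp: V_def)
 then have "g (f v) = v" if "v \<in> V S" for v
  using that act_0[OF VP[OF that]] by (metis add.assoc add.left_inverse add_0_left add_0_right)
 then show ?thesis using that g by blast
qed

lemma R_nz: assumes "minS S" "f \<in> R" "f \<notin> ann S" "v \<in> V S" "f v = 0" shows "v = 0"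
 using R_inv[OF assms(1-3)] assms(4,5) R_z by metis
lemma ann_V: "minS S ==> f \<in> R ==> f \<in> ann S \<longleftrightarrow> (\<forall>v\<in>V S. f v = 0)"
 using S_V[of S] unfolding V_def[of S] by (auto simp: ann_def)

text \<open>The operator of \<open>h\<close> need not be \<open>R\<close>-linear, but it twists
  \<open>R\<close> by conjugation (\<open>R_conj\<close>), which still carries submodules to
  submodules.\<close>

lemma act_image_sub: assumes "h \<in> H" "sub Q" shows "sub (act h ` Q)"
 unfolding sub_def
proof (intro conjI ballI)
 have Q: "Q \<subseteq> P" "sg Q" using assms by (auto simp: sub_def)
 have "hm (act h) P" using act_add assms by (simp add: hm_def)
 then show "sg (act h ` Q)" using hm_sg_image sgP Q by blast
 show "act h ` Q \<subseteq> P" using act_in assms Q by auto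
 fix f x assume f: "f \<in> R" "x \<in> act h ` Q"
 then obtain y where y: "y \<in> Q" "x = act h y" by auto
 obtain f' where f': "f' \<in> R" "\<forall>x\<in>P. act (- h) (f x) = f' (act (- h) x)" using R_conj[OF f(1) Hneg[OF assms(1)]] by blast
 have yP: "y \<in> P" "x \<in> P" using y Q act_in assms by auto
 have "act (- h) (f x) = f' y" using f' y yP act_inv(2)[OF assms(1)] by simp
 then have "f x = act h (f' y)" using act_inv(1)[OF assms(1) R_in[OF f(1) yP(2)]] by simp
 then show "f x \<in> act h ` Q" using assms(2) f'(1) y by (auto simp: sub_def)
qed
lemma act_act_image: assumes "h \<in> H" "Q \<subseteq> P" shows "act (- h) ` act h ` Q = Q" "act h ` act (- h) ` Q = Q"
 using act_inv[OF assms(1)] assms(2) by (force simp: image_iff)+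
lemma act_minS: assumes h: "h \<in> H" and S: "minS S" shows "minS (act h ` S)"
 unfolding minS_def
proof (intro conjI allI impI)
 show "sub (act h ` S)" using act_image_sub h S by (auto simp: minS_def)
 obtain s where s: "s \<in> S" "s \<noteq> 0" "s \<in> P" using minS_nz[OF S] .
 have "act h s \<noteq> 0" using act_inv(2)[OF h s(3)] act_z[OF Hneg[OF h]] s(2) by auto
 then show "act h ` S \<noteq> {0}" using s by auto
 fix Q assume Q: "sub Q" "Q \<subseteq> act h ` S" "Q \<noteq> {0}"
 have QP: "Q \<subseteq> P" using Q by (simp add: sub_def)
 have "sub (act (- h) ` Q)" using act_image_sub[OF Hneg[OF h]] Q by blast
 moreover have "act (- h) ` Q \<subseteq> S" using Q(2) act_act_image(1)[OF h minSP[OF S]] by blast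
 moreover have "act (- h) ` Q \<noteq> {0}"
 proof
  assume "act (- h) ` Q = {0}"
  then have "act h ` {0} = Q" using act_act_image(2)[OF h QP] by simp
  then show False using Q(3) act_z[OF h] by auto
 qed
 ultimately have "act (- h) ` Q = S" using S by (auto simp: minS_def)
 then show "Q = act h ` S" using act_act_image(2)[OF h QP] by simp
qed
lemma act_V_subset: assumes h: "h \<in> H" and SP: "S \<subseteq> P" shows "act h ` V S \<subseteq> V (act h ` S)"
proof
 fix x assume "x \<in> act h ` V S"
 then obtain v where v: "v \<in> V S" "x = act h v" by auto
 have "f x = 0" if f: "f \<in> ann (act h ` S)" for f
 proof -
  have fR: "f \<in> R" using f by (simp add: ann_def)
  obtain f' where f': "f' \<in> R" "\<forall>x\<in>P. act (- h) (f x) = f' (act (- h) x)" using R_conj[OF fR Hneg[OF h]] by blast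
  have "f' s = 0" if "s \<in> S" for s
  proof -
   have "f (act h s) = 0" using f that by (auto simp: ann_def)
   then show ?thesis using f' act_inv(2)[OF h] act_in[OF h] that SP act_z[OF Hneg[OF h]] by (metis subsetD)
  qed
  then have "f' \<in> ann S" using f' by (auto simp: ann_def)
  then have "f' v = 0" using v by (auto simp: V_def)
  then have "act (- h) (f x) = 0" using f' v act_inv(2)[OF h VP[OF v(1)]] act_in[OF h VP[OF v(1)]] by simp
  then show ?thesis using act_inv(1)[OF h, of "f x"] R_in[OF fR] act_in[OF h VP[OF v(1)]] v(2) act_z[OF h] by metis
 qed
 then show "x \<in> V (act h ` S)" using v act_in[OF h VP[OF v(1)]] by (auto simp: V_def)
qed
lemma act_V: assumes h: "h \<in> H" and S: "minS S" shows "act h ` V S = V (act h ` S)"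
proof
 show "act h ` V S \<subseteq> V (act h ` S)" using act_V_subset[OF h minSP[OF S]] .
 have "act (- h) ` V (act h ` S) \<subseteq> V (act (- h) ` act h ` S)"
  using act_V_subset[OF Hneg[OF h] minSP[OF act_minS[OF h S]]] .
 then have "act h ` act (- h) ` V (act h ` S) \<subseteq> act h ` V S" using act_act_image(1)[OF h minSP[OF S]] by auto
 then show "V (act h ` S) \<subseteq> act h ` V S" using act_act_image(2)[OF h, of "V (act h ` S)"] VP by blast
qed
lemma inj_act: "h \<in> H ==> inj_on (act h) P" by (rule inj_on_inverseI[of _ "act (- h)"]) (rule act_inv(2))

text \<open>The field through which the operators act on an isotypic component, as functions on \<open>P\<close>
 cut off outside the component.\<close>

definition rs :: "'p set \<Rightarrow> ('p \<Rightarrow> 'p) \<Rightarrow> 'p \<Rightarrow> 'p" where "rs S f = (\<lambda>x. if x \<in> V S then f x else 0)"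
definition K :: "'p set \<Rightarrow> ('p \<Rightarrow> 'p) set" where "K S = rs S ` R"

lemma rs_eq: "rs S f = rs S g \<longleftrightarrow> (\<forall>v\<in>V S. f v = g v)" by (auto simp: rs_def fun_eq_iff)
lemma finK: "finite (K S)" by (simp add: K_def finR)
lemma rs_diff_ann: assumes "minS S" "f \<in> R" "g \<in> R"
 shows "(\<lambda>x. f x + - g x) \<in> ann S \<longleftrightarrow> (\<forall>v\<in>V S. f v = g v)"
 unfolding ann_V[OF assms(1) R_diff[OF assms(2,3)]] by (metis add.right_inverse add_left_cancel eq_neg_iff_add_eq_0 minus_minus)

text \<open>A minimal submodule is a line over its field: evaluation at a nonzero \<open>s\<close>
  is a bijection from the field to \<open>S\<close>.\<close>

lemma card_K: assumes S: "minS S" shows "card (K S) = card S"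
proof -
 obtain s where s: "s \<in> S" "s \<noteq> 0" "s \<in> P" using minS_nz[OF S] .
 have sV: "s \<in> V S" using S_V[OF S] s by auto
 have "bij_betw (\<lambda>k. k s) (K S) S"
 proof (rule bij_betw_imageI)
  show "inj_on (\<lambda>k. k s) (K S)"
  proof (rule inj_onI)
   fix k l assume "k \<in> K S" "l \<in> K S" and e: "k s = l s"
   then obtain f g where fg: "f \<in> R" "g \<in> R" "k = rs S f" "l = rs S g" by (auto simp: K_def)
   have "f s + - g s = 0" using e sV fg by (simp add: rs_def)
   then have "(\<lambda>x. f x + - g x) \<in> ann S" using R_nz[OF S R_diff[OF fg(1,2)] _ sV] s(2) by blast
   then show "k = l" using rs_diff_ann[OF S fg(1,2)] fg rs_eq by blast
  qed
  have "{f s | f. f \<in> R} = S" using orbit_S[OF S s(1,2)] .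
  then show "(\<lambda>k. k s) ` K S = S" unfolding K_def image_image using sV by (auto simp: rs_def)
 qed
 then show ?thesis by (rule bij_betw_same_card)
qed

text \<open>The fixed points of \<open>A\<close> form an \<open>H\<close>-submodule. If they
  contained a component they would be nonzero, hence all of \<open>P\<close>.\<close>

lemma A_nt_V: assumes S: "minS S" shows "\<exists>a\<in>A. \<exists>v\<in>V S. act a v \<noteq> v"
proof (rule ccontr)
 assume "\<not> ?thesis"
 then have t: "act a v = v" if "a \<in> A" "v \<in> V S" for a v using that by blast
 let ?Q = "{x \<in> P. \<forall>a\<in>A. act a x = x}"
 have "sg ?Q" by (rule sgI) (auto simp: zP addP negP act_z act_add act_neg AH')
 moreover have "act h x \<in> ?Q" if "h \<in> H" "x \<in> ?Q" for h x
 proof -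
  have "act a (act h x) = act h x" if a: "a \<in> A" for a
  proof -
   have "- h + a + - (- h) \<in> A" using nrmD[OF nA Hneg[OF \<open>h \<in> H\<close>] a] .
   moreover have "act (h + (- h + a + - (- h)) + - h) (act h x) = act h (act (- h + a + - (- h)) x)"
    using act_cj \<open>h \<in> H\<close> AH' calculation that \<open>x \<in> ?Q\<close> by blast
   ultimately show ?thesis using \<open>x \<in> ?Q\<close> by (simp add: add.assoc)
  qed
  then show ?thesis using that act_in by auto
 qed
 moreover have "?Q \<noteq> {0}"
 proof -
  obtain s where "s \<in> S" "s \<noteq> 0" "s \<in> P" using minS_nz[OF S] .
  then have "s \<in> ?Q" using t S_V[OF S] by auto
  then show ?thesis using \<open>s \<noteq> 0\<close> by blast
 qed
 ultimately have "?Q = P" by (intro simple) auto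
 then show False using A_nt by blast
qed

lemma act_A_not_ann: assumes "minS S" "a \<in> A" shows "act a \<notin> ann S"
proof
 assume "act a \<in> ann S"
 moreover obtain s where "s \<in> S" "s \<noteq> 0" "s \<in> P" using minS_nz[OF assms(1)] .
 ultimately have "act (- a) (act a s) = 0" using act_z AH' Hneg assms(2) by (auto simp: ann_def)
 then show False using act_inv(2)[of a s] AH' assms(2) \<open>s \<in> P\<close> \<open>s \<noteq> 0\<close> by auto
qed

lemma K_ge_3: assumes S: "minS S" shows "card (K S) \<ge> 3"
proof -
 obtain a v where a: "a \<in> A" "v \<in> V S" "act a v \<noteq> v" using A_nt_V[OF S] by blast
 have "act a \<notin> ann S" "act 0 \<notin> ann S" using act_A_not_ann[OF S] a sg_zero[OF sgA] by auto
 then have "rs S (act a) \<noteq> rs S (\<lambda>x. 0)" "rs S (act 0) \<noteq> rs S (\<lambda>x. 0)" unfolding rs_eq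
  using ann_V[OF S] R.act a(1) R_one by auto
 moreover have "rs S (act a) \<noteq> rs S (act 0)" unfolding rs_eq using a act_0 VP by metis
 ultimately have "card {rs S (act a), rs S (act 0), rs S (\<lambda>x. 0)} = 3" by auto
 moreover have "{rs S (act a), rs S (act 0), rs S (\<lambda>x. 0)} \<subseteq> K S" unfolding K_def using R.act a R_one R_zero by auto
 ultimately show ?thesis using card_mono[OF finK] by metis
qed

text \<open>\<open>R_inv\<close> provides the inverses. The record is formed so that the cyclicity
  of the multiplicative group of a finite field becomes applicable.\<close>

lemma K_field:
 assumes S: "minS S"
 shows "field \<lparr>carrier = K S, monoid.mult = (\<circ>), monoid.one = rs S (act 0), ring.zero = rs S (\<lambda>x. 0), ring.add = \<lambda>k l x. k x + l x\<rparr>" (is "field ?F")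
proof -
 have comp: "rs S f \<circ> rs S g = rs S (\<lambda>x. f (g x))" if "f \<in> R" "g \<in> R" for f g
  using that V_R R_z by (auto simp: rs_def fun_eq_iff)
 have add: "(\<lambda>x. rs S f x + rs S g x) = rs S (\<lambda>x. f x + g x)" for f g by (auto simp: rs_def)
 have one: "rs S (act 0) \<circ> k = k" if k: "k \<in> K S" for k
 proof -
  obtain f where f: "f \<in> R" "k = rs S f" using k by (auto simp: K_def)
  show ?thesis unfolding f(2) comp[OF R_one f(1)] rs_eq using act_0 R_in VP f(1) by blast
 qed
 have ag: "abelian_group ?F"
 proof (rule abelian_groupI, simp_all)
  fix k l m assume k: "k \<in> K S"
  then obtain f where f: "f \<in> R" "k = rs S f" by (auto simp: K_def)
  show "\<exists>y\<in>K S. (\<lambda>x. y x + k x) = rs S (\<lambda>x. 0)"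
   by (rule bexI[of _ "rs S (\<lambda>x. - f x)"]) (use f R.neg in \<open>auto simp: K_def rs_def\<close>)
  show "(\<lambda>x. rs S (\<lambda>x. 0) x + k x) = k" by (auto simp: rs_def)
  assume l: "l \<in> K S"
  then obtain g where g: "g \<in> R" "l = rs S g" by (auto simp: K_def)
  show "(\<lambda>x. k x + l x) \<in> K S" unfolding f g add K_def using R.add f g by auto
  show "(\<lambda>x. k x + l x) = (\<lambda>x. l x + k x)" using f g comm R_in VP by (auto simp: rs_def fun_eq_iff)
  show "(\<lambda>x. k x + l x + m x) = (\<lambda>x. k x + (l x + m x))" by (simp add: add.assoc)
 next
  show "rs S (\<lambda>x. 0) \<in> K S" using R_zero by (auto simp: K_def)
 qed
 have cl: "k \<circ> l \<in> K S \<and> k \<circ> l = l \<circ> k" if kl: "k \<in> K S" "l \<in> K S" for k l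
 proof -
  obtain f g where f: "f \<in> R" "k = rs S f" and g: "g \<in> R" "l = rs S g" using kl by (auto simp: K_def)
  have "k \<circ> l = l \<circ> k" unfolding f g comp[OF f(1) g(1)] comp[OF g(1) f(1)] rs_eq using R_comm f g VP by auto
  moreover have "k \<circ> l \<in> K S" unfolding f g comp[OF f(1) g(1)] K_def using R_comp f g by auto
  ultimately show ?thesis by blast
 qed
 have oneK: "rs S (act 0) \<in> K S" using R_one by (auto simp: K_def)
 have cm: "comm_monoid ?F"
  by (rule comm_monoidI) (use cl one oneK in \<open>auto simp: comp_assoc\<close>)
 have cr: "cring ?F"
  by (rule cringI[OF ag cm]) (simp add: comp_def)
 show ?thesis
 proof (rule cring.cring_fieldI2[OF cr], unfold ring_record_simps)
  show "rs S (\<lambda>x. 0) \<noteq> rs S (act 0)"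
   using act_A_not_ann[OF S sg_zero[OF sgA]] ann_V[OF S R_one] unfolding rs_eq by auto
  fix k assume "k \<in> K S" and nz: "k \<noteq> rs S (\<lambda>x. 0)"
  then obtain f where f: "f \<in> R" "k = rs S f" by (auto simp: K_def)
  then have "f \<notin> ann S" using nz ann_V[OF S f(1)] unfolding f rs_eq by auto
  then obtain g where g: "g \<in> R" "\<And>v. v \<in> V S ==> g (f v) = v" using R_inv[OF S f(1)] by blast
  have "k \<circ> rs S g = rs S (act 0)" unfolding f comp[OF f(1) g(1)] rs_eq
   using g R_comm[OF g(1) f(1)] act_0 VP by metis
  then show "\<exists>b\<in>K S. k \<circ> b = rs S (act 0)" using g by (auto simp: K_def)
 qed
qed

end

context simple_action begin

text \<open>A generator \<open>t\<close> of the multiplicative group allows field automorphisms to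
  be handled as exponents: an automorphism is known from the power of \<open>t\<close> to which it
  sends \<open>t\<close>.\<close>

lemma K_cyclic:
 assumes S: "minS S"
 obtains t where "t \<in> R" "t \<notin> ann S" "\<And>f. f \<in> R ==> f \<notin> ann S ==> \<exists>n. \<forall>v\<in>V S. f v = (t ^^ n) v"
proof -
 define F where "F = \<lparr>carrier = K S, monoid.mult = (\<circ>), monoid.one = rs S (act 0), ring.zero = rs S (\<lambda>x. 0), ring.add = \<lambda>k l x. k x + l x\<rparr>"
 interpret F: field F unfolding F_def using K_field[OF S] .
 have "finite (carrier F)" by (simp add: F_def finK)
 then obtain t where t: "t \<in> carrier (Multiplicative_Group.mult_of F)" "carrier (Multiplicative_Group.mult_of F) = {t [^]\<^bsub>F\<^esub> i | i::nat. i \<in> UNIV}"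
  using F.finite_field_mult_group_has_gen by blast
 then have tK: "t \<in> K S" "t \<noteq> rs S (\<lambda>x. 0)" by (auto simp: Multiplicative_Group.carrier_mult_of F_def)
 then obtain th where th: "th \<in> R" "t = rs S th" by (auto simp: K_def)
 have thn: "th \<notin> ann S" using tK(2) ann_V[OF S th(1)] unfolding th(2) rs_eq by auto
 have pow: "(t [^]\<^bsub>F\<^esub> n) v = (th ^^ n) v" if "v \<in> V S" for n :: nat and v
  using that
 proof (induction n arbitrary: v)
  case 0 then show ?case by (simp add: F_def nat_pow_def rs_def act_0 VP)
 next
  case (Suc n)
  have "t [^]\<^bsub>F\<^esub> Suc n = (t [^]\<^bsub>F\<^esub> n) \<circ> t" by (simp add: F.nat_pow_Suc) (simp add: F_def)
  then have "(t [^]\<^bsub>F\<^esub> Suc n) v = (t [^]\<^bsub>F\<^esub> n) (th v)" using Suc.prems by (simp add: th(2) rs_def)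
  then show ?case using Suc.IH[OF V_R[OF Suc.prems th(1)]] by (simp add: funpow_swap1)
 qed
 show ?thesis
 proof (rule that[OF th(1) thn])
  fix f assume f: "f \<in> R" "f \<notin> ann S"
  then have "rs S f \<noteq> rs S (\<lambda>x. 0)" using ann_V[OF S f(1)] unfolding rs_eq by auto
  then have "rs S f \<in> carrier (Multiplicative_Group.mult_of F)" using f(1) by (simp add: Multiplicative_Group.carrier_mult_of F_def K_def)
  then obtain n :: nat where "rs S f = t [^]\<^bsub>F\<^esub> n" using t(2) by auto
  then have "\<forall>v\<in>V S. f v = (th ^^ n) v" using pow by (metis rs_def)
  then show "\<exists>n. \<forall>v\<in>V S. f v = (th ^^ n) v" by blast
 qed
qed

definition St :: "'p set \<Rightarrow> 'g set" where "St S = {h \<in> H. act h ` V S = V S}"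

lemma act_plus_image: "h \<in> H ==> k \<in> H ==> Q \<subseteq> P ==> act (h + k) ` Q = act h ` act k ` Q"
 unfolding image_image by (intro image_cong refl act_plus) auto
lemma V_subP: "V S \<subseteq> P" using VP by blast
lemma St_sg: "sg (St S)"
proof (rule sgI)
 show "0 \<in> St S" using act_0 VP sg_zero[OF sgH] by (auto simp: St_def image_iff)
 show "h + k \<in> St S" if "h \<in> St S" "k \<in> St S" for h k
  using that act_plus_image[of h k "V S"] V_subP Hadd by (auto simp: St_def)
 show "- h \<in> St S" if "h \<in> St S" for h
  using that act_act_image(1)[of h "V S"] V_subP Hneg by (auto simp: St_def)
qed
lemma St_V: "h \<in> St S ==> v \<in> V S ==> act h v \<in> V S" by (auto simp: St_def)
lemma St_H: "h \<in> St S ==> h \<in> H" by (auto simp: St_def)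
lemma StI: "h \<in> H ==> (\<And>v. v \<in> V S ==> act h v \<in> V S) ==> (\<And>v. v \<in> V S ==> act (- h) v \<in> V S) ==> h \<in> St S"
 unfolding St_def using act_inv(1)[OF _ VP] by (auto simp: image_iff) metis
lemma A_St: "a \<in> A ==> a \<in> St S"
 using V_R R.act sg_neg[OF sgA] AH' by (intro StI) auto

text \<open>Elements of the stabilizer act on the component semilinearly, with field automorphisms
  that raise \<open>t\<close> to powers \<open>m\<close> and \<open>n\<close>. Such automorphisms
  commute, so the commutator is linear over the field and commutes with the scalars induced by
  \<open>A\<close>.\<close>

lemma semilinear_commute:
 assumes S: "minS S" and g: "g \<in> St S" and h: "h \<in> St S" and a: "a \<in> A" and v: "v \<in> V S"
 shows "act (cm (cm g h) a) v = v"
proof -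
 obtain t where t: "t \<in> R" "t \<notin> ann S" "\<And>f. f \<in> R ==> f \<notin> ann S ==> \<exists>n. \<forall>v\<in>V S. f v = (t ^^ n) v"
  using K_cyclic[OF S] by blast
 have tV: "(t ^^ i) v \<in> V S" if "v \<in> V S" for i v using that V_R[OF _ t(1)] by (induction i) auto
 have ex: "\<exists>m. \<forall>v\<in>V S. \<forall>i. act g ((t ^^ i) v) = (t ^^ (m * i)) (act g v)" if g: "g \<in> St S" for g
 proof -
  obtain f where f: "f \<in> R" "\<forall>x\<in>P. act g (t x) = f (act g x)" using R_conj[OF t(1) St_H[OF g]] by blast
  have "f \<notin> ann S"
  proof
   assume "f \<in> ann S"
   then have "f v = 0" if "v \<in> V S" for v using ann_V[OF S f(1)] that by blast
   then have "act g (t x) = 0" if "x \<in> V S" for x using f(2) VP[OF that] St_V[OF g that] by metis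
   then have "t x = 0" if "x \<in> V S" for x
    using act_inv(2)[OF St_H[OF g] R_in[OF t(1) VP[OF that]]] act_z[OF Hneg[OF St_H[OF g]]] that by metis
   then show False using t(1,2) ann_V[OF S] by blast
  qed
  then obtain m where m: "\<forall>v\<in>V S. f v = (t ^^ m) v" using t(3) f(1) by blast
  have "act g ((t ^^ i) v) = (t ^^ (m * i)) (act g v)" if v: "v \<in> V S" for v i
  proof (induction i)
   case (Suc i)
   have "act g ((t ^^ Suc i) v) = f (act g ((t ^^ i) v))" using f(2) VP[OF tV[OF v]] by simp
   also have "\<dots> = (t ^^ m) ((t ^^ (m * i)) (act g v))" using m St_V[OF g tV[OF v]] Suc by metis
   finally show ?case by (simp add: funpow_add)
  qed simp
  then show ?thesis by blast
 qed
 obtain m where m: "\<And>v i. v \<in> V S ==> act g ((t ^^ i) v) = (t ^^ (m * i)) (act g v)" using ex[OF g] by blast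
 obtain n where n: "\<And>v i. v \<in> V S ==> act h ((t ^^ i) v) = (t ^^ (n * i)) (act h v)" using ex[OF h] by blast
 let ?k = "h + g" and ?k' = "g + h" and ?c = "cm g h"
 have mem: "?k \<in> St S" "?k' \<in> St S" "?c \<in> St S" using g h sg_add[OF St_sg] sg_cm[OF St_sg] by auto
 \<comment> \<open>Chosen so that conjugation by \<open>h + g\<close> carries \<open>a'\<close> to
   \<open>a\<close>. The exponents \<open>m * n\<close> are symmetric, so \<open>g + h\<close>
   carries \<open>a'\<close> to the same operator, and the quotient \<open>?c\<close> of the two
   fixes it.\<close>
 define a' where "a' = - ?k + a + - (- ?k)"
 have a': "a' \<in> A" unfolding a'_def by (rule nrmD[OF nA Hneg[OF St_H[OF mem(1)]] a])
 obtain i where i: "\<And>v. v \<in> V S ==> act a' v = (t ^^ i) v" using t(3)[OF R.act[OF a'] act_A_not_ann[OF S a']] by blast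
 have e1: "act ?k (act a' v) = act a (act ?k v)" if "v \<in> V S" for v
  using act_cj[OF St_H[OF mem(1)] AH'[OF a'] VP[OF that]] by (simp add: a'_def minus_add add.assoc)
 have e2: "act ?k (act a' v) = (t ^^ (m * n * i)) (act ?k v)" if v: "v \<in> V S" for v
  using act_plus[OF St_H[OF h] St_H[OF g] VP[OF V_R[OF v R.act[OF a']]]] act_plus[OF St_H[OF h] St_H[OF g] VP[OF v]]
   n[OF St_V[OF g v]] m[OF v] i[OF v] by (simp add: mult.left_commute mult.assoc)
 have e3: "act ?k' (act a' v) = (t ^^ (m * n * i)) (act ?k' v)" if v: "v \<in> V S" for v
  using act_plus[OF St_H[OF g] St_H[OF h] VP[OF V_R[OF v R.act[OF a']]]] act_plus[OF St_H[OF g] St_H[OF h] VP[OF v]]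
   m[OF St_V[OF h v]] n[OF v] i[OF v] by (simp add: mult.left_commute mult.assoc)
 have e4: "act a w = (t ^^ (m * n * i)) w" if w: "w \<in> V S" for w
 proof -
  have "act (- ?k) w \<in> V S" using St_V[OF sg_neg[OF St_sg mem(1)] w] .
  then show ?thesis using e1 e2 act_inv(1)[OF St_H[OF mem(1)] VP[OF w]] by metis
 qed
 have e5: "act ?c (act a w) = act a (act ?c w)" if w: "w \<in> V S" for w
 proof -
  define u where "u = act (- ?k) w"
  have u: "u \<in> V S" "w = act ?k u" unfolding u_def
   using St_V[OF sg_neg[OF St_sg mem(1)] w] act_inv(1)[OF St_H[OF mem(1)] VP[OF w]] by auto
  have c: "act ?c (act ?k x) = act ?k' x" if "x \<in> V S" for x
   using act_cm[OF St_H[OF g] St_H[OF h] VP[OF that]] .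
  have "act ?c (act a w) = act ?k' (act a' u)" using e1[OF u(1)] c[OF V_R[OF u(1) R.act[OF a']]] u(2) by simp
  also have "\<dots> = act a (act ?k' u)" using e3[OF u(1)] e4[OF St_V[OF mem(2) u(1)]] by simp
  finally show ?thesis using c[OF u(1)] u(2) by simp
 qed
 let ?l = "a + ?c"
 have l: "?l \<in> St S" "?c + a \<in> St S" using mem A_St[OF a] sg_add[OF St_sg] by auto
 define w where "w = act (- ?l) v"
 have w: "w \<in> V S" "v = act ?l w" unfolding w_def
  using St_V[OF sg_neg[OF St_sg l(1)] v] act_inv(1)[OF St_H[OF l(1)] VP[OF v]] by auto
 have "act (cm ?c a) v = act (?c + a) w" using act_cm[OF St_H[OF mem(3)] AH'[OF a] VP[OF w(1)]] w(2) by simp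
 also have "\<dots> = v" using e5[OF w(1)] act_plus[OF St_H[OF mem(3)] AH'[OF a] VP[OF w(1)]]
  act_plus[OF AH'[OF a] St_H[OF mem(3)] VP[OF w(1)]] w(2) by simp
 finally show ?thesis .
qed

text \<open>The field with three elements has no automorphism but the identity: \<open>a\<close> and
  its conjugate are nonzero and are 1 together, so they coincide. The derivation saved here is
  essential for the smallest case of \<open>cost_bound\<close>.\<close>

lemma semilinear_commute_3:
 assumes S: "minS S" and q: "card (K S) = 3" and g: "g \<in> St S" and a: "a \<in> A" and v: "v \<in> V S"
 shows "act (cm g a) v = v"
proof -
 define b where "b = g + a + - g"
 have b: "b \<in> A" unfolding b_def by (rule nrmD[OF nA St_H[OF g] a])
 have cj: "act b (act g x) = act g (act a x)" if "x \<in> V S" for x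
  unfolding b_def by (rule act_cj[OF St_H[OF g] AH'[OF a] VP[OF that]])
 have surj: "\<exists>u\<in>V S. x = act g u" if "x \<in> V S" for x using g that by (auto simp: St_def)
 have eq: "rs S (act a) = rs S (act 0) \<longleftrightarrow> rs S (act b) = rs S (act 0)"
 proof
  assume l: "rs S (act a) = rs S (act 0)"
  have "act b x = act 0 x" if x: "x \<in> V S" for x
  proof -
   obtain u where u: "u \<in> V S" "x = act g u" using surj[OF x] by blast
   then have "act a u = u" using l act_0[OF VP[OF u(1)]] unfolding rs_eq by auto
   then show ?thesis using cj[OF u(1)] u act_0[OF VP[OF x]] by simp
  qed
  then show "rs S (act b) = rs S (act 0)" unfolding rs_eq by blast
 next
  assume l: "rs S (act b) = rs S (act 0)"
  have "act a x = act 0 x" if x: "x \<in> V S" for x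
  proof -
   have "act g (act a x) = act g x" using l cj[OF x] St_V[OF g x] act_0[OF VP[OF St_V[OF g x]]] unfolding rs_eq by auto
   then have "act a x = x" using inj_onD[OF inj_act[OF St_H[OF g]]] VP[OF x] R_in[OF R.act[OF a]] by blast
   then show ?thesis using act_0[OF VP[OF x]] by simp
  qed
  then show "rs S (act a) = rs S (act 0)" unfolding rs_eq by blast
 qed
 have nz: "rs S (act x) \<noteq> rs S (\<lambda>x. 0)" if "x \<in> A" for x
  using act_A_not_ann[OF S that] ann_V[OF S R.act[OF that]] unfolding rs_eq by auto
 have "rs S (act a) = rs S (act b)"
 proof (rule ccontr)
  assume ne: "rs S (act a) \<noteq> rs S (act b)"
  then have "card {rs S (act a), rs S (act b), rs S (act 0), rs S (\<lambda>x. 0)} = 4"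
   using eq nz[OF a] nz[OF b] nz[OF sg_zero[OF sgA]] by auto
  moreover have "{rs S (act a), rs S (act b), rs S (act 0), rs S (\<lambda>x. 0)} \<subseteq> K S"
   unfolding K_def using R.act a b R_one R_zero by auto
  ultimately have "4 \<le> card (K S)" using card_mono[OF finK] by metis
  then show False using q by simp
 qed
 then have ab: "act b x = act a x" if "x \<in> V S" for x using that unfolding rs_eq by auto
 have na: "act (- a) v \<in> V S" using V_R[OF v R.act[OF sg_neg[OF sgA a]]] .
 have "cm g a = b + - a" by (simp add: cm_def b_def)
 then have "act (cm g a) v = act b (act (- a) v)" using act_plus[OF AH'[OF b] Hneg[OF AH'[OF a]] VP[OF v]] by simp
 also have "\<dots> = v" using ab[OF na] act_inv(1)[OF AH'[OF a] VP[OF v]] by simp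
 finally show ?thesis .
qed

definition lin :: "'p set \<Rightarrow> ('p \<Rightarrow> 'p) \<Rightarrow> bool"
 where "lin S f \<longleftrightarrow> hm f (V S) \<and> (\<forall>r\<in>R. \<forall>x\<in>V S. f (r x) = r (f x))"

text \<open>Linear algebra by counting: if \<open>Q\<close> is a maximal proper submodule of
  \<open>T\<close> and \<open>v\<close> lies outside, then \<open>T\<close> is the direct sum of
  \<open>Q\<close> and the line through \<open>v\<close>. The set \<open>E\<close> serves as a
  basis, in that linear maps are determined on it.\<close>

lemma ex_basis:
 assumes S: "minS S" and T: "sub T" "T \<subseteq> V S"
 shows "\<exists>E. finite E \<and> E \<subseteq> T \<and> card T = card (K S) ^ card E \<and>
  (\<forall>f g. lin S f --> lin S g --> (\<forall>x\<in>E. f x = g x) --> (\<forall>x\<in>T. f x = g x))"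
 using T
proof (induction "card T" arbitrary: T rule: less_induct)
 case less
 have sgT: "sg T" and TP: "T \<subseteq> P" and TR: "\<And>f x. f \<in> R ==> x \<in> T ==> f x \<in> T" using less.prems(1) by (auto simp: sub_def)
 have finT: "finite T" using finite_subset[OF TP finP] .
 show ?case
 proof (cases "T = {0}")
  case True
  have "f 0 = g 0" if "lin S f" "lin S g" for f g
   using that hm_zero[OF _ V_sg] by (metis lin_def)
  then show ?thesis using True by (intro exI[of _ "{}"]) auto
 next
  case False
  define Z where "Z = {Q. sub Q \<and> Q \<subset> T}"
  have "sub {0}" by (auto simp: sub_def sg_def zP R_z)
  then have "{0} \<in> Z" using False sg_zero[OF sgT] by (auto simp: Z_def)
  moreover have "finite Z" by (rule finite_subset[of _ "Pow T"]) (auto simp: Z_def finT)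
  ultimately obtain Q where Q: "Q \<in> Z" "\<forall>Q'\<in>Z. Q \<subseteq> Q' --> Q = Q'" using finite_has_maximal[of Z] by blast
  have Qs: "sub Q" "Q \<subset> T" using Q by (auto simp: Z_def)
  then have sgQ: "sg Q" and QR: "\<And>f x. f \<in> R ==> x \<in> Q ==> f x \<in> Q" and QP: "\<And>x. x \<in> Q ==> x \<in> P" by (auto simp: sub_def)
  obtain v where v: "v \<in> T" "v \<notin> Q" using Qs by blast
  have vV: "v \<in> V S" "v \<in> P" using v less.prems(2) TP by auto
  define T' where "T' = {t + r v | t r. t \<in> Q \<and> r \<in> R}"
  have T'I: "t + r v \<in> T'" if "t \<in> Q" "r \<in> R" for t r using that unfolding T'_def by blast
  have "sub T'" unfolding sub_def
  proof (intro conjI ballI)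
   show "sg T'"
   proof (rule sgI)
    show "0 \<in> T'" using T'I[OF sg_zero[OF sgQ] R_zero] by simp
    fix x y assume "x \<in> T'" "y \<in> T'"
    then obtain t r t' r' where x: "t \<in> Q" "r \<in> R" "x = t + r v" "t' \<in> Q" "r' \<in> R" "y = t' + r' v" unfolding T'_def by blast
    then have "x + y = (t + t') + (r v + r' v)" using shuffle[of t "r v" t' "r' v"] QP R_in vV by simp
    then show "x + y \<in> T'" using T'I[OF sg_add[OF sgQ x(1,4)] R.add[OF x(2,5)]] by simp
   next
    fix x assume "x \<in> T'"
    then obtain t r where x: "t \<in> Q" "r \<in> R" "x = t + r v" unfolding T'_def by blast
    then have "- x = - t + - r v" using neg_sum QP R_in vV by simp
    then show "- x \<in> T'" using T'I[OF sg_neg[OF sgQ x(1)] R.neg[OF x(2)]] by simp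
   qed
   show "T' \<subseteq> P" unfolding T'_def using addP QP R_in vV by auto
   fix f x assume f: "f \<in> R" and "x \<in> T'"
   then obtain t r where x: "t \<in> Q" "r \<in> R" "x = t + r v" unfolding T'_def by blast
   then have "f x = f t + f (r v)" using R_add[OF f] QP R_in vV by simp
   then show "f x \<in> T'" using T'I[OF QR[OF f x(1)] R_comp[OF f x(2)]] by simp
  qed
  moreover have "Q \<subseteq> T'" using T'I[OF _ R_zero] by fastforce
  moreover have "T' \<subseteq> T" unfolding T'_def using Qs TR v sg_add[OF sgT] by auto
  moreover have "v \<in> T'" using T'I[OF sg_zero[OF sgQ] R_one] act_0 vV by simp
  ultimately have T': "T' = T" using Q v unfolding Z_def by blast
  have "bij_betw (\<lambda>(t, k). t + k v) (Q \<times> K S) T"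
  proof (rule bij_betw_imageI)
   show "inj_on (\<lambda>(t, k). t + k v) (Q \<times> K S)"
   proof (rule inj_onI, clarify)
    fix t k t' k' assume tk: "t \<in> Q" "t' \<in> Q" "k \<in> K S" "k' \<in> K S" and e: "t + k v = t' + k' v"
    then obtain f f' where f: "f \<in> R" "k = rs S f" "f' \<in> R" "k' = rs S f'" by (auto simp: K_def)
    have e': "t + f v = t' + f' v" using e vV f by (simp add: rs_def)
    let ?d = "\<lambda>x. f x + - f' x"
    have "- t' + (t + f v) + - f' v = 0" unfolding e' by (simp add: add.assoc)
    then have "(- t' + t) + ?d v = 0" by (simp add: add.assoc)
    then have dv: "?d v \<in> Q" using tk sg_add[OF sgQ] sg_neg[OF sgQ] sg_zero[OF sgQ] sg_add_left[OF sgQ] by metis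
    have dR: "?d \<in> R" using R_diff f by blast
    have "?d \<in> ann S"
    proof (rule ccontr)
     assume "?d \<notin> ann S"
     then obtain g where g: "g \<in> R" "\<And>w. w \<in> V S ==> g (?d w) = w" using R_inv[OF S dR] by blast
     then have "g (?d v) = v" using vV by blast
     then have "v \<in> Q" using QR[OF g(1) dv] by simp
     then show False using v by blast
    qed
    then have "k = k'" using rs_diff_ann[OF S f(1,3)] f rs_eq by blast
    then show "t = t' \<and> k = k'" using e by simp
   qed
   show "(\<lambda>(t, k). t + k v) ` (Q \<times> K S) = T" unfolding T'[symmetric] T'_def K_def using vV
    by (force simp: rs_def image_iff)
  qed
  then have cT: "card T = card Q * card (K S)" using bij_betw_same_card card_cartesian_product by metis
  have "card Q < card T" "Q \<subseteq> V S" using Qs finT psubset_card_mono less.prems by auto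
  from less.hyps[OF this(1) Qs(1) this(2)] obtain E where E: "finite E" "E \<subseteq> Q" "card Q = card (K S) ^ card E"
   "\<forall>f g. lin S f --> lin S g --> (\<forall>x\<in>E. f x = g x) --> (\<forall>x\<in>Q. f x = g x)"
   by blast
  have vE: "v \<notin> E" using E v by blast
  have det: "f x = g x" if fg: "lin S f" "lin S g" "\<forall>x\<in>insert v E. f x = g x" and x: "x \<in> T" for f g x
  proof -
   obtain t r where tr: "t \<in> Q" "r \<in> R" "x = t + r v" using x T' unfolding T'_def by blast
   have "\<forall>x\<in>E. f x = g x" using fg(3) by blast
   then have "f t = g t" using E(4) fg(1,2) tr(1) by blast
   moreover have "f (r v) = g (r v)" using fg tr(2) vV(1) unfolding lin_def by auto
   moreover have "t \<in> V S" "r v \<in> V S" using tr Qs less.prems V_R vV by auto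
   moreover have "hm f (V S)" "hm g (V S)" using fg by (auto simp: lin_def)
   ultimately show ?thesis using hmD[of f "V S" t "r v"] hmD[of g "V S" t "r v"] tr(3) by simp
  qed
  have "card T = card (K S) ^ card (insert v E)" using cT E(1,3) vE by simp
  moreover have "insert v E \<subseteq> T" "finite (insert v E)" using E(1,2) v Qs(2) by auto
  moreover have "\<forall>f g. lin S f --> lin S g --> (\<forall>x\<in>insert v E. f x = g x) --> (\<forall>x\<in>T. f x = g x)"
   using det by (intro allI impI ballI)
  ultimately show ?thesis by (intro exI[of _ "insert v E"] conjI)
 qed
qed

text \<open>A linear endomorphism is determined by the images of the \<open>e\<close> basis vectors,
  each one of q^e vectors.\<close>

lemma card_lin:
 assumes S: "minS S"
 obtains e where "card (V S) = card (K S) ^ e" "e \<ge> 1"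
  "finite {f. lin S f \<and> (\<forall>x\<in>V S. f x \<in> V S) \<and> (\<forall>x. x \<notin> V S --> f x = 0)}"
  "card {f. lin S f \<and> (\<forall>x\<in>V S. f x \<in> V S) \<and> (\<forall>x. x \<notin> V S --> f x = 0)} \<le> card (K S) ^ (e * e)"
proof -
 let ?L = "{f. lin S f \<and> (\<forall>x\<in>V S. f x \<in> V S) \<and> (\<forall>x. x \<notin> V S --> f x = 0)}"
 have finV: "finite (V S)" using finite_subset[OF V_subP finP] .
 obtain E where E: "finite E" "E \<subseteq> V S" "card (V S) = card (K S) ^ card E"
  "\<And>f g. lin S f ==> lin S g ==> (\<forall>x\<in>E. f x = g x) ==> (\<forall>x\<in>V S. f x = g x)"
  using ex_basis[OF S V_sub order_refl] by metis
 have "card E \<noteq> 0"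
 proof
  assume "card E = 0"
  then have "card (V S) = 1" using E by simp
  then obtain x where "V S = {x}" using card_1_singletonE by blast
  moreover obtain s where "s \<in> S" "s \<noteq> 0" using minS_nz[OF S] by blast
  ultimately show False using S_V[OF S] sg_zero[OF V_sg, of S] by auto
 qed
 have inj: "inj_on (\<lambda>f. restrict f E) ?L"
 proof (rule inj_onI)
  fix f g assume f: "f \<in> ?L" and g: "g \<in> ?L" and e: "restrict f E = restrict g E"
  have "\<forall>x\<in>E. f x = g x" using e by (metis restrict_apply')
  then have "\<forall>x\<in>V S. f x = g x" using E(4) f g by blast
  then show "f = g" using f g by (auto simp: fun_eq_iff)
 qed
 have sub: "(\<lambda>f. restrict f E) ` ?L \<subseteq> PiE E (\<lambda>_. V S)" using E by auto
 have finPi: "finite (PiE E (\<lambda>_. V S))" using E finV by (intro finite_PiE) auto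
 have fin: "finite ?L" using inj_on_finite[OF inj sub finPi] .
 have "card ?L \<le> card (PiE E (\<lambda>_. V S))" using card_inj_on_le[OF inj sub finPi] .
 also have "\<dots> = card (K S) ^ (card E * card E)" using E by (simp add: card_PiE power_mult)
 finally show ?thesis using that[OF E(3) _ fin] \<open>card E \<noteq> 0\<close> by auto
qed

section \<open>Operators of nilpotency class two on a component\<close>

primrec comb :: "'p set \<Rightarrow> 'g list \<Rightarrow> ('p \<Rightarrow> 'p) set" where
 "comb S [] = {\<lambda>x. 0}"
| "comb S (i # is) = {\<lambda>x. f x + rs S (\<lambda>x. r (act i x)) x | f r. f \<in> comb S is \<and> r \<in> R}"

text \<open>Operators that are linear over the fields and whose commutators are scalars. Conjugating
  one of them by another multiplies it by a scalar (\<open>ops_cj\<close>), which is what the count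
  of characters rests on.\<close>

definition ops :: "'g set \<Rightarrow> bool"
 where "ops B \<longleftrightarrow> sg B \<and> B \<subseteq> H \<and> (\<forall>b\<in>B. \<forall>a\<in>A. \<forall>x\<in>P. act a (act b x) = act b (act a x)) \<and> (\<forall>b\<in>B. \<forall>b'\<in>B. cm b b' \<in> A)"

lemma ops_R: "ops B ==> b \<in> B ==> r \<in> R ==> x \<in> P ==> r (act b x) = act b (r x)"
 unfolding ops_def using R_comm_act[of r b x] by blast
lemma ops_H: "ops B ==> b \<in> B ==> b \<in> H" by (auto simp: ops_def)
lemma ops_V: assumes "ops B" "b \<in> B" "v \<in> V S" shows "act b v \<in> V S"
proof -
 have "f (act b v) = 0" if "f \<in> ann S" for f
  using that ops_R[OF assms(1,2), of f v] VP[OF assms(3)] assms(3) act_z[OF ops_H[OF assms(1,2)]] by (auto simp: ann_def V_def)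
 then show ?thesis using act_in[OF ops_H[OF assms(1,2)] VP[OF assms(3)]] by (auto simp: V_def)
qed
lemma ops_neg: "ops B ==> b \<in> B ==> - b \<in> B" using sg_neg by (auto simp: ops_def)
lemma ops_cm: "ops B ==> b \<in> B ==> c \<in> B ==> cm b c \<in> A" by (auto simp: ops_def)
lemma ops_cj: assumes "ops B" "b \<in> B" "i \<in> B" "x \<in> P" shows "act b (act i (act (- b) x)) = act (cm b i) (act i x)"
proof -
 note H = ops_H[OF assms(1,2)] ops_H[OF assms(1,3)]
 have "act b (act i (act (- b) x)) = act (b + i + - b) x"
  using act_plus[of b "i + - b" x] act_plus[of i "- b" x] H Hneg Hadd assms(4) by (simp add: add.assoc)
 also have "b + i + - b = cm b i + i" by (simp add: cm_def add.assoc)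
 finally show ?thesis using act_plus[of "cm b i" i x] H sg_cm[OF sgH] assms(4) by simp
qed

lemma comb_in: assumes "ops B" "set is \<subseteq> B" "f \<in> comb S is"
 shows "lin S f \<and> (\<forall>x\<in>V S. f x \<in> V S) \<and> (\<forall>x. x \<notin> V S --> f x = 0)"
 using assms(2,3)
proof (induction "is" arbitrary: f)
 case Nil
 then show ?case using sg_zero[OF V_sg] R_z by (auto simp: lin_def hm_def)
next
 case (Cons i "is")
 then obtain g r where g: "g \<in> comb S is" "r \<in> R" "f = (\<lambda>x. g x + rs S (\<lambda>x. r (act i x)) x)" by auto
 have i: "i \<in> B" "i \<in> H" using Cons.prems ops_H[OF assms(1)] by auto
 note IH = Cons.IH[OF _ g(1)]
 have gV: "lin S g" "\<And>x. x \<in> V S ==> g x \<in> V S" "\<And>x. x \<notin> V S ==> g x = 0" using IH Cons.prems by auto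
 have fx: "f x = g x + r (act i x)" if "x \<in> V S" for x using that g(3) by (simp add: rs_def)
 have rV: "r (act i x) \<in> V S" if "x \<in> V S" for x using V_R[OF ops_V[OF assms(1) i(1) that] g(2)] .
 have "hm f (V S)" unfolding hm_def
 proof (intro ballI)
  fix x y assume xy: "x \<in> V S" "y \<in> V S"
  have "r (act i (x + y)) = r (act i x) + r (act i y)"
   using act_add[OF i(2)] R_add[OF g(2)] xy VP act_in[OF i(2)] by simp
  then show "f (x + y) = f x + f y" 
   using fx xy sg_add[OF V_sg xy] gV(1) hmD[of g "V S" x y] shuffle[of "g x" "g y" "r (act i x)" "r (act i y)"] VP[OF gV(2)] VP[OF rV]
   by (simp add: lin_def)
 qed
 moreover have "f (s x) = s (f x)" if s: "s \<in> R" "x \<in> V S" for s x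
 proof -
  have "r (act i (s x)) = s (r (act i x))"
   using ops_R[OF assms(1) i(1) s(1) VP[OF s(2)]] R_comm[OF g(2) s(1) act_in[OF i(2) VP[OF s(2)]]] by simp
  moreover have "g (s x) = s (g x)" using gV(1) s by (auto simp: lin_def)
  ultimately show ?thesis using fx[OF s(2)] fx[OF V_R[OF s(2,1)]] R_add[OF s(1)] VP[OF gV(2)] VP[OF rV] s(2) by simp
 qed
 moreover have "f x \<in> V S" if "x \<in> V S" for x using fx that gV(2) rV sg_add[OF V_sg] by simp
 moreover have "f x = 0" if "x \<notin> V S" for x using that g(3) gV(3) by (simp add: rs_def)
 ultimately show ?case by (auto simp: lin_def)
qed

lemma comb_VP: "ops B ==> set is \<subseteq> B ==> f \<in> comb S is ==> f x \<in> P"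
 using comb_in[of B "is" f S] VP zP by metis

lemma comb_diff: assumes "ops B" "set is \<subseteq> B" "f \<in> comb S is" "g \<in> comb S is"
 shows "(\<lambda>x. f x + - g x) \<in> comb S is"
 using assms(2-)
proof (induction "is" arbitrary: f g)
 case (Cons i "is")
 then obtain f' r where f: "f' \<in> comb S is" "r \<in> R" "f = (\<lambda>x. f' x + rs S (\<lambda>x. r (act i x)) x)" by auto
 obtain g' s where g: "g' \<in> comb S is" "s \<in> R" "g = (\<lambda>x. g' x + rs S (\<lambda>x. s (act i x)) x)" using Cons by auto
 have i: "i \<in> B" "i \<in> H" using Cons.prems ops_H[OF assms(1)] by auto
 have "f x + - g x = (f' x + - g' x) + rs S (\<lambda>x. r (act i x) + - s (act i x)) x" for x
 proof (cases "x \<in> V S")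
  case True
  have m: "f' x \<in> P" "g' x \<in> P" using comb_VP[OF assms(1)] f(1) g(1) Cons.prems by auto
  have m': "r (act i x) \<in> P" "s (act i x) \<in> P" using R_in f(2) g(2) act_in[OF i(2) VP[OF True]] by auto
  show ?thesis using True m m' neg_sum[OF m(2) m'(2)] shuffle[OF m(1) m'(1) negP[OF m(2)] negP[OF m'(2)]]
   by (simp add: f g rs_def)
 next
  case False
  then show ?thesis by (simp add: f g rs_def)
 qed
 moreover have "(\<lambda>x. f' x + - g' x) \<in> comb S is" using Cons f g by auto
 moreover have "(\<lambda>x. r x + - s x) \<in> R" using R_diff f g by blast
 ultimately show ?case unfolding comb.simps
  by (intro CollectI exI[of _ "\<lambda>x. f' x + - g' x"] exI[of _ "\<lambda>x. r x + - s x"]) auto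
qed auto

lemma comb_R: assumes "ops B" "set is \<subseteq> B" "f \<in> comb S is" "s \<in> R" shows "(\<lambda>x. s (f x)) \<in> comb S is"
 using assms(2,3)
proof (induction "is" arbitrary: f)
 case (Cons i "is")
 then obtain f' r where f: "f' \<in> comb S is" "r \<in> R" "f = (\<lambda>x. f' x + rs S (\<lambda>x. r (act i x)) x)" by auto
 have i: "i \<in> H" using Cons.prems ops_H[OF assms(1)] by auto
 have "s (f x) = s (f' x) + rs S (\<lambda>x. s (r (act i x))) x" for x
  using R_add[OF assms(4)] comb_VP[OF assms(1) _ f(1)] Cons.prems R_in[OF f(2) act_in[OF i VP]] by (auto simp: f rs_def)
 moreover have "(\<lambda>x. s (f' x)) \<in> comb S is" using Cons f by auto
 ultimately show ?case using R_comp[OF assms(4) f(2)] unfolding comb.simps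
  by (intro CollectI exI[of _ "\<lambda>x. s (f' x)"] exI[of _ "\<lambda>x. s (r x)"]) auto
qed (auto simp: R_z[OF assms(4)])

lemma comb_cj: assumes "ops B" "set is \<subseteq> B" "f \<in> comb S is" "b \<in> B"
 shows "rs S (\<lambda>x. act b (f (act (- b) x))) \<in> comb S is"
 using assms(2,3)
proof (induction "is" arbitrary: f)
 case Nil
 then show ?case using act_z[OF ops_H[OF assms(1,4)]] by (auto simp: rs_def)
next
 case (Cons i "is")
 then obtain f' r where f: "f' \<in> comb S is" "r \<in> R" "f = (\<lambda>x. f' x + rs S (\<lambda>x. r (act i x)) x)" by auto
 have i: "i \<in> B" "i \<in> H" using Cons.prems ops_H[OF assms(1)] by auto
 note bH = ops_H[OF assms(1,4)]
 let ?r = "\<lambda>x. r (act (cm b i) x)"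
 have rR: "?r \<in> R" using R_comp[OF f(2) R.act[OF ops_cm[OF assms(1,4) i(1)]]] .
 have "rs S (\<lambda>x. act b (f (act (- b) x))) x = rs S (\<lambda>x. act b (f' (act (- b) x))) x + rs S (\<lambda>x. ?r (act i x)) x" for x
 proof (cases "x \<in> V S")
  case True
  have y: "act (- b) x \<in> V S" using ops_V[OF assms(1) ops_neg[OF assms(1,4)] True] .
  have m: "f' (act (- b) x) \<in> P" "r (act i (act (- b) x)) \<in> P" 
   using comb_VP[OF assms(1) _ f(1)] Cons.prems R_in[OF f(2) act_in[OF i(2) VP[OF y]]] by auto
  have "act b (r (act i (act (- b) x))) = ?r (act i x)"
   using ops_R[OF assms(1,4) f(2) act_in[OF i(2) VP[OF y]]] ops_cj[OF assms(1,4) i(1) VP[OF True]] by simp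
  then show ?thesis using True y act_add[OF bH m] by (simp add: f rs_def)
 qed (simp add: rs_def)
 moreover have "rs S (\<lambda>x. act b (f' (act (- b) x))) \<in> comb S is" using Cons f by auto
 ultimately show ?case using rR unfolding comb.simps
  by (intro CollectI exI[of _ "rs S (\<lambda>x. act b (f' (act (- b) x)))"] exI[of _ ?r]) auto
qed

definition eqv :: "'p set \<Rightarrow> 'g set \<Rightarrow> 'g \<Rightarrow> 'g \<Rightarrow> bool"
 where "eqv S B i j \<longleftrightarrow> (\<forall>b\<in>B. \<forall>v\<in>V S. act (cm b i) v = act (cm b j) v)"

text \<open>Operators with distinct commutator characters are eigenvectors of conjugation with distinct
 eigenvalues, hence linearly independent over the field.\<close>

lemma comb_independent:
 assumes S: "minS S" and B: "ops B" and "set is \<subseteq> B" "b \<in> B" "\<forall>i\<in>set is. \<not> eqv S B i b"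
  "f \<in> comb S is" "k \<in> R" "\<forall>x\<in>V S. f x = k (act b x)"
 shows "k \<in> ann S"
 using assms(3-)
proof (induction "is" arbitrary: f k)
 case Nil
 have "k x = 0" if x: "x \<in> V S" for x
 proof -
  have "act (- b) x \<in> V S" using ops_V[OF B ops_neg[OF B Nil(2)] x] .
  then show ?thesis using Nil act_inv(1)[OF ops_H[OF B Nil(2)] VP[OF x]] by auto
 qed
 then show ?case using ann_V[OF S Nil(5)] by blast
next
 case (Cons i "is")
 then obtain f1 r where f: "f1 \<in> comb S is" "r \<in> R" "f = (\<lambda>x. f1 x + rs S (\<lambda>x. r (act i x)) x)" by auto
 have i: "i \<in> B" "set is \<subseteq> B" and b: "b \<in> B" and k: "k \<in> R" using Cons.prems by auto
 obtain b' v0 where b': "b' \<in> B" "v0 \<in> V S" "act (cm b' i) v0 \<noteq> act (cm b' b) v0" using Cons.prems(3) by (auto simp: eqv_def)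
 have ci: "act (cm b' i) \<in> R" and cb: "act (cm b' b) \<in> R" using ops_cm[OF B b'(1)] i b R.act by auto
 \<comment> \<open>As in the independence of characters: conjugation by \<open>b'\<close> minus
   multiplication by the eigenvalue of \<open>i\<close> cancels the term of \<open>i\<close>, while
   the coefficient of \<open>b\<close> is multiplied by the difference \<open>?d\<close> of the
   eigenvalues, which is invertible on the component.\<close>
 let ?g = "\<lambda>x. rs S (\<lambda>x. act b' (f1 (act (- b') x))) x + - act (cm b' i) (f1 x)"
 let ?d = "\<lambda>x. act (cm b' b) x + - act (cm b' i) x"
 let ?k = "\<lambda>x. ?d (k x)"
 have gc: "?g \<in> comb S is" using comb_diff[OF B i(2) comb_cj[OF B i(2) f(1) b'(1)] comb_R[OF B i(2) f(1) ci]] .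
 have dR: "?d \<in> R" using R_diff[OF cb ci] .
 have kR: "?k \<in> R" using R_comp[OF dR k] .
 have "?g x = ?k (act b x)" if x: "x \<in> V S" for x
 proof -
  have y: "act (- b') x \<in> V S" using ops_V[OF B ops_neg[OF B b'(1)] x] .
  have bx: "act b x \<in> P" "act i x \<in> P" using act_in ops_H[OF B] b i VP[OF x] by auto
  have m: "f1 x \<in> P" "f1 (act (- b') x) \<in> P" "r (act i x) \<in> P" "r (act i (act (- b') x)) \<in> P"
   using comb_VP[OF B i(2) f(1)] R_in[OF f(2)] bx act_in[OF ops_H[OF B i(1)] VP[OF y]] by auto
  have "act b' (f (act (- b') x)) = act b' (k (act b (act (- b') x)))" using Cons.prems(6) y by simp
  also have "\<dots> = act (cm b' b) (k (act b x))"
   using ops_R[OF B b'(1) k act_in[OF ops_H[OF B b] VP[OF y]]] ops_cj[OF B b'(1) b VP[OF x]] R_comm[OF cb k bx(1)] by simp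
  finally have 1: "act b' (f (act (- b') x)) = act (cm b' b) (k (act b x))" .
  have "act b' (f (act (- b') x)) = act b' (f1 (act (- b') x)) + act b' (r (act i (act (- b') x)))"
   using y act_add[OF ops_H[OF B b'(1)] m(2,4)] by (simp add: f rs_def)
  also have "act b' (r (act i (act (- b') x))) = act (cm b' i) (r (act i x))"
   using ops_R[OF B b'(1) f(2) act_in[OF ops_H[OF B i(1)] VP[OF y]]] ops_cj[OF B b'(1) i(1) VP[OF x]] R_comm[OF ci f(2) bx(2)] by simp
  finally have 2: "act (cm b' b) (k (act b x)) = act b' (f1 (act (- b') x)) + act (cm b' i) (r (act i x))" using 1 by simp
  have 3: "act (cm b' i) (k (act b x)) = act (cm b' i) (f1 x) + act (cm b' i) (r (act i x))"
   using Cons.prems(6) x R_add[OF ci m(1,3)] by (simp add: f rs_def)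
  show ?thesis unfolding 2 3 using x by (simp add: rs_def minus_add add.assoc)
 qed
 then have kann: "?k \<in> ann S" using Cons.IH[OF i(2) b _ gc kR] Cons.prems(3) by auto
 have "?d v0 \<noteq> 0"
 proof
  assume "?d v0 = 0"
  then have "act (cm b' b) v0 = act (cm b' i) v0" by (simp add: eq_neg_iff_add_eq_0[symmetric])
  then show False using b'(3) by simp
 qed
 then have "?d \<notin> ann S" using ann_V[OF S dR] b'(2) by blast
 then have "k v = 0" if "v \<in> V S" for v
  using R_nz[OF S dR _ V_R[OF that k]] kann that ann_V[OF S kR] by blast
 then show ?case using ann_V[OF S k] by blast
qed

text \<open>Independence makes the coefficients unique. Compared with the size of the endomorphism
  ring in \<open>card_lin\<close>, this bounds the number of distinct characters by the square of
  the dimension.\<close>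

lemma card_comb:
 assumes S: "minS S" and B: "ops B"
 shows "set is \<subseteq> B ==> sorted_wrt (\<lambda>b i. \<not> eqv S B i b) is ==> finite (comb S is) \<and> card (comb S is) = card (K S) ^ length is"
proof (induction "is")
 case (Cons b "is")
 have b: "b \<in> B" "set is \<subseteq> B" "\<forall>i\<in>set is. \<not> eqv S B i b" using Cons.prems by auto
 have bV: "act b x \<in> V S" if "x \<in> V S" for x using ops_V[OF B b(1) that] .
 let ?F = "\<lambda>(f, k). \<lambda>x. f x + rs S (\<lambda>x. k (act b x)) x"
 have "bij_betw ?F (comb S is \<times> K S) (comb S (b # is))"
 proof (rule bij_betw_imageI)
  have rr: "rs S (\<lambda>x. rs S r (act b x)) = rs S (\<lambda>x. r (act b x))" for r
   unfolding rs_eq using bV by (simp add: rs_def)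
  show "?F ` (comb S is \<times> K S) = comb S (b # is)" unfolding K_def by (force simp: rr image_iff)
  show "inj_on ?F (comb S is \<times> K S)"
  proof (rule inj_onI, clarify)
   fix f k f' k' assume f: "f \<in> comb S is" "f' \<in> comb S is" and "k \<in> K S" "k' \<in> K S"
    and e: "(\<lambda>x. f x + rs S (\<lambda>x. k (act b x)) x) = (\<lambda>x. f' x + rs S (\<lambda>x. k' (act b x)) x)"
   then obtain r r' where r: "r \<in> R" "k = rs S r" "r' \<in> R" "k' = rs S r'" by (auto simp: K_def)
   have e': "f x + rs S (\<lambda>x. r (act b x)) x = f' x + rs S (\<lambda>x. r' (act b x)) x" for x using e unfolding r rr by metis
   have "f x + - f' x = r' (act b x) + - r (act b x)" if x: "x \<in> V S" for x
   proof -
    have m: "f x \<in> P" "f' x \<in> P" "r (act b x) \<in> P" "r' (act b x) \<in> P"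
     using comb_VP[OF B b(2)] f R_in r VP[OF bV[OF x]] by auto
    have "f x + r (act b x) = f' x + r' (act b x)" using e'[of x] x by (simp add: rs_def)
    then have "f x = r' (act b x) + f' x + - r (act b x)" using comm[OF m(2,4)] by (metis add.assoc add.right_inverse add_0_right)
    also have "\<dots> = r' (act b x) + - r (act b x) + f' x" using comm[OF m(2) negP[OF m(3)]] by (simp add: add.assoc)
    finally show ?thesis by (simp add: add.assoc)
   qed
   then have "(\<lambda>x. r' x + - r x) \<in> ann S"
    using comb_independent[OF S B b(2,1,3) comb_diff[OF B b(2) f] R_diff[OF r(3,1)]] by blast
   then have kk: "k = k'" using rs_diff_ann[OF S r(3,1)] r rs_eq by metis
   then have "f x = f' x" for x using e'[of x] r by (metis add_right_cancel rr)
   then show "f = f' \<and> k = k'" using kk by auto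
  qed
 qed
 note F = bij_betw_same_card[OF this] bij_betw_finite[OF this]
 have IH: "finite (comb S is)" "card (comb S is) = card (K S) ^ length is" using Cons by auto
 have "finite (comb S (b # is))" using F(2) IH(1) finK by blast
 moreover have "card (comb S (b # is)) = card (comb S is) * card (K S)" using F(1) by (simp only: card_cartesian_product)
 ultimately show ?case using IH by (simp del: comb.simps)
qed simp

lemma eqv_trivial: assumes "ops B" "i \<in> B" "j \<in> B" "eqv S B i j" "b \<in> B" "v \<in> V S"
 shows "act (cm b (- i + j)) v = v"
proof -
 have iH: "i \<in> H" "- i \<in> H" using ops_H[OF assms(1,2)] Hneg by auto
 have c: "cm b i \<in> H" "cm b j \<in> H" using ops_cm[OF assms(1,5)] assms(2,3) AH by auto
 have w: "act i v \<in> V S" using ops_V[OF assms(1,2,6)] .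
 have e: "cm b (- i + j) = - i + (- cm b i + (cm b j + i))" by (simp add: cm_def minus_add add.assoc)
 have "act (cm b (- i + j)) v = act (- i) (act (- cm b i) (act (cm b j) (act i v)))"
  unfolding e using act_plus VP[OF assms(6)] iH c Hneg Hadd act_in by simp
 also have "act (cm b j) (act i v) = act (cm b i) (act i v)" using assms(4,5) w by (auto simp: eqv_def)
 also have "act (- cm b i) (act (cm b i) (act i v)) = act i v" using act_inv(2)[OF c(1) VP[OF w]] .
 finally show ?thesis using act_inv(2)[OF iH(1) VP[OF assms(6)]] by simp
qed

text \<open>Distinct components have annihilators not contained in one another. A product of
  elements that kill the other components but not \<open>T\<close> stays nonzero on
  \<open>T\<close>, where \<open>R\<close> acts through a field.\<close>

lemma killer:
 assumes T: "minS T" and "finite Y" "\<And>S. S \<in> Y ==> minS S \<and> V S \<noteq> V T"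
 shows "\<exists>r\<in>R. r \<notin> ann T \<and> (\<forall>S\<in>Y. \<forall>x\<in>V S. r x = 0)"
 using assms(2,3)
proof (induction Y rule: finite_induct)
 case empty
 then show ?case using R_one act_A_not_ann[OF T sg_zero[OF sgA]] by blast
next
 case (insert S Y)
 then obtain r where r: "r \<in> R" "r \<notin> ann T" "\<forall>S\<in>Y. \<forall>x\<in>V S. r x = 0" by auto
 have S: "minS S" "V S \<noteq> V T" using insert by auto
 have "\<not> ann S \<subseteq> ann T"
 proof
  assume sub: "ann S \<subseteq> ann T"
  then have VV: "V T \<subseteq> V S" by (auto simp: V_def)
  have "f \<in> ann S" if f: "f \<in> ann T" for f
  proof (rule ccontr)
   assume "f \<notin> ann S"
   moreover have fR: "f \<in> R" using f by (simp add: ann_def)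
   moreover obtain t where "t \<in> T" "t \<noteq> 0" using minS_nz[OF T] by blast
   moreover from this have "t \<in> V S" "f t = 0" using S_V[OF T] VV f by (auto simp: ann_def)
   ultimately show False using R_nz[OF S(1)] by blast
  qed
  then have "ann S = ann T" using sub by blast
  then show False using S(2) by (simp add: V_def)
 qed
 then obtain f where f: "f \<in> ann S" "f \<notin> ann T" by blast
 have fR: "f \<in> R" using f by (simp add: ann_def)
 let ?g = "\<lambda>x. f (r x)"
 have g: "?g \<in> R" using R_comp fR r by blast
 have "?g \<notin> ann T"
 proof
  assume "?g \<in> ann T"
  then have "f (r v) = 0" if "v \<in> V T" for v using that by (auto simp: V_def)
  then have "r v = 0" if "v \<in> V T" for v using R_nz[OF T fR f(2) V_R[OF that r(1)]] that by blast
  then show False using r(1,2) ann_V[OF T] by blast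
 qed
 moreover have "?g x = 0" if "x \<in> V S" for x
  using that R_comm[OF r(1) fR VP[OF that]] f(1) R_z[OF r(1)] by (auto simp: V_def)
 moreover have "?g x = 0" if "x \<in> V S'" "S' \<in> Y" for x S' using that r(3) R_z[OF fR] by auto
 ultimately show ?case using g by auto
qed

text \<open>The sum of distinct components is direct: an operator that kills all earlier components
  is injective on the next one.\<close>

lemma card_sum:
 assumes "finite Y" "\<And>W. W \<in> Y ==> \<exists>S. minS S \<and> W = V S" "\<And>W. W \<in> Y ==> card W = c"
 shows "gen (\<Union>Y) \<subseteq> P \<and> card (gen (\<Union>Y)) = c ^ card Y"
 using assms
proof (induction Y rule: finite_induct)
 case empty
 have "gen {} = {0::'p}" using gen_least[of "{0}" "{}"] sg_zero[OF sg_gen] by (auto simp: sg_def)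
 then show ?case using zP by simp
next
 case (insert W Y)
 obtain T where T: "minS T" "W = V T" using insert by blast
 have IH: "gen (\<Union>Y) \<subseteq> P" "card (gen (\<Union>Y)) = c ^ card Y" using insert by auto
 let ?G = "gen (\<Union>Y)"
 have "Y \<subseteq> V ` {S. minS S}" using insert.prems(1) by blast
 then have "\<exists>Y'. finite Y' \<and> (\<forall>S\<in>Y'. minS S) \<and> Y = V ` Y'"
  using finite_subset_image[OF insert.hyps(1), of V "{S. minS S}"] by blast
 then obtain Y' where Y': "finite Y'" "\<forall>S\<in>Y'. minS S" "Y = V ` Y'" by blast
 then have "\<And>S. S \<in> Y' ==> minS S \<and> V S \<noteq> V T" using insert.hyps T by auto
 then obtain r where r: "r \<in> R" "r \<notin> ann T" "\<forall>S\<in>Y'. \<forall>x\<in>V S. r x = 0" using killer[OF T(1) Y'(1)] by blast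
 have sgk: "sg {x \<in> P. r x = 0}" using sub_kernel[OF subP r(1)] by (simp add: sub_def)
 have "?G \<subseteq> {x \<in> P. r x = 0}" by (rule gen_least[OF sgk]) (use r Y' VP in auto)
 then have rG: "r x = 0" if "x \<in> ?G" for x using that by auto
 have int: "x = 0" if "x \<in> ?G" "x \<in> W" for x using R_nz[OF T(1) r(1,2)] rG that T by blast
 have WP: "W \<subseteq> P" "sg W" using T V_subP V_sg by auto
 have "bij_betw (\<lambda>(x, w). x + w) (?G \<times> W) (gen (\<Union>(insert W Y)))"
 proof (rule bij_betw_imageI)
  show "inj_on (\<lambda>(x, w). x + w) (?G \<times> W)"
  proof (rule inj_onI, clarify)
   fix x w x' w' assume m: "x \<in> ?G" "w \<in> W" "x' \<in> ?G" "w' \<in> W" and e: "x + w = x' + w'"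
   have "- x' + x = - x' + (x + w) + - w" by (simp add: add.assoc)
   also have "\<dots> = w' + - w" unfolding e by (simp add: add.assoc)
   finally have "- x' + x = w' + - w" .
   moreover have "- x' + x \<in> ?G" "w' + - w \<in> W" using m sg_add sg_neg sg_gen WP(2) by metis+
   ultimately have "- x' + x = 0" "w' + - w = 0" using int by metis+
   then show "x = x' \<and> w = w'" by (metis add.right_neutral add_minus_cancel eq_neg_iff_add_eq_0 minus_minus)
  qed
  let ?I = "(\<lambda>(x, w). x + w) ` (?G \<times> W)"
  have Ii: "x + w \<in> ?I" if "x \<in> ?G" "w \<in> W" for x w using that by force
  have sgI: "sg ?I"
  proof (rule sgI)
   show "0 \<in> ?I" using Ii[OF sg_zero[OF sg_gen] sg_zero[OF WP(2)]] by simp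
   fix a b assume "a \<in> ?I" "b \<in> ?I"
   then obtain x w x' w' where m: "x \<in> ?G" "w \<in> W" "x' \<in> ?G" "w' \<in> W" "a = x + w" "b = x' + w'" by auto
   then have "a + b = (x + x') + (w + w')" using shuffle[of x w x' w'] IH(1) WP(1) by auto
   then show "a + b \<in> ?I" using Ii[OF sg_add[OF sg_gen m(1,3)] sg_add[OF WP(2) m(2,4)]] by simp
  next
   fix a assume "a \<in> ?I"
   then obtain x w where m: "x \<in> ?G" "w \<in> W" "a = x + w" by auto
   then have "- a = - x + - w" using neg_sum[of x w] IH(1) WP(1) by auto
   then show "- a \<in> ?I" using Ii[OF sg_neg[OF sg_gen m(1)] sg_neg[OF WP(2) m(2)]] by simp
  qed
  have "\<Union>(insert W Y) \<subseteq> ?I"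
  proof
   fix x assume "x \<in> \<Union>(insert W Y)"
   then have "x \<in> W \<or> x \<in> ?G" using gen_base[of "\<Union>Y"] by auto
   then show "x \<in> ?I" using Ii[OF sg_zero[OF sg_gen], of x] Ii[OF _ sg_zero[OF WP(2)], of x] by auto
  qed
  then have "gen (\<Union>(insert W Y)) \<subseteq> ?I" by (rule gen_least[OF sgI])
  moreover have "?I \<subseteq> gen (\<Union>(insert W Y))"
   using gen_mono[of "\<Union>Y" "\<Union>(insert W Y)"] gen_base[of "\<Union>(insert W Y)"] by (auto intro!: sg_add[OF sg_gen])
  ultimately show "?I = gen (\<Union>(insert W Y))" by blast
 qed
 then have "card (gen (\<Union>(insert W Y))) = card ?G * card W" using bij_betw_same_card card_cartesian_product by metis
 moreover have "gen (\<Union>(insert W Y)) \<subseteq> P"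
  using gen_least[OF sgP, of "\<Union>(insert W Y)"] WP(1) IH(1) gen_base[of "\<Union>Y"] by auto
 ultimately show ?case using IH insert by auto
qed

text \<open>Clifford's theorem: \<open>Om\<close> is the \<open>H\<close>-orbit of one component,
  its sum is invariant and hence all of \<open>P\<close>, and all members share the field size
  \<open>q\<close> and the dimension \<open>e\<close>. The other clauses serve the derived series:
  commutators of elements fixing the components centralize \<open>A\<close>, single elements do so
  if \<open>q = 3\<close>, and a class-two group of operators has at most \<open>e * e\<close>
  commutator characters on a component.\<close>

theorem simple_structure:
 obtains Om q e where "finite Om" "Om \<noteq> {}" "\<forall>W\<in>Om. W \<subseteq> P" "\<forall>h\<in>H. \<forall>W\<in>Om. act h ` W \<in> Om"
  "q \<ge> 3" "e \<ge> 1" "card P = q ^ (e * card Om)"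
  "\<forall>c\<in>H. (\<forall>W\<in>Om. \<forall>x\<in>W. act c x = x) --> (\<forall>x\<in>P. act c x = x)"
  "\<forall>g\<in>H. \<forall>h\<in>H. (\<forall>W\<in>Om. act g ` W = W \<and> act h ` W = W) --> (\<forall>a\<in>A. \<forall>x\<in>P. act (cm (cm g h) a) x = x)"
  "q = 3 --> (\<forall>g\<in>H. (\<forall>W\<in>Om. act g ` W = W) --> (\<forall>a\<in>A. \<forall>x\<in>P. act (cm g a) x = x))"
  "\<forall>B W I. ops B --> W \<in> Om --> finite I --> I \<subseteq> B -->
    (\<forall>i\<in>I. \<forall>j\<in>I. i \<noteq> j --> (\<exists>b\<in>B. \<exists>x\<in>W. act (cm b (- i + j)) x \<noteq> x)) --> card I \<le> e * e"
proof -
 obtain S where S: "minS S" using ex_minS by blast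
 define Om where "Om = (\<lambda>h. act h ` V S) ` H"
 define q where "q = card (K S)"
 obtain e where e: "card (V S) = q ^ e" "e \<ge> 1" using card_lin[OF S] q_def by metis
 have Om: "\<exists>T. minS T \<and> W = V T \<and> card (K T) = q \<and> card W = q ^ e" if "W \<in> Om" for W
 proof -
  obtain h where h: "h \<in> H" "W = act h ` V S" using \<open>W \<in> Om\<close> by (auto simp: Om_def)
  have i: "inj_on (act h) P" using inj_act[OF h(1)] .
  have "card W = q ^ e" using h card_image[OF inj_on_subset[OF i V_subP]] e by simp
  moreover have "card (K (act h ` S)) = q"
   using card_K[OF act_minS[OF h(1) S]] card_K[OF S] card_image[OF inj_on_subset[OF i minSP[OF S]]] q_def by simp
  ultimately show ?thesis using act_minS[OF h(1) S] act_V[OF h(1) S] h(2) by blast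
 qed
 have OmP: "W \<subseteq> P" if "W \<in> Om" for W using Om[OF that] V_subP by blast
 have OmH: "act h ` W \<in> Om" if "h \<in> H" "W \<in> Om" for h W
  using that act_plus_image[OF that(1) _ V_subP] Hadd unfolding Om_def by (auto simp: image_iff) metis
 have fin: "finite Om" by (rule finite_subset[of _ "Pow P"]) (use OmP finP in auto)
 have VOm: "V S \<in> Om" unfolding Om_def using sg_zero[OF sgH] act_0 VP by (intro image_eqI[of _ _ 0]) (auto simp: image_iff)
 have cs: "gen (\<Union>Om) \<subseteq> P" "card (gen (\<Union>Om)) = (q ^ e) ^ card Om"
  using card_sum[OF fin, of "q ^ e"] Om by blast+
 have "gen (\<Union>Om) = P"
 proof (rule simple[OF sg_gen cs(1)])
  obtain s where "s \<in> S" "s \<noteq> 0" using minS_nz[OF S] by blast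
  then show "gen (\<Union>Om) \<noteq> {0}" using S_V[OF S] VOm gen_base[of "\<Union>Om"] by blast
  fix h x assume h: "h \<in> H" and x: "x \<in> gen (\<Union>Om)"
  have "sg {x \<in> P. act h x \<in> gen (\<Union>Om)}"
   by (rule sgI) (auto simp: zP addP negP act_z[OF h] act_add[OF h] act_neg[OF h] intro: sg_zero sg_add sg_neg sg_gen)
  moreover have "\<Union>Om \<subseteq> {x \<in> P. act h x \<in> gen (\<Union>Om)}" using OmP OmH[OF h] gen_base[of "\<Union>Om"] by blast
  ultimately show "act h x \<in> gen (\<Union>Om)" using gen_least x by blast
 qed
 note genP = this
 have triv: "act c x = x" if c: "c \<in> H" "\<And>W x. W \<in> Om ==> x \<in> W ==> act c x = x" and x: "x \<in> P" for c x
 proof -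
  have "sg {x \<in> P. act c x = x}"
   by (rule sgI) (auto simp: zP addP negP act_z[OF c(1)] act_add[OF c(1)] act_neg[OF c(1)])
  moreover have "\<Union>Om \<subseteq> {x \<in> P. act c x = x}" using OmP c(2) by blast
  ultimately show ?thesis using gen_least genP x by blast
 qed
 have StT: "g \<in> St T" if "g \<in> H" "W = V T" "act g ` W = W" for g W T using that by (auto simp: St_def)
 have q3: "q \<ge> 3" using K_ge_3[OF S] q_def by simp
 have O2: "act (cm (cm g h) a) x = x"
  if gh: "g \<in> H" "h \<in> H" "\<And>W. W \<in> Om ==> act g ` W = W \<and> act h ` W = W" and a: "a \<in> A" and x: "x \<in> P" for g h a x
  proof (rule triv[OF _ _ x])
   show "cm (cm g h) a \<in> H" using gh AH'[OF a] sg_cm[OF sgH] by auto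
   fix W y assume W: "W \<in> Om" "y \<in> W"
   obtain T where T: "minS T" "W = V T" using Om[OF W(1)] by blast
   show "act (cm (cm g h) a) y = y"
    using semilinear_commute[OF T(1) StT[OF gh(1) T(2)] StT[OF gh(2) T(2)] a] gh(3)[OF W(1)] W(2) T(2) by blast
  qed
 have O3: "act (cm g a) x = x"
  if q: "q = 3" and g: "g \<in> H" "\<And>W. W \<in> Om ==> act g ` W = W" and a: "a \<in> A" and x: "x \<in> P" for g a x
  proof (rule triv[OF _ _ x])
   show "cm g a \<in> H" using g AH'[OF a] sg_cm[OF sgH] by auto
   fix W y assume W: "W \<in> Om" "y \<in> W"
   obtain T where T: "minS T" "W = V T" "card (K T) = q" using Om[OF W(1)] by blast
   show "act (cm g a) y = y"
    using semilinear_commute_3[OF T(1) _ StT[OF g(1) T(2)] a] T(3) q g(2)[OF W(1)] W(2) T(2) by blast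
  qed
 have O4: "card I \<le> e * e" if B: "ops B" and W: "W \<in> Om" and I: "finite I" "I \<subseteq> B"
   and ij: "\<And>i j. i \<in> I ==> j \<in> I ==> i \<noteq> j ==> \<exists>b\<in>B. \<exists>x\<in>W. act (cm b (- i + j)) x \<noteq> x" for B W I
 proof -
  obtain T where T: "minS T" "W = V T" "card (K T) = q" "card W = q ^ e" using Om[OF W] by blast
  obtain "is" where is': "set is = I" "distinct is" using finite_distinct_list[OF I(1)] by blast
  have "\<not> eqv T B i j" if "i \<in> I" "j \<in> I" "i \<noteq> j" for i j
   using ij[OF that] eqv_trivial[OF B, of i j T] that I(2) T(2) by blast
  then have "sorted_wrt (\<lambda>b i. \<not> eqv T B i b) is" using is' unfolding sorted_wrt_iff_nth_less
   by (metis distinct_conv_nth less_imp_neq nth_mem less_trans)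
  then have c: "finite (comb T is)" "card (comb T is) = q ^ length is" using card_comb[OF T(1) B, of "is"] is' I T(3) by auto
  have "q \<ge> 3" using K_ge_3[OF S] q_def by simp
  obtain e' where e': "card (V T) = q ^ e'"
    "finite {f. lin T f \<and> (\<forall>x\<in>V T. f x \<in> V T) \<and> (\<forall>x. x \<notin> V T --> f x = 0)}"
    "card {f. lin T f \<and> (\<forall>x\<in>V T. f x \<in> V T) \<and> (\<forall>x. x \<notin> V T --> f x = 0)} \<le> q ^ (e' * e')"
   using card_lin[OF T(1), unfolded T(3)] by blast
  then have "q ^ e = q ^ e'" using T by simp
  then have ee: "e' = e" using \<open>q \<ge> 3\<close> power_inject_exp[of q e e'] by simp
  have "comb T is \<subseteq> {f. lin T f \<and> (\<forall>x\<in>V T. f x \<in> V T) \<and> (\<forall>x. x \<notin> V T --> f x = 0)}"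
   using comb_in[OF B, of "is" _ T] is' I(2) by blast
  then have "card (comb T is) \<le> q ^ (e' * e')" using card_mono[OF e'(2)] e'(3) le_trans by blast
  then have "q ^ length is \<le> q ^ (e * e)" unfolding c(2) ee .
  moreover have "1 < q" using \<open>q \<ge> 3\<close> by simp
  ultimately have "length is \<le> e * e" by (rule power_le_imp_le_exp[rotated])
  then show "card I \<le> e * e" using distinct_card[OF is'(2)] is'(1) by simp
 qed
 show ?thesis
 proof (rule that[of Om q e])
  show "\<forall>W\<in>Om. W \<subseteq> P" "\<forall>h\<in>H. \<forall>W\<in>Om. act h ` W \<in> Om" using OmP OmH by blast+
  show "Om \<noteq> {}" using VOm by blast
  show "card P = q ^ (e * card Om)" using cs(2) genP by (simp add: power_mult)
  show "\<forall>c\<in>H. (\<forall>W\<in>Om. \<forall>x\<in>W. act c x = x) --> (\<forall>x\<in>P. act c x = x)"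
   by (intro ballI impI, rule triv) auto
  show "\<forall>g\<in>H. \<forall>h\<in>H. (\<forall>W\<in>Om. act g ` W = W \<and> act h ` W = W) --> (\<forall>a\<in>A. \<forall>x\<in>P. act (cm (cm g h) a) x = x)"
   by (intro ballI impI, rule O2) auto
  show "q = 3 --> (\<forall>g\<in>H. (\<forall>W\<in>Om. act g ` W = W) --> (\<forall>a\<in>A. \<forall>x\<in>P. act (cm g a) x = x))"
   by (intro ballI impI, rule O3) auto
  show "\<forall>B W I. ops B --> W \<in> Om --> finite I --> I \<subseteq> B -->
    (\<forall>i\<in>I. \<forall>j\<in>I. i \<noteq> j --> (\<exists>b\<in>B. \<exists>x\<in>W. act (cm b (- i + j)) x \<noteq> x)) --> card I \<le> e * e"
  proof (intro allI impI)
   fix B W I assume "ops B" "W \<in> Om" "finite I" "I \<subseteq> B"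
    and "\<forall>i\<in>I. \<forall>j\<in>I. i \<noteq> j --> (\<exists>b\<in>B. \<exists>x\<in>W. act (cm b (- i + j)) x \<noteq> x)"
   then show "card I \<le> e * e" by (intro O4[of B W I]) blast+
  qed
 qed (fact fin q3 e(2))+
qed

end

subsection \<open>Abelian sections\<close>

text \<open>A finite abelian module \<open>U / W\<close> for \<open>H\<close> under conjugation,
  kept as a pair of subgroups so that submodules and quotients stay in the same type.\<close>

definition sec :: "'g::group_add set \<Rightarrow> 'g set \<Rightarrow> 'g set \<Rightarrow> bool"
 where "sec H U W \<longleftrightarrow> sg H \<and> sg U \<and> sg W \<and> W \<subseteq> U \<and> nrm H U \<and> nrm H W \<and>
  (\<forall>u\<in>U. \<forall>v\<in>U. cm u v \<in> W) \<and> finite (cos U W)"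

definition triv :: "'g::group_add set \<Rightarrow> 'g set \<Rightarrow> 'g set \<Rightarrow> bool"
 where "triv E U W \<longleftrightarrow> (\<forall>h\<in>E. \<forall>u\<in>U. cm h u \<in> W)"

text \<open>Solvability is asked of the action on the section only; it therefore passes to
  submodules and quotients without any change of \<open>H\<close>.\<close>

definition solv :: "'g::group_add set \<Rightarrow> 'g set \<Rightarrow> 'g set \<Rightarrow> bool"
 where "solv H U W \<longleftrightarrow> (\<exists>l. triv (dern l H) U W)"

lemma triv_mono: "triv E U W ==> E' \<subseteq> E ==> U' \<subseteq> U ==> W \<subseteq> W' ==> triv E' U' W'"
 unfolding triv_def by blast

lemma triv_dern_mono: "triv (dern d H) U W ==> sg H ==> d \<le> d' ==> triv (dern d' H) U W"
 by (erule triv_mono[OF _ dern_anti]) auto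

lemma nrm_of_cm: assumes "sg W" "\<And>u v. u \<in> U ==> v \<in> W ==> cm u v \<in> W" shows "nrm U W"
 unfolding nrm_def
proof (intro ballI)
 fix u v assume "u \<in> U" "v \<in> W"
 then have "cm u v + v \<in> W" using assms sg_add by blast
 then show "u + v + - u \<in> W" by (simp add: cm_def add.assoc)
qed

lemma sg_all: assumes "sg H" "\<And>u. u \<in> U ==> sg {h \<in> H. Q h u}" shows "sg {h \<in> H. \<forall>u\<in>U. Q h u}"
proof (rule sgI)
 show "0 \<in> {h \<in> H. \<forall>u\<in>U. Q h u}" using assms sg_zero by fastforce
 show "x + y \<in> {h \<in> H. \<forall>u\<in>U. Q h u}" if "x \<in> {h \<in> H. \<forall>u\<in>U. Q h u}" "y \<in> {h \<in> H. \<forall>u\<in>U. Q h u}" for x y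
  using that assms(1) sg_add[OF assms(2), of _ x y] by (auto intro: sg_add)
 show "- x \<in> {h \<in> H. \<forall>u\<in>U. Q h u}" if "x \<in> {h \<in> H. \<forall>u\<in>U. Q h u}" for x
  using that assms(1) sg_neg[OF assms(2), of _ x] by (auto intro: sg_neg)
qed

lemma sg_centralizer: assumes "sg H" "sg W" "nrm H W" shows "sg {h \<in> H. \<forall>u\<in>U. cm h u \<in> W}"
 by (rule sg_all[OF assms(1)]) (rule sg_cm_left[OF assms(1,3,2)])

lemma nrm_centralizer: assumes "sg H" "nrm H U" "nrm H W" "nrm H K" shows "nrm H {h \<in> K. \<forall>u\<in>U. cm h u \<in> W}"
 unfolding nrm_def
proof (intro ballI CollectI conjI)
 fix k h u assume k: "k \<in> H" and h: "h \<in> {h \<in> K. \<forall>u\<in>U. cm h u \<in> W}"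
 show "k + h + - k \<in> K" using nrmD[OF assms(4) k] h by blast
 assume u: "u \<in> U"
 have "- k + u + - (- k) \<in> U" using nrmD[OF assms(2) sg_neg[OF assms(1) k] u] .
 then have "k + cm h (- k + u + - (- k)) + - k \<in> W" using h nrmD[OF assms(3) k] by blast
 then show "cm (k + h + - k) u \<in> W" unfolding cj_cm by (simp add: add.assoc)
qed

text \<open>Both conjugates of \<open>x\<close> equal \<open>(p + r) + x\<close>: each of
  \<open>g\<close>, \<open>h\<close> adds its own part and commutes with the part of the
  other.\<close>

lemma commuting_parts:
 fixes g h x p r :: "'g::group_add"
 assumes "cm g x = p" "cm h x = r" "cm p r = 0" "cm g r = 0" "cm h p = 0"
 shows "g + h + x + - (g + h) = h + g + x + - (h + g)"
proof -
 have c: "p + r = r + p" "g + r = r + g" "h + p = p + h" using assms(3-) cm_zero_iff by auto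
 have gx: "g + x + - g = p + x" "h + x + - h = r + x"
  using assms(1,2) by (auto simp: cm_def add.assoc)
 have "g + h + x + - (g + h) = g + (h + x + - h) + - g" by (simp add: add.assoc minus_add)
 also have "\<dots> = (g + r) + x + - g" by (simp only: gx(2)) (simp add: add.assoc)
 also have "\<dots> = r + (g + x + - g)" by (simp only: c(2) add.assoc)
 also have "\<dots> = (p + r) + x" by (simp only: gx(1)) (simp only: c(1) add.assoc)
 also have "\<dots> = p + (h + x + - h)" by (simp only: gx(2)) (simp only: add.assoc)
 also have "\<dots> = (h + p) + x + - h" by (simp only: c(3) add.assoc)
 also have "\<dots> = h + (g + x + - g) + - h" by (simp only: gx(1)) (simp only: add.assoc)
 also have "\<dots> = h + g + x + - (h + g)" by (simp add: add.assoc minus_add)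
 finally show ?thesis .
qed

text \<open>The action on \<open>U / W\<close> is by unitriangular two-by-two matrices, and those
  commute because \<open>Q / W\<close> is abelian. So a single derivation makes the action
  trivial.\<close>

lemma merge_triv:
 assumes M: "sg M" "E \<subseteq> M" "U \<subseteq> M" "Q \<subseteq> M" "sg W" "W \<subseteq> M" "nrm M W" and E: "sg E" "nrm E U"
  and "triv E U Q" "triv E Q W" "\<And>a b. a \<in> Q ==> b \<in> Q ==> cm a b \<in> W"
 shows "triv (der E) U W"
proof -
 obtain f :: "'a \<Rightarrow> 'a set bijn" where f: "hm f M" "\<And>u. u \<in> M ==> f u = 0 \<longleftrightarrow> u \<in> W"
  using ex_quotient_hom[OF M(1,5,6,7)] by blast
 note add = sg_add[OF M(1)] and neg = sg_neg[OF M(1)]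
 have fc: "f (cm a b) = cm (f a) (f b)" if "a \<in> M" "b \<in> M" for a b using hm_cm[OF f(1) M(1) that] .
 have eq: "f (g + h + u + - (g + h)) = f (h + g + u + - (h + g))" if g: "g \<in> E" "h \<in> E" "u \<in> U" for g h u
 proof -
  have m: "g \<in> M" "h \<in> M" "u \<in> M" using g M by auto
  have p: "cm g u \<in> Q" "cm h u \<in> Q" using assms(10) g by (auto simp: triv_def)
  have pM: "cm g u \<in> M" "cm h u \<in> M" using p M by auto
  have "cm (f (cm g u)) (f (cm h u)) = 0" using fc[OF pM] f(2) assms(12)[OF p] sg_cm[OF M(1) pM] by metis
  moreover have "cm (f g) (f (cm h u)) = 0" "cm (f h) (f (cm g u)) = 0"
   using fc[OF m(1) pM(2)] fc[OF m(2) pM(1)] f(2) assms(11) g p sg_cm[OF M(1)] m pM unfolding triv_def by metis+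
  ultimately have "f g + f h + f u + - (f g + f h) = f h + f g + f u + - (f h + f g)"
   using commuting_parts[OF fc[OF m(1,3), symmetric] fc[OF m(2,3), symmetric]] by blast
  then show ?thesis using m add neg by (simp add: hmD[OF f(1)] hm_neg[OF f(1) M(1)])
 qed
 have nEW: "nrm E W" using nrm_sub[OF M(7,2)] .
 have "der E \<subseteq> {h \<in> E. \<forall>u\<in>U. cm h u \<in> W}"
 proof (rule der_least[OF sg_centralizer[OF E(1) M(5) nEW]])
  fix g h assume g: "g \<in> E" "h \<in> E"
  have "cm (cm g h) u \<in> W" if u: "u \<in> U" for u
  proof -
   let ?y = "- (h + g) + u + - (- (h + g))"
   have y: "?y \<in> U" using nrmD[OF E(2) sg_neg[OF E(1) sg_add[OF E(1) g(2,1)]] u] .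
   have m: "g \<in> M" "h \<in> M" "u \<in> M" "?y \<in> M" using g u y M by auto
   have "f (g + h + ?y + - (g + h)) = f u" using eq[OF g y] by (simp add: add.assoc)
   moreover have "g + h + ?y + - (g + h) = cm (cm g h) u + u" by (simp add: cm_def minus_add add.assoc)
   ultimately have "f (cm (cm g h) u) + f u = f u" using hmD[OF f(1)] sg_cm[OF M(1)] m by metis
   then have "f (cm (cm g h) u) = 0" using add_right_cancel[of _ "f u" 0] by simp
   then show ?thesis using f(2) sg_cm[OF M(1)] m by metis
  qed
  then show "cm g h \<in> {h \<in> E. \<forall>u\<in>U. cm h u \<in> W}" using sg_cm[OF E(1) g] by blast
 qed
 then show ?thesis by (auto simp: triv_def)
qed

lemma secD: assumes "sec H U W"
 shows "sg H" "sg U" "sg W" "W \<subseteq> U" "nrm H U" "nrm H W" "\<And>u v. u \<in> U ==> v \<in> U ==> cm u v \<in> W" "finite (cos U W)" "nrm U W"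
 using assms nrm_of_cm[of W U] by (auto simp: sec_def)

lemma sec_split:
 assumes "sec H U W" "sg Q" "W \<subseteq> Q" "Q \<subseteq> U" "nrm H Q"
 shows "sec H U Q" "sec H Q W" "idx U W = idx U Q * idx Q W"
 using secD[OF assms(1)] idx_mult[of U Q W] assms unfolding sec_def by blast+

lemma solv_split: "solv H U W ==> W \<subseteq> Q ==> Q \<subseteq> U ==> solv H U Q \<and> solv H Q W"
 unfolding solv_def using triv_mono[OF _ order_refl] by blast

lemma sec_merge:
 assumes "sec H U W" "sg Q" "W \<subseteq> Q" "Q \<subseteq> U" "triv (dern d H) U Q" "triv (dern d H) Q W"
 shows "triv (dern (Suc d) H) U W"
proof -
 note D = secD[OF assms(1)]
 let ?M = "gen (H \<union> U)"
 have HM: "H \<subseteq> ?M" "U \<subseteq> ?M" using gen_base[of "H \<union> U"] by auto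
 have "nrm ?M W"
 proof (rule nrm_gen_left)
  fix s u assume "s \<in> H \<union> U" "u \<in> W"
  then show "s + u + - s \<in> W" "- s + u + s \<in> W"
   using nrmD[OF D(6), of s u] nrmD[OF D(6), of "- s" u] nrmD[OF D(9), of s u] nrmD[OF D(9), of "- s" u] sg_neg D(1,2) by auto
 qed
 moreover have "nrm (dern d H) U" using nrm_sub[OF D(5) dern_sub[OF D(1)]] .
 moreover have "dern d H \<subseteq> ?M" using HM dern_sub[OF D(1)] by blast
 moreover have "cm a b \<in> W" if "a \<in> Q" "b \<in> Q" for a b using D(7) assms(4) that by blast
 ultimately show ?thesis unfolding dern_Suc
  using assms D HM by (intro merge_triv[of ?M "dern d H" U Q W]) (auto simp: sg_gen sg_dern)
qed

lemma sec_action: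
 assumes "sec H U W"
 obtains f :: "'g::group_add \<Rightarrow> 'g set bijn" and act where
  "hm f U" "\<And>u. u \<in> U ==> f u = 0 \<longleftrightarrow> u \<in> W" "sg (f ` U)" "finite (f ` U)" "card (f ` U) = idx U W"
  "\<And>x y. x \<in> f ` U ==> y \<in> f ` U ==> x + y = y + x"
  "\<And>h u. h \<in> H ==> u \<in> U ==> act h (f u) = f (h + u + - h)"
  "\<And>h x. x \<notin> f ` U ==> act h x = 0"
  "\<And>h. h \<in> H ==> (\<forall>u\<in>U. cm h u \<in> W) \<longleftrightarrow> (\<forall>x\<in>f ` U. act h x = x)"
proof -
 note D = secD[OF assms]
 obtain f :: "'g \<Rightarrow> 'g set bijn" where f: "hm f U" "\<And>u. u \<in> U ==> f u = 0 \<longleftrightarrow> u \<in> W"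
  using ex_quotient_hom[OF D(2-4,9)] by blast
 define act where "act h x = (if x \<in> f ` U then f (h + inv_into U f x + - h) else 0)" for h x
 have cj: "h + u + - h \<in> U" if "h \<in> H" "u \<in> U" for h u using nrmD[OF D(5) that] .
 have feq: "f u = f v \<longleftrightarrow> - u + v \<in> W" if "u \<in> U" "v \<in> U" for u v
 proof -
  have "f (- u + v) = - f u + f v" using that hm_neg[OF f(1) D(2)] hmD[OF f(1)] sg_neg[OF D(2)] by simp
  moreover have "- f u + f v = 0 \<longleftrightarrow> f u = f v" by (metis add.left_inverse add_left_cancel)
  ultimately show ?thesis using f(2) that sg_add[OF D(2)] sg_neg[OF D(2)] by metis
 qed
 have act: "act h (f u) = f (h + u + - h)" if hu: "h \<in> H" "u \<in> U" for h u
 proof -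
  let ?v = "inv_into U f (f u)"
  have v: "?v \<in> U" "f ?v = f u" using hu by (auto intro: inv_into_into f_inv_into_f)
  have "h + (- ?v + u) + - h \<in> W" using feq[OF v(1) hu(2)] v(2) nrmD[OF D(6) hu(1)] by auto
  then have "- (h + ?v + - h) + (h + u + - h) \<in> W" by (simp add: minus_add add.assoc)
  then have "f (h + ?v + - h) = f (h + u + - h)" using feq cj hu v by blast
  then show ?thesis using hu by (simp add: act_def)
 qed
 have iff: "(\<forall>u\<in>U. cm h u \<in> W) \<longleftrightarrow> (\<forall>x\<in>f ` U. act h x = x)" if h: "h \<in> H" for h
 proof -
  have "act h (f u) = f u \<longleftrightarrow> cm h u \<in> W" if u: "u \<in> U" for u
  proof -
   have "act h (f u) = f u \<longleftrightarrow> - (h + u + - h) + u \<in> W" using act[OF h u] feq[OF cj[OF h u] u] by simp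
   also have "\<dots> \<longleftrightarrow> - (h + u + - h) + - cm h u + - (- (h + u + - h)) \<in> W" by (simp add: cm_def minus_add add.assoc)
   also have "\<dots> \<longleftrightarrow> cm h u \<in> W" using nrm_iff[OF D(2,9) sg_neg[OF D(2) cj[OF h u]]] sg_neg_iff[OF D(3)] by metis
   finally show ?thesis .
  qed
  then show ?thesis by auto
 qed
 have comm: "x + y = y + x" if xy: "x \<in> f ` U" "y \<in> f ` U" for x y
 proof -
  obtain u v where uv: "u \<in> U" "v \<in> U" "x = f u" "y = f v" using xy by auto
  then have "cm (f u) (f v) = 0" using hm_cm[OF f(1) D(2)] f(2) D(7) sg_cm[OF D(2)] by metis
  then show ?thesis using uv cm_zero_iff by auto
 qed
 have card: "card (f ` U) = idx U W" "finite (f ` U)" using idx_hom[OF f(1) D(2-4) f(2)] D(8) by auto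
 show ?thesis using that[OF f hm_sg_image[OF f(1) D(2) D(2) order_refl] card(2,1) comm act _ iff] by (auto simp: act_def)
qed

subsection \<open>Solvable permutation groups\<close>

text \<open>The crude bound for all sections of order at most \<open>n\<close>, as an induction
  hypothesis over every acting group in the type; the first argument only records that type. The
  spare factor 2 in \<open>d + 1\<close> pays for the derivation that
  \<open>transitive_bound\<close> adds.\<close>

definition small :: "'g::group_add itself \<Rightarrow> nat \<Rightarrow> bool"
 where "small _ n \<longleftrightarrow> (\<forall>(H::'g set) U W. sec H U W --> solv H U W --> 2 \<le> idx U W --> idx U W \<le> n -->
  (\<exists>d. 2 ^ (d + 1) \<le> (idx U W)\<^sup>2 \<and> triv (dern d H) U W))"

text \<open>The orbits of the last nontrivial derived subgroup \<open>N\<close> are blocks.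
  Induction handles the action on the blocks. On a block, \<open>N\<close> acts as a regular abelian
  group, so the action of the block stabilizers on it is a section of the order of the block,
  handled by \<open>small\<close>; what remains acts on the block by commuting permutations. The two
  bounds multiply.\<close>

lemma transitive_bound:
 fixes H :: "'g::group_add set" and b :: "'g \<Rightarrow> 'b \<Rightarrow> 'b"
 assumes "sg H" "small TYPE('g) n"
  and "finite Y" "Y \<noteq> {}" "card Y \<le> n"
  and "\<And>h w. h \<in> H ==> w \<in> Y ==> b h w \<in> Y"
  and "\<And>h k w. h \<in> H ==> k \<in> H ==> w \<in> Y ==> b (h + k) w = b h (b k w)"
  and "\<And>w. w \<in> Y ==> b 0 w = w"
  and "\<And>v w. v \<in> Y ==> w \<in> Y ==> \<exists>h\<in>H. b h v = w"
  and "\<forall>h\<in>dern l H. \<forall>w\<in>Y. b h w = w"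
 shows "\<exists>d. 2 ^ d \<le> (card Y)\<^sup>2 \<and> (\<forall>h\<in>dern d H. \<forall>w\<in>Y. b h w = w)"
 using assms(3-)
proof (induction "card Y" arbitrary: Y b rule: less_induct)
 case less
 note fin = less.prems(1) and ne = less.prems(2) and cn = less.prems(3) and bY = less.prems(4)
  and badd = less.prems(5) and b0 = less.prems(6) and tr = less.prems(7) and bl = less.prems(8)
 note sgH = assms(1)
 show ?case
 proof (cases "\<forall>h\<in>H. \<forall>w\<in>Y. b h w = w")
  case True
  have "card Y \<ge> 1" using fin ne by (simp add: Suc_le_eq card_gt_0_iff)
  then have "2 ^ 0 \<le> (card Y)\<^sup>2" by simp
  then show ?thesis using True by (intro exI[of _ 0]) auto
 next
  case False
  let ?fix = "\<lambda>i. \<forall>h\<in>dern i H. \<forall>w\<in>Y. b h w = w"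
  define m where "m = (LEAST i. ?fix i)"
  have m: "?fix m" "\<And>i. i < m ==> \<not> ?fix i" unfolding m_def by (rule LeastI, rule bl) (use not_less_Least in blast)
  then obtain j where j: "m = Suc j" using False by (cases m) auto
  \<comment> \<open>The last derived subgroup that still moves a point; its own derived subgroup
    acts trivially, so \<open>N\<close> acts through an abelian group.\<close>
  define N where "N = dern j H"
  have sgN: "sg N" and NH: "N \<subseteq> H" and nN: "nrm H N"
   unfolding N_def using sg_dern sgH dern_sub nrm_dern nrm_self by blast+
  have derN: "b h w = w" if "h \<in> der N" "w \<in> Y" for h w using m(1) that by (simp add: j dern_Suc N_def)
  have binv: "b (- h) (b h w) = w" "b h (b (- h) w) = w" if "h \<in> H" "w \<in> Y" for h w
   using badd[of "- h" h w] badd[of h "- h" w] that b0 sg_neg[OF sgH] by auto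
  have cmb: "b (cm g h) (b h (b g w)) = b g (b h w)" if "g \<in> H" "h \<in> H" "w \<in> Y" for g h w
  proof -
   have "cm g h + (h + g) = g + h" by (simp add: cm_def add.assoc)
   then show ?thesis using badd[of "cm g h" "h + g" w] badd that sg_cm[OF sgH] sg_add[OF sgH] by metis
  qed
  have comN: "b g (b h w) = b h (b g w)" if "g \<in> N" "h \<in> N" "w \<in> Y" for g h w
   using cmb[of g h w] derN[OF der_cm[OF that(1,2)], of "b h (b g w)"] that NH bY by (metis subsetD)
  define orb where "orb w = (\<lambda>g. b g w) ` N" for w
  have orbY: "orb w \<subseteq> Y" if "w \<in> Y" for w using that bY NH by (auto simp: orb_def)
  have self: "w \<in> orb w" if "w \<in> Y" for w using b0[OF that] sg_zero[OF sgN] unfolding orb_def by (metis image_eqI)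
  have orbeq: "orb v = orb w" if v: "v \<in> orb w" and w: "w \<in> Y" for v w
  proof -
   obtain g where g: "g \<in> N" "v = b g w" using v by (auto simp: orb_def)
   have vY: "v \<in> Y" using v orbY w by blast
   have w': "w = b (- g) v" using g binv NH w by auto
   have "orb (b k u) \<subseteq> orb u" if "k \<in> N" "u \<in> Y" for k u
    unfolding orb_def using badd[of _ k u] that NH sg_add[OF sgN] by (auto simp: image_iff) (metis subsetD)
   then show ?thesis using g w vY w' sg_neg[OF sgN g(1)] by (metis subset_antisym)
  qed
  have orbH: "orb (b h w) = b h ` orb w" if h: "h \<in> H" "w \<in> Y" for h w
  proof -
   have 1: "b g (b h w) = b h (b (- h + g + - (- h)) w)" if "g \<in> N" for g
   proof -
    have "h + (- h + g + - (- h)) = g + h" by (simp add: add.assoc)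
    moreover have "- h + g + - (- h) \<in> H" using h(1) that NH by (intro sg_add[OF sgH] sg_neg[OF sgH]) auto
    ultimately show ?thesis using badd h that NH by (metis subsetD)
   qed
   have 2: "b h (b g w) = b (h + g + - h) (b h w)" if "g \<in> N" for g
   proof -
    have "(h + g + - h) + h = h + g" by (simp add: add.assoc)
    moreover have "h + g + - h \<in> H" using h(1) that NH by (intro sg_add[OF sgH] sg_neg[OF sgH]) auto
    ultimately show ?thesis using badd h that NH by (metis subsetD)
   qed
   show ?thesis unfolding orb_def
   proof (intro equalityI subsetI)
    fix x assume "x \<in> (\<lambda>g. b g (b h w)) ` N"
    then obtain g where "g \<in> N" "x = b g (b h w)" by auto
    then show "x \<in> b h ` (\<lambda>g. b g w) ` N" using 1 nrmD[OF nN sg_neg[OF sgH h(1)]] by blast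
   next
    fix x assume "x \<in> b h ` (\<lambda>g. b g w) ` N"
    then obtain g where "g \<in> N" "x = b h (b g w)" by auto
    then show "x \<in> (\<lambda>g. b g (b h w)) ` N" using 2 nrmD[OF nN h(1)] by blast
   qed
  qed
  \<comment> \<open>Blocks are represented by points of \<open>Y\<close>, so that the induction
    hypothesis applies with the same type of points.\<close>
  define r where "r w = (SOME v. v \<in> orb w)" for w
  have r: "r w \<in> orb w" if "w \<in> Y" for w unfolding r_def using self[OF that] by (rule someI)
  have rY: "r w \<in> Y" if "w \<in> Y" for w using r orbY that by blast
  have orbr: "orb (r w) = orb w" if "w \<in> Y" for w using orbeq[OF r[OF that] that] .
  have rcong: "r v = r w" if "orb v = orb w" for v w using that by (simp add: r_def)
  have r_iff: "r v = r w \<longleftrightarrow> orb v = orb w" if "v \<in> Y" "w \<in> Y" for v w using orbr that rcong by metis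
  define Y' where "Y' = r ` Y"
  have Y'Y: "Y' \<subseteq> Y" using rY by (auto simp: Y'_def)
  have rb: "r (b h (r w)) = r (b h w)" if "h \<in> H" "w \<in> Y" for h w
   using rcong orbH orbr rY that by metis
  have rr: "r w = w" if w: "w \<in> Y'" for w
  proof -
   obtain v where "v \<in> Y" "w = r v" using w by (auto simp: Y'_def)
   then show ?thesis using rcong[OF orbr] by simp
  qed
  obtain g0 w0 where g0: "g0 \<in> N" "w0 \<in> Y" "b g0 w0 \<noteq> w0" using m(2)[of j] j by (auto simp: N_def)
  define wd where "wd = card (orb w0)"
  have bi: "inj_on (b h) Y" if "h \<in> H" for h by (rule inj_on_inverseI[of _ "b (- h)"]) (use binv that in auto)
  have card_orb: "card (orb w) = wd" if w: "w \<in> Y" for w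
  proof -
   obtain h where h: "h \<in> H" "b h w0 = w" using tr[OF g0(2) w] by blast
   then show ?thesis using orbH[OF h(1) g0(2)] card_image[OF inj_on_subset[OF bi[OF h(1)] orbY[OF g0(2)]]] by (simp add: wd_def)
  qed
  have fin_orb: "finite (orb w)" if "w \<in> Y" for w using finite_subset[OF orbY[OF that] fin] .
  have wd2: "wd \<ge> 2"
  proof -
   have "{w0, b g0 w0} \<subseteq> orb w0" using self g0 by (auto simp: orb_def)
   moreover have "card {w0, b g0 w0} = 2" using g0(3) by auto
   ultimately show ?thesis unfolding wd_def using card_mono[OF fin_orb[OF g0(2)]] by metis
  qed
  have cardY: "card Y = card Y' * wd"
  proof -
   have "card Y = (\<Sum>v\<in>Y'. card {w \<in> Y. r w = v})"
    unfolding Y'_def using sum.image_gen[OF fin, of "\<lambda>_. 1::nat" r] by simp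
   also have "\<dots> = (\<Sum>v\<in>Y'. wd)"
   proof (rule sum.cong[OF refl])
    fix v assume v: "v \<in> Y'"
    have "w \<in> orb v \<longleftrightarrow> r w = v" if "w \<in> Y" for w
     using that v Y'Y rr r_iff[of w v] orbeq self by (metis subsetD)
    then have "{w \<in> Y. r w = v} = orb v" using orbY v Y'Y by blast
    then show "card {w \<in> Y. r w = v} = wd" using card_orb v Y'Y by auto
   qed
   finally show ?thesis by simp
  qed
  have posY: "card Y > 0" using fin ne by (simp add: card_gt_0_iff)
  then have posY': "card Y' > 0" using cardY by (cases "card Y'") auto
  have "card Y' * 1 < card Y' * wd" using wd2 posY' by (intro mult_strict_left_mono) auto
  then have less': "card Y' < card Y" using cardY by simp
  have "\<exists>d. 2 ^ d \<le> (card Y')\<^sup>2 \<and> (\<forall>h\<in>dern d H. \<forall>w\<in>Y'. r (b h w) = w)"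
  proof (rule less.hyps[OF less'])
   show "finite Y'" using fin by (simp add: Y'_def)
   show "Y' \<noteq> {}" using ne by (simp add: Y'_def)
   show "card Y' \<le> n" using less' cn by simp
   show "r (b h w) \<in> Y'" if "h \<in> H" "w \<in> Y'" for h w using that Y'Y bY by (auto simp: Y'_def)
   show "r (b (h + k) w) = r (b h (r (b k w)))" if "h \<in> H" "k \<in> H" "w \<in> Y'" for h k w
    using that Y'Y bY rb badd by (metis subsetD)
   show "r (b 0 w) = w" if "w \<in> Y'" for w using that rr b0 Y'Y by auto
   show "\<exists>h\<in>H. r (b h v) = w" if "v \<in> Y'" "w \<in> Y'" for v w using tr[of v w] that Y'Y rr by (metis subsetD)
   show "\<forall>h\<in>dern l H. \<forall>w\<in>Y'. r (b h w) = w" using bl Y'Y rr by (metis subsetD)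
  qed
  then obtain d1 where d1: "2 ^ d1 \<le> (card Y')\<^sup>2" "\<forall>h\<in>dern d1 H. \<forall>w\<in>Y'. r (b h w) = w" by blast
  define H1 where "H1 = dern d1 H"
  have sgH1: "sg H1" and H1H: "H1 \<subseteq> H" unfolding H1_def using sg_dern[OF sgH] dern_sub[OF sgH] by auto
  have H1orb: "orb (b h w) = orb w" if h: "h \<in> H1" "w \<in> Y" for h w
  proof -
   have hH: "h \<in> H" using h H1H by blast
   have "r (b h (r w)) = r w" using d1(2) h by (auto simp: H1_def Y'_def)
   then have "r (b h w) = r w" using rb[OF hH h(2)] by simp
   then show ?thesis using r_iff bY[OF hH h(2)] h(2) by blast
  qed
  \<comment> \<open>As the action of \<open>N\<close> is abelian, the stabilizer of one point fixes
    its whole block, and \<open>N / St\<close> is an abelian section with as many elements as the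
    block.\<close>
  define St where "St = {g \<in> N. b g w0 = w0}"
  have St: "b g w = w" if gw: "g \<in> St" "w \<in> orb w0" for g w
  proof -
   obtain k where "k \<in> N" "w = b k w0" using gw by (auto simp: orb_def)
   then show ?thesis using comN[of g k w0] gw g0 by (auto simp: St_def)
  qed
  have sgSt: "sg St" 
  proof (rule sgI)
   show "0 \<in> St" using sg_zero[OF sgN] b0 g0 by (simp add: St_def)
   show "x + y \<in> St" if "x \<in> St" "y \<in> St" for x y using that badd[of x y w0] NH g0 sg_add[OF sgN] by (auto simp: St_def)
   show "- x \<in> St" if "x \<in> St" for x using that binv(1)[of x w0] NH g0 sg_neg[OF sgN] by (auto simp: St_def)
  qed
  have StN: "St \<subseteq> N" by (auto simp: St_def)
  have cmSt: "cm g h \<in> St" if "g \<in> N" "h \<in> N" for g h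
   using derN[OF der_cm[OF that]] g0 sg_cm[OF sgN that] by (simp add: St_def)
  have coset: "(+) g ` St = {k \<in> N. b k w0 = b g w0}" if g: "g \<in> N" for g
  proof (intro equalityI subsetI)
   fix x assume "x \<in> (+) g ` St"
   then obtain s where "s \<in> St" "x = g + s" by auto
   then show "x \<in> {k \<in> N. b k w0 = b g w0}" using badd[of g s w0] g NH g0 sg_add[OF sgN] by (auto simp: St_def)
  next
   fix x assume x: "x \<in> {k \<in> N. b k w0 = b g w0}"
   have "b (- g + x) w0 = w0" using badd[of "- g" x w0] x NH g0 binv(1)[of g w0] sg_neg[OF sgH subsetD[OF NH g]] subsetD[OF NH g] by auto
   then have "- g + x \<in> St" using x g sg_add[OF sgN] sg_neg[OF sgN] by (simp add: St_def)
   then show "x \<in> (+) g ` St" by (intro image_eqI[of _ _ "- g + x"]) (auto simp: add.assoc[symmetric])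
  qed
  have bij: "bij_betw (\<lambda>y. {k \<in> N. b k w0 = y}) (orb w0) (cos N St)"
  proof (rule bij_betw_imageI)
   show "inj_on (\<lambda>y. {k \<in> N. b k w0 = y}) (orb w0)" by (rule inj_onI) (auto simp: orb_def)
   show "(\<lambda>y. {k \<in> N. b k w0 = y}) ` orb w0 = cos N St"
    unfolding cos_def orb_def image_image using coset by (intro image_cong) auto
  qed
  have idxN: "idx N St = wd" "finite (cos N St)"
   using bij_betw_same_card[OF bij] bij_betw_finite[OF bij] fin_orb[OF g0(2)] by (auto simp: idx_def wd_def)
  have "nrm H1 St" unfolding nrm_def
  proof (intro ballI)
   fix h g assume h: "h \<in> H1" and g: "g \<in> St"
   have hH: "h \<in> H" "- h \<in> H1" "- h \<in> H" using h H1H sg_neg[OF sgH1] by auto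
   have w: "b (- h) w0 \<in> orb w0" using H1orb[OF hH(2) g0(2)] self bY[OF hH(3) g0(2)] by blast
   have "b (h + g + - h) w0 = b h (b g (b (- h) w0))"
    using badd[of "h + g" "- h" w0] badd[of h g "b (- h) w0"] hH g NH g0 bY sg_add[OF sgH] by (auto simp: St_def)
   then have "b (h + g + - h) w0 = w0" using St[OF g w] binv(2)[OF hH(1) g0(2)] by simp
   then show "h + g + - h \<in> St" using nrmD[OF nN hH(1)] g by (auto simp: St_def)
  qed
  then have sec: "sec H1 N St"
   using sgH1 sgN sgSt StN nrm_sub[OF nN H1H] cmSt idxN by (auto simp: sec_def)
  have "dern j H1 \<subseteq> N" unfolding N_def using dern_mono[OF H1H] .
  then have "solv H1 N St" unfolding solv_def triv_def using cmSt by blast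
  moreover have "wd \<le> n" using cardY posY' cn by (metis One_nat_def Suc_leI le_trans mult.commute mult_le_mono1 nat_mult_1_right)
  ultimately obtain d2 where d2: "2 ^ (d2 + 1) \<le> wd\<^sup>2" "triv (dern d2 H1) N St"
   using assms(2) sec wd2 idxN unfolding small_def by metis
  define E where "E = dern d2 H1"
  have sgE: "sg E" and EH1: "E \<subseteq> H1" unfolding E_def using sg_dern[OF sgH1] dern_sub[OF sgH1] by auto
  have Eorb: "b e w \<in> orb w0" if "e \<in> E" "w \<in> orb w0" for e w
   using H1orb[of e w] orbeq[OF that(2) g0(2)] self that EH1 H1H bY orbY[OF g0(2)] by (metis subsetD)
  \<comment> \<open>At a point of the block, \<open>e\<close> and \<open>e'\<close> agree with
    elements of \<open>N\<close>. Elements of \<open>E\<close> commute with \<open>N\<close> on the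
    block, so the two elements commute there.\<close>
  have Ecom: "b e (b e' w) = b e' (b e w)" if e: "e \<in> E" "e' \<in> E" and w: "w \<in> orb w0" for e e' w
  proof -
   have wY: "w \<in> Y" using w orbY g0 by blast
   have ow: "orb w = orb w0" using orbeq w g0 by blast
   obtain g g' where g: "g \<in> N" "b e w = b g w" "g' \<in> N" "b e' w = b g' w"
    using Eorb[OF e(1) w] Eorb[OF e(2) w] unfolding ow[symmetric] by (auto simp: orb_def)
   have key: "b e (b g w) = b g (b e w)" if e: "e \<in> E" "g \<in> N" for e g
   proof -
    have H: "e \<in> H" "g \<in> H" using e EH1 H1H NH by auto
    have "b e w \<in> orb w0" using Eorb e w by blast
    then have "b g (b e w) \<in> orb w0" using orbeq[of "b e w" w0] g0 e(2) by (auto simp: orb_def)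
    then show ?thesis using cmb[OF H wY] St[of "cm e g"] d2(2) e by (metis E_def triv_def)
   qed
   show ?thesis using key[OF e(1) g(3)] key[OF e(2) g(1)] g comN[OF g(1,3) wY] by simp
  qed
  have fixw0: "b h w0 = w0" if h: "h \<in> der E" for h
  proof -
   have "der E \<subseteq> {h \<in> H. b h w0 = w0}"
   proof (rule der_least)
    show "sg {h \<in> H. b h w0 = w0}"
     by (rule sgI) (use b0 badd binv(1) g0 sg_zero[OF sgH] sg_add[OF sgH] sg_neg[OF sgH] in \<open>auto, metis\<close>)
    fix e e' assume e: "e \<in> E" "e' \<in> E"
    then have H: "e \<in> H" "e' \<in> H" "- e \<in> E" "- e' \<in> E" "- e \<in> H" "- e' \<in> H" using EH1 H1H sg_neg[OF sgE] sg_neg[OF sgH] by auto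
    let ?y = "b (- e) (b (- e') w0)"
    have y0: "b (- e') w0 \<in> orb w0" using Eorb H self g0 by blast
    have y: "?y \<in> orb w0" using Eorb H y0 by blast
    have "b e' (b e ?y) = w0" using binv(2)[OF H(1)] binv(2)[OF H(2) g0(2)] y0 orbY[OF g0(2)] by auto
    then have "b (cm e e') w0 = w0" using cmb[OF H(1,2), of ?y] Ecom[OF e y] y orbY[OF g0(2)] by auto
    then show "cm e e' \<in> {h \<in> H. b h w0 = w0}" using sg_cm[OF sgH H(1,2)] by blast
   qed
   then show ?thesis using h by blast
  qed
  have dE: "der E = dern (Suc (d2 + d1)) H" by (simp add: dern_Suc dern_add E_def H1_def)
  have nE: "nrm H (der E)" unfolding dE by (rule nrm_dern[OF nrm_self[OF sgH]])
  have "b h w = w" if h: "h \<in> der E" and w: "w \<in> Y" for h w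
  proof -
   obtain k where k: "k \<in> H" "b k w0 = w" using tr[OF g0(2) w] by blast
   have hk: "- k + h + - (- k) \<in> der E" using nrmD[OF nE sg_neg[OF sgH k(1)] h] .
   have hH: "h \<in> H" "- k + h + - (- k) \<in> H" using h hk dE dern_sub[OF sgH] by blast+
   have "h + k = k + (- k + h + - (- k))" by (simp add: add.assoc)
   then have "b h (b k w0) = b k (b (- k + h + - (- k)) w0)" using badd hH k g0 by metis
   then show ?thesis using fixw0[OF hk] k by simp
  qed
  moreover have "2 ^ Suc (d2 + d1) \<le> (card Y)\<^sup>2"
  proof -
   have "2 ^ (d2 + 1) * 2 ^ d1 \<le> wd\<^sup>2 * (card Y')\<^sup>2" using d1(1) d2(1) by (intro mult_mono) auto
   then show ?thesis unfolding cardY power_mult_distrib by (simp add: power_add mult.commute)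
  qed
  ultimately show ?thesis unfolding dE by blast
 qed
qed

text \<open>Each orbit satisfies the bound on its own, and the derived lengths of the orbits combine
  by maximum, not by sum.\<close>

lemma permutation_bound:
 fixes H :: "'g::group_add set" and b :: "'g \<Rightarrow> 'b \<Rightarrow> 'b"
 assumes sgH: "sg H" and sm: "small TYPE('g) n"
  and fin: "finite Y" "Y \<noteq> {}" "card Y \<le> n"
  and bY: "\<And>h w. h \<in> H ==> w \<in> Y ==> b h w \<in> Y"
  and badd: "\<And>h k w. h \<in> H ==> k \<in> H ==> w \<in> Y ==> b (h + k) w = b h (b k w)"
  and b0: "\<And>w. w \<in> Y ==> b 0 w = w"
  and bl: "\<forall>h\<in>dern l H. \<forall>w\<in>Y. b h w = w"
 shows "\<exists>d. 2 ^ d \<le> (card Y)\<^sup>2 \<and> (\<forall>h\<in>dern d H. \<forall>w\<in>Y. b h w = w)"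
proof -
 have "\<exists>d. 2 ^ d \<le> (card Y)\<^sup>2 \<and> (\<forall>h\<in>dern d H. b h w = w)" if w: "w \<in> Y" for w
 proof -
  let ?O = "(\<lambda>h. b h w) ` H"
  have OY: "?O \<subseteq> Y" using bY w by auto
  have wO: "w \<in> ?O" using b0[OF w] sg_zero[OF sgH] by (metis image_eqI)
  have c: "card ?O \<le> card Y" using card_mono[OF fin(1) OY] .
  have "\<exists>d. 2 ^ d \<le> (card ?O)\<^sup>2 \<and> (\<forall>h\<in>dern d H. \<forall>w\<in>?O. b h w = w)"
  proof (rule transitive_bound[OF sgH sm])
   show "finite ?O" using finite_subset[OF OY fin(1)] .
   show "?O \<noteq> {}" using wO by blast
   show "card ?O \<le> n" using c fin by simp
   show "b h v \<in> ?O" if "h \<in> H" "v \<in> ?O" for h v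
    using that badd[of h _ w] w sg_add[OF sgH] by (auto simp: image_iff) metis
   show "b (h + k) v = b h (b k v)" if "h \<in> H" "k \<in> H" "v \<in> ?O" for h k v using badd that OY by blast
   show "b 0 v = v" if "v \<in> ?O" for v using b0 that OY by blast
   show "\<forall>h\<in>dern l H. \<forall>w\<in>?O. b h w = w" using bl OY by blast
   fix u v assume "u \<in> ?O" "v \<in> ?O"
   then obtain h k where hk: "h \<in> H" "k \<in> H" "u = b h w" "v = b k w" by auto
   have "b (k + - h) u = v" using badd[of "k + - h" h w] hk w sg_add[OF sgH] sg_neg[OF sgH] by (simp add: add.assoc)
   then show "\<exists>h\<in>H. b h u = v" using hk sg_add[OF sgH] sg_neg[OF sgH] by metis
  qed
  moreover have "(card ?O)\<^sup>2 \<le> (card Y)\<^sup>2" using c by (rule power_mono) simp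
  ultimately show ?thesis using wO by (meson le_trans)
 qed
 then obtain D where D: "\<And>w. w \<in> Y ==> 2 ^ D w \<le> (card Y)\<^sup>2 \<and> (\<forall>h\<in>dern (D w) H. b h w = w)" by metis
 define d where "d = Max (D ` Y)"
 have "d \<in> D ` Y" unfolding d_def using fin by (intro Max_in) auto
 then have "2 ^ d \<le> (card Y)\<^sup>2" using D by auto
 moreover have "b h w = w" if "h \<in> dern d H" "w \<in> Y" for h w
 proof -
  have "D w \<le> d" unfolding d_def using that fin by (intro Max_ge) auto
  then show ?thesis using D[OF that(2)] dern_anti[OF sgH] that(1) by blast
 qed
 ultimately show ?thesis by blast
qed

section \<open>Irreducible sections\<close>

lemma finite_between:
 assumes "sg W" "finite (cos U W)" shows "finite {Y. sg Y \<and> W \<subseteq> Y \<and> Y \<subseteq> U}"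
proof -
 have un: "\<Union>(cos Y W) = Y" if "sg Y" "W \<subseteq> Y" for Y
 proof
  show "\<Union>(cos Y W) \<subseteq> Y" using that sg_add[OF that(1)] by (auto simp: cos_def)
  show "Y \<subseteq> \<Union>(cos Y W)"
  proof
   fix y assume "y \<in> Y"
   moreover have "y \<in> (+) y ` W" using sg_zero[OF assms(1)] by (intro image_eqI[of _ _ 0]) auto
   ultimately show "y \<in> \<Union>(cos Y W)" by (auto simp: cos_def)
  qed
 qed
 have "inj_on (\<lambda>Y. cos Y W) {Y. sg Y \<and> W \<subseteq> Y \<and> Y \<subseteq> U}" by (rule inj_on_inverseI[of _ Union]) (use un in auto)
 moreover have "(\<lambda>Y. cos Y W) ` {Y. sg Y \<and> W \<subseteq> Y \<and> Y \<subseteq> U} \<subseteq> Pow (cos U W)" by (auto simp: cos_def)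
 ultimately show ?thesis using inj_on_finite assms(2) by blast
qed

lemma finite_image_factor:
 assumes "finite (F ` A)" "\<And>x y. x \<in> A ==> y \<in> A ==> F x = F y ==> k x = k y" shows "finite (k ` A)"
proof (rule finite_subset[OF _ finite_imageI[OF assms(1), of "\<lambda>z. k (SOME x. x \<in> A \<and> F x = z)"]])
 show "k ` A \<subseteq> (\<lambda>z. k (SOME x. x \<in> A \<and> F x = z)) ` F ` A"
 proof
  fix z assume "z \<in> k ` A"
  then obtain x where x: "x \<in> A" "z = k x" by auto
  have "(SOME y. y \<in> A \<and> F y = F x) \<in> A \<and> F (SOME y. y \<in> A \<and> F y = F x) = F x"
   by (rule someI[of _ x]) (use x in auto)
  then have "z = k (SOME y. y \<in> A \<and> F y = F x)" using assms(2) x by metis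
  then show "z \<in> (\<lambda>z. k (SOME x. x \<in> A \<and> F x = z)) ` F ` A" using x by blast
 qed
qed

lemma idx_le_reps:
 assumes "sg W" "\<And>I. finite I ==> I \<subseteq> U ==> (\<And>i j. i \<in> I ==> j \<in> I ==> i \<noteq> j ==> - i + j \<notin> W) ==> card I \<le> m"
 shows "finite (cos U W) \<and> idx U W \<le> m"
proof (rule ccontr)
 assume n: "\<not> ?thesis"
 have "\<exists>F. F \<subseteq> cos U W \<and> finite F \<and> card F = Suc m"
 proof (cases "finite (cos U W)")
  case True
  then have "Suc m \<le> card (cos U W)" using n by (simp add: idx_def)
  then show ?thesis using True by (meson obtain_subset_with_card_n)
 next
  case False
  then show ?thesis using infinite_arbitrarily_large by metis
 qed
 then obtain F where F: "F \<subseteq> cos U W" "finite F" "card F = Suc m" by blast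
 have "\<forall>C\<in>F. \<exists>u. u \<in> U \<and> C = (+) u ` W" using F(1) by (auto simp: cos_def)
 then obtain r where r: "\<And>C. C \<in> F ==> r C \<in> U \<and> C = (+) (r C) ` W" by metis
 have inj: "inj_on r F" by (rule inj_onI) (use r in metis)
 have "card (r ` F) \<le> m"
 proof (rule assms(2))
  show "finite (r ` F)" "r ` F \<subseteq> U" using F r by auto
  fix i j assume "i \<in> r ` F" "j \<in> r ` F" and ij: "i \<noteq> j"
  then obtain c c' where c: "c \<in> F" "c' \<in> F" "i = r c" "j = r c'" by auto
  show "- i + j \<notin> W"
  proof
   assume "- i + j \<in> W"
   then have "(+) i ` W = (+) j ` W" using coset_eq[OF assms(1)] by blast
   then have "c = c'" using r[OF c(1)] r[OF c(2)] c(3,4) by auto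
   then show False using ij c by simp
  qed
 qed
 then show False using card_image[OF inj] F by simp
qed

lemma centralizer_finite_index:
 assumes "sec H U W" shows "finite (cos H {h \<in> H. \<forall>u\<in>U. cm h u \<in> W})"
 unfolding cos_def
proof (rule finite_image_factor)
 note D = secD[OF assms]
 \<comment> \<open>The graph of the permutation of \<open>U / W\<close> induced by \<open>h\<close>;
   there are only finitely many such graphs.\<close>
 let ?F = "\<lambda>h. (\<lambda>u. ((+) u ` W, (+) (h + u + - h) ` W)) ` U"
 let ?Z = "{h \<in> H. \<forall>u\<in>U. cm h u \<in> W}"
 have "?F ` H \<subseteq> Pow (cos U W \<times> cos U W)" using nrmD[OF D(5)] by (auto simp: cos_def)
 then show "finite (?F ` H)" using D(8) finite_subset by blast
 fix h k assume hk: "h \<in> H" "k \<in> H" "?F h = ?F k"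
 have m: "- h + k \<in> H" "- h \<in> H" using hk sg_add[OF D(1)] sg_neg[OF D(1)] by auto
 have "cm (- h + k) u \<in> W" if u: "u \<in> U" for u
 proof -
  have "((+) u ` W, (+) (h + u + - h) ` W) \<in> ?F k" using u hk(3) by blast
  then obtain v where v: "v \<in> U" "(+) u ` W = (+) v ` W" "(+) (h + u + - h) ` W = (+) (k + v + - k) ` W" by auto
  have "- v + u \<in> W" "- (h + u + - h) + (k + v + - k) \<in> W" using coset_eq[OF D(3)] v by metis+
  then have "- (h + u + - h) + (k + v + - k) + (k + (- v + u) + - k) \<in> W" using sg_add[OF D(3)] nrmD[OF D(6) hk(2)] by blast
  from nrmD[OF D(6) m(2) this] have "- u + (- h + k + u + - (- h + k)) \<in> W" by (simp add: add.assoc minus_add)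
  from nrmD[OF D(9) u this] show ?thesis by (simp add: cm_def add.assoc)
 qed
 then have "- h + k \<in> ?Z" using m by blast
 then show "(+) h ` ?Z = (+) k ` ?Z" using coset_eq[OF sg_centralizer[OF D(1,3,6)]] by blast
qed

text \<open>For an irreducible section, let \<open>A\<close> be a maximal normal subgroup acting through an abelian group,
 \<open>C\<close> its centralizer and \<open>B\<close> maximal normal in \<open>C\<close> with \<open>B\<close> abelian modulo \<open>A\<close>.
 The derived series passes successively into the stabilizer of the components, into \<open>C\<close>, into the
 centralizer of \<open>B\<close> modulo \<open>A\<close>, into \<open>A\<close>, and finally acts trivially.\<close>

lemma simple_core:
 fixes H :: "'g::group_add set"
 assumes S: "sec H U W" and sol: "solv H U W"
  and simp: "\<And>Q. sg Q ==> W \<subseteq> Q ==> Q \<subseteq> U ==> nrm H Q ==> Q = W \<or> Q = U"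
  and sm: "small TYPE('g) (idx U W - 1)"
  and nt: "\<not> triv H U W"
 obtains k q e dp where "k \<ge> 1" "q \<ge> 3" "e \<ge> 1" "idx U W = q ^ (e * k)" "2 ^ dp \<le> k\<^sup>2"
  "\<And>v. (\<And>(H'::'g set) U' W'. sec H' U' W' ==> solv H' U' W' ==> 2 \<le> idx U' W' ==> idx U' W' \<le> e * e ==>
    \<exists>d\<le>v. triv (dern d H') U' W') ==> triv (dern (dp + (if q = 3 then 0 else 1) + v + 2) H) U W"
proof -
 note D = secD[OF S]
 obtain f :: "'g \<Rightarrow> 'g set bijn" and act where
  f: "hm f U" "\<And>u. u \<in> U ==> f u = 0 \<longleftrightarrow> u \<in> W" and P: "sg (f ` U)" "finite (f ` U)" "card (f ` U) = idx U W"
  "\<And>x y. x \<in> f ` U ==> y \<in> f ` U ==> x + y = y + x"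
  and act: "\<And>h u. h \<in> H ==> u \<in> U ==> act h (f u) = f (h + u + - h)"
  and out: "\<And>h x. x \<notin> f ` U ==> act h x = 0"
  and tr: "\<And>h. h \<in> H ==> (\<forall>u\<in>U. cm h u \<in> W) \<longleftrightarrow> (\<forall>x\<in>f ` U. act h x = x)"
  using sec_action[OF S] by blast
 let ?P = "f ` U"
 note sgH = D(1)
 have Hadd: "h \<in> H ==> k \<in> H ==> h + k \<in> H" and Hneg: "h \<in> H ==> - h \<in> H" for h k
  using sg_add[OF sgH] sg_neg[OF sgH] by auto
 have act_in: "act h x \<in> ?P" if "h \<in> H" "x \<in> ?P" for h x using that act nrmD[OF D(5)] by auto
 have act_add: "act h (x + y) = act h x + act h y" if hxy: "h \<in> H" "x \<in> ?P" "y \<in> ?P" for h x y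
 proof -
  obtain u v where uv: "u \<in> U" "v \<in> U" "x = f u" "y = f v" using hxy by auto
  have e: "h + (u + v) + - h = (h + u + - h) + (h + v + - h)" by (simp add: add.assoc)
  have "x + y = f (u + v)" using uv hmD[OF f(1)] by simp
  then have "act h (x + y) = f (h + (u + v) + - h)" using act hxy(1) uv sg_add[OF D(2)] by simp
  also have "\<dots> = f (h + u + - h) + f (h + v + - h)" unfolding e by (rule hmD[OF f(1)]) (use nrmD[OF D(5) hxy(1)] uv in auto)
  finally show ?thesis using act hxy(1) uv by simp
 qed
 have act_plus: "act (h + k) x = act h (act k x)" if hkx: "h \<in> H" "k \<in> H" "x \<in> ?P" for h k x
 proof -
  obtain u where u: "u \<in> U" "x = f u" using hkx by auto
  have "h + k + u + - (h + k) = h + (k + u + - k) + - h" by (simp add: minus_add add.assoc)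
  then show ?thesis using u act hkx Hadd nrmD[OF D(5) hkx(2) u(1)] by simp
 qed
 have act_0: "act 0 x = x" if "x \<in> ?P" for x using that act[OF sg_zero[OF sgH]] by auto
 define Z where "Z = {h \<in> H. \<forall>u\<in>U. cm h u \<in> W}"
 have sgZ: "sg Z" unfolding Z_def by (rule sg_centralizer[OF sgH D(3,6)])
 have nZ: "nrm H Z" unfolding Z_def by (rule nrm_centralizer[OF sgH D(5,6) nrm_self[OF sgH]])
 have ZH: "Z \<subseteq> H" by (auto simp: Z_def)
 have Z_iff: "h \<in> Z \<longleftrightarrow> (\<forall>x\<in>?P. act h x = x)" if "h \<in> H" for h using tr[OF that] that by (simp add: Z_def)
 have cZ: "cm h z \<in> Z" "cm z h \<in> Z" if "h \<in> H" "z \<in> Z" for h z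
  using nrm_cm[OF sgZ nZ that] nrm_cm'[OF sgZ nZ sgH that] by auto
 obtain l where "triv (dern l H) U W" using sol by (auto simp: solv_def)
 then have l: "dern l H \<subseteq> Z" using dern_sub[OF sgH, of l] by (auto simp: triv_def Z_def)
 \<comment> \<open>\<open>E\<close> is the last term of the derived series of \<open>K\<close> that
   is not contained in \<open>A\<close>; the series ends in \<open>A\<close> because it ends in the
   kernel \<open>Z\<close>.\<close>
 have last: "\<exists>E. sg E \<and> E \<subseteq> K \<and> nrm H E \<and> \<not> E \<subseteq> A \<and> (\<forall>a\<in>E. \<forall>b\<in>E. cm a b \<in> A)"
  if K: "sg K" "K \<subseteq> H" "nrm H K" "\<not> K \<subseteq> A" "Z \<subseteq> A" for K A
 proof -
  have ex: "dern l K \<subseteq> A" using dern_mono[OF K(2)] l K(5) by blast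
  define m where "m = (LEAST i. dern i K \<subseteq> A)"
  have m: "dern m K \<subseteq> A" "\<And>i. i < m ==> \<not> dern i K \<subseteq> A" unfolding m_def by (rule LeastI, rule ex) (use not_less_Least in blast)
  then obtain j where j: "m = Suc j" using K(4) by (cases m) auto
  have "cm a b \<in> A" if "a \<in> dern j K" "b \<in> dern j K" for a b using m(1) der_cm[OF that] by (auto simp: j dern_Suc)
  then show ?thesis using m(2)[of j] j sg_dern[OF K(1)] dern_sub[OF K(1)] nrm_dern[OF K(3)] by blast
 qed
 have nHZ: "\<not> H \<subseteq> Z" using nt by (auto simp: triv_def Z_def)
 have finHZ: "finite (cos H Z)" unfolding Z_def by (rule centralizer_finite_index[OF S])
 have fam: "finite {Y. sg Y \<and> Z \<subseteq> Y \<and> Y \<subseteq> H}" using finite_between[OF sgZ finHZ] .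
 have gen_join: "nrm H (gen (E \<union> E'))" if "nrm H E" "nrm H E'" for E E'
  by (rule nrm_gen) (use that gen_base[of "E \<union> E'"] in \<open>auto dest: nrmD\<close>)
 \<comment> \<open>Keeping \<open>A\<close> above this subgroup guarantees that \<open>A\<close>
   acts nontrivially.\<close>
 obtain A0 where A0: "sg A0" "A0 \<subseteq> H" "nrm H A0" "\<not> A0 \<subseteq> Z" "\<forall>a\<in>A0. \<forall>b\<in>A0. cm a b \<in> Z"
  using last[OF sgH order_refl nrm_self[OF sgH] nHZ order_refl] by blast
 define AA where "AA = {A. sg A \<and> Z \<subseteq> A \<and> A \<subseteq> H \<and> nrm H A \<and> (\<forall>a\<in>A. \<forall>b\<in>A. cm a b \<in> Z)}"
 have joinA: "gen (E \<union> E') \<in> AA"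
  if E: "E \<subseteq> H" "E' \<subseteq> H" "nrm H E" "nrm H E'" "Z \<subseteq> E" "\<And>a b. a \<in> E \<union> E' ==> b \<in> E \<union> E' ==> cm a b \<in> Z" for E E'
 proof -
  have gH: "gen (E \<union> E') \<subseteq> H" using gen_least[OF sgH] E by simp
  have "cm a b \<in> Z" if "a \<in> gen (E \<union> E')" "b \<in> gen (E \<union> E')" for a b
   using cm_gen_closed[OF sgZ nrm_sub[OF nZ gH] nrm_sub[OF nZ gH] E(6) that] .
  then show ?thesis unfolding AA_def using sg_gen gH gen_join E gen_base[of "E \<union> E'"] by auto
 qed
 have gAA: "gen (Z \<union> A0) \<in> AA" by (rule joinA) (use ZH A0 nZ cZ in auto)
 have fAA: "finite AA" by (rule finite_subset[OF _ fam]) (auto simp: AA_def)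
 obtain A where A: "A \<in> AA" "gen (Z \<union> A0) \<subseteq> A" and Am: "\<forall>A'\<in>AA. A \<subseteq> A' --> A = A'"
  using finite_has_maximal2[OF fAA gAA] by (elim bexE conjE)
 have A': "sg A" "Z \<subseteq> A" "A \<subseteq> H" "nrm H A" "\<And>a b. a \<in> A ==> b \<in> A ==> cm a b \<in> Z" using A(1) by (auto simp: AA_def)
 have A0A: "A0 \<subseteq> A" using A(2) gen_base[of "Z \<union> A0"] by auto
 define C where "C = {h \<in> H. \<forall>a\<in>A. cm h a \<in> Z}"
 have sgC: "sg C" unfolding C_def by (rule sg_centralizer[OF sgH sgZ nZ])
 have nC: "nrm H C" unfolding C_def by (rule nrm_centralizer[OF sgH A'(4) nZ nrm_self[OF sgH]])
 have CH: "C \<subseteq> H" and AC: "A \<subseteq> C" and Ca: "\<And>c a. c \<in> C ==> a \<in> A ==> cm c a \<in> Z" using A' by (auto simp: C_def)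
 have aC: "cm a c \<in> Z" if "c \<in> C" "a \<in> A" for a c using Ca[OF that] neg_cm sg_neg[OF sgZ] by metis
 define BB where "BB = {B. sg B \<and> A \<subseteq> B \<and> B \<subseteq> C \<and> nrm H B \<and> (\<forall>a\<in>B. \<forall>b\<in>B. cm a b \<in> A)}"
 have gBB: "A \<in> BB" using A' AC by (auto simp: BB_def)
 have fBB: "finite BB" by (rule finite_subset[OF _ fam]) (use A'(2) CH in \<open>auto simp: BB_def\<close>)
 obtain B where B: "B \<in> BB" and Bm: "\<forall>B'\<in>BB. B \<subseteq> B' --> B = B'"
  using finite_has_maximal2[OF fBB gBB] by (elim bexE conjE)
 have B': "sg B" "A \<subseteq> B" "B \<subseteq> C" "nrm H B" "\<And>a b. a \<in> B ==> b \<in> B ==> cm a b \<in> A" using B by (auto simp: BB_def)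
 have BH: "B \<subseteq> H" using B'(3) CH by blast
 define T where "T = {c \<in> C. \<forall>b\<in>B. cm c b \<in> Z}"
 have nTZ: "nrm C Z" using nrm_sub[OF nZ CH] .
 have sgT: "sg T" unfolding T_def by (rule sg_centralizer[OF sgC sgZ nTZ])
 have nT: "nrm H T" unfolding T_def by (rule nrm_centralizer[OF sgH B'(4) nZ nC])
 \<comment> \<open>Otherwise there is a normal \<open>E\<close> in \<open>T\<close>, not in
   \<open>A\<close>, abelian modulo \<open>A\<close>. Maximality of \<open>B\<close> puts
   \<open>E\<close> inside \<open>B\<close>, and then \<open>E\<close> centralizes itself and
   \<open>A\<close> modulo \<open>Z\<close>, against the maximality of \<open>A\<close>.\<close>
 have TA: "T \<subseteq> A"
 proof (rule ccontr)
  assume "\<not> T \<subseteq> A"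
  moreover have TC: "T \<subseteq> C" by (auto simp: T_def)
  ultimately obtain E where E: "sg E" "E \<subseteq> T" "nrm H E" "\<not> E \<subseteq> A" "\<forall>a\<in>E. \<forall>b\<in>E. cm a b \<in> A"
   using last[OF sgT _ nT _ A'(2)] CH by blast
  have EH: "E \<subseteq> H" "E \<subseteq> C" using E TC CH by auto
  let ?B = "gen (B \<union> E)"
  have BE: "B \<union> E \<subseteq> C" using B' EH by auto
  have gC: "?B \<subseteq> C" using gen_least[OF sgC BE] .
  then have gH: "?B \<subseteq> H" using CH by blast
  have eb: "cm x b \<in> Z \<and> cm b x \<in> Z" if "x \<in> E" "b \<in> B" for x b
  proof -
   have "cm x b \<in> Z" using that E(2) by (auto simp: T_def)
   then show ?thesis using neg_cm sg_neg[OF sgZ] by metis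
  qed
  have "cm a b \<in> A" if "a \<in> ?B" "b \<in> ?B" for a b
  proof (rule cm_gen_closed[OF A'(1) nrm_sub[OF A'(4) gH] nrm_sub[OF A'(4) gH] _ that])
   show "cm a b \<in> A" if "a \<in> B \<union> E" "b \<in> B \<union> E" for a b using that E(5) B'(5) eb A'(2) by blast
  qed
  then have "?B \<in> BB" unfolding BB_def using sg_gen gC gen_join[OF B'(4) E(3)] B'(2) gen_base[of "B \<union> E"] by auto
  then have "B = ?B" using Bm gen_base[of "B \<union> E"] by auto
  then have EB: "E \<subseteq> B" using gen_base[of "B \<union> E"] by auto
  have "gen (A \<union> E) \<in> AA"
  proof (rule joinA[OF A'(3) EH(1) A'(4) E(3) A'(2)])
   show "cm a b \<in> Z" if "a \<in> A \<union> E" "b \<in> A \<union> E" for a b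
    using that A'(5) Ca aC EH(2) eb EB by blast
  qed
  then have "A = gen (A \<union> E)" using Am gen_base[of "A \<union> E"] by auto
  then show False using E(4) gen_base[of "A \<union> E"] by auto
 qed
 interpret M: simple_action H A ?P act
 proof
  show "sg H" "sg ?P" "finite ?P" "sg A" "A \<subseteq> H" "nrm H A" using sgH P A' by auto
  show "x + y = y + x" if "x \<in> ?P" "y \<in> ?P" for x y using P(4) that .
  show "act h x \<in> ?P" if "h \<in> H" "x \<in> ?P" for h x using act_in that .
  show "act h x = 0" if "x \<notin> ?P" for h x using out that .
  show "act h (x + y) = act h x + act h y" if "h \<in> H" "x \<in> ?P" "y \<in> ?P" for h x y using act_add that .
  show "act (h + k) x = act h (act k x)" if "h \<in> H" "k \<in> H" "x \<in> ?P" for h k x using act_plus that .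
  show "act 0 x = x" if "x \<in> ?P" for x using act_0 that .
  show "act a (act b x) = act b (act a x)" if ab: "a \<in> A" "b \<in> A" and x: "x \<in> ?P" for a b x
  proof -
   have H: "a \<in> H" "b \<in> H" using ab A'(3) by auto
   have "cm a b \<in> Z" using A'(5) ab by blast
   then have "act (cm a b) (act (b + a) x) = act (b + a) x" using Z_iff ZH act_in[OF Hadd[OF H(2,1)] x] by blast
   moreover have "act (cm a b) (act (b + a) x) = act (cm a b + (b + a)) x"
    using act_plus[OF sg_cm[OF sgH H] Hadd[OF H(2,1)] x] by simp
   moreover have "cm a b + (b + a) = a + b" by (simp add: cm_def add.assoc)
   ultimately show ?thesis using act_plus H x by simp
  qed
  show "\<exists>a\<in>A. \<exists>x\<in>?P. act a x \<noteq> x" using A0(4) A0A A'(3) Z_iff by blast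
  fix Q assume Q: "sg Q" "Q \<subseteq> ?P" "Q \<noteq> {0}" "\<And>h x. h \<in> H ==> x \<in> Q ==> act h x \<in> Q"
  let ?U = "{u \<in> U. f u \<in> Q}"
  have "?U = W \<or> ?U = U"
  proof (rule simp)
   show "sg ?U" by (rule sgI) (use sg_zero[OF D(2)] sg_add[OF D(2)] sg_neg[OF D(2)] hm_zero[OF f(1) D(2)] hmD[OF f(1)] hm_neg[OF f(1) D(2)] sg_zero[OF Q(1)] sg_add[OF Q(1)] sg_neg[OF Q(1)] in auto)
   show "W \<subseteq> ?U"
   proof
    fix w assume w: "w \<in> W"
    then have "w \<in> U" "f w = 0" using D(4) f(2)[of w] by auto
    then show "w \<in> ?U" using sg_zero[OF Q(1)] by simp
   qed
   show "nrm H ?U" unfolding nrm_def using nrmD[OF D(5)] Q(4) act by fastforce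
  qed auto
  moreover have "?U \<noteq> W"
  proof
   assume "?U = W"
   then have "x = 0" if "x \<in> Q" for x using that Q(2) f(2) by blast
   then show False using Q(3) sg_zero[OF Q(1)] by blast
  qed
  ultimately show "Q = ?P" using Q(2) by auto
 qed
 obtain Om q e where Om: "finite Om" "Om \<noteq> {}" "\<forall>V\<in>Om. V \<subseteq> ?P" "\<forall>h\<in>H. \<forall>V\<in>Om. act h ` V \<in> Om"
  "q \<ge> 3" "e \<ge> 1" "card ?P = q ^ (e * card Om)"
  and O: "\<forall>c\<in>H. (\<forall>V\<in>Om. \<forall>x\<in>V. act c x = x) --> (\<forall>x\<in>?P. act c x = x)"
  "\<forall>g\<in>H. \<forall>h\<in>H. (\<forall>V\<in>Om. act g ` V = V \<and> act h ` V = V) --> (\<forall>a\<in>A. \<forall>x\<in>?P. act (cm (cm g h) a) x = x)"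
  "q = 3 --> (\<forall>g\<in>H. (\<forall>V\<in>Om. act g ` V = V) --> (\<forall>a\<in>A. \<forall>x\<in>?P. act (cm g a) x = x))"
  "\<forall>B V I. M.ops B --> V \<in> Om --> finite I --> I \<subseteq> B -->
    (\<forall>i\<in>I. \<forall>j\<in>I. i \<noteq> j --> (\<exists>b\<in>B. \<exists>x\<in>V. act (cm b (- i + j)) x \<noteq> x)) --> card I \<le> e * e"
  by (rule M.simple_structure) (rule that, assumption+)
 have OmP: "V \<subseteq> ?P" if "V \<in> Om" for V using Om(3) that by blast
 have OmH: "act h ` V \<in> Om" if "h \<in> H" "V \<in> Om" for h V using Om(4) that by blast
 define k where "k = card Om"
 have k1: "k \<ge> 1" using Om by (simp add: k_def Suc_le_eq card_gt_0_iff)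
 have idxq: "idx U W = q ^ (e * k)" using Om(7) P(3) by (simp add: k_def)
 \<comment> \<open>The number of components is below the order of the section, so the permutation
   bound may use \<open>small\<close> at \<open>idx U W - 1\<close>.\<close>
 have "k < 3 ^ k" by (rule less_exp[THEN less_le_trans]) (rule power_mono, auto)
 also have "(3::nat) ^ k \<le> q ^ k" using Om(5) by (rule power_mono) simp
 also have "\<dots> \<le> q ^ (e * k)" using Om(5,6) by (intro power_increasing) auto
 finally have kn: "k \<le> idx U W - 1" unfolding idxq by simp
 have imp: "act (g + h) ` V = act g ` act h ` V" if "g \<in> H" "h \<in> H" "V \<in> Om" for g h V
  using M.act_plus_image[OF that(1,2) OmP[OF that(3)]] .
 have fixV: "act z ` V = V" if "\<And>x. x \<in> ?P ==> act z x = x" "V \<in> Om" for z V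
 proof -
  have "act z ` V = id ` V" by (rule image_cong) (use that(1) OmP[OF that(2)] in auto)
  then show ?thesis by simp
 qed
 have im0: "act 0 ` V = V" if "V \<in> Om" for V by (rule fixV[OF act_0 that])
 have "act z ` V = V" if "z \<in> Z" "V \<in> Om" for z V by (rule fixV[OF _ that(2)]) (use that(1) Z_iff ZH in blast)
 then have pl: "\<forall>h\<in>dern l H. \<forall>V\<in>Om. act h ` V = V" using l by blast
 have "\<exists>d. 2 ^ d \<le> (card Om)\<^sup>2 \<and> (\<forall>h\<in>dern d H. \<forall>V\<in>Om. act h ` V = V)"
  by (rule permutation_bound[OF sgH sm Om(1,2) _ _ _ _ pl]) (use kn OmH imp im0 in \<open>auto simp: k_def\<close>)
 then obtain dp where dp: "2 ^ dp \<le> k\<^sup>2" "\<forall>h\<in>dern dp H. \<forall>V\<in>Om. act h ` V = V"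
  unfolding k_def by blast
 define g where "g = (if q = 3 then 0 else 1 :: nat)"
 define H1 where "H1 = dern dp H"
 have H1: "sg H1" "H1 \<subseteq> H" "\<And>h V. h \<in> H1 ==> V \<in> Om ==> act h ` V = V"
  using sg_dern[OF sgH] dern_sub[OF sgH] dp(2) by (auto simp: H1_def)
 have H2C: "dern g H1 \<subseteq> C"
 proof (cases "q = 3")
  case True
  have "h \<in> C" if h: "h \<in> H1" for h
  proof -
   have hH: "h \<in> H" using h H1 by blast
   have "cm h a \<in> Z" if a: "a \<in> A" for a
   proof -
    have "act (cm h a) x = x" if "x \<in> ?P" for x by (rule O(3)[rule_format, OF True hH _ a that]) (rule H1(3)[OF h])
    then show ?thesis using Z_iff[OF sg_cm[OF sgH hH]] a A'(3) by blast
   qed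
   then show ?thesis using hH by (auto simp: C_def)
  qed
  then show ?thesis using True by (auto simp: g_def)
 next
  case False
  have "der H1 \<subseteq> C"
  proof (rule der_least[OF sgC])
   fix x y assume xy: "x \<in> H1" "y \<in> H1"
   have H: "x \<in> H" "y \<in> H" using xy H1(2) by auto
   then have H: "x \<in> H" "y \<in> H" "cm x y \<in> H" using sg_cm[OF sgH] by auto
   have "cm (cm x y) a \<in> Z" if a: "a \<in> A" for a
   proof -
    have "act (cm (cm x y) a) z = z" if "z \<in> ?P" for z
     by (rule O(2)[rule_format, OF H(1,2) _ a that]) (use H1(3)[OF xy(1)] H1(3)[OF xy(2)] in blast)
    then show ?thesis using Z_iff[OF sg_cm[OF sgH H(3)]] a A'(3) by blast
   qed
   then show "cm x y \<in> C" using H by (auto simp: C_def)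
  qed
  then show ?thesis using False by (simp add: g_def dern_Suc)
 qed
 define E where "E = dern g H1"
 have E: "sg E" "E \<subseteq> C" "E \<subseteq> H" unfolding E_def using sg_dern[OF H1(1)] H2C CH by auto
 have Eeq: "E = dern (g + dp) H" by (simp add: E_def H1_def dern_add)
 have opsB: "M.ops B" unfolding M.ops_def
 proof (intro conjI ballI)
  fix b a x assume b: "b \<in> B" and a: "a \<in> A" and x: "x \<in> ?P"
  have H: "a \<in> H" "b \<in> H" using a b A'(3) BH by auto
  have "cm b a \<in> Z" using Ca a b B'(3) by blast
  then have "act (cm b a) (act (a + b) x) = act (a + b) x" using Z_iff ZH act_in[OF Hadd[OF H] x] by blast
  then show "act a (act b x) = act b (act a x)" using M.act_cm[OF H(2,1) x] act_plus H x by simp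
 qed (use B' BH in auto)
 \<comment> \<open>\<open>ZV V\<close> is the kernel of \<open>A\<close> on the component
   \<open>V\<close>, and \<open>RV V\<close> the radical of the commutator pairing of
   \<open>B\<close> seen on \<open>V\<close>. Distinct cosets of the radical have distinct
   characters, so its index is at most \<open>e * e\<close>.\<close>
 define ZV where "ZV V = {a \<in> A. \<forall>x\<in>V. act a x = x}" for V
 define RV where "RV V = {b \<in> B. \<forall>b'\<in>B. cm b b' \<in> ZV V}" for V
 have ZZV: "Z \<subseteq> ZV V" if V: "V \<in> Om" for V
 proof
  fix z assume z: "z \<in> Z"
  then have "\<forall>x\<in>?P. act z x = x" using Z_iff ZH by blast
  then show "z \<in> ZV V" using z A'(2) OmP[OF V] unfolding ZV_def by blast
 qed
 have sgZV: "sg (ZV V)" if V: "V \<in> Om" for V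
 proof (rule sgI)
  have VP: "x \<in> ?P" if "x \<in> V" for x using that OmP[OF V] by blast
  show "0 \<in> ZV V" using sg_zero[OF A'(1)] act_0 VP by (auto simp: ZV_def)
  show "a + b \<in> ZV V" if "a \<in> ZV V" "b \<in> ZV V" for a b
   using that act_plus[of a b] VP A'(3) sg_add[OF A'(1)] unfolding ZV_def by (auto simp: subset_iff)
  show "- a \<in> ZV V" if "a \<in> ZV V" for a
  proof -
   have aH: "a \<in> H" using that A'(3) by (auto simp: ZV_def)
   have "act (- a) x = x" if "x \<in> V" for x using M.act_inv(2)[OF aH VP[OF that]] \<open>a \<in> ZV V\<close> that by (auto simp: ZV_def)
   then show ?thesis using that sg_neg[OF A'(1)] by (auto simp: ZV_def)
  qed
 qed
 have nZV: "nrm C (ZV V)" if V: "V \<in> Om" for V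
 proof (rule nrm_of_cm[OF sgZV[OF V]])
  fix c z assume "c \<in> C" "z \<in> ZV V"
  then have "cm c z \<in> Z" using Ca by (auto simp: ZV_def)
  then show "cm c z \<in> ZV V" using ZZV[OF V] by blast
 qed
 have nZVB: "nrm B (ZV V)" if "V \<in> Om" for V using nrm_sub[OF nZV[OF that] B'(3)] .
 have sgRV: "sg (RV V)" if V: "V \<in> Om" for V unfolding RV_def by (rule sg_centralizer[OF B'(1) sgZV[OF V] nZVB[OF V]])
 have nRV: "nrm C (RV V)" if V: "V \<in> Om" for V
  unfolding RV_def by (rule nrm_centralizer[OF sgC nrm_sub[OF B'(4) CH] nZV[OF V] nrm_sub[OF B'(4) CH]])
 have ARV: "cm a b \<in> ZV V" if "V \<in> Om" "a \<in> A" "b \<in> B" for a b V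
  using aC[of b a] that B'(3) ZZV[OF that(1)] by blast
 have RVfin: "finite (cos B (RV V)) \<and> idx B (RV V) \<le> e * e" if V: "V \<in> Om" for V
 proof (rule idx_le_reps[OF sgRV[OF V]])
  fix I assume I: "finite I" "I \<subseteq> B" "\<And>i j. i \<in> I ==> j \<in> I ==> i \<noteq> j ==> - i + j \<notin> RV V"
  have "\<exists>b\<in>B. \<exists>x\<in>V. act (cm b (- i + j)) x \<noteq> x" if ij: "i \<in> I" "j \<in> I" "i \<noteq> j" for i j
  proof -
   have m: "- i + j \<in> B" using ij I(2) sg_add[OF B'(1)] sg_neg[OF B'(1)] by blast
   obtain b where b: "b \<in> B" "cm (- i + j) b \<notin> ZV V" using I(3)[OF ij] m by (auto simp: RV_def)
   then have "cm b (- i + j) \<notin> ZV V" using sg_neg[OF sgZV[OF V]] neg_cm by metis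
   then show ?thesis using b(1) B'(5)[OF b(1) m] by (auto simp: ZV_def)
  qed
  then show "card I \<le> e * e" by (intro O(4)[rule_format, OF opsB V I(1,2)])
 qed
 have secV: "sec E B (RV V)" if V: "V \<in> Om" for V unfolding sec_def
 proof (intro conjI ballI)
  show "RV V \<subseteq> B" by (auto simp: RV_def)
  show "cm u v \<in> RV V" if "u \<in> B" "v \<in> B" for u v
   using B'(5)[OF that] sg_cm[OF B'(1) that] ARV[OF V] by (auto simp: RV_def)
 qed (use E B'(1) sgRV[OF V] nrm_sub[OF B'(4) E(3)] nrm_sub[OF nRV[OF V] E(2)] RVfin[OF V] in auto)
 have solV: "solv E B (RV V)" if V: "V \<in> Om" for V
 proof -
  have "cm z b \<in> RV V" if z: "z \<in> Z" "b \<in> B" for z b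
  proof -
   have zz: "cm z b \<in> Z" using cZ z BH by blast
   then have "cm (cm z b) b' \<in> ZV V" if "b' \<in> B" for b' using cZ(2)[of b' "cm z b"] that BH ZZV[OF V] by blast
   then show ?thesis using zz A'(2) B'(2) by (auto simp: RV_def)
  qed
  moreover have "dern l E \<subseteq> Z" using dern_mono[OF E(3)] l by blast
  ultimately show ?thesis unfolding solv_def triv_def by blast
 qed
 show ?thesis
 proof (rule that[OF k1 Om(5,6) idxq dp(1)])
  fix v assume hyp: "\<And>(H'::'g set) U' W'. sec H' U' W' ==> solv H' U' W' ==> 2 \<le> idx U' W' ==> idx U' W' \<le> e * e ==>
    \<exists>d\<le>v. triv (dern d H') U' W'"
  define E1 where "E1 = dern v E"
  have E1: "sg E1" "E1 \<subseteq> C" "E1 \<subseteq> E" unfolding E1_def using sg_dern[OF E(1)] dern_sub[OF E(1)] E(2) by auto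
  have tV: "triv E1 B (RV V)" if V: "V \<in> Om" for V
  proof (cases "2 \<le> idx B (RV V)")
   case True
   then obtain d where "d \<le> v" "triv (dern d E) B (RV V)" using hyp[OF secV[OF V] solV[OF V]] RVfin[OF V] by blast
   then show ?thesis unfolding E1_def using triv_dern_mono E(1) by blast
  next
   case False
   then have "B = RV V" using idx_1[OF B'(1) sgRV[OF V]] RVfin[OF V] by (auto simp: RV_def)
   then show ?thesis using nrm_cm[OF B'(1,4)] E1 E unfolding triv_def by (metis subsetD)
  qed
  have tA: "triv E1 B A" unfolding triv_def
  proof (intro ballI)
   fix h b assume h: "h \<in> E1" and b: "b \<in> B"
   let ?y = "cm h b"
   have hC: "h \<in> C" "h \<in> H" using h E1 E by auto
   have yB: "?y \<in> B" using nrm_cm[OF B'(1,4) hC(2) b] .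
   have "cm ?y b' \<in> Z" if b': "b' \<in> B" for b'
   proof -
    have yH: "cm ?y b' \<in> H" using sg_cm[OF sgH] yB b' BH by blast
    have "cm ?y b' \<in> ZV V" if "V \<in> Om" for V using tV[OF that] h b b' unfolding triv_def RV_def by blast
    then have "\<forall>V\<in>Om. \<forall>x\<in>V. act (cm ?y b') x = x" by (auto simp: ZV_def)
    then have "\<forall>x\<in>?P. act (cm ?y b') x = x" using O(1)[rule_format, OF yH] by blast
    then show ?thesis using Z_iff[OF yH] by blast
   qed
   then have "?y \<in> T" using yB B'(3) by (auto simp: T_def)
   then show "?y \<in> A" using TA by blast
  qed
  \<comment> \<open>\<open>E1\<close> is trivial on \<open>B / A\<close> and on
    \<open>A / Z\<close>, so one derivation centralizes \<open>B\<close> modulo \<open>Z\<close> and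
    lands in \<open>T\<close>, hence in \<open>A\<close>; a second one lands in \<open>Z\<close>.
    This is the summand 2 of the total.\<close>
  have "triv (der E1) B Z"
  proof (rule merge_triv[OF sgH])
   show "nrm E1 B" using nrm_sub[OF B'(4)] E1 E by blast
   show "triv E1 A Z" using Ca E1 by (auto simp: triv_def)
  qed (use E1 E BH A' sgZ ZH nZ tA in auto)
  moreover have "der E1 \<subseteq> C" using der_sub[OF E1(1)] E1(2) by blast
  ultimately have "der E1 \<subseteq> A" using TA by (auto simp: triv_def T_def)
  then have "der (der E1) \<subseteq> Z" using A'(5) by (intro der_least[OF sgZ]) blast
  then have "triv (der (der E1)) U W" by (auto simp: triv_def Z_def)
  moreover have "der (der E1) = dern (dp + (if q = 3 then 0 else 1) + v + 2) H"
  proof -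
   have "dp + (if q = 3 then 0 else 1) + v + 2 = Suc (Suc (v + (g + dp)))" by (simp add: g_def)
   then show ?thesis by (simp only: E1_def E_def H1_def dern_Suc dern_add)
  qed
  ultimately show "triv (dern (dp + (if q = 3 then 0 else 1) + v + 2) H) U W" by simp
 qed
qed

section \<open>The bound by the order of the section\<close>

lemma idx_proper: assumes "sec H U W" "W \<noteq> U" shows "2 \<le> idx U W"
 using idx_1[OF secD(2,3,4,8)[OF assms(1)]] assms(2) by (cases "idx U W \<le> 1") auto

text \<open>In this and the next three inequalities the bases 9 and 16 are the least values of the
  square of \<open>q\<close> in the cases \<open>q = 3\<close> and \<open>q \<ge> 4\<close> of
  \<open>cost_bound\<close>.\<close>

lemma pow4_9: "n \<ge> 2 ==> 4 * (n::nat) ^ 4 \<le> 9 ^ n"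
proof (induction n rule: dec_induct)
 case (step n)
 have "2 * Suc n \<le> 3 * n" using step by simp
 then have "(2 * Suc n) ^ 4 \<le> (3 * n) ^ 4" by (rule power_mono) simp
 then have "16 * Suc n ^ 4 \<le> 81 * n ^ 4" unfolding power_mult_distrib by simp
 then show ?case using step by simp
qed simp

lemma pow8_16: "n \<ge> 2 ==> 8 * (n::nat) ^ 4 \<le> 16 ^ n"
proof (induction n rule: dec_induct)
 case (step n)
 have "2 * Suc n \<le> 3 * n" using step by simp
 then have "(2 * Suc n) ^ 4 \<le> (3 * n) ^ 4" by (rule power_mono) simp
 then have "16 * Suc n ^ 4 \<le> 81 * n ^ 4" unfolding power_mult_distrib by simp
 then show ?case using step by simp
qed simp

lemma pow2_9: "n \<ge> 1 ==> 8 * (n::nat) ^ 2 \<le> 9 ^ n"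
proof (induction n rule: dec_induct)
 case (step n)
 have "Suc n \<le> 2 * n" using step by simp
 then have "(Suc n) ^ 2 \<le> (2 * n) ^ 2" by (rule power_mono) simp
 then show ?case using step by (simp add: power_mult_distrib)
qed simp

lemma pow2_16: "n \<ge> 1 ==> 16 * (n::nat) ^ 2 \<le> 16 ^ n"
proof (induction n rule: dec_induct)
 case (step n)
 have "Suc n \<le> 2 * n" using step by simp
 then have "(Suc n) ^ 2 \<le> (2 * n) ^ 2" by (rule power_mono) simp
 then show ?case using step by (simp add: power_mult_distrib)
qed simp

text \<open>There is hardly any slack: for \<open>e = k = 1\<close> the claim reads 8 <= 9 at
  \<open>q = 3\<close> and 16 <= 16 at \<open>q = 4\<close>. One more derivation at
  \<open>q = 3\<close> would break it. For \<open>e = 1\<close> the class-two sections are trivial,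
  whence \<open>v = 0\<close>.\<close>

lemma cost_bound:
 assumes "k \<ge> 1" "q \<ge> (3::nat)" "e \<ge> 1" "2 ^ dp \<le> k\<^sup>2" and v: "if e = 1 then v = 0 else 2 ^ (v + 1) \<le> e ^ 4"
 shows "2 ^ (dp + (if q = 3 then 0 else 1) + v + 2 + 1) \<le> (q ^ (e * k))\<^sup>2"
proof -
 define g where "g = (if q = 3 then 0 else 1 :: nat)"
 let ?x = "e * k"
 have sq: "(a ^ x)\<^sup>2 = (a\<^sup>2) ^ x" for a x :: nat by (metis mult.commute power_mult)
 have q9: "9 ^ ?x \<le> (q ^ ?x)\<^sup>2"
 proof -
  have "(3 ^ ?x)\<^sup>2 \<le> (q ^ ?x)\<^sup>2" using assms(2) by (intro power_mono) auto
  then show ?thesis using sq[of 3 ?x] sq[of 4 ?x] by simp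
 qed
 have q16: "16 ^ ?x \<le> (q ^ ?x)\<^sup>2" if "q \<noteq> 3"
 proof -
  have "(4 ^ ?x)\<^sup>2 \<le> (q ^ ?x)\<^sup>2" using assms(2) that by (intro power_mono) auto
  then show ?thesis using sq[of 3 ?x] sq[of 4 ?x] by simp
 qed
 have eq: "(2::nat) ^ (dp + g + v + 2 + 1) = 2 ^ g * (2 ^ dp * (4 * 2 ^ (v + 1)))" by (simp add: power_add)
 have "2 ^ g * (2 ^ dp * (4 * 2 ^ (v + 1))) \<le> (q ^ ?x)\<^sup>2"
 proof (cases "e = 1")
  case True
  then have "2 ^ dp * (4 * 2 ^ (v + 1)) \<le> 8 * k\<^sup>2" using assms(4) v by simp
  then have *: "2 ^ g * (2 ^ dp * (4 * 2 ^ (v + 1))) \<le> 2 ^ g * (8 * k\<^sup>2)" by (rule mult_left_mono) simp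
  show ?thesis
  proof (cases "q = 3")
   case True
   then show ?thesis using * pow2_9[OF assms(1)] q9 \<open>e = 1\<close> by (simp add: g_def)
  next
   case False
   then show ?thesis using * pow2_16[OF assms(1)] q16 \<open>e = 1\<close> by (simp add: g_def)
  qed
 next
  case False
  then have x2: "?x \<ge> 2" using assms(1,3) by (metis One_nat_def Suc_1 Suc_leI le_neq_implies_less mult_le_mono nat_mult_1_right)
  have "2 ^ dp * (4 * 2 ^ (v + 1)) \<le> k\<^sup>2 * (4 * e ^ 4)" using assms(4) v False by (intro mult_mono) auto
  also have "\<dots> \<le> k ^ 4 * (4 * e ^ 4)" using assms(1) by (intro mult_right_mono power_increasing) auto
  also have "\<dots> = 4 * ?x ^ 4" by (simp add: power_mult_distrib)
  finally have *: "2 ^ g * (2 ^ dp * (4 * 2 ^ (v + 1))) \<le> 2 ^ g * (4 * ?x ^ 4)" by (rule mult_left_mono) simp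
  show ?thesis
  proof (cases "q = 3")
   case True
   then show ?thesis using * pow4_9[OF x2] q9 by (simp add: g_def)
  next
   case False
   then show ?thesis using * pow8_16[OF x2] q16 by (simp add: g_def)
  qed
 qed
 from eq this show ?thesis unfolding g_def by (rule ord_eq_le_trans)
qed

text \<open>Induction on the order. A reducible section costs one derivation beyond the longer of
  its two parts, a factor 2, while the square of the order of the other part is at least 4. An
  irreducible one with nontrivial action is paid for by \<open>simple_core\<close> and
  \<open>cost_bound\<close>.\<close>

theorem small_all: "small TYPE('g::group_add) n"
proof (induction n)
 case 0 show ?case by (simp add: small_def)
next
 case (Suc n)
 have "\<exists>d. 2 ^ (d + 1) \<le> (idx U W)\<^sup>2 \<and> triv (dern d H) U W"
  if S: "sec H U W" "solv H U W" "2 \<le> idx U W" "idx U W = Suc n" for H U W :: "'g set"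
 proof -
  consider "\<forall>Q. sg Q --> W \<subseteq> Q --> Q \<subseteq> U --> nrm H Q --> Q = W \<or> Q = U" "triv H U W"
   | "\<forall>Q. sg Q --> W \<subseteq> Q --> Q \<subseteq> U --> nrm H Q --> Q = W \<or> Q = U" "\<not> triv H U W"
   | Q where "sg Q" "W \<subset> Q" "Q \<subset> U" "nrm H Q" by blast
  then show ?thesis
  proof cases
   case 1
   have "2\<^sup>2 \<le> (idx U W)\<^sup>2" using S(3) by (rule power_mono) simp
   then show ?thesis using 1 by (intro exI[of _ 0]) auto
  next
   case 2
   have sm: "small TYPE('g) (idx U W - 1)" using Suc S by simp
   obtain k q e dp where k: "k \<ge> 1" "q \<ge> 3" "e \<ge> 1" "idx U W = q ^ (e * k)" "2 ^ dp \<le> k\<^sup>2"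
    and c: "\<And>v. (\<And>(H'::'g set) U' W'. sec H' U' W' ==> solv H' U' W' ==> 2 \<le> idx U' W' ==> idx U' W' \<le> e * e ==>
     \<exists>d\<le>v. triv (dern d H') U' W') ==> triv (dern (dp + (if q = 3 then 0 else 1) + v + 2) H) U W"
    by (rule simple_core[OF S(1,2) _ sm 2(2)]) (use 2(1) in blast)+
   \<comment> \<open>Since e^2 < 3^e, the class-two sections are smaller than the given one and
     covered by the induction hypothesis.\<close>
   have en: "e * e \<le> n"
   proof -
    have "e * e < 3 ^ e" using k(3)
    proof (induction e rule: dec_induct)
     case (step m)
     have "m = 1 \<or> m = 2 \<or> Suc m * Suc m \<le> 3 * (m * m)"
     proof -
      have "2 * m + 1 \<le> 2 * (m * m)" if "m \<ge> 3"
      proof -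
       have "3 * m \<le> m * m" using that by simp
       then show ?thesis using that by linarith
      qed
      then show ?thesis using step by (cases "m \<ge> 3") auto
     qed
     then show ?case using step by auto
    qed simp
    also have "(3::nat) ^ e \<le> q ^ e" using k(2) by (rule power_mono) simp
    also have "\<dots> \<le> q ^ (e * k)" using k(1,2) by (intro power_increasing) auto
    finally show ?thesis using k(4) S(4) by simp
   qed
   have Smu: "\<exists>d. 2 ^ (d + 1) \<le> (idx U' W')\<^sup>2 \<and> triv (dern d H') U' W'"
    if "sec H' U' W'" "solv H' U' W'" "2 \<le> idx U' W'" "idx U' W' \<le> e * e" for H' U' W' :: "'g set"
    using Suc that en unfolding small_def by (meson le_trans)
   \<comment> \<open>The largest derived length that the crude bound allows for a section of order
     at most \<open>e * e\<close>.\<close>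
   define v where "v = (if e = 1 then 0 else (GREATEST v. (2::nat) ^ (v + 1) \<le> e ^ 4))"
   have bdd: "y \<le> e ^ 4" if "(2::nat) ^ (y + 1) \<le> e ^ 4" for y
    using that less_exp[of "y + 1"] by linarith
   have ex: "(2::nat) ^ (0 + 1) \<le> e ^ 4" if "e \<noteq> 1"
   proof -
    have "(2::nat) ^ 4 \<le> e ^ 4" using k(3) that by (intro power_mono) auto
    then show ?thesis by simp
   qed
   have v: "if e = 1 then v = 0 else 2 ^ (v + 1) \<le> e ^ 4"
    using GreatestI_nat[of "\<lambda>v. (2::nat) ^ (v + 1) \<le> e ^ 4", OF ex bdd] by (auto simp: v_def)
   have vmax: "d \<le> v" if "2 ^ (d + 1) \<le> m\<^sup>2" "m \<le> e * e" "2 \<le> m" for d m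
   proof -
    have "m\<^sup>2 \<le> (e * e)\<^sup>2" using that by (intro power_mono) auto
    then have "2 ^ (d + 1) \<le> e ^ 4" using that by (simp add: power2_eq_square numeral_eq_Suc)
    moreover have "e \<noteq> 1" using that by auto
    ultimately show ?thesis unfolding v_def using Greatest_le_nat[of "\<lambda>v. (2::nat) ^ (v + 1) \<le> e ^ 4" d, OF _ bdd] by auto
   qed
   have "triv (dern (dp + (if q = 3 then 0 else 1) + v + 2) H) U W"
    by (rule c) (use Smu vmax in metis)
   then show ?thesis using cost_bound[OF k(1,2,3,5) v] k(4) by metis
  next
   case 3
   have D: "W \<subseteq> Q" "Q \<subseteq> U" using 3 by auto
   note sp = sec_split[OF S(1) 3(1) D 3(4)]
   have so: "solv H U Q" "solv H Q W" using solv_split[OF S(2) D] by auto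
   have i2: "2 \<le> idx U Q" "2 \<le> idx Q W" using idx_proper[OF sp(1)] idx_proper[OF sp(2)] 3 by auto
   have "idx U Q * 2 \<le> Suc n" "2 * idx Q W \<le> Suc n" using sp(3) i2 S(4) by (metis mult_le_mono1 mult_le_mono2)+
   then have "idx U Q \<le> n" "idx Q W \<le> n" using i2 by auto
   then obtain d1 d2 where d: "2 ^ (d1 + 1) \<le> (idx U Q)\<^sup>2" "triv (dern d1 H) U Q"
    "2 ^ (d2 + 1) \<le> (idx Q W)\<^sup>2" "triv (dern d2 H) Q W"
    using Suc sp so i2 unfolding small_def by metis
   let ?d = "max d1 d2"
   have sgH: "sg H" using secD[OF S(1)] by blast
   have "triv (dern ?d H) U Q" "triv (dern ?d H) Q W"
    using triv_dern_mono[OF d(2) sgH, of ?d] triv_dern_mono[OF d(4) sgH, of ?d] by auto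
   then have "triv (dern (Suc ?d) H) U W" using sec_merge[OF S(1) 3(1) D] by blast
   moreover have "2 ^ (Suc ?d + 1) \<le> (idx U W)\<^sup>2"
   proof -
    have a: "2 \<le> (idx U Q)\<^sup>2" "2 \<le> (idx Q W)\<^sup>2" using i2 by (simp_all add: power2_eq_square) (metis mult_le_mono mult_2 le_add1 le_trans)+
    have "2 * 2 ^ (?d + 1) \<le> (idx U Q)\<^sup>2 * (idx Q W)\<^sup>2"
    proof (cases "d1 \<le> d2")
     case True
     then show ?thesis using mult_le_mono[OF a(1) d(3)] by (simp add: max_def)
    next
     case False
     then show ?thesis using mult_le_mono[OF d(1) a(2)] by (simp add: max_def mult.commute)
    qed
    then show ?thesis unfolding sp(3) power_mult_distrib by simp
   qed
   ultimately show ?thesis by blast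
  qed
 qed
 then show ?case using Suc unfolding small_def by (metis le_Suc_eq)
qed

section \<open>The bound by the number of prime factors counted with multiplicity\<close>

definition Om :: "nat \<Rightarrow> nat" where "Om n = size (prime_factorization n)"

lemma Om_mult: "a \<noteq> 0 ==> b \<noteq> 0 ==> Om (a * b) = Om a + Om b"
 by (simp add: Om_def prime_factorization_mult)

lemma Om_power: "a \<noteq> 0 ==> Om (a ^ n) = n * Om a"
proof (induction n)
 case (Suc n)
 then show ?case using Om_mult[of a "a ^ n"] by simp
qed (simp add: Om_def)

lemma Om_pos: "2 \<le> n ==> 1 \<le> Om n"
 using prime_factorization_empty_iff[of n] by (simp add: Om_def Suc_le_eq nonempty_has_size[symmetric])

lemma Om_prime: "Factorial_Ring.prime (p::nat) ==> Om p = 1"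
 by (simp add: Om_def prime_factorization_prime)

lemma two_pow_Om: assumes "n \<noteq> 0" shows "2 ^ Om n \<le> n"
proof -
 have "2 ^ size M \<le> prod_mset M" if "\<forall>p\<in>#M. 2 \<le> p" for M :: "nat multiset"
  using that by (induction M) (auto intro: mult_le_mono)
 moreover have "\<forall>p\<in>#prime_factorization n. 2 \<le> p" using prime_ge_2_nat by auto
 ultimately have "2 ^ Om n \<le> prod_mset (prime_factorization n)" unfolding Om_def by blast
 then show ?thesis using prod_mset_prime_factorization_nat[of n] assms by simp
qed

lemma sq_exp_bound: "13 \<le> n ==> 32 * n\<^sup>2 \<le> (2::nat) ^ n"
proof (induction n rule: dec_induct)
 case (step n)
 have "2 * n + 1 \<le> n * n"
 proof -
  have "13 * n \<le> n * n" using step by simp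
  then show ?thesis using step by linarith
 qed
 then show ?case using step by (simp add: power2_eq_square)
qed simp

lemma max_exponent: assumes "1 \<le> (m::nat)" obtains v where "2 ^ v \<le> m" "\<And>d. 2 ^ d \<le> m ==> d \<le> v"
proof (rule that)
 have b: "y \<le> m" if "(2::nat) ^ y \<le> m" for y using that less_exp[of y] by linarith
 show "2 ^ (GREATEST v. (2::nat) ^ v \<le> m) \<le> m" by (rule GreatestI_nat[of "\<lambda>v. (2::nat) ^ v \<le> m" 0, OF _ b]) (use assms in auto)
 show "d \<le> (GREATEST v. (2::nat) ^ v \<le> m)" if "2 ^ d \<le> m" for d by (rule Greatest_le_nat[of "\<lambda>v. (2::nat) ^ v \<le> m", OF that b])
qed

text \<open>The spare factor 4 pays for the two mergers in \<open>section_bound\<close>. For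
  \<open>e < 128\<close> the crude bound gives derived length at most 27 for the class-two sections,
  as 127^4 < 2^28, and the constant 2^40 covers the cost. For larger \<open>e\<close> their prime
  length is at most \<open>L\<close>, the integer part of the binary logarithm of e^2, and
  \<open>32 * L\<^sup>2 \<le> e\<^sup>2\<close> absorbs all fixed costs; 2^14 = 128^2 puts
  \<open>L\<close> in the range of \<open>sq_exp_bound\<close>.\<close>

lemma simple_bound:
 fixes H :: "'g::group_add set"
 assumes S: "sec H U W" and sol: "solv H U W" and ge: "2 \<le> idx U W"
  and simp: "\<And>Q. sg Q ==> W \<subseteq> Q ==> Q \<subseteq> U ==> nrm H Q ==> Q = W \<or> Q = U"
  and IH: "\<And>(H'::'g set) U' W'. sec H' U' W' ==> solv H' U' W' ==> 2 \<le> idx U' W' ==> idx U' W' < idx U W ==>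
   \<exists>d. 2 ^ d \<le> 2 ^ 40 * (Om (idx U' W'))\<^sup>2 \<and> triv (dern d H') U' W'"
 shows "\<exists>d. 4 * 2 ^ d \<le> 2 ^ 40 * (Om (idx U W))\<^sup>2 \<and> triv (dern d H) U W"
proof (cases "triv H U W")
 case True
 have "1\<^sup>2 \<le> (Om (idx U W))\<^sup>2" using Om_pos[OF ge] by (intro power_mono) auto
 then show ?thesis using True by (intro exI[of _ 0]) simp
next
 case False
 obtain k q e dp where k: "k \<ge> 1" "q \<ge> 3" "e \<ge> 1" "idx U W = q ^ (e * k)" "2 ^ dp \<le> k\<^sup>2"
  and c: "\<And>v. (\<And>(H'::'g set) U' W'. sec H' U' W' ==> solv H' U' W' ==> 2 \<le> idx U' W' ==> idx U' W' \<le> e * e ==>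
   \<exists>d\<le>v. triv (dern d H') U' W') ==> triv (dern (dp + (if q = 3 then 0 else 1) + v + 2) H) U W"
  by (rule simple_core[OF S sol _ small_all False]) (use simp in blast)+
 let ?w = "Om (idx U W)"
 let ?g = "if q = 3 then 0 else 1 :: nat"
 have "e * k * 1 \<le> e * k * Om q" by (rule mult_le_mono2) (use Om_pos k(2) in auto)
 then have w: "e * k \<le> ?w" using Om_power[of q "e * k"] k(2,4) by simp
 \<comment> \<open>The factor 32 collects the spare 4, the Galois derivation and the two final ones.
   The permutation part is bounded by the number of components, which uses up k^2 of
   \<open>(e * k)\<^sup>2\<close>.\<close>
 have cost: "4 * 2 ^ (dp + ?g + v + 2) \<le> 2 ^ 40 * ?w\<^sup>2" if v: "32 * 2 ^ v \<le> 2 ^ 40 * e\<^sup>2" for v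
 proof -
  have "4 * 2 ^ (dp + ?g + v + 2) \<le> 4 * (2::nat) ^ (dp + 1 + v + 2)" by (intro mult_le_mono2 power_increasing) auto
  also have "\<dots> = 2 ^ dp * (32 * 2 ^ v)" by (simp add: power_add)
  also have "\<dots> \<le> k\<^sup>2 * (2 ^ 40 * e\<^sup>2)" using k(5) v by (rule mult_le_mono)
  also have "\<dots> = 2 ^ 40 * (e * k)\<^sup>2" by (simp add: power_mult_distrib)
  also have "\<dots> \<le> 2 ^ 40 * ?w\<^sup>2" using w by (intro mult_le_mono2 power_mono) auto
  finally show ?thesis .
 qed
 show ?thesis
 proof (cases "e < 128")
  case True
  have "\<exists>d\<le>27. triv (dern d H') U' W'"
   if h: "sec H' U' W'" "solv H' U' W'" "2 \<le> idx U' W'" "idx U' W' \<le> e * e" for H' U' W' :: "'g set"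
  proof -
   obtain d where d: "2 ^ (d + 1) \<le> (idx U' W')\<^sup>2" "triv (dern d H') U' W'"
    using small_all[where 'g='g and n="e * e"] h unfolding small_def by blast
   have "e * e \<le> 127 * 127" using True by (intro mult_le_mono) auto
   then have "(idx U' W')\<^sup>2 \<le> (127 * 127)\<^sup>2" using h(4) by (intro power_mono) auto
   also have "\<dots> < 2 ^ 28" by simp
   finally have "(2::nat) ^ (d + 1) < 2 ^ 28" using d(1) by linarith
   then have "d + 1 < 28" by (rule power_less_imp_less_exp[rotated]) simp
   then show ?thesis using d(2) by (intro exI[of _ d]) simp
  qed
  moreover have "32 * 2 ^ 27 \<le> 2 ^ 40 * e\<^sup>2"
  proof -
   have "(2::nat) ^ 40 * 1\<^sup>2 \<le> 2 ^ 40 * e\<^sup>2" using k(3) by (intro mult_le_mono2 power_mono) auto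
   then show ?thesis by simp
  qed
  ultimately show ?thesis using c[of 27] cost[of 27] by blast
 next
  case False
  have ee: "e * e < idx U W"
  proof -
   have "0 < e\<^sup>2" "32 * e\<^sup>2 \<le> 2 ^ e" using sq_exp_bound[of e] False by auto
   then have "e\<^sup>2 < 2 ^ e" by linarith
   also have "(2::nat) ^ e \<le> q ^ e" using k(2) by (intro power_mono) auto
   also have "\<dots> \<le> q ^ (e * k)" using k(1,2) by (intro power_increasing) auto
   finally show ?thesis using k(4) by (simp add: power2_eq_square)
  qed
  obtain L where L: "2 ^ L \<le> e * e" "\<And>d. 2 ^ d \<le> e * e ==> d \<le> L" using max_exponent[of "e * e"] k(3) by auto
  have "14 \<le> L"
  proof (rule L(2))
   have "128 * 128 \<le> e * e" using False by (intro mult_le_mono) auto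
   then show "2 ^ 14 \<le> e * e" by simp
  qed
  then have L2: "32 * L\<^sup>2 \<le> e\<^sup>2" "1 \<le> 2 ^ 40 * L\<^sup>2" using sq_exp_bound[of L] L(1) by (auto simp: power2_eq_square)
  obtain v where v: "2 ^ v \<le> 2 ^ 40 * L\<^sup>2" "\<And>d. 2 ^ d \<le> 2 ^ 40 * L\<^sup>2 ==> d \<le> v"
   using max_exponent[OF L2(2)] by blast
  have "\<exists>d\<le>v. triv (dern d H') U' W'"
   if h: "sec H' U' W'" "solv H' U' W'" "2 \<le> idx U' W'" "idx U' W' \<le> e * e" for H' U' W' :: "'g set"
  proof -
   obtain d where d: "2 ^ d \<le> 2 ^ 40 * (Om (idx U' W'))\<^sup>2" "triv (dern d H') U' W'"
    using IH[OF h(1,2,3)] h(4) ee by auto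
   have "Om (idx U' W') \<le> L" by (rule L(2)) (use two_pow_Om[of "idx U' W'"] h in linarith)
   then have "2 ^ 40 * (Om (idx U' W'))\<^sup>2 \<le> 2 ^ 40 * L\<^sup>2" by (intro mult_le_mono2 power_mono) auto
   then show ?thesis using d v(2) le_trans by blast
  qed
  moreover have "32 * 2 ^ v \<le> 2 ^ 40 * e\<^sup>2"
  proof -
   have "32 * 2 ^ v \<le> 32 * (2 ^ 40 * L\<^sup>2)" using v(1) by (rule mult_le_mono2)
   also have "\<dots> = 2 ^ 40 * (32 * L\<^sup>2)" by simp
   also have "\<dots> \<le> 2 ^ 40 * e\<^sup>2" using L2(1) by (rule mult_le_mono2)
   finally show ?thesis .
  qed
  ultimately show ?thesis using c[of v] cost[of v] by blast
 qed
qed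

text \<open>Cutting at half of the length and isolating the irreducible factor at the cut costs only two further
 derivations, a factor \<open>4 = 2\<^sup>2\<close>; this is why the bound is quadratic.\<close>

theorem section_bound:
 fixes H :: "'g::group_add set"
 assumes "sec H U W" "solv H U W" "2 \<le> idx U W"
 shows "\<exists>d. 2 ^ d \<le> 2 ^ 40 * (Om (idx U W))\<^sup>2 \<and> triv (dern d H) U W"
 using assms
proof (induction "idx U W" arbitrary: H U W rule: less_induct)
 case less
 note S = less.prems(1) and sol = less.prems(2)
 note D = secD[OF S]
 let ?w = "Om (idx U W)"
 have w1: "1 \<le> ?w" using Om_pos less.prems(3) by blast
 define F where "F = {Y. sg Y \<and> W \<subseteq> Y \<and> Y \<subseteq> U \<and> nrm H Y}"
 have fF: "finite F" by (rule finite_subset[OF _ finite_between[OF D(3,8)]]) (auto simp: F_def)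
 have sub: "sec H V Y \<and> solv H V Y \<and> idx U W = idx U V * (idx V Y * idx Y W) \<and> idx U V \<noteq> 0 \<and> idx V Y \<noteq> 0 \<and> idx Y W \<noteq> 0"
  if VY: "V \<in> F" "Y \<in> F" "Y \<subseteq> V" for V Y
 proof -
  have V: "sg V" "W \<subseteq> V" "V \<subseteq> U" "nrm H V" and Y: "sg Y" "W \<subseteq> Y" "nrm H Y" using VY by (auto simp: F_def)
  note s = sec_split[OF S V]
  note t = sec_split[OF s(2) Y(1,2) VY(3) Y(3)]
  have "solv H V Y" using solv_split[OF sol V(2,3)] solv_split[OF _ Y(2) VY(3)] by blast
  moreover have "idx U W \<noteq> 0" using less.prems(3) by simp
  ultimately show ?thesis using s(3) t by (metis mult_is_0)
 qed
 have WU: "W \<in> F" "U \<in> F" using D by (auto simp: F_def)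
 \<comment> \<open>\<open>Y\<close> is a maximal invariant subgroup with at most half of the length
   below it, and \<open>Z\<close> a minimal one above \<open>Y\<close>. So \<open>Z / Y\<close> is
   irreducible, and the part above \<open>Z\<close> has less than half of the length.\<close>
 define FY where "FY = {Y \<in> F. 2 * Om (idx Y W) \<le> ?w}"
 have "W \<in> FY" using WU idx_self[OF D(3)] by (auto simp: FY_def Om_def)
 then obtain Y where Y: "Y \<in> FY" and Ym: "\<forall>Y'\<in>FY. Y \<subseteq> Y' --> Y = Y'"
  using finite_has_maximal[of FY] fF by (auto simp: FY_def)
 have YF: "Y \<in> F" "2 * Om (idx Y W) \<le> ?w" using Y by (auto simp: FY_def)
 have YU: "Y \<subset> U" using YF w1 by (auto simp: F_def)
 then have "U \<in> {Z\<in>F. Y \<subset> Z}" using WU by auto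
 then obtain Z where Z: "Z \<in> F" "Y \<subset> Z" and Zm: "\<forall>Z'\<in>{Z\<in>F. Y \<subset> Z}. Z' \<subseteq> Z --> Z = Z'"
  using finite_has_minimal[of "{Z\<in>F. Y \<subset> Z}"] fF by auto
 have WY: "W \<subseteq> Y" "Z \<subseteq> U" using YF Z by (auto simp: F_def)
 note ZY = sub[OF Z(1) YF(1)] and YW = sub[OF YF(1) WU(1) WY(1)] and UZ = sub[OF WU(2) Z(1) WY(2)]
 have ZYs: "Y \<subseteq> Z" using Z by auto
 have Zl: "?w < 2 * Om (idx Z W)" using Z Ym by (auto simp: FY_def not_le[symmetric])
 have UW: "idx U W = idx U Z * idx Z W" "idx Z W \<noteq> 0"
  using UZ idx_self[OF D(2)] by auto
 have UZl: "2 * Om (idx U Z) \<le> ?w" using Zl UW Om_mult[of "idx U Z" "idx Z W"] UZ by simp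
 have wZY: "Om (idx Z Y) \<le> ?w" using ZY[OF ZYs] Om_mult by simp
 have iZY: "2 \<le> idx Z Y" using idx_proper ZY[OF ZYs] Z(2) by blast
 have le: "idx Z Y \<le> idx U W"
 proof -
  have "idx Z Y dvd idx U W" using ZY[OF ZYs] by (metis dvd_triv_left dvd_mult)
  then show ?thesis using less.prems(3) by (simp add: dvd_imp_le)
 qed
 have half: "\<exists>d. 4 * 2 ^ d \<le> 2 ^ 40 * ?w\<^sup>2 \<and> triv (dern d H) V T"
  if VT: "sec H V T" "solv H V T" "2 * Om (idx V T) \<le> ?w" "idx V T dvd idx U W" for V T
 proof (cases "T = V")
  case True
  have "(2::nat) ^ 40 * 1\<^sup>2 \<le> 2 ^ 40 * ?w\<^sup>2" using w1 by (intro mult_le_mono2 power_mono) auto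
  then show ?thesis using True nrm_cm secD[OF VT(1)] by (intro exI[of _ 0]) (auto simp: triv_def)
 next
  case False
  have i: "2 \<le> idx V T" using idx_proper[OF VT(1) False] .
  have "idx V T \<noteq> idx U W" using VT(3) w1 by auto
  then have "idx V T < idx U W" using VT(4) less.prems(3) by (simp add: dvd_imp_le nat_less_le)
  then obtain d where d: "2 ^ d \<le> 2 ^ 40 * (Om (idx V T))\<^sup>2" "triv (dern d H) V T"
   using less.hyps VT(1,2) i by blast
  have "4 * 2 ^ d \<le> 4 * (2 ^ 40 * (Om (idx V T))\<^sup>2)" using d(1) by (rule mult_le_mono2)
  also have "\<dots> = 2 ^ 40 * (2 * Om (idx V T))\<^sup>2" by (simp add: power_mult_distrib)
  also have "\<dots> \<le> 2 ^ 40 * ?w\<^sup>2" using VT(3) by (intro mult_le_mono2 power_mono) auto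
  finally show ?thesis using d(2) by blast
 qed
 obtain d1 where d1: "4 * 2 ^ d1 \<le> 2 ^ 40 * ?w\<^sup>2" "triv (dern d1 H) Y W"
  using half[of Y W] YW YF(2) by (metis dvd_triv_right mult.commute mult.left_commute)
 obtain d3 where d3: "4 * 2 ^ d3 \<le> 2 ^ 40 * ?w\<^sup>2" "triv (dern d3 H) U Z"
  using half[of U Z] UZ UZl UW by (metis dvd_triv_left)
 have "\<exists>d. 4 * 2 ^ d \<le> 2 ^ 40 * (Om (idx Z Y))\<^sup>2 \<and> triv (dern d H) Z Y"
 proof (rule simple_bound)
  show "sec H Z Y" "solv H Z Y" "2 \<le> idx Z Y" using ZY[OF ZYs] iZY by auto
  show "Q = Y \<or> Q = Z" if Q: "sg Q" "Y \<subseteq> Q" "Q \<subseteq> Z" "nrm H Q" for Q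
  proof -
   have "Q \<in> F" using Q WY by (auto simp: F_def)
   then show ?thesis using Zm Q(2,3) by auto
  qed
  show "\<exists>d. 2 ^ d \<le> 2 ^ 40 * (Om (idx U' W'))\<^sup>2 \<and> triv (dern d H') U' W'"
   if "sec H' U' W'" "solv H' U' W'" "2 \<le> idx U' W'" "idx U' W' < idx Z Y" for H' U' W' :: "'g set"
   using less.hyps[of U' W' H'] that le by auto
 qed
 then obtain d2 where d2: "4 * 2 ^ d2 \<le> 2 ^ 40 * (Om (idx Z Y))\<^sup>2" "triv (dern d2 H) Z Y" by blast
 have "2 ^ 40 * (Om (idx Z Y))\<^sup>2 \<le> 2 ^ 40 * ?w\<^sup>2" using wZY by (intro mult_le_mono2 power_mono) auto
 then have d2': "4 * 2 ^ d2 \<le> 2 ^ 40 * ?w\<^sup>2" using d2(1) by linarith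
 \<comment> \<open>The three factors are handled simultaneously, so only the maximum counts,
   followed by two mergers.\<close>
 define d where "d = max d1 (max d2 d3)"
 have d: "4 * 2 ^ d \<le> 2 ^ 40 * ?w\<^sup>2" using d1(1) d2' d3(1) unfolding d_def by (auto simp: max_def)
 have t: "triv (dern d H) Y W" "triv (dern d H) Z Y" "triv (dern d H) U Z"
  using triv_dern_mono[OF d1(2) D(1), of d] triv_dern_mono[OF d2(2) D(1), of d] triv_dern_mono[OF d3(2) D(1), of d]
  by (auto simp: d_def)
 have sg: "sg Y" "sg Z" using YF Z by (auto simp: F_def)
 have S2: "sec H Z W" using sub[OF Z(1) WU(1)] WY ZYs by blast
 have "triv (dern (Suc d) H) Z W" by (rule sec_merge[OF S2 sg(1) WY(1) ZYs t(2,1)])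
 moreover have "triv (dern (Suc d) H) U Z" using triv_dern_mono[OF t(3) D(1)] by simp
 ultimately have "triv (dern (Suc (Suc d)) H) U W" using sec_merge[OF S sg(2) _ WY(2)] WY ZYs by blast
 moreover have "2 ^ Suc (Suc d) \<le> 2 ^ 40 * ?w\<^sup>2" using d by simp
 ultimately show ?case by blast
qed

subsection \<open>Homomorphisms to the integers\<close>

lemma nm_int: "nm n (i :: int) = int n * i" by (induction n) (auto simp: nm_Suc algebra_simps)
lemma cm_int: "cm (i :: int) j = 0" by (simp add: cm_def)

lemma gen_empty: "gen ({}::'g::group_add set) = {0}" using gen_least[of "{0}" "{}"] sg_zero[OF sg_gen[of "{}"]] by (auto simp: sg_def)

lemma gen_insert:
 assumes "\<And>a b. a \<in> gen (insert y T) ==> b \<in> gen (insert y T) ==> a + b = b + a" "v \<in> gen (insert y T)"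
 shows "\<exists>i. \<exists>q\<in>gen T. v = zm i y + q"
 using assms(2)
proof (induction rule: gen_ind)
 case zero
 show ?case by (intro exI[of _ 0] bexI[of _ 0]) (auto simp: sg_zero sg_gen)
next
 have zg: "zm i y \<in> gen (insert y T)" for i using sg_zm[OF sg_gen] gen_base by blast
 have step: "\<exists>i. \<exists>q\<in>gen T. s + v = zm i y + q"
  if s: "s \<in> gen T \<or> s = zm k y" and v: "\<exists>i. \<exists>q\<in>gen T. v = zm i y + q" for s v k
 proof -
  obtain i q where q: "q \<in> gen T" "v = zm i y + q" using v by blast
  from s show ?thesis
  proof
   assume s: "s \<in> gen T"
   then have "s \<in> gen (insert y T)" using gen_mono[of T "insert y T"] by auto
   then have "s + v = zm i y + (s + q)" using assms(1)[OF _ zg] q by (metis add.assoc)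
   then show ?thesis using sg_add[OF sg_gen s q(1)] by blast
  next
   assume "s = zm k y"
   then have "s + v = zm (k + i) y + q" using q by (simp add: zm_add add.assoc)
   then show ?thesis using q by blast
  qed
 qed
 { case (add s v)
  then show ?case using step[of s 1 v] gen_base[of T] by auto }
 { case (neg s v)
  have "- s \<in> gen T \<or> - s = zm (- 1) y" using neg(1) sg_neg[OF sg_gen, of s T] gen_base[of T] by (auto simp: zm_neg)
  then show ?case using step[of "- s" "- 1" v] neg by blast }
qed

lemma zm_mod: assumes "nm p y = 0" "p > 0" shows "zm i y = nm (nat (i mod int p)) y"
proof -
 have "zm (int p * int m) y = 0" for m using nm_mult[of m p y] assms zm_int[of "p * m" y] by (simp add: mult.commute)
 then have "zm (int p * k) y = 0" for k using zm_neg[of "int p * - k" y] by (cases k rule: int_cases2) (auto simp: zm_neg)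
 then have "zm (int p * (i div int p) + i mod int p) y = zm (int (nat (i mod int p))) y" using assms(2) by (simp only: zm_add) simp
 then show ?thesis by (simp only: zm_int mult_div_mod_eq)
qed

lemma gen_insert_torsion:
 assumes "\<And>a b. a \<in> gen (insert y T) ==> b \<in> gen (insert y T) ==> a + b = b + a" "nm p y = 0" "p > 0"
 shows "gen (insert y T) = (\<lambda>(i, q). nm i y + q) ` ({..<p} \<times> gen T)"
proof
 show "gen (insert y T) \<subseteq> (\<lambda>(i, q). nm i y + q) ` ({..<p} \<times> gen T)"
 proof
  fix v assume v: "v \<in> gen (insert y T)"
  obtain i q where q: "q \<in> gen T" "v = zm i y + q" using gen_insert[OF assms(1) v] by blast
  then show "v \<in> (\<lambda>(i, q). nm i y + q) ` ({..<p} \<times> gen T)"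
   using assms(3) zm_mod[OF assms(2,3)] by (intro image_eqI[of _ _ "(nat (i mod int p), q)"]) (auto simp: nat_less_iff)
 qed
 have "nm i y \<in> gen (insert y T)" "gen T \<subseteq> gen (insert y T)" for i using sg_nm[OF sg_gen] gen_base[of "insert y T"] gen_mono[of T "insert y T"] by auto
 then show "(\<lambda>(i, q). nm i y + q) ` ({..<p} \<times> gen T) \<subseteq> gen (insert y T)" by (auto intro!: sg_add sg_gen)
qed

text \<open>Every homomorphism to the integers kills the torsion, so \<open>e\<close> is also an exponent of the torsion.\<close>

lemma abelian_separation:
 assumes "\<And>a b :: 'g::group_add. a \<in> gen (set ys) ==> b \<in> gen (set ys) ==> a + b = b + a"
 shows "\<exists>\<Psi> e. finite \<Psi> \<and> e \<ge> 1 \<and> (\<forall>\<psi>\<in>\<Psi>. hm \<psi> (gen (set ys))) \<and>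
  (\<forall>v\<in>gen (set ys). (\<forall>\<psi>\<in>\<Psi>. \<psi> v = (0::int)) --> nm e v = 0)"
 using assms
proof (induction ys)
 case Nil
 show ?case by (intro exI[of _ "{}"] exI[of _ 1]) (auto simp: gen_empty)
next
 case (Cons y ys)
 let ?Q = "gen (set ys)" and ?V = "gen (set (y # ys))"
 have QV: "?Q \<subseteq> ?V" by (rule gen_mono) auto
 have yV: "y \<in> ?V" using gen_base by fastforce
 have comm: "a + b = b + a" if "a \<in> ?V" "b \<in> ?V" for a b using Cons.prems that by blast
 obtain \<Psi> e where I: "finite \<Psi>" "e \<ge> 1" "\<forall>\<psi>\<in>\<Psi>. hm \<psi> ?Q" "\<forall>v\<in>?Q. (\<forall>\<psi>\<in>\<Psi>. \<psi> v = (0::int)) --> nm e v = 0"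
  using Cons.IH[OF comm[OF subsetD[OF QV] subsetD[OF QV]]] by blast
 have rep: "\<exists>i. \<exists>q\<in>?Q. v = zm i y + q" if "v \<in> ?V" for v using gen_insert[of y "set ys" v] comm that by auto
 show ?case
 \<comment> \<open>If a multiple of \<open>y\<close> falls into \<open>?Q\<close>, homomorphisms
   extend after multiplication by \<open>m\<close>, and the exponent is multiplied by
   \<open>m\<close>. Otherwise \<open>y\<close> splits off an infinite cyclic summand, whose
   coordinate is a new homomorphism.\<close>
 proof (cases "\<exists>m\<ge>1. nm m y \<in> ?Q")
  case True
  then obtain m where m: "m \<ge> 1" "nm m y \<in> ?Q" by blast
  have mQ: "nm m v \<in> ?Q" if v: "v \<in> ?V" for v
  proof -
   obtain i q where q: "q \<in> ?Q" "v = zm i y + q" using rep[OF v] by blast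
   have "zm i y + q = q + zm i y" using comm sg_zm[OF sg_gen yV] QV q by blast
   then have "nm m v = nm m (zm i y) + nm m q" using q nm_comm by blast
   moreover have "nm m (zm i y) = zm i (nm m y)"
    by (auto simp: zm_def nm_neg nm_mult[symmetric] mult.commute)
   ultimately show ?thesis using sg_zm[OF sg_gen m(2)] sg_nm[OF sg_gen q(1)] by (simp add: sg_add sg_gen)
  qed
  show ?thesis
  proof (intro exI[of _ "(\<lambda>\<psi> v. \<psi> (nm m v)) ` \<Psi>"] exI[of _ "e * m"] conjI ballI impI)
   show "hm \<psi> ?V" if ps: "\<psi> \<in> (\<lambda>\<psi> v. \<psi> (nm m v)) ` \<Psi>" for \<psi>
   proof -
    obtain \<psi>' where p: "\<psi>' \<in> \<Psi>" "\<psi> = (\<lambda>v. \<psi>' (nm m v))" using ps by blast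
    have "\<psi>' (nm m (v + w)) = \<psi>' (nm m v) + \<psi>' (nm m w)" if "v \<in> ?V" "w \<in> ?V" for v w
     unfolding nm_comm[OF comm[OF that]] by (rule hmD[of _ ?Q]) (use I(3) p(1) mQ that in auto)
    then show ?thesis by (simp add: hm_def p(2))
   qed
   show "nm (e * m) v = 0" if "v \<in> ?V" "\<forall>\<psi>\<in>(\<lambda>\<psi> v. \<psi> (nm m v)) ` \<Psi>. \<psi> v = 0" for v
    using I(4) mQ[OF that(1)] that(2) by (simp add: nm_mult)
  qed (use I m in auto)
 next
  case False
  have zQ: "i = 0" if "zm i y \<in> ?Q" for i
  proof (rule ccontr)
   assume "i \<noteq> 0"
   then have "nat \<bar>i\<bar> \<ge> 1" "nm (nat \<bar>i\<bar>) y = zm i y \<or> nm (nat \<bar>i\<bar>) y = - zm i y" by (auto simp: zm_def)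
   then show False using False that sg_neg[OF sg_gen that] by metis
  qed
  \<comment> \<open>The coordinate of \<open>y\<close>; it is well defined since no nonzero multiple
    of \<open>y\<close> lies in \<open>?Q\<close>.\<close>
  define c where "c v = (SOME i. - zm i y + v \<in> ?Q)" for v
  have c: "c (zm i y + q) = i" if q: "q \<in> ?Q" for i q
  proof -
   have "- zm (c (zm i y + q)) y + (zm i y + q) \<in> ?Q" unfolding c_def by (rule someI[of _ i]) (use q in \<open>simp add: add.assoc[symmetric]\<close>)
   then have "zm (- c (zm i y + q) + i) y + q \<in> ?Q" by (simp only: zm_add zm_neg add.assoc)
   then have "zm (- c (zm i y + q) + i) y \<in> ?Q" using sg_add_right[OF sg_gen q] by blast
   then show ?thesis using zQ by fastforce
  qed
  define r where "r v = - zm (c v) y + v" for v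
  have r: "r (zm i y + q) = q" if "q \<in> ?Q" for i q unfolding r_def c[OF that] by (simp add: add.assoc[symmetric])
  have dec: "\<exists>i. \<exists>q\<in>?Q. v = zm i y + q \<and> c v = i \<and> r v = q" if "v \<in> ?V" for v using rep[OF that] c r by metis
  have sum: "c (v + w) = c v + c w \<and> r (v + w) = r v + r w" if vw: "v \<in> ?V" "w \<in> ?V" for v w
  proof -
   obtain i q where q: "q \<in> ?Q" "v = zm i y + q" using rep[OF vw(1)] by blast
   obtain j q' where q': "q' \<in> ?Q" "w = zm j y + q'" using rep[OF vw(2)] by blast
   have "q + zm j y = zm j y + q" using comm sg_zm[OF sg_gen yV] QV q by blast
   then have "v + w = zm (i + j) y + (q + q')" unfolding q(2) q'(2) zm_add by (metis add.assoc)
   then show ?thesis using c r q q' sg_add[OF sg_gen q(1) q'(1)] by metis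
  qed
  show ?thesis
  proof (intro exI[of _ "insert c ((\<lambda>\<psi> v. \<psi> (r v)) ` \<Psi>)"] exI[of _ e] conjI ballI impI)
   have rQ: "r v \<in> ?Q" if "v \<in> ?V" for v using dec[OF that] by auto
   show "hm \<psi> ?V" if ps: "\<psi> \<in> insert c ((\<lambda>\<psi> v. \<psi> (r v)) ` \<Psi>)" for \<psi>
   proof (cases "\<psi> = c")
    case True
    then show ?thesis using sum by (simp add: hm_def)
   next
    case False
    then obtain \<psi>' where p: "\<psi>' \<in> \<Psi>" "\<psi> = (\<lambda>v. \<psi>' (r v))" using ps by blast
    have "\<psi>' (r (v + w)) = \<psi>' (r v) + \<psi>' (r w)" if "v \<in> ?V" "w \<in> ?V" for v w
     unfolding conjunct2[OF sum[OF that]] by (rule hmD[of _ ?Q]) (use I(3) p(1) rQ[OF that(1)] rQ[OF that(2)] in blast)+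
    then show ?thesis by (simp add: hm_def p(2))
   qed
   show "nm e v = 0" if v: "v \<in> ?V" "\<forall>\<psi>\<in>insert c ((\<lambda>\<psi> v. \<psi> (r v)) ` \<Psi>). \<psi> v = 0" for v
   proof -
    have "c v = 0" "\<forall>\<psi>\<in>\<Psi>. \<psi> (r v) = 0" using v(2) by auto
    moreover have "r v = v" unfolding r_def \<open>c v = 0\<close> by simp
    ultimately show ?thesis using I(4) rQ[OF v(1)] by simp
   qed
  qed (use I in auto)
 qed
qed

lemma nrm_der_self: "sg B ==> nrm B (der B)" using nrm_der nrm_self by blast

text \<open>Integer homomorphisms see exactly the torsion-free part of the abelianization of a
  finitely generated group, and one exponent \<open>e\<close> kills what they miss.\<close>

lemma separation:
 fixes Y B :: "'g::group_add set"
 assumes "finite Y" "B = gen Y"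
 obtains \<Psi> :: "('g \<Rightarrow> int) set" and e :: nat where "finite \<Psi>" "e \<ge> 1" "\<forall>\<psi>\<in>\<Psi>. hm \<psi> B"
  "\<forall>x\<in>B. (\<forall>\<psi>\<in>\<Psi>. \<psi> x = 0) --> nm e x \<in> der B"
proof -
 have sgX: "sg B" using assms sg_gen by simp
 obtain f :: "'g \<Rightarrow> 'g set bijn" where f: "hm f B" "\<And>u. u \<in> B ==> f u = 0 \<longleftrightarrow> u \<in> der B"
  using ex_quotient_hom[OF sgX sg_der der_sub[OF sgX] nrm_der_self[OF sgX]] by blast
 obtain ys where ys: "set ys = f ` Y" using assms(1) by (meson finite_imageI finite_list)
 have im: "f ` B = gen (set ys)" using hm_gen[OF f(1) sgX] assms(2) gen_base[of Y] ys by auto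
 have "a + b = b + a" if ab: "a \<in> gen (set ys)" "b \<in> gen (set ys)" for a b
 proof -
  obtain u v where uv: "u \<in> B" "v \<in> B" "a = f u" "b = f v" using ab unfolding im[symmetric] by blast
  then have "cm a b = 0" using hm_cm[OF f(1) sgX] f(2)[OF sg_cm[OF sgX]] der_cm by metis
  then show ?thesis by (simp add: cm_zero_iff)
 qed
 then obtain \<Psi> e where P: "finite \<Psi>" "e \<ge> 1" "\<forall>\<psi>\<in>\<Psi>. hm \<psi> (f ` B)" "\<forall>v\<in>f ` B. (\<forall>\<psi>\<in>\<Psi>. \<psi> v = (0::int)) --> nm e v = 0"
  using abelian_separation[of ys] unfolding im by blast
 show ?thesis
 proof (rule that[of "(\<lambda>\<psi> x. \<psi> (f x)) ` \<Psi>" e])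
  show "\<forall>\<psi>\<in>(\<lambda>\<psi> x. \<psi> (f x)) ` \<Psi>. hm \<psi> B" using P(3) f(1) unfolding hm_def by auto
  show "\<forall>x\<in>B. (\<forall>\<psi>\<in>(\<lambda>\<psi> x. \<psi> (f x)) ` \<Psi>. \<psi> x = 0) --> nm e x \<in> der B"
  proof (intro ballI impI)
   fix x assume x: "x \<in> B" "\<forall>\<psi>\<in>(\<lambda>\<psi> x. \<psi> (f x)) ` \<Psi>. \<psi> x = 0"
   then have "f (nm e x) = 0" using P(4) hm_nm[OF f(1) sgX] by simp
   then show "nm e x \<in> der B" using f(2)[OF sg_nm[OF sgX x(1)]] by blast
  qed
 qed (use P in auto)
qed

lemma hm_int_cm: "hm (\<psi> :: 'g::group_add \<Rightarrow> int) B ==> sg B ==> x \<in> B ==> y \<in> B ==> \<psi> (cm x y) = 0"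
 by (simp add: hm_cm cm_int)

lemma sg_kernel: assumes "hm \<psi> B" "sg B" shows "sg {x \<in> B. \<psi> x = (0::int)}"
 by (rule sgI) (use assms in \<open>auto simp: sg_zero sg_add sg_neg hm_zero hm_neg hmD\<close>)

lemma hm_int_der: assumes "hm (\<psi> :: 'g::group_add \<Rightarrow> int) B" "sg B" "x \<in> der B" shows "\<psi> x = 0"
 using der_least[OF sg_kernel[OF assms(1,2)], of B] assms hm_int_cm sg_cm by blast

subsection \<open>Groups of growth below the sixth root\<close>

text \<open>A basis is extracted greedily from a spanning list. In doing so every retained element
  lies outside the span of the later ones, which makes the basis an ascending list.\<close>

lemma elementary_rank:
 fixes V :: "'g::group_add set"
 assumes V: "sg V" "\<And>a b. a \<in> V ==> b \<in> V ==> a + b = b + a" "\<And>a. a \<in> V ==> nm p a = 0"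
  and p: "Factorial_Ring.prime (p::nat)" and "set ys \<subseteq> V"
 shows "\<exists>xs. set xs \<subseteq> set ys \<and> asc xs \<and> finite (gen (set ys)) \<and> card (gen (set ys)) = p ^ length xs"
 using assms(5)
proof (induction ys)
 case Nil
 show ?case by (intro exI[of _ "[]"]) (simp add: gen_empty)
next
 case (Cons y ys)
 let ?Q = "gen (set ys)" and ?V = "gen (set (y # ys))"
 obtain xs where xs: "set xs \<subseteq> set ys" "asc xs" "finite ?Q" "card ?Q = p ^ length xs" using Cons by auto
 have yV: "y \<in> V" and QV: "?Q \<subseteq> V" "?V \<subseteq> V" using Cons.prems gen_least[OF V(1)] by auto
 have p1: "p > 0" using p by (simp add: prime_gt_0_nat)
 show ?case
 proof (cases "y \<in> ?Q")
  case True
  then have "?V \<subseteq> ?Q" using gen_least[OF sg_gen, of "set (y # ys)" "set ys"] gen_base[of "set ys"] by auto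
  then have "?V = ?Q" using gen_mono[of "set ys" "set (y # ys)"] by auto
  then show ?thesis using xs by (intro exI[of _ xs]) auto
 next
  case False
  have "y \<notin> gen (set xs)" using False gen_mono[OF xs(1)] by blast
  then have a: "asc (y # xs)" using xs by simp
  let ?h = "\<lambda>(i, q). nm i y + q"
  have im: "?V = ?h ` ({..<p} \<times> ?Q)"
   using gen_insert_torsion[of y "set ys" p] V(2)[OF subsetD[OF QV(2)] subsetD[OF QV(2)]] V(3)[OF yV] p1 by simp
  have less: False if ij: "i < j" "j < p" "nm i y + q = nm j y + q'" "q \<in> ?Q" "q' \<in> ?Q" for i j q q'
  proof -
   define k where "k = j - i"
   have k: "0 < k" "k < p" "j = i + k" using ij by (auto simp: k_def)
   have "nm k y + q' = q" using ij(3) by (simp add: k(3) nm_add add.assoc)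
   then have kQ: "nm k y \<in> ?Q" using sg_add_right[OF sg_gen ij(5), of "nm k y"] ij(4) by simp
   \<comment> \<open>By Bezout, a multiple of \<open>y\<close> by some \<open>k\<close> strictly
     between 0 and \<open>p\<close> generates \<open>y\<close> itself.\<close>
   have "coprime k p" using k p by (metis coprime_commute dvd_imp_le not_less prime_imp_coprime)
   then obtain a b where "k * a = p * b + 1" using bezout_nat[of k p] k by (auto simp: coprime_iff_gcd_eq_1)
   then have "nm a (nm k y) = nm b (nm p y) + y" by (metis add.commute mult.commute nm_1 nm_add nm_mult One_nat_def)
   then show False using False sg_nm[OF sg_gen kQ, of a] V(3)[OF yV] by simp
  qed
  have inj: "inj_on ?h ({..<p} \<times> ?Q)"
  proof (rule inj_onI)
   fix a b assume "a \<in> {..<p} \<times> ?Q" "b \<in> {..<p} \<times> ?Q" "?h a = ?h b"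
   then obtain i q j q' where *: "a = (i, q)" "b = (j, q')" "i \<in> {..<p}" "j \<in> {..<p}" "q \<in> ?Q" "q' \<in> ?Q" "nm i y + q = nm j y + q'"
    by auto
   then have "i = j" using less[of i j q q'] less[of j i q' q] by (metis lessThan_iff linorder_neqE_nat)
   then show "a = b" using * by simp
  qed
  have "finite ?V" "card ?V = p ^ length (y # xs)" unfolding im using card_image[OF inj] xs by auto
  then show ?thesis using a xs by (intro exI[of _ "y # xs"]) auto
 qed
qed

lemma asc_lift: assumes "hm f B" "sg B" shows "set ys \<subseteq> B ==> asc (map f ys) ==> asc ys"
proof (induction ys)
 case (Cons y ys)
 then have "y \<notin> gen (set ys)" using hm_gen[OF assms, of "set ys"] by auto
 then show ?case using Cons by simp
qed simp

text \<open>A basis of the quotient over the field with \<open>p\<close> elements can be chosen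
  among the images of the short generators; it lifts to an ascending list of short elements, so the
  chain condition bounds the rank.\<close>

lemma exponent_quotient:
 fixes B :: "'g::group_add set"
 assumes Y: "finite Y" "B = gen Y" "Y \<subseteq> ball S l" and nc: "nochain S M l" and p: "Factorial_Ring.prime (p::nat)"
  and W: "sg W" "W \<subseteq> B" "nrm B W" "der B \<subseteq> W" "\<And>x. x \<in> B ==> nm p x \<in> W"
 shows "finite (cos B W) \<and> (\<exists>q<M. idx B W = p ^ q)"
proof -
 have sgX: "sg B" using Y sg_gen by simp
 obtain f :: "'g \<Rightarrow> 'g set bijn" where f: "hm f B" "\<And>u. u \<in> B ==> f u = 0 \<longleftrightarrow> u \<in> W"
  using ex_quotient_hom[OF sgX W(1,2,3)] by blast
 obtain ys where ys: "set ys = f ` Y" using Y(1) by (meson finite_imageI finite_list)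
 have YB: "Y \<subseteq> B" using Y(2) gen_base by blast
 have im: "f ` B = gen (set ys)" using hm_gen[OF f(1) sgX YB] Y(2) ys by auto
 have "\<exists>xs. set xs \<subseteq> set ys \<and> asc xs \<and> finite (gen (set ys)) \<and> card (gen (set ys)) = p ^ length xs"
 proof (rule elementary_rank[OF _ _ _ p])
  show "sg (f ` B)" by (simp add: im sg_gen)
  show "a + b = b + a" if ab: "a \<in> f ` B" "b \<in> f ` B" for a b
  proof -
   obtain u v where uv: "u \<in> B" "v \<in> B" "a = f u" "b = f v" using ab by blast
   then have "cm a b = 0" using hm_cm[OF f(1) sgX] f(2)[OF sg_cm[OF sgX]] der_cm W(4) by (metis subsetD)
   then show ?thesis by (simp add: cm_zero_iff)
  qed
  show "nm p a = 0" if "a \<in> f ` B" for a using that hm_nm[OF f(1) sgX] f(2)[OF sg_nm[OF sgX]] W(5) by force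
  show "set ys \<subseteq> f ` B" using im gen_base by blast
 qed
 then obtain xs where xs: "set xs \<subseteq> f ` Y" "asc xs" "finite (f ` B)" "card (f ` B) = p ^ length xs"
  unfolding im ys[symmetric] by blast
 have "xs \<in> map f ` lists Y" using xs(1) by (simp add: lists_image[symmetric] in_lists_conv_set subset_iff)
 then obtain zs where zs: "set zs \<subseteq> Y" "map f zs = xs" by auto
 then have "asc zs" using asc_lift[OF f(1) sgX] xs(2) YB by blast
 then have "length zs < M" using nc Y(3) zs(1) unfolding nochain_def by blast
 moreover have "length zs = length xs" using zs(2) by auto
 ultimately show ?thesis using idx_hom[OF f(1) sgX W(1,2) f(2)] xs(3,4) by metis
qed

text \<open>The section of \<open>B\<close> modulo \<open>der B\<close> and \<open>p\<close>-th
  multiples has fewer than \<open>M\<close> prime factors, uniformly in \<open>p\<close>, so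
  \<open>section_bound\<close> gives a derived length at most \<open>k\<close>. The action on it is
  solvable because \<open>B\<close>, a derived subgroup itself, acts trivially.\<close>

lemma trivial_mod_prime:
 fixes S :: "'g::group_add set"
 assumes B: "B = dern j (gen S)" "B = gen Y" "finite Y" "Y \<subseteq> ball S l" and nc: "nochain S M l"
  and k: "2 ^ 40 * M\<^sup>2 \<le> 2 ^ k" and p: "Factorial_Ring.prime (p::nat)"
  and d: "d \<in> dern k (gen S)" "x \<in> B"
 shows "cm d x \<in> gen (der B \<union> nm p ` B)"
proof -
 let ?G = "gen S" and ?W = "gen (der B \<union> nm p ` B)"
 have sgX: "sg B" unfolding B(2) by (rule sg_gen)
 have XG: "B \<subseteq> ?G" using B(1) dern_sub[OF sg_gen] by blast
 have nX: "nrm ?G B" using B(1) nrm_dern[OF nrm_self[OF sg_gen]] by simp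
 have WX: "?W \<subseteq> B" by (rule gen_least[OF sgX]) (use der_sub[OF sgX] sg_nm[OF sgX] in auto)
 have dW: "der B \<subseteq> ?W" "\<And>x. x \<in> B ==> nm p x \<in> ?W" using gen_base[of "der B \<union> nm p ` B"] by auto
 have nW: "nrm ?G ?W"
 proof (rule nrm_gen)
  fix g s assume g: "g \<in> ?G" and s: "s \<in> der B \<union> nm p ` B"
  from s show "g + s + - g \<in> ?W"
  proof
   assume "s \<in> der B" then show ?thesis using nrmD[OF nrm_der[OF nX] g] dW(1) by blast
  next
   assume "s \<in> nm p ` B"
   then obtain x where "x \<in> B" "s = nm p x" by blast
   then show ?thesis using dW(2)[OF nrmD[OF nX g]] by (simp add: nm_cj[symmetric])
  qed
 qed
 have fin: "finite (cos B ?W) \<and> (\<exists>q<M. idx B ?W = p ^ q)"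
  by (rule exponent_quotient[OF B(3,2,4) nc p sg_gen WX nrm_sub[OF nW XG] dW])
 then obtain q where q: "q < M" "idx B ?W = p ^ q" by blast
 have S: "sec ?G B ?W" unfolding sec_def using sgX sg_gen WX nX nW fin der_cm dW(1) by blast
 have "dern j ?G = B" using B(1) by simp
 then have so: "solv ?G B ?W" unfolding solv_def triv_def using der_cm dW(1) by blast
 show ?thesis
 proof (cases "idx B ?W \<le> 1")
  case True
  then have "B = ?W" using idx_1[OF sgX sg_gen WX] fin by blast
  then show ?thesis using nrm_cm[OF sg_gen nW, of d x] d dern_sub[OF sg_gen] by blast
 next
  case False
  then obtain e where e: "2 ^ e \<le> 2 ^ 40 * (Om (idx B ?W))\<^sup>2" "triv (dern e ?G) B ?W" using section_bound[OF S so] by auto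
  have "Om (idx B ?W) \<le> M" using q p Om_power[of p q] Om_prime[OF p] by (simp add: prime_gt_0_nat)
  then have "2 ^ 40 * (Om (idx B ?W))\<^sup>2 \<le> 2 ^ 40 * M\<^sup>2" by (intro mult_le_mono2 power_mono) auto
  then have "(2::nat) ^ e \<le> 2 ^ k" using e(1) k by linarith
  then have "e \<le> k" by (rule power_le_imp_le_exp[rotated]) simp
  then show ?thesis using triv_dern_mono[OF e(2) sg_gen] d unfolding triv_def by blast
 qed
qed

text \<open>The value is divisible by every prime, and only 0 is.\<close>

lemma hom_invariant:
 fixes \<psi> :: "'g::group_add \<Rightarrow> int"
 assumes "sg B" "hm \<psi> B" "\<And>p::nat. Factorial_Ring.prime p ==> z \<in> gen (der B \<union> nm p ` B)" shows "\<psi> z = 0"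
proof (rule ccontr)
 assume nz: "\<psi> z \<noteq> 0"
 obtain p :: nat where p: "Factorial_Ring.prime p" "nat \<bar>\<psi> z\<bar> < p" using bigger_prime by blast
 let ?K = "{x \<in> B. int p dvd \<psi> x}"
 have "sg ?K" by (rule sgI) (use assms(1,2) in \<open>auto simp: sg_zero sg_add sg_neg hm_zero hm_neg hmD\<close>)
 moreover have "der B \<union> nm p ` B \<subseteq> ?K"
  using hm_int_der[OF assms(2,1)] hm_nm[OF assms(2,1)] der_sub[OF assms(1)] sg_nm[OF assms(1)] by (auto simp: nm_int)
 ultimately have "int p dvd \<psi> z" using gen_least assms(3)[OF p(1)] by blast
 then have "int p \<le> \<bar>\<psi> z\<bar>" using nz dvd_imp_le_int[of "\<psi> z" "int p"] by simp
 then show False using p(2) by linarith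
qed

text \<open>Commutators of \<open>D\<close> with \<open>der D\<close> centralize \<open>der D\<close>, and further commutators of them with \<open>D\<close> are
 torsion; by the three subgroups lemma \<open>der (der D)\<close> is torsion.\<close>

lemma central_torsion_free:
 assumes D: "sg (D :: 'g::group_add set)" and cen: "\<And>d z. d \<in> D ==> z \<in> der (der D) ==> cm d z = 0"
  and tf: "\<And>n z. n \<ge> 1 ==> z \<in> der (der D) ==> nm n z = 0 ==> z = 0"
  and tor: "\<And>d x. d \<in> D ==> x \<in> der D ==> \<exists>n\<ge>1. nm n (cm d x) \<in> der (der D)"
 shows "der (der D) = {0}"
proof -
 let ?X = "der D" and ?Z = "der (der D)"
 have XD: "?X \<subseteq> D" and ZX: "?Z \<subseteq> ?X" using der_sub[OF D] der_sub[OF sg_der] by auto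
 have nX: "nrm D ?X" and nZ: "nrm D ?Z" using nrm_der nrm_self[OF D] by auto
 have z0: "sg {0::'g}" by (simp add: sg_def)
 have n0: "nrm D {0}" by (simp add: nrm_def)
 \<comment> \<open>\<open>C\<close> is the centre of \<open>der D\<close>. Commutators of
   \<open>D\<close> with \<open>der D\<close> will fall into \<open>A\<close>, those of
   \<open>D\<close> with \<open>A\<close> into the torsion \<open>T\<close>.\<close>
 define C where "C = {u \<in> ?X. \<forall>y\<in>?X. cm u y \<in> {0}}"
 have sgC: "sg C" unfolding C_def by (rule sg_centralizer[OF sg_der z0 nrm_sub[OF n0 XD]])
 have nC: "nrm D C" unfolding C_def by (rule nrm_centralizer[OF D nX n0 nX])
 have Cc: "u + v = v + u" if "u \<in> C" "v \<in> C" for u v using that by (auto simp: C_def cm_zero_iff[symmetric])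
 define A where "A = {u \<in> C. \<exists>n\<ge>1. nm n u \<in> ?Z}"
 define T where "T = {u \<in> C. \<exists>n\<ge>1. nm n u \<in> {0}}"
 have sgT: "sg {u \<in> C. \<exists>n\<ge>1. nm n u \<in> N}" if N: "sg N" for N
 proof (rule sgI)
  show "0 \<in> {u \<in> C. \<exists>n\<ge>1. nm n u \<in> N}" using sg_zero[OF sgC] sg_zero[OF N] by auto
  fix u assume u: "u \<in> {u \<in> C. \<exists>n\<ge>1. nm n u \<in> N}"
  then show "- u \<in> {u \<in> C. \<exists>n\<ge>1. nm n u \<in> N}" using sg_neg[OF sgC] sg_neg[OF N] by (auto simp: nm_neg)
  fix v assume v: "v \<in> {u \<in> C. \<exists>n\<ge>1. nm n u \<in> N}"
  obtain m n where mn: "m \<ge> 1" "n \<ge> 1" "nm m u \<in> N" "nm n v \<in> N" using u v by blast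
  have "nm (n * m) (u + v) = nm n (nm m u) + nm m (nm n v)"
   using nm_comm[OF Cc] u v by (simp add: nm_mult[symmetric] mult.commute)
  then have "nm (n * m) (u + v) \<in> N" using mn sg_nm[OF N] sg_add[OF N] by simp
  moreover have "n * m \<ge> 1" using mn by simp
  ultimately show "u + v \<in> {u \<in> C. \<exists>n\<ge>1. nm n u \<in> N}" using u v sg_add[OF sgC] by blast
 qed
 have nT: "nrm D T" unfolding T_def nrm_def using nrmD[OF nC] by (auto simp: nm_cj)
 have "triv D ?X A" unfolding triv_def
 proof (intro ballI)
  fix d x assume dx: "d \<in> D" "x \<in> ?X"
  let ?u = "cm d x"
  have u: "?u \<in> ?X" using nrm_cm[OF sg_der nX dx] .
  obtain n where n: "n \<ge> 1" "nm n ?u \<in> ?Z" using tor[OF dx] by blast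
  have "cm ?u y = 0" if y: "y \<in> ?X" for y
  proof -
   \<comment> \<open>Commutators within \<open>der D\<close> lie in the central \<open>?Z\<close>,
     so the commutator is additive in multiples of \<open>?u\<close>. Some multiple of
     \<open>?u\<close> is itself central, and torsion-freeness concludes.\<close>
   have "cm (nm m ?u) y = nm m (cm ?u y)" for m
   proof (induction m)
    case (Suc m)
    let ?w = "nm m ?u"
    have wX: "?w \<in> ?X" using sg_nm[OF sg_der u] .
    have "cm ?w y \<in> ?Z" using der_cm wX y by blast
    then have "cm ?u (cm ?w y) = 0" using cen u XD by blast
    then have "?u + cm ?w y + - ?u = cm ?w y" by (simp add: cm_zero_iff add.assoc)
    moreover have "cm (?u + ?w) y = ?u + cm ?w y + - ?u + cm ?u y" by (simp add: cm_def add.assoc minus_add)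
    ultimately show ?case by (metis nm_Suc nm_Suc2 Suc)
   qed simp
   moreover have "cm (nm n ?u) y = 0" using cen[OF subsetD[OF XD y] n(2)] neg_cm[of y "nm n ?u"] by simp
   ultimately show ?thesis using tf[OF n(1) der_cm[OF u y]] by metis
  qed
  then show "?u \<in> A" using u n by (auto simp: A_def C_def)
 qed
 moreover have "triv D A T" unfolding triv_def
 proof (intro ballI)
  fix d u assume d: "d \<in> D" and u: "u \<in> A"
  then obtain n where n: "n \<ge> 1" "nm n u \<in> ?Z" "u \<in> C" by (auto simp: A_def)
  have c: "d + u + - d \<in> C" using nrmD[OF nC d n(3)] .
  have "nm n (cm d u) = nm n (d + u + - d) + nm n (- u)"
   unfolding cm_def by (rule nm_comm[OF Cc[OF c sg_neg[OF sgC n(3)]]])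
  also have "\<dots> = cm d (nm n u)" by (simp only: nm_cj nm_neg cm_def)
  also have "\<dots> = 0" using cen d n(2) by blast
  finally show "cm d u \<in> T" using nrm_cm[OF sgC nC d n(3)] n(1) by (auto simp: T_def)
 qed
 \<comment> \<open>By \<open>merge_triv\<close> the derived subgroup of \<open>D\<close> acts
   trivially on itself modulo \<open>T\<close>; its commutators are then torsion in the torsion-free
   \<open>?Z\<close>.\<close>
 ultimately have t: "triv ?X ?X T"
 proof (intro merge_triv[where M = D])
  show "sg T" unfolding T_def by (rule sgT[OF z0])
  show "A \<subseteq> D" "T \<subseteq> D" using XD by (auto simp: A_def T_def C_def)
  show "cm a b \<in> T" if "a \<in> A" "b \<in> A" for a b
   using that Cc[of a b] sg_zero[OF sgC] by (auto simp: A_def T_def cm_zero_iff[symmetric] intro: exI[of _ 1])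
 qed (use D XD nX nT in auto)
 have "?Z \<subseteq> {0}"
 proof (rule der_least[OF z0])
  fix x y assume xy: "x \<in> ?X" "y \<in> ?X"
  then have "cm x y \<in> T" using t by (auto simp: triv_def)
  then show "cm x y \<in> {0}" using tf der_cm[OF xy] by (auto simp: T_def)
 qed
 then show ?thesis using sg_zero[OF sg_der] by blast
qed

definition slow6 :: "'g::group_add set \<Rightarrow> bool"
 where "slow6 S \<longleftrightarrow> (\<forall>L. \<exists>M\<ge>1. card (ball S (L * M ^ 6)) < 2 ^ M)"

lemma slow6_slow: assumes "finite S" "slow6 S" shows "slow S"
 unfolding slow_def
proof
 fix L
 obtain M where M: "M \<ge> 1" "card (ball S (L * M ^ 6)) < 2 ^ M" using assms(2) unfolding slow6_def by blast
 have "L * M * M \<le> L * M ^ 6" using power_increasing[of 2 6 M] M(1) by (simp add: power2_eq_square mult.assoc)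
 then have "card (ball S (L * M * M)) \<le> card (ball S (L * M ^ 6))" by (intro card_mono finite_ball ball_mono assms)
 then show "\<exists>N\<ge>1. card (ball S (L * N * N)) < 2 ^ N" using M by (intro exI[of _ M]) auto
qed

text \<open>The recursion from \<open>l\<close> to \<open>4 * l + 2 * M\<close>, started at 1, stays
  below \<open>4 ^ j * (1 + M) - M\<close>; subtracting \<open>M\<close> absorbs the additive
  term.\<close>

lemma short_dern:
 assumes "nochain S M l" "4 ^ j * (1 + M) \<le> l"
 shows "\<exists>Y\<subseteq>ball S (4 ^ j * (1 + M) - M). dern j (gen S) = gen Y"
 using assms(2)
proof (induction j)
 case 0
 then show ?case using ball_base by (intro exI[of _ S]) auto
next
 case (Suc j)
 let ?l = "4 ^ j * (1 + M) - M"
 have b: "4 * ?l + 2 * M \<le> 4 ^ Suc j * (1 + M) - M"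
 proof -
  have "1 * (1 + M) \<le> 4 ^ j * (1 + M)" by (rule mult_le_mono1) simp
  moreover have "4 * (a - M) + 2 * M \<le> 4 * a - M" if "1 * (1 + M) \<le> a" for a using that by arith
  ultimately show ?thesis unfolding power_Suc mult.assoc by blast
 qed
 obtain Y where Y: "Y \<subseteq> ball S ?l" "dern j (gen S) = gen Y" using Suc by auto
 have n: "nrm (gen S) (gen Y)" using nrm_dern[OF nrm_self[OF sg_gen], of S j] Y(2) by simp
 have nc: "nochain S M (4 * ?l + 2 * M)" by (rule nochain_mono[OF assms(1)]) (use b Suc.prems in linarith)
 obtain Y' where Y': "Y' \<subseteq> ball S (4 * ?l + 2 * M)" "der (gen Y) = gen Y'" using short_der[OF nc Y(1) n] by blast
 have "Y' \<subseteq> ball S (4 ^ Suc j * (1 + M) - M)" using Y'(1) ball_mono[OF b] by blast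
 then show ?case using Y'(2) Y(2) by (intro exI[of _ Y']) (simp add: dern_Suc)
qed

lemma cone_sub: "cone P G ==> sg H ==> H \<subseteq> G ==> cone (P \<inter> H) H"
 using sg_add[of H] sg_neg[of H] unfolding cone_def by auto

text \<open>Were \<open>dern (k + 2)\<close> nontrivial, it would have a nonzero homomorphism to the
  integers. Modulo the kernel, \<open>dern (k + 2)\<close> becomes torsion-free and central in
  \<open>dern k\<close>, and commutators of \<open>dern k\<close> with \<open>dern (k + 1)\<close>
  have multiples in it; then \<open>central_torsion_free\<close> makes it vanish. This is why the
  trivial action is required on two consecutive levels.\<close>

theorem slow6_solvable:
 fixes S :: "'g::group_add set"
 assumes fin: "finite S" and slow6: "slow6 S" and cone: "cone P (gen S)"
 shows "\<exists>l. dern l (gen S) = {0}"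
proof -
 let ?G = "gen S"
 \<comment> \<open>From 2^k <= 2^41 M^2 follow 4^k <= 2^82 M^4 and
   \<open>l = 16 * 4 ^ k * (1 + M) \<le> 2 ^ 87 * M ^ 5\<close>; a chain of \<open>M\<close>
   elements then explains the radius.\<close>
 obtain M where M: "M \<ge> 1" "card (ball S (2 ^ 87 * M ^ 6)) < 2 ^ M" using slow6 unfolding slow6_def by blast
 have "1 \<le> 2 ^ 40 * M\<^sup>2" using M(1) by (simp add: Suc_le_eq)
 then obtain v where v: "2 ^ v \<le> 2 ^ 40 * M\<^sup>2" "\<And>d. 2 ^ d \<le> 2 ^ 40 * M\<^sup>2 ==> d \<le> v" using max_exponent by blast
 \<comment> \<open>One more than the integer part of the logarithm, so that 2^k lies above
   \<open>2 ^ 40 * M\<^sup>2\<close> and at most at its double.\<close>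
 define k where "k = Suc v"
 have k: "2 ^ 40 * M\<^sup>2 \<le> 2 ^ k" "2 ^ k \<le> 2 ^ 41 * M\<^sup>2" using v(1) v(2)[of k] by (auto simp: k_def not_le[symmetric] intro: ccontr)
 define l where "l = 4 ^ (k + 2) * (1 + M)"
 have "l \<le> 2 ^ 87 * M ^ 5"
 proof -
  have "(4::nat) ^ k = (2 ^ k)\<^sup>2" by (metis mult.commute power2_eq_square power_mult numeral_Bit0_eq_double mult_2 numeral_Bit0 power_even_eq)
  also have "\<dots> \<le> (2 ^ 41 * M\<^sup>2)\<^sup>2" using k(2) by (intro power_mono) auto
  also have "\<dots> = 2 ^ 82 * M ^ 4" by (simp add: power_mult_distrib)
  finally have *: "(4::nat) ^ k \<le> 2 ^ 82 * M ^ 4" .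
  have "l = 16 * 4 ^ k * (1 + M)" by (simp add: l_def power_add)
  also have "\<dots> \<le> 16 * (2 ^ 82 * M ^ 4) * (2 * M)" using M(1) by (intro mult_le_mono order_refl *) simp
  also have "\<dots> = 2 ^ 87 * M ^ 5" using power_add[of M 4 1] by simp
  finally show ?thesis .
 qed
 then have "l * M \<le> 2 ^ 87 * M ^ 6" using mult_le_mono1[of l "2 ^ 87 * M ^ 5" M] power_add[of M 5 1] by (simp add: mult.assoc)
 then have nc: "nochain S M l" using nochainI[OF fin M(2)] by blast
 have slow: "slow S" by (rule slow6_slow[OF fin slow6])
 let ?D = "dern k ?G"
 have gens: "\<exists>Y. finite Y \<and> Y \<subseteq> ball S l \<and> dern j ?G = gen Y" if "j \<le> k + 2" for j
 proof -
  have "4 ^ j * (1 + M) \<le> l" unfolding l_def using that by (intro mult_le_mono1 power_increasing) auto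
  then obtain Y where "Y \<subseteq> ball S (4 ^ j * (1 + M) - M)" "dern j ?G = gen Y" "4 ^ j * (1 + M) - M \<le> l" using short_dern[OF nc] by force
  then show ?thesis using ball_mono[of _ l S] finite_ball[OF fin] by (meson finite_subset order_trans)
 qed
 have inv: "\<psi> (cm d x) = 0" if "j \<le> k + 2" "hm (\<psi> :: 'g \<Rightarrow> int) (dern j ?G)" "d \<in> ?D" "x \<in> dern j ?G" for j \<psi> d x
 proof -
  obtain Y where Y: "finite Y" "Y \<subseteq> ball S l" "dern j ?G = gen Y" using gens \<open>j \<le> k + 2\<close> by blast
  show ?thesis
   by (rule hom_invariant[OF sg_dern[OF sg_gen] that(2)])
    (rule trivial_mod_prime[OF refl Y(3,1,2) nc k(1) _ that(3,4)])
 qed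
 have D: "sg ?D" using sg_dern[OF sg_gen] .
 have X1: "der ?D = dern (k + 1) ?G" and X2: "der (der ?D) = dern (k + 2) ?G" by (simp_all add: dern_Suc)
 let ?X = "der (der ?D)"
 have XD: "?X \<subseteq> ?D" "?X \<subseteq> ?G" using der_sub[OF D] der_sub[OF sg_der, of ?D] dern_sub[OF sg_gen, of k S] by blast+
 obtain Y1 where Y1: "finite Y1" "der ?D = gen Y1" using gens[of "k + 1"] X1 by auto
 obtain Y2 where Y2: "finite Y2" "?X = gen Y2" using gens[of "k + 2"] X2 by auto
 have "?X = {0}"
 proof (rule ccontr)
  assume ne: "?X \<noteq> {0}"
  have "slow Y2" using slow_sub[OF fin slow Y2(1)] gen_base[of Y2] Y2(2) XD(2) by blast
  moreover have "cone (P \<inter> gen Y2) (gen Y2)" by (rule cone_sub[OF cone sg_gen]) (use XD(2) Y2(2) in simp)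
  moreover have "gen Y2 \<noteq> {0}" using ne Y2(2) by simp
  ultimately obtain g where "g \<in> gen Y2" "\<And>n. n \<ge> 1 ==> nm n g \<notin> der (gen Y2)"
   by (rule slow_nontorsion[OF Y2(1)]) (rule that, assumption+)
  then have g: "g \<in> ?X" "\<And>n. n \<ge> 1 ==> nm n g \<notin> der ?X" unfolding Y2(2) by blast+
  obtain \<Psi> :: "('g \<Rightarrow> int) set" and e where s2: "e \<ge> 1" "\<forall>\<psi>\<in>\<Psi>. hm \<psi> ?X"
   "\<forall>x\<in>?X. (\<forall>\<psi>\<in>\<Psi>. \<psi> x = 0) --> nm e x \<in> der ?X"
   by (rule separation[OF Y2]) (rule that, assumption+)
  have "nm e g \<notin> der ?X" using g(2) s2(1) by simp
  then obtain \<phi> where "\<phi> \<in> \<Psi>" "\<phi> g \<noteq> 0" using s2(3) g(1) by blast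
  then have p: "hm \<phi> ?X" "\<phi> g \<noteq> 0" using s2(2) by auto
  \<comment> \<open>Invariance of the homomorphism under \<open>?D\<close> makes its kernel normal
    in \<open>?D\<close> and the quotient \<open>?X / K\<close> central.\<close>
  define K where "K = {x \<in> ?X. \<phi> x = 0}"
  have sgK: "sg K" unfolding K_def by (rule sg_kernel[OF p(1) sg_der])
  have cmK: "cm d z \<in> K" if "d \<in> ?D" "z \<in> ?X" for d z
   using inv[of "k + 2" \<phi> d z] p(1) that nrm_cm[OF sg_der nrm_der[OF nrm_der[OF nrm_self[OF D]]]] by (auto simp: K_def X2)
  have KX: "K \<subseteq> ?X" by (auto simp: K_def)
  have KD: "K \<subseteq> ?D" using KX XD by blast
  have nK: "nrm ?D K" by (rule nrm_of_cm[OF sgK]) (use cmK KX in blast)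
  obtain f :: "'g \<Rightarrow> 'g set bijn" where f: "hm f ?D" "\<And>u. u \<in> ?D ==> f u = 0 \<longleftrightarrow> u \<in> K"
   using ex_quotient_hom[OF D sgK KD nK] by blast
  have i1: "der (f ` ?D) = f ` der ?D" using hm_der[OF f(1) D order_refl] by simp
  have i2: "der (der (f ` ?D)) = f ` ?X" unfolding i1 using hm_der[OF f(1) D der_sub[OF D]] by simp
  have "der (der (f ` ?D)) = {0}"
  proof (rule central_torsion_free)
   show "sg (f ` ?D)" by (rule hm_sg_image[OF f(1) D D order_refl])
   show "cm d z = 0" if dz: "d \<in> f ` ?D" "z \<in> der (der (f ` ?D))" for d z
   proof -
    obtain d' z' where w: "d' \<in> ?D" "d = f d'" "z' \<in> ?X" "z = f z'" using dz unfolding i2 by blast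
    have "f (cm d' z') = 0" using f(2) cmK[OF w(1,3)] KD by blast
    then show ?thesis using hm_cm[OF f(1) D w(1)] w XD by auto
   qed
   show "z = 0" if z: "n \<ge> 1" "z \<in> der (der (f ` ?D))" "nm n z = 0" for n z
   proof -
    obtain z' where w: "z' \<in> ?X" "z = f z'" using z(2) unfolding i2 by blast
    have "f (nm n z') = 0" using hm_nm[OF f(1) D, of z' n] w XD z(3) by auto
    then have "nm n z' \<in> K" using f(2)[of "nm n z'"] sg_nm[OF D] w(1) XD by blast
    then have "z' \<in> K" using hm_nm[OF p(1) sg_der w(1), of n] w(1) z(1) by (simp add: K_def nm_int)
    then show ?thesis using f(2) KD w(2) by blast
   qed
   show "\<exists>n\<ge>1. nm n (cm d x) \<in> der (der (f ` ?D))" if dx: "d \<in> f ` ?D" "x \<in> der (f ` ?D)" for d x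
   proof -
    obtain d' x' where w: "d' \<in> ?D" "d = f d'" "x' \<in> der ?D" "x = f x'" using dx unfolding i1 by blast
    obtain \<Psi> :: "('g \<Rightarrow> int) set" and e where s: "e \<ge> 1" "\<forall>\<psi>\<in>\<Psi>. hm \<psi> (der ?D)"
     "\<forall>x\<in>der ?D. (\<forall>\<psi>\<in>\<Psi>. \<psi> x = 0) --> nm e x \<in> ?X" by (rule separation[OF Y1]) (rule that, assumption+)
    have u: "cm d' x' \<in> der ?D" "x' \<in> ?D" using nrm_cm[OF sg_der nrm_der[OF nrm_self[OF D]] w(1,3)] w(3) der_sub[OF D] by auto
    have "\<psi> (cm d' x') = 0" if "\<psi> \<in> \<Psi>" for \<psi>
     using inv[of "k + 1" \<psi> d' x'] s(2) that w by (simp only: X1)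
    then have "nm e (cm d' x') \<in> ?X" using s(3) u(1) by blast
    then have "f (nm e (cm d' x')) \<in> der (der (f ` ?D))" unfolding i2 by blast
    moreover have "f (nm e (cm d' x')) = nm e (cm d x)"
     using hm_nm[OF f(1) D sg_cm[OF D w(1) u(2)]] hm_cm[OF f(1) D w(1) u(2)] w by simp
    ultimately show ?thesis using s(1) by auto
   qed
  qed
  then have "f g = 0" using g(1) unfolding i2 by blast
  then show False using f(2)[of g] g(1) XD(1) p(2) by (auto simp: K_def)
 qed
 then show ?thesis using X2 by metis
qed

subsection \<open>Unipotent actions\<close>

text \<open>The operator h - 1 of the dual action by conjugation. It is defined on all functions;
  only values on the subgroup under study matter.\<close>

definition dif :: "'g::group_add \<Rightarrow> ('g \<Rightarrow> int) \<Rightarrow> 'g \<Rightarrow> int" where "dif h \<psi> = (\<lambda>x. \<psi> (h + x + - h) - \<psi> x)"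

text \<open>Unipotency in dual form: the m-th power of the augmentation ideal of \<open>E\<close>
  annihilates the function on \<open>B\<close>.\<close>

primrec nul :: "'g::group_add set \<Rightarrow> 'g set \<Rightarrow> nat \<Rightarrow> ('g \<Rightarrow> int) \<Rightarrow> bool" where
 "nul B E 0 \<psi> = (\<forall>x\<in>B. \<psi> x = 0)"
| "nul B E (Suc m) \<psi> = (\<forall>h\<in>E. nul B E m (dif h \<psi>))"

lemma dif_add: "dif h (\<lambda>x. \<psi> x + \<phi> x) = (\<lambda>x. dif h \<psi> x + dif h \<phi> x)" by (simp add: dif_def fun_eq_iff)
lemma dif_neg: "dif h (\<lambda>x. - \<psi> x) = (\<lambda>x. - dif h \<psi> x)" by (simp add: dif_def fun_eq_iff)
lemma dif_plus: "dif (g + h) \<psi> = (\<lambda>x. dif h (dif g \<psi>) x + (dif g \<psi> x + dif h \<psi> x))"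
 by (simp add: dif_def fun_eq_iff add.assoc minus_add)
lemma dif_minus: "dif (- h) \<psi> = (\<lambda>x. - (dif (- h) (dif h \<psi>) x + dif h \<psi> x))"
 by (simp add: dif_def fun_eq_iff add.assoc)

lemma nul_add: "nul B E m \<psi> ==> nul B E m \<phi> ==> nul B E m (\<lambda>x. \<psi> x + \<phi> x)"
 by (induction m arbitrary: \<psi> \<phi>) (auto simp: dif_add)
lemma nul_neg: "nul B E m \<psi> ==> nul B E m (\<lambda>x. - \<psi> x)"
 by (induction m arbitrary: \<psi>) (auto simp: dif_neg)

lemma nul_Suc: assumes "nrm E B" shows "nul B E m \<psi> ==> nul B E (Suc m) \<psi>"
proof (induction m arbitrary: \<psi>)
 case 0
 then show ?case using nrmD[OF assms] by (simp add: dif_def)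
qed auto

lemma nul_mono: assumes "nrm E B" "m \<le> n" "nul B E m \<psi>" shows "nul B E n \<psi>"
 using assms(2,3) by (induction n rule: dec_induct) (use nul_Suc[OF assms(1)] in blast)+

lemma nul_dif: "nrm E B ==> nul B E m \<psi> ==> h \<in> E ==> nul B E m (dif h \<psi>)"
 using nul_Suc[of E B m \<psi>] by simp

text \<open>\<open>dif_plus\<close> and \<open>dif_minus\<close> express gh - 1 and h^(-1) - 1
  through g - 1 and h - 1, so the elements whose difference is annihilated at stage \<open>m\<close>
  form a subgroup.\<close>

lemma nul_gen: assumes "nrm (gen Y) B" "\<And>y. y \<in> Y ==> nul B (gen Y) m (dif y \<psi>)" shows "nul B (gen Y) (Suc m) \<psi>"
proof -
 let ?A = "{h \<in> gen Y. nul B (gen Y) m (dif h \<psi>)}"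
 have "sg ?A"
 proof (rule sgI)
  have z: "nul B (gen Y) m (\<lambda>x. 0)" by (induction m) (auto simp: dif_def)
  then show "0 \<in> ?A" using sg_zero[OF sg_gen] by (auto simp: dif_def)
  show "g + h \<in> ?A" if "g \<in> ?A" "h \<in> ?A" for g h
   unfolding mem_Collect_eq dif_plus using that
   by (auto intro: nul_add[OF nul_dif[OF assms(1) _ _] nul_add] sg_add[OF sg_gen])
  show "- h \<in> ?A" if h: "h \<in> ?A" for h
  proof -
   have mh: "- h \<in> gen Y" using h sg_neg[OF sg_gen] by blast
   have "nul B (gen Y) m (\<lambda>x. - (dif (- h) (dif h \<psi>) x + dif h \<psi> x))"
    using nul_neg[OF nul_add[OF nul_dif[OF assms(1) _ mh]]] h by blast
   then show ?thesis using mh unfolding dif_minus[of h \<psi>, symmetric] by simp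
  qed
 qed
 then have "gen Y \<subseteq> ?A" by (rule gen_least) (use gen_base[of Y] assms(2) in auto)
 then show ?thesis by auto
qed

definition nule :: "'g::group_add set \<Rightarrow> 'g set \<Rightarrow> ('g \<Rightarrow> int) \<Rightarrow> bool" where "nule B E \<psi> \<longleftrightarrow> (\<exists>m. nul B E m \<psi>)"

lemma nule_add: assumes "nrm E B" "nule B E \<psi>" "nule B E \<phi>" shows "nule B E (\<lambda>x. \<psi> x + \<phi> x)"
proof -
 obtain m n where "nul B E m \<psi>" "nul B E n \<phi>" using assms by (auto simp: nule_def)
 then have "nul B E (max m n) \<psi>" "nul B E (max m n) \<phi>" using nul_mono[OF assms(1)] by (meson max.cobounded1 max.cobounded2)+
 then show ?thesis using nul_add unfolding nule_def by blast
qed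

lemma nule_neg: "nule B E \<psi> ==> nule B E (\<lambda>x. - \<psi> x)" using nul_neg unfolding nule_def by blast
lemma nule_dif: "nrm E B ==> nule B E \<psi> ==> h \<in> E ==> nule B E (dif h \<psi>)" using nul_dif unfolding nule_def by blast
lemma nule_gen: assumes "nrm (gen Y) B" "finite Y" "\<And>y. y \<in> Y ==> nule B (gen Y) (dif y \<psi>)" shows "nule B (gen Y) \<psi>"
proof -
 obtain m where m: "\<And>y. y \<in> Y ==> nul B (gen Y) (m y) (dif y \<psi>)" using assms(3) unfolding nule_def by metis
 have "nul B (gen Y) (Max (m ` Y)) (dif y \<psi>)" if "y \<in> Y" for y
  by (rule nul_mono[OF assms(1) _ m[OF that]]) (use assms(2) that in simp)
 then show ?thesis using nul_gen[OF assms(1)] unfolding nule_def by blast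
qed

text \<open>Kolchin's theorem for solvable groups: modulo functions already known to be annihilated, the derived subgroup fixes \<open>\<psi>\<close>,
 so the generators of \<open>E\<close> act on it by commuting unipotent maps.\<close>

lemma kolchin_step:
 fixes B :: "'g::group_add set"
 assumes E: "E = gen Y" "finite Y" and n: "nrm E B"
  and C: "\<And>\<psi> h. \<psi> \<in> \<C> ==> h \<in> E ==> dif h \<psi> \<in> \<C>"
  and uni: "\<And>\<psi> h. \<psi> \<in> \<C> ==> h \<in> E ==> \<exists>m. nul B E 0 ((dif h ^^ m) \<psi>)"
  and der: "\<psi> \<in> \<C>" "nul B (der E) m \<psi>"
 shows "nule B E \<psi>"
 using der
proof (induction m arbitrary: \<psi>)
 case 0
 then have "nul B E 0 \<psi>" by simp
 then show ?case unfolding nule_def by blast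
next
 case (Suc m)
 have sgE: "sg E" using E sg_gen by simp
 \<comment> \<open>Invariance under the derived subgroup up to annihilated functions.\<close>
 let ?F = "\<lambda>\<psi>. \<forall>k\<in>der E. nule B E (dif k \<psi>)"
 have F0: "?F \<psi>"
  using Suc C der_sub[OF sgE] by (metis nul.simps(2) subsetD)
 note add = nule_add[OF n] and neg = nule_neg
 have dE: "k \<in> E" if "k \<in> der E" for k using that der_sub[OF sgE] by blast
 have Fs: "?F (dif e \<phi>)" if e: "e \<in> E" and F: "?F \<phi>" for e \<phi>
 proof
  fix k assume k: "k \<in> der E"
  let ?k = "e + k + - e"
  have k': "?k \<in> der E" using nrmD[OF nrm_der_self[OF sgE] e k] .
  have "nule B E (\<lambda>x. (dif e (dif ?k \<phi>) x + dif ?k \<phi> x) + - dif k \<phi> x)"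
   using add[OF add[OF nule_dif[OF n _ e] _] neg] F k k' by blast
  moreover have "e + k = ?k + e" by (simp add: add.assoc)
  then have "dif (e + k) \<phi> = dif (?k + e) \<phi>" by (simp only:)
  then have "(\<lambda>x. (dif e (dif ?k \<phi>) x + dif ?k \<phi> x) + - dif k \<phi> x) = dif k (dif e \<phi>)"
   unfolding dif_plus fun_eq_iff by (auto simp: algebra_simps)
  ultimately show "nule B E (dif k (dif e \<phi>))" by simp
 qed
 have com: "nule B E (\<lambda>x. dif h (dif g \<phi>) x + - dif g (dif h \<phi>) x)" if gh: "g \<in> E" "h \<in> E" and F: "?F \<phi>" for g h \<phi>
 proof -
  have c: "nule B E (dif (cm g h) \<phi>)" using F der_cm gh by blast
  have "g + h = cm g h + (h + g)" by (simp add: cm_def add.assoc)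
  then have "dif (g + h) \<phi> = dif (cm g h + (h + g)) \<phi>" by (simp only:)
  then have "(\<lambda>x. dif (h + g) (dif (cm g h) \<phi>) x + dif (cm g h) \<phi> x) = (\<lambda>x. dif h (dif g \<phi>) x + - dif g (dif h \<phi>) x)"
   unfolding dif_plus[of "cm g h"] dif_plus[of g h \<phi>] dif_plus[of h g \<phi>] fun_eq_iff by (auto simp: algebra_simps)
  moreover have "nule B E (\<lambda>x. dif (h + g) (dif (cm g h) \<phi>) x + dif (cm g h) \<phi> x)"
   by (rule add[OF nule_dif[OF n c sg_add[OF sgE gh(2,1)]] c])
  ultimately show ?thesis by simp
 qed
 have pow: "?F ((dif z ^^ a) \<phi>) \<and> nule B E (\<lambda>x. (dif z ^^ a) (dif y \<phi>) x + - dif y ((dif z ^^ a) \<phi>) x)"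
  if zy: "z \<in> E" "y \<in> E" and F: "?F \<phi>" for z y a \<phi>
 proof (induction a)
  case 0
  have "nul B E 0 (\<lambda>x. dif y \<phi> x + - dif y \<phi> x)" by simp
  then show ?case using F unfolding nule_def by (auto simp del: nul.simps)
 next
  case (Suc a)
  let ?p = "(dif z ^^ a) \<phi>" and ?q = "(dif z ^^ a) (dif y \<phi>)"
  have "nule B E (\<lambda>x. dif z (\<lambda>x. ?q x + - dif y ?p x) x + (dif z (dif y ?p) x + - dif y (dif z ?p) x))"
   by (rule add[OF nule_dif[OF n _ zy(1)] com[OF zy(2,1)]]) (use Suc in auto)
  then have "nule B E (\<lambda>x. dif z ?q x + - dif y (dif z ?p) x)" by (simp add: dif_def algebra_simps)
  then show ?case using Fs[OF zy(1)] Suc by simp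
 qed
 \<comment> \<open>Induction on the sum of the exponents: \<open>dif y\<close> lowers the exponent
   of \<open>y\<close> by one and, since the differences commute up to annihilated functions,
   respects the others.\<close>
 have main: "nule B E \<phi>" if "?F \<phi>" "\<forall>y\<in>Y. nule B E ((dif y ^^ a y) \<phi>)" for a \<phi>
  using that
 proof (induction "sum a Y" arbitrary: a \<phi> rule: less_induct)
  case less
  have YE: "y \<in> E" if "y \<in> Y" for y using that E gen_base by blast
  show ?case
  proof (cases "\<exists>y\<in>Y. a y = 0")
   case True
   then show ?thesis using less.prems(2) by fastforce
  next
   case False
   have "nule B E (dif y \<phi>)" if y: "y \<in> Y" for y
   proof (rule less.hyps)
    let ?a = "a(y := a y - 1)"
    have ay: "a y = Suc (a y - 1)" using False y by auto
    show "sum ?a Y < sum a Y" by (rule sum_strict_mono_ex1[OF E(2)]) (use y ay in \<open>auto intro!: bexI[of _ y]\<close>)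
    show "?F (dif y \<phi>)" using Fs[OF YE[OF y] less.prems(1)] .
    show "\<forall>z\<in>Y. nule B E ((dif z ^^ ?a z) (dif y \<phi>))"
    proof
     fix z assume z: "z \<in> Y"
     show "nule B E ((dif z ^^ ?a z) (dif y \<phi>))"
     proof (cases "z = y")
      case True
      have "(dif y ^^ (a y - 1)) (dif y \<phi>) = (dif y ^^ a y) \<phi>" by (subst ay) (simp add: funpow_swap1)
      then show ?thesis using less.prems(2) True y by simp
     next
      case False
      have "nule B E (\<lambda>x. ((dif z ^^ a z) (dif y \<phi>) x + - dif y ((dif z ^^ a z) \<phi>) x) + dif y ((dif z ^^ a z) \<phi>) x)"
       by (rule add[OF pow[THEN conjunct2, OF YE[OF z] YE[OF y] less.prems(1)] nule_dif[OF n _ YE[OF y]]]) (use less.prems(2) z in blast)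
      then show ?thesis using False by simp
     qed
    qed
   qed
   then show ?thesis using nule_gen[of Y B \<phi>] E n by simp
  qed
 qed
 have "\<forall>y\<in>E. \<exists>a. nule B E ((dif y ^^ a) \<psi>)" using uni[OF Suc.prems(1)] unfolding nule_def by blast
 then obtain a where "\<forall>y\<in>E. nule B E ((dif y ^^ a y) \<psi>)" by metis
 moreover have "Y \<subseteq> E" using E gen_base by blast
 ultimately show ?case using main[OF F0, of a] by blast
qed

lemma hm_dif: assumes "hm \<psi> B" "nrm E B" "h \<in> E" shows "hm (dif h \<psi>) B"
proof -
 have "\<psi> (h + (x + y) + - h) = \<psi> (h + x + - h) + \<psi> (h + y + - h)" if "x \<in> B" "y \<in> B" for x y
 proof -
  have "h + (x + y) + - h = (h + x + - h) + (h + y + - h)" by (simp add: add.assoc)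
  then show ?thesis using hmD[OF assms(1) nrmD[OF assms(2,3) that(1)] nrmD[OF assms(2,3) that(2)]] by (simp only:)
 qed
 then show ?thesis using hmD[OF assms(1)] by (simp add: hm_def dif_def)
qed

lemma dif_cm: assumes "hm \<psi> B" "sg B" "nrm E B" "h \<in> E" "x \<in> B" shows "dif h \<psi> x = \<psi> (cm h x)"
 unfolding cm_def using hmD[OF assms(1) nrmD[OF assms(3,4,5)] sg_neg[OF assms(2,5)]] hm_neg[OF assms(1,2,5)] by (simp add: dif_def)

lemma hm_dif_pow: "hm \<psi> B ==> nrm E B ==> h \<in> E ==> hm ((dif h ^^ m) \<psi>) B"
 by (induction m) (auto intro: hm_dif)

lemma ball_nm: "x \<in> ball S c ==> nm k x \<in> ball S (k * c)"
 by (induction k) (auto simp: nm_Suc ball_zero intro: ball_add)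

abbreviation cjp :: "'g::group_add \<Rightarrow> nat \<Rightarrow> 'g \<Rightarrow> 'g" where "cjp h k x \<equiv> nm k h + x + - nm k h"

text \<open>Among the 2^N ordered sums over subsets of the conjugates of \<open>x\<close> by the
  first \<open>N\<close> multiples of \<open>h\<close>, two agree. The difference of the two
  indicator functions is a relation that every integer homomorphism sees; \<open>t\<close> is the
  highest index at which it is nonzero.\<close>

lemma collision:
 fixes S :: "'g::group_add set"
 assumes "finite S" "slow S" "h \<in> gen S" "x \<in> gen S"
 obtains N t and \<delta> :: "nat \<Rightarrow> int" where "t < N" "\<delta> t \<noteq> 0" "\<forall>k. \<bar>\<delta> k\<bar> \<le> 1"
  "\<forall>\<psi> B. sg B --> hm \<psi> B --> (\<forall>k. cjp h k x \<in> B) --> (\<Sum>k\<le>t. \<delta> k * \<psi> (cjp h k x)) = 0"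
proof -
 obtain c where c: "{h, x} \<subseteq> ball S c" using gen_finite_ball[of "{h, x}" S] assms(3,4) by auto
 obtain N where N: "N \<ge> 1" "card (ball S (3 * c * N * N)) < 2 ^ N" using slowD[OF assms(1,2)] by blast
 let ?v = "\<lambda>I k. if k \<in> I then cjp h k x else 0"
 define w where "w n I = sum_list (map (?v I) [0..<n])" for n I
 have y: "cjp h k x \<in> ball S (3 * c * N)" if "k < N" for k
 proof -
  \<comment> \<open>\<open>N\<close> conjugates of this length make up the radius
    \<open>3 * c * N * N\<close>.\<close>
  have "cjp h k x \<in> ball S (c + 2 * (k * c))" using ball_conj ball_nm c by blast
  moreover have "c + 2 * (k * c) \<le> 3 * c * N"
  proof -
   have "c * (1 + 2 * k) \<le> c * (3 * N)" using that by (intro mult_le_mono2) simp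
   then show ?thesis by (simp add: algebra_simps)
  qed
  ultimately show ?thesis using ball_mono by blast
 qed
 have wb: "n \<le> N ==> w n I \<in> ball S (3 * c * N * n)" for n I
 proof (induction n)
  case (Suc n)
  have "?v I n \<in> ball S (3 * c * N)" using y[of n] Suc.prems ball_zero by auto
  then have "w n I + ?v I n \<in> ball S (3 * c * N * n + 3 * c * N)" using Suc by (intro ball_add) auto
  then show ?case by (simp add: w_def algebra_simps)
 qed (simp add: w_def ball_zero)
 have "card (w N ` Pow {..<N}) \<le> card (ball S (3 * c * N * N))"
  by (intro card_mono finite_ball assms) (use wb[of N] in auto)
 then have "\<not> inj_on (w N) (Pow {..<N})" using N(2) by (intro pigeonhole) (simp add: card_Pow)
 then obtain I J where IJ: "I \<subseteq> {..<N}" "J \<subseteq> {..<N}" "I \<noteq> J" "w N I = w N J" by (auto simp: inj_on_def)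
 let ?d = "\<lambda>I k. if k \<in> I then 1 else 0 :: int"
 define \<delta> where "\<delta> k = ?d I k - ?d J k" for k
 have d0: "\<delta> k = 0 \<longleftrightarrow> (k \<in> I \<longleftrightarrow> k \<in> J)" for k by (simp add: \<delta>_def)
 define Q where "Q = {k. k < N \<and> \<delta> k \<noteq> 0}"
 have Q: "finite Q" "Q \<noteq> {}" using IJ unfolding Q_def d0 by auto
 define t where "t = Max Q"
 have t: "t < N" "\<delta> t \<noteq> 0" using Max_in[OF Q] by (auto simp: t_def Q_def)
 have above: "\<delta> k = 0" if "t < k" "k < N" for k using Max_ge[OF Q(1), of k] that by (fastforce simp: t_def Q_def)
 show ?thesis
 proof (rule that[of t N \<delta>, OF t])
  show "\<forall>k. \<bar>\<delta> k\<bar> \<le> 1" by (simp add: \<delta>_def)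
  show "\<forall>\<psi> B. sg B --> hm \<psi> B --> (\<forall>k. cjp h k x \<in> B) --> (\<Sum>k\<le>t. \<delta> k * \<psi> (cjp h k x)) = 0"
  proof (intro allI impI)
   fix \<psi> :: "'g \<Rightarrow> int" and B assume B: "sg B" "hm \<psi> B" "\<forall>k. cjp h k x \<in> B"
   have wI: "\<psi> (w N I) = (\<Sum>k<N. ?d I k * \<psi> (cjp h k x))" for I
   proof -
    have "set (map (?v I) [0..<N]) \<subseteq> B" using B(3) sg_zero[OF B(1)] by auto
    then have "\<psi> (w N I) = sum_list (map \<psi> (map (?v I) [0..<N]))" unfolding w_def by (rule hm_sum_list[OF B(2,1)])
    also have "map \<psi> (map (?v I) [0..<N]) = map (\<lambda>k. ?d I k * \<psi> (cjp h k x)) [0..<N]" using hm_zero[OF B(2,1)] by simp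
    finally show ?thesis by (simp only: interv_sum_list_conv_sum_set_nat set_upt atLeast0LessThan)
   qed
   then have "(\<Sum>k<N. \<delta> k * \<psi> (cjp h k x)) = 0" using IJ(4) wI[of I] wI[of J] by (simp add: \<delta>_def left_diff_distrib sum_subtractf)
   moreover have "(\<Sum>k\<le>t. \<delta> k * \<psi> (cjp h k x)) = (\<Sum>k<N. \<delta> k * \<psi> (cjp h k x))"
    by (rule sum.mono_neutral_left) (use t above in auto)
   ultimately show "(\<Sum>k\<le>t. \<delta> k * \<psi> (cjp h k x)) = 0" by simp
  qed
 qed
qed

text \<open>The roots of a polynomial with coefficients in \<open>{-1, 0, 1}\<close> have modulus below \<open>2\<close>.\<close>

lemma recurrence_bound:
 fixes a :: "nat \<Rightarrow> int"
 assumes "t < N" "\<delta> t \<noteq> 0" "\<forall>k. \<bar>\<delta> k\<bar> \<le> 1" "\<And>j. (\<Sum>k\<le>t. \<delta> k * a (k + j)) = 0"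
 obtains C \<rho> :: real where "0 \<le> C" "1 \<le> \<rho>" "\<rho> < 2" "\<forall>n. \<bar>real_of_int (a n)\<bar> \<le> C * \<rho> ^ n"
proof -
 \<comment> \<open>The gap 1 / 2^N below 2 gives \<open>\<rho> ^ t * (2 - \<rho>) \<le> 1\<close>,
   which is the estimate of the geometric sum by \<open>\<rho> ^ t\<close>.\<close>
 define \<rho> :: real where "\<rho> = 2 - 1 / 2 ^ N"
 define C where "C = (\<Sum>k<N. \<bar>real_of_int (a k)\<bar>)"
 have N2: "(2::real) ^ N \<ge> 2 ^ 1" using assms(1) by (intro power_increasing) auto
 then have r: "3 / 2 \<le> \<rho>" "\<rho> < 2" by (simp_all add: \<rho>_def field_simps)
 have geo: "(\<Sum>k<t. \<rho> ^ k) \<le> \<rho> ^ t"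
 proof -
  have "\<rho> ^ t \<le> 2 ^ t" using r by (intro power_mono) auto
  also have "\<dots> \<le> 2 ^ N" using assms(1) by (intro power_increasing) auto
  finally have "\<rho> ^ t * (2 - \<rho>) \<le> 1" by (simp add: \<rho>_def field_simps)
  then have "\<rho> ^ t - 1 \<le> (\<rho> - 1) * \<rho> ^ t" by (simp add: algebra_simps)
  then have "(\<rho> - 1) * (\<Sum>k<t. \<rho> ^ k) \<le> (\<rho> - 1) * \<rho> ^ t" using power_diff_1_eq[of \<rho> t] by simp
  then show ?thesis using r by (simp add: mult_le_cancel_left_pos)
 qed
 have C0: "0 \<le> C" unfolding C_def by (intro sum_nonneg) auto
 have "\<bar>real_of_int (a n)\<bar> \<le> C * \<rho> ^ n" for n
 proof (induction n rule: less_induct)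
  case (less n)
  show ?case
  proof (cases "n < t")
   case True
   have "\<bar>real_of_int (a n)\<bar> \<le> C" unfolding C_def using True assms(1) by (intro member_le_sum) auto
   also have "\<dots> \<le> C * \<rho> ^ n" using C0 r by (simp add: mult_le_cancel_left1 one_le_power)
   finally show ?thesis .
  next
   case False
   define j where "j = n - t"
   have n: "n = t + j" using False by (simp add: j_def)
   have dt: "\<bar>\<delta> t\<bar> = 1" using assms(2) spec[OF assms(3), of t] by linarith
   have "(\<Sum>k<t. \<delta> k * a (k + j)) + \<delta> t * a n = 0" using assms(4)[of j] n by (simp add: lessThan_Suc_atMost[symmetric])
   then have "\<bar>\<delta> t * a n\<bar> = \<bar>\<Sum>k<t. \<delta> k * a (k + j)\<bar>" by linarith
   then have "\<bar>a n\<bar> = \<bar>\<Sum>k<t. \<delta> k * a (k + j)\<bar>" using dt by (simp add: abs_mult)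
   also have "\<dots> \<le> (\<Sum>k<t. \<bar>\<delta> k * a (k + j)\<bar>)" by (rule sum_abs)
   also have "\<dots> \<le> (\<Sum>k<t. \<bar>a (k + j)\<bar>)"
    using assms(3) by (intro sum_mono) (simp add: abs_mult mult_left_le_one_le)
   finally have "\<bar>a n\<bar> \<le> (\<Sum>k<t. \<bar>a (k + j)\<bar>)" by simp
   then have "real_of_int \<bar>a n\<bar> \<le> real_of_int (\<Sum>k<t. \<bar>a (k + j)\<bar>)" by (rule of_int_le_iff[THEN iffD2])
   then have "\<bar>real_of_int (a n)\<bar> \<le> (\<Sum>k<t. \<bar>real_of_int (a (k + j))\<bar>)" by simp
   also have "\<dots> \<le> (\<Sum>k<t. C * \<rho> ^ (k + j))" using n by (intro sum_mono less) auto
   also have "\<dots> = C * \<rho> ^ j * (\<Sum>k<t. \<rho> ^ k)" by (simp add: power_add sum_distrib_left mult_ac)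
   also have "\<dots> \<le> C * \<rho> ^ j * \<rho> ^ t" using geo C0 r by (intro mult_left_mono) auto
   finally show ?thesis by (simp add: n power_add mult_ac)
  qed
 qed
 then show ?thesis using that[of C \<rho>] C0 r by simp
qed

lemma dif_pow_cong: assumes "nrm E B" "h \<in> E" "\<forall>x\<in>B. \<phi> x = \<phi>' x" shows "\<forall>x\<in>B. (dif h ^^ m) \<phi> x = (dif h ^^ m) \<phi>' x"
 by (induction m) (use assms(3) nrmD[OF assms(1,2)] in \<open>auto simp: dif_def\<close>)

lemma dif_pow_scale: "(dif h ^^ m) (\<lambda>x. c * \<phi> x) = (\<lambda>x. c * (dif h ^^ m) \<phi> x)"
 by (induction m) (auto simp: dif_def right_diff_distrib)

text \<open>On homomorphisms \<open>dif h\<close> is three times another map into homomorphisms, so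
  each application extracts one factor 3.\<close>

lemma dif_pow_divisible:
 assumes "sg B" "nrm E B" "h \<in> E" "\<And>\<phi> x. hm \<phi> B ==> x \<in> B ==> 3 dvd dif h \<phi> x"
 shows "hm \<psi> B ==> x \<in> B ==> 3 ^ m dvd (dif h ^^ m) \<psi> x"
proof (induction m arbitrary: \<psi>)
 case (Suc m)
 define \<phi> where "\<phi> = (\<lambda>x. dif h \<psi> x div 3)"
 have e: "dif h \<psi> y = 3 * \<phi> y" if "y \<in> B" for y using assms(4)[OF Suc.prems(1) that] by (simp add: \<phi>_def)
 have "hm \<phi> B"
  unfolding hm_def
 proof (intro ballI)
  fix x y assume xy: "x \<in> B" "y \<in> B"
  have "3 * \<phi> (x + y) = 3 * \<phi> x + 3 * \<phi> y"
   using hmD[OF hm_dif[OF Suc.prems(1) assms(2,3)] xy] e xy sg_add[OF assms(1) xy] by simp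
  then show "\<phi> (x + y) = \<phi> x + \<phi> y" by linarith
 qed
 then have "3 ^ m dvd (dif h ^^ m) \<phi> x" using Suc by blast
 moreover have "(dif h ^^ Suc m) \<psi> x = 3 * (dif h ^^ m) \<phi> x"
 proof -
  have "(dif h ^^ Suc m) \<psi> x = (dif h ^^ m) (dif h \<psi>) x" by (simp add: funpow_swap1)
  also have "\<dots> = (dif h ^^ m) (\<lambda>x. 3 * \<phi> x) x" using dif_pow_cong[OF assms(2,3), of "dif h \<psi>" "\<lambda>x. 3 * \<phi> x"] e Suc.prems(2) by blast
  finally show ?thesis by (simp add: dif_pow_scale)
 qed
 ultimately show ?case by simp
qed simp

text \<open>\<open>(dif h ^^ m) \<psi> x\<close> is divisible by \<open>3 ^ m\<close> but only of the order \<open>(1 + \<rho>) ^ m\<close> with \<open>\<rho> < 2\<close>.\<close>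

lemma unipotent:
 fixes S :: "'g::group_add set"
 assumes S: "finite S" "slow S" and B: "finite Y" "B = gen Y" "B \<subseteq> gen S"
  and E: "sg E" "E \<subseteq> gen S" "nrm E B" "h \<in> E" and p: "hm \<psi> B"
  and three: "\<And>\<phi> x. hm \<phi> B ==> x \<in> B ==> 3 dvd dif h \<phi> x"
 shows "\<exists>m. \<forall>x\<in>B. (dif h ^^ m) \<psi> x = 0"
proof -
 have sgB: "sg B" using B(2) sg_gen by simp
 have cjB: "cjp h k x \<in> B" if "x \<in> B" for k x using nrmD[OF E(3) sg_nm[OF E(1,4)] that] .
 have "\<exists>m0. \<forall>m\<ge>m0. (dif h ^^ m) \<psi> x = 0" if x: "x \<in> B" for x
 proof -
  have hx: "h \<in> gen S" "x \<in> gen S" using E B x by auto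
  obtain N t and \<delta> :: "nat \<Rightarrow> int" where t: "t < N" "\<delta> t \<noteq> 0" "\<forall>k. \<bar>\<delta> k\<bar> \<le> 1"
   "\<forall>\<psi> B. sg B --> hm \<psi> B --> (\<forall>k. cjp h k x \<in> B) --> (\<Sum>k\<le>t. \<delta> k * \<psi> (cjp h k x)) = 0"
   by (rule collision[OF S hx]) (rule that, assumption+)
  define a where "a k = \<psi> (cjp h k x)" for k
  have "(\<Sum>k\<le>t. \<delta> k * a (k + j)) = 0" for j
  proof -
   \<comment> \<open>The function \<open>\<psi>\<close> after conjugation by \<open>nm j h\<close>;
     applied to it, the same relation becomes the recurrence shifted by \<open>j\<close>.\<close>
   define \<phi> where "\<phi> = (\<lambda>x. dif (nm j h) \<psi> x + \<psi> x)"
   have "hm \<phi> B" unfolding \<phi>_def using hmD[OF hm_dif[OF p E(3) sg_nm[OF E(1,4)]]] hmD[OF p] by (simp add: hm_def)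
   then have "(\<Sum>k\<le>t. \<delta> k * \<phi> (cjp h k x)) = 0" using t(4) sgB cjB[OF x] by blast
   moreover have "\<phi> (cjp h k x) = a (k + j)" for k
    unfolding \<phi>_def a_def dif_def using nm_add[of j k h] by (simp add: add.commute[of k j] add.assoc minus_add)
   ultimately show ?thesis by simp
  qed
  then obtain C \<rho> :: real where C: "0 \<le> C" "1 \<le> \<rho>" "\<rho> < 2" "\<forall>n. \<bar>real_of_int (a n)\<bar> \<le> C * \<rho> ^ n"
   using recurrence_bound[OF t(1,2,3)] by blast
  have bd: "\<bar>real_of_int ((dif h ^^ m) \<psi> (cjp h k x))\<bar> \<le> C * \<rho> ^ k * (1 + \<rho>) ^ m" for m k
  proof (induction m arbitrary: k)
   case 0
   then show ?case using C(4) by (simp add: a_def)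
  next
   case (Suc m)
   let ?f = "(dif h ^^ m) \<psi>"
   have "h + cjp h k x + - h = cjp h (Suc k) x" by (simp add: nm_Suc add.assoc minus_add)
   then have "real_of_int ((dif h ^^ Suc m) \<psi> (cjp h k x)) = real_of_int (?f (cjp h (Suc k) x)) - real_of_int (?f (cjp h k x))"
    by (simp add: dif_def del: add.assoc)
   then have "\<bar>real_of_int ((dif h ^^ Suc m) \<psi> (cjp h k x))\<bar> \<le> C * \<rho> ^ Suc k * (1 + \<rho>) ^ m + C * \<rho> ^ k * (1 + \<rho>) ^ m"
    using Suc[of "Suc k"] Suc[of k] by linarith
   also have "\<dots> = C * \<rho> ^ k * (1 + \<rho>) ^ Suc m" by (simp add: algebra_simps)
   finally show ?case .
  qed
  obtain m0 where m0: "((1 + \<rho>) / 3) ^ m0 < 1 / (C + 1)" using real_arch_pow_inv[of "1 / (C + 1)" "(1 + \<rho>) / 3"] C by auto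
  have "(dif h ^^ m) \<psi> x = 0" if m: "m0 \<le> m" for m
  proof (rule ccontr)
   assume nz: "(dif h ^^ m) \<psi> x \<noteq> 0"
   have "3 ^ m \<le> \<bar>(dif h ^^ m) \<psi> x\<bar>" using dvd_imp_le_int[OF nz dif_pow_divisible[OF sgB E(3,4) three p x]] by simp
   then have "3 ^ m \<le> \<bar>real_of_int ((dif h ^^ m) \<psi> x)\<bar>" by (metis of_int_abs of_int_le_iff of_int_numeral of_int_power)
   also have "\<dots> \<le> C * (1 + \<rho>) ^ m" using bd[of m 0] by simp
   finally have "1 \<le> C * ((1 + \<rho>) / 3) ^ m" by (simp add: power_divide field_simps)
   also have "\<dots> \<le> C * ((1 + \<rho>) / 3) ^ m0" using C m by (intro mult_left_mono power_decreasing) auto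
   also have "\<dots> \<le> C * (1 / (C + 1))" using m0 C by (intro mult_left_mono) auto
   also have "\<dots> < 1" using C by (simp add: field_simps)
   finally show False by simp
  qed
  then show ?thesis by blast
 qed
 then obtain M where M: "\<And>x m. x \<in> B ==> M x \<le> m ==> (dif h ^^ m) \<psi> x = 0" by metis
 \<comment> \<open>The exponent found depends on the point. As differences of homomorphisms are
   homomorphisms, the maximum over the finitely many generators serves all of
   \<open>B\<close>.\<close>
 define m where "m = Max (M ` Y)"
 have "Y \<subseteq> {x \<in> B. (dif h ^^ m) \<psi> x = 0}" using M B(1,2) gen_base[of Y] by (auto simp: m_def)
 then have "B \<subseteq> {x \<in> B. (dif h ^^ m) \<psi> x = 0}"
  using gen_least[OF sg_kernel[OF hm_dif_pow[OF p E(3,4)] sgB]] B(2) by blast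
 then show ?thesis by auto
qed

subsection \<open>Subgroups of finite index\<close>

text \<open>Reading a word from right to left and replacing the current prefix by its coset
  representative produces one Schreier generator per letter, so lengths in \<open>T\<close> do not
  exceed lengths in \<open>S\<close>.\<close>

lemma schreier:
 fixes S H :: "'g::group_add set"
 assumes S: "finite S" and H: "sg H" "H \<subseteq> gen S" "finite (cos (gen S) H)"
 obtains T R where "finite T" "finite R" "H = gen T" "\<forall>n. \<forall>x\<in>ball S n. \<exists>r\<in>R. \<exists>t\<in>ball T n. x = r + t"
proof -
 define r where "r g = (SOME u. u \<in> gen S \<and> (+) u ` H = (+) g ` H)" for g
 have r: "r g \<in> gen S \<and> (+) (r g) ` H = (+) g ` H" if "g \<in> gen S" for g
  unfolding r_def by (rule someI[of _ g]) (use that in auto)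
 have "finite (r ` gen S)"
  by (rule finite_image_factor[of "\<lambda>g. (+) g ` H"]) (use H(3) in \<open>auto simp: cos_def r_def\<close>)
 define R where "R = insert 0 (r ` gen S)"
 have R: "finite R" "R \<subseteq> gen S" using \<open>finite (r ` gen S)\<close> r sg_zero[OF sg_gen] by (auto simp: R_def)
 let ?A = "S \<union> uminus ` S"
 \<comment> \<open>The representative \<open>a\<close> of an element of \<open>H\<close> need not be
   0, so the elements of \<open>R\<close> in \<open>H\<close> are added to the generators.\<close>
 define T where "T = ((\<lambda>(a, s, b). - a + s + b) ` (R \<times> ?A \<times> R) \<union> R) \<inter> H"
 have T: "finite T" "T \<subseteq> H" using S R by (auto simp: T_def)
 have AS: "?A \<subseteq> gen S" using gen_base sg_neg[OF sg_gen] by fastforce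
 have words: "\<exists>a\<in>R. \<exists>t\<in>ball T (length ws). sum_list ws = a + t" if "set ws \<subseteq> ?A" for ws
  using that
 proof (induction ws)
  case Nil
  then show ?case by (auto simp: R_def ball_zero intro!: bexI[of _ 0])
 next
  case (Cons s ws)
  then obtain b t where b: "b \<in> R" "t \<in> ball T (length ws)" "sum_list ws = b + t" by auto
  have s: "s \<in> ?A" "s \<in> gen S" using Cons.prems AS by auto
  have sb: "s + b \<in> gen S" using sg_add[OF sg_gen s(2)] b(1) R(2) by blast
  define a where "a = r (s + b)"
  have a: "a \<in> R" "- a + (s + b) \<in> H" using r[OF sb] sb coset_eq[OF H(1)] by (auto simp: a_def R_def)
  have "- a + s + b \<in> T" unfolding T_def using a b(1) s(1)
   by (auto intro!: image_eqI[of _ _ "(a, s, b)"] simp: add.assoc)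
  then have "(- a + s + b) + t \<in> ball T (1 + length ws)" using ball_add[OF ball_base b(2)] by blast
  moreover have "sum_list (s # ws) = a + ((- a + s + b) + t)" using b(3) by (simp add: add.assoc)
  ultimately show ?case using a(1) by auto
 qed
 then have dec: "\<forall>n. \<forall>x\<in>ball S n. \<exists>a\<in>R. \<exists>t\<in>ball T n. x = a + t"
  unfolding ball_def[of S] using ball_mono[of _ _ T] by (fastforce simp: subset_iff)
 have "H \<subseteq> gen T"
 proof
  fix x assume x: "x \<in> H"
  then obtain n where "x \<in> ball S n" using H(2) by (auto simp: gen_def)
  then obtain a t where a: "a \<in> R" "t \<in> gen T" "x = a + t" using dec ball_gen by blast
  have "t \<in> H" using a(2) gen_least[OF H(1) T(2)] by blast
  then have "a \<in> H" using sg_add_right[OF H(1)] a(3) x by blast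
  then have "a \<in> gen T" using a(1) gen_base[of T] by (auto simp: T_def)
  then show "x \<in> gen T" using a(2,3) sg_add[OF sg_gen] by blast
 qed
 then show ?thesis using that[OF T(1) R(1) _ dec] gen_least[OF H(1) T(2)] by blast
qed

lemma finite_cos_Int:
 assumes "sg A" "sg B" "finite (cos G A)" "finite (cos G B)" shows "finite (cos G (A \<inter> B))"
 unfolding cos_def
proof (rule finite_image_factor[of "\<lambda>g. ((+) g ` A, (+) g ` B)"])
 show "finite ((\<lambda>g. ((+) g ` A, (+) g ` B)) ` G)"
  by (rule finite_subset[OF _ finite_cartesian_product[OF assms(3,4)]]) (auto simp: cos_def)
qed (use coset_eq[OF assms(1)] coset_eq[OF assms(2)] coset_eq[OF sg_Int[OF assms(1,2)]] in auto)

lemma finite_exponent_quotient: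
 fixes B :: "'g::group_add set"
 assumes Y: "finite Y" "B = gen Y" and W: "sg W" "W \<subseteq> B" "nrm B W" "der B \<subseteq> W" "\<And>x. x \<in> B ==> nm n x \<in> W" "n > 0"
 shows "finite (cos B W)"
proof -
 have sgB: "sg B" using Y sg_gen by simp
 obtain f :: "'g \<Rightarrow> 'g set bijn" where f: "hm f B" "\<And>u. u \<in> B ==> f u = 0 \<longleftrightarrow> u \<in> W"
  using ex_quotient_hom[OF sgB W(1,2,3)] by blast
 obtain ys where ys: "set ys = f ` Y" using Y(1) by (meson finite_imageI finite_list)
 have im: "f ` B = gen (set ys)" using hm_gen[OF f(1) sgB] Y(2) gen_base[of Y] ys by auto
 have comm: "a + b = b + a" if ab: "a \<in> f ` B" "b \<in> f ` B" for a b
 proof -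
  obtain u v where uv: "u \<in> B" "v \<in> B" "a = f u" "b = f v" using ab by blast
  then have "cm a b = 0" using hm_cm[OF f(1) sgB] f(2)[OF sg_cm[OF sgB]] der_cm W(4) by (metis subsetD)
  then show ?thesis by (simp add: cm_zero_iff)
 qed
 have ex: "nm n a = 0" if "a \<in> f ` B" for a using that hm_nm[OF f(1) sgB] f(2)[OF sg_nm[OF sgB]] W(5) by force
 have sf: "sg (f ` B)" by (simp add: im sg_gen)
 have "finite (gen (set zs))" if "set zs \<subseteq> f ` B" for zs
  using that
 proof (induction zs)
  case (Cons z zs)
  have "gen (set (z # zs)) \<subseteq> f ` B" using gen_least[OF sf Cons.prems] .
  then have "gen (insert z (set zs)) = (\<lambda>(i, q). nm i z + q) ` ({..<n} \<times> gen (set zs))"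
   by (intro gen_insert_torsion comm ex W(6)) (use Cons.prems in auto)
  then show ?case using Cons by simp
 qed (simp add: gen_empty)
 then have "finite (f ` B)" using im gen_base[of "set ys"] by simp
 then show ?thesis using idx_hom[OF f(1) sgB W(1,2) f(2)] by blast
qed

section \<open>Descent of the lower central series\<close>

primrec lcs :: "'g::group_add set \<Rightarrow> nat \<Rightarrow> 'g set" where
 "lcs H 0 = H"
| "lcs H (Suc n) = gen {cm x y | x y. x \<in> lcs H n \<and> y \<in> H}"

primrec difs :: "'g::group_add list \<Rightarrow> ('g \<Rightarrow> int) \<Rightarrow> 'g \<Rightarrow> int" where
 "difs [] \<psi> = \<psi>"
| "difs (h # hs) \<psi> = difs hs (dif h \<psi>)"

lemma difs_snoc: "difs (hs @ [h]) \<psi> = dif h (difs hs \<psi>)" by (induction hs arbitrary: \<psi>) auto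
lemma hm_difs: "nrm E B ==> hm \<psi> B ==> set hs \<subseteq> E ==> hm (difs hs \<psi>) B"
 by (induction hs arbitrary: \<psi>) (auto intro: hm_dif)
lemma nul_difs: "nul B E (length hs) \<psi> ==> set hs \<subseteq> E ==> x \<in> B ==> difs hs \<psi> x = 0"
 by (induction hs arbitrary: \<psi>) auto

lemma lcs_step: assumes "sg A" "lcs H n \<subseteq> A'" "\<And>x h. x \<in> A' ==> h \<in> H ==> cm h x \<in> A" shows "lcs H (Suc n) \<subseteq> A"
 unfolding lcs.simps
proof (rule gen_least[OF assms(1)], clarify)
 fix x y assume "x \<in> lcs H n" "y \<in> H"
 then have "- cm y x \<in> A" using assms sg_neg by blast
 then show "cm x y \<in> A" by (simp add: neg_cm)
qed

text \<open>The homomorphisms to the integers lead down to the torsion \<open>A 0\<close> of \<open>B\<close> modulo \<open>der B\<close>; being trivial modulo \<open>3 * e\<close>,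
 the action on the torsion is trivial.\<close>

lemma lcs_descend:
 fixes B H :: "'g::group_add set"
 assumes H: "nrm H B" and B: "sg B"
  and sep: "finite \<Psi>" "e \<ge> 1" "\<forall>\<psi>\<in>\<Psi>. hm \<psi> B" "\<forall>x\<in>B. (\<forall>\<psi>\<in>\<Psi>. \<psi> x = (0::int)) --> nm e x \<in> der B"
  and cong: "\<And>h x. h \<in> H ==> x \<in> B ==> cm h x \<in> gen (der B \<union> nm (3 * e) ` B)"
  and ann: "\<And>\<psi>. hm \<psi> B ==> nule B H \<psi>" and n: "lcs H n \<subseteq> B"
 shows "\<exists>n'. lcs H n' \<subseteq> der B"
proof -
 obtain m where m: "\<And>\<psi>. \<psi> \<in> \<Psi> ==> nul B H (m \<psi>) \<psi>" using ann sep(3) unfolding nule_def by metis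
 define M where "M = Max (m ` \<Psi>)"
 have M: "nul B H M \<psi>" if "\<psi> \<in> \<Psi>" for \<psi> by (rule nul_mono[OF H _ m[OF that]]) (use sep(1) that in \<open>simp add: M_def\<close>)
 \<comment> \<open>A descending filtration of \<open>B\<close>: \<open>A M\<close> is all of
   \<open>B\<close>, \<open>A 0\<close> is the torsion modulo \<open>der B\<close>, and commutators
   with \<open>H\<close> lower the index by one.\<close>
 define A where "A k = {x \<in> B. \<forall>\<phi>\<in>{difs hs \<psi> | hs \<psi>. set hs \<subseteq> H \<and> length hs = k \<and> \<psi> \<in> \<Psi>}. \<phi> x = 0}" for k
 have sgA: "sg (A k)" for k
 proof (rule sgI)
  have hom: "hm \<phi> B" if "\<phi> \<in> {difs hs \<psi> | hs \<psi>. set hs \<subseteq> H \<and> length hs = k \<and> \<psi> \<in> \<Psi>}" for \<phi>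
   using that hm_difs[OF H] sep(3) by auto
  show "0 \<in> A k" unfolding A_def using hm_zero[OF hom B] sg_zero[OF B] by blast
  show "x + y \<in> A k" if "x \<in> A k" "y \<in> A k" for x y unfolding A_def
  proof (intro CollectI conjI ballI)
   show "x + y \<in> B" using that sg_add[OF B] by (auto simp: A_def)
   fix \<phi> assume p: "\<phi> \<in> {difs hs \<psi> | hs \<psi>. set hs \<subseteq> H \<and> length hs = k \<and> \<psi> \<in> \<Psi>}"
   then have "\<phi> x = 0" "\<phi> y = 0" "x \<in> B" "y \<in> B" using that unfolding A_def by blast+
   then show "\<phi> (x + y) = 0" using hmD[OF hom[OF p]] by simp
  qed
  show "- x \<in> A k" if "x \<in> A k" for x unfolding A_def
  proof (intro CollectI conjI ballI)
   show "- x \<in> B" using that sg_neg[OF B] by (auto simp: A_def)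
   fix \<phi> assume p: "\<phi> \<in> {difs hs \<psi> | hs \<psi>. set hs \<subseteq> H \<and> length hs = k \<and> \<psi> \<in> \<Psi>}"
   then have "\<phi> x = 0" "x \<in> B" using that unfolding A_def by blast+
   then show "\<phi> (- x) = 0" using hm_neg[OF hom[OF p] B] by simp
  qed
 qed
 have A_iff: "x \<in> A k \<longleftrightarrow> x \<in> B \<and> (\<forall>hs \<psi>. set hs \<subseteq> H --> length hs = k --> \<psi> \<in> \<Psi> --> difs hs \<psi> x = 0)" for x k
  unfolding A_def by blast
 have down: "cm h x \<in> A k" if x: "x \<in> A (Suc k)" "h \<in> H" for h x k
  unfolding A_iff
 proof (intro conjI allI impI)
  have xB: "x \<in> B" using x A_iff by blast
  then show "cm h x \<in> B" using nrm_cm[OF B H x(2)] by blast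
  fix hs \<psi> assume hs: "set hs \<subseteq> H" "length hs = k" "\<psi> \<in> \<Psi>"
  have "difs (hs @ [h]) \<psi> x = 0" using x hs unfolding A_iff by simp
  then show "difs hs \<psi> (cm h x) = 0" using dif_cm[OF hm_difs[OF H _ hs(1)] B H x(2) xB] sep(3) hs(3) by (simp add: difs_snoc)
 qed
 have start: "B \<subseteq> A M" using nul_difs M unfolding A_iff subset_iff by blast
 have "lcs H (n + j) \<subseteq> A (M - j)" if "j \<le> M" for j
  using that
 proof (induction j)
  case (Suc j)
  then have "lcs H (n + j) \<subseteq> A (Suc (M - Suc j))" by (simp add: Suc_diff_Suc)
  then have "lcs H (Suc (n + j)) \<subseteq> A (M - Suc j)" using lcs_step[OF sgA] down by blast
  then show ?case by (simp del: lcs.simps)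
 qed (use n start in auto)
 from this[of M] have l0: "lcs H (n + M) \<subseteq> A 0" by simp
 have A0: "x \<in> A 0 \<longleftrightarrow> x \<in> B \<and> (\<forall>\<psi>\<in>\<Psi>. \<psi> x = 0)" for x unfolding A_iff by auto
 have tor: "\<psi> x = 0" if "x \<in> B" "nm e x \<in> der B" "\<psi> \<in> \<Psi>" for x \<psi>
 proof -
  have p: "hm \<psi> B" using sep(3) that(3) by blast
  have "int e * \<psi> x = 0" using hm_int_der[OF p B that(2)] hm_nm[OF p B that(1)] by (simp add: nm_int)
  then show ?thesis using sep(2) by simp
 qed
 obtain f :: "'g \<Rightarrow> 'g set bijn" where f: "hm f B" "\<And>u. u \<in> B ==> f u = 0 \<longleftrightarrow> u \<in> der B"
  using ex_quotient_hom[OF B sg_der der_sub[OF B] nrm_der_self[OF B]] by blast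
 have fc: "f u + f v = f v + f u" if "u \<in> B" "v \<in> B" for u v
  using that hm_cm[OF f(1) B] f(2)[OF sg_cm[OF B]] der_cm cm_zero_iff by metis
 \<comment> \<open>The congruence subgroup, rewritten as the elements that are multiples by
   \<open>3 * e\<close> modulo \<open>der B\<close>.\<close>
 let ?W = "{z \<in> B. \<exists>y\<in>B. f z = nm (3 * e) (f y)}"
 have "gen (der B \<union> nm (3 * e) ` B) \<subseteq> ?W"
 proof (rule gen_least)
  show "sg ?W"
  proof (rule sgI)
   show "0 \<in> ?W" using sg_zero[OF B] hm_zero[OF f(1) B] by (auto intro!: bexI[of _ 0])
   fix u assume "u \<in> ?W"
   then obtain y where u: "u \<in> B" "y \<in> B" "f u = nm (3 * e) (f y)" by blast
   have "f (- u) = nm (3 * e) (f (- y))" using u hm_neg[OF f(1) B] by (simp add: nm_neg)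
   then show "- u \<in> ?W" using u sg_neg[OF B] by blast
   fix v assume "v \<in> ?W"
   then obtain z where v: "v \<in> B" "z \<in> B" "f v = nm (3 * e) (f z)" by blast
   have "f (u + v) = nm (3 * e) (f (y + z))" using u v hmD[OF f(1)] nm_comm[OF fc[OF u(2) v(2)]] by simp
   then show "u + v \<in> ?W" using u v sg_add[OF B] by blast
  qed
  have "f z = nm (3 * e) (f 0)" if "z \<in> der B" for z using that f(2) der_sub[OF B] hm_zero[OF f(1) B] by auto
  then show "der B \<union> nm (3 * e) ` B \<subseteq> ?W"
   using der_sub[OF B] sg_zero[OF B] sg_nm[OF B] hm_nm[OF f(1) B] by blast
 qed
 then have W: "\<exists>y\<in>B. f (cm h x) = nm (3 * e) (f y)" if "h \<in> H" "x \<in> B" for h x using cong[OF that] by blast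
 have "cm h x \<in> der B" if x: "x \<in> A 0" and h: "h \<in> H" for h x
 proof -
  have xB: "x \<in> B" and x0: "\<forall>\<psi>\<in>\<Psi>. \<psi> x = 0" using x A0 by auto
  have uB: "cm h x \<in> B" and vB: "h + x + - h \<in> B" using nrm_cm[OF B H h xB] nrmD[OF H h xB] .
  obtain y where y: "y \<in> B" "f (cm h x) = nm (3 * e) (f y)" using W h xB by blast
  have "nm e (h + x + - h) \<in> der B" unfolding nm_cj using nrmD[OF nrm_der[OF H] h] sep(4) xB x0 by blast
  then have u0: "\<psi> (cm h x) = 0" if "\<psi> \<in> \<Psi>" for \<psi>
   using tor[OF vB _ that] bspec[OF x0 that] that dif_cm[OF _ B H h xB, of \<psi>] sep(3) by (simp add: dif_def)
  have "- nm (3 * e) y + cm h x \<in> der B"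
  proof -
   have "f (- nm (3 * e) y + cm h x) = 0"
    using hmD[OF f(1) sg_neg[OF B sg_nm[OF B y(1)]] uB] hm_neg[OF f(1) B sg_nm[OF B y(1)]] hm_nm[OF f(1) B y(1)] y(2) by simp
   then show ?thesis using f(2) sg_add[OF B sg_neg[OF B sg_nm[OF B y(1)]] uB] by blast
  qed
  \<comment> \<open>The commutator is \<open>3 * e\<close> times \<open>y\<close> modulo
    \<open>der B\<close> and has zero values, so \<open>y\<close> has zero values, is torsion, and
    is killed by \<open>e\<close>; hence so is the commutator modulo \<open>der B\<close>.\<close>
  then have "\<psi> y = 0" if "\<psi> \<in> \<Psi>" for \<psi>
  proof -
   have p: "hm \<psi> B" using sep(3) that by blast
   have "\<psi> (- nm (3 * e) y + cm h x) = - (int (3 * e) * \<psi> y) + \<psi> (cm h x)"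
    using hmD[OF p sg_neg[OF B sg_nm[OF B y(1)]] uB] hm_neg[OF p B sg_nm[OF B y(1)]] hm_nm[OF p B y(1)] by (simp add: nm_int)
   then have "int (3 * e) * \<psi> y = 0" using u0[OF that] hm_int_der[OF p B] \<open>- nm (3 * e) y + cm h x \<in> der B\<close> by simp
   then show ?thesis using sep(2) by simp
  qed
  then have "nm e y \<in> der B" using sep(4) y(1) by blast
  then have "nm e (f y) = 0" using f(2)[OF sg_nm[OF B y(1)]] hm_nm[OF f(1) B y(1)] by simp
  then have "f (cm h x) = 0" using y(2) by (simp add: nm_mult)
  then show ?thesis using f(2)[OF uB] by blast
 qed
 then have "lcs H (Suc (n + M)) \<subseteq> der B" using lcs_step[OF sg_der l0] by blast
 then show ?thesis by blast
qed

text \<open>\<open>H\<close> is a congruence subgroup for all derived factors at once, modulo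
  \<open>3 * e i\<close>: the factor 3 makes single elements unipotent, and the factor
  \<open>e i\<close>, an exponent of the torsion, makes the action on the torsion trivial. The lower
  central series of \<open>H\<close> then descends through the derived series of the whole
  group.\<close>

theorem slow_solvable_virtually_nilpotent:
 fixes S :: "'g::group_add set"
 assumes S: "finite S" "slow S" and l: "dern l (gen S) = {0}"
 shows "\<exists>H c. sg H \<and> H \<subseteq> gen S \<and> finite (cos (gen S) H) \<and> lcs H c = {0}"
proof -
 let ?G = "gen S"
 define D where "D i = dern i ?G" for i
 have sgD: "sg (D i)" and DG: "D i \<subseteq> ?G" and nD: "nrm ?G (D i)" for i
  unfolding D_def by (rule sg_dern[OF sg_gen], rule dern_sub[OF sg_gen], rule nrm_dern[OF nrm_self[OF sg_gen]])
 obtain Y where Y: "\<And>i. finite (Y i) \<and> D i = gen (Y i)" using slow_dern_fg[OF S] unfolding D_def by metis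
 have "\<exists>\<Psi> e. finite \<Psi> \<and> e \<ge> 1 \<and> (\<forall>\<psi>\<in>\<Psi>. hm \<psi> (D i)) \<and> (\<forall>x\<in>D i. (\<forall>\<psi>\<in>\<Psi>. \<psi> x = (0::int)) --> nm e x \<in> der (D i))" for i
  by (rule separation[OF conjunct1[OF Y] conjunct2[OF Y], of i]) (intro exI conjI, assumption+)
 then obtain \<Psi> e where sep: "\<And>i. finite (\<Psi> i) \<and> e i \<ge> 1 \<and> (\<forall>\<psi>\<in>\<Psi> i. hm \<psi> (D i)) \<and>
   (\<forall>x\<in>D i. (\<forall>\<psi>\<in>\<Psi> i. \<psi> x = (0::int)) --> nm (e i) x \<in> der (D i))" by metis
 define W where "W i = gen (der (D i) \<union> nm (3 * e i) ` D i)" for i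
 have dW: "der (D i) \<subseteq> W i" "nm (3 * e i) x \<in> W i" if "x \<in> D i" for i x
  using that gen_base[of "der (D i) \<union> nm (3 * e i) ` D i"] by (auto simp: W_def)
 have dW': "der (D i) \<subseteq> W i" for i using dW(1) sg_zero[OF sgD] by blast
 have sgW: "sg (W i)" for i by (simp add: W_def sg_gen)
 have WD: "W i \<subseteq> D i" for i unfolding W_def by (rule gen_least[OF sgD]) (use der_sub[OF sgD] sg_nm[OF sgD] in auto)
 have nW: "nrm ?G (W i)" for i unfolding W_def
 proof (rule nrm_gen, fold W_def)
  fix g s assume g: "g \<in> ?G" and s: "s \<in> der (D i) \<union> nm (3 * e i) ` D i"
  from s show "g + s + - g \<in> W i"
  proof
   assume "s \<in> der (D i)" then show ?thesis using nrmD[OF nrm_der[OF nD] g] dW' by blast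
  next
   assume "s \<in> nm (3 * e i) ` D i"
   then obtain x where "x \<in> D i" "s = nm (3 * e i) x" by blast
   then show ?thesis using dW(2)[OF nrmD[OF nD g]] by (simp add: nm_cj[symmetric])
  qed
 qed
 have sec: "sec ?G (D i) (W i)" for i
 proof -
  have "finite (cos (D i) (W i))"
   by (rule finite_exponent_quotient[OF conjunct1[OF Y] conjunct2[OF Y] sgW WD nrm_sub[OF nW DG] dW' dW(2)]) (use sep[of i] in auto)
  then show ?thesis unfolding sec_def using sgD sgW WD nD nW sg_gen der_cm dW' by blast
 qed
 define Z where "Z i = {g \<in> ?G. \<forall>x\<in>D i. cm g x \<in> W i}" for i
 have Z: "sg (Z i)" "finite (cos ?G (Z i))" for i
  unfolding Z_def using sg_centralizer[OF sg_gen sgW nW] centralizer_finite_index[OF sec] by auto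
 have "\<exists>H. sg H \<and> H \<subseteq> ?G \<and> finite (cos ?G H) \<and> (\<forall>i<n. H \<subseteq> Z i)" for n
 proof (induction n)
  case 0
  have "cos ?G ?G \<subseteq> {?G}"
  proof -
   have "(+) u ` ?G = ?G" if "u \<in> ?G" for u
    using coset_eq[OF sg_gen, of u S 0] sg_neg[OF sg_gen that] by simp
   then show ?thesis by (auto simp: cos_def)
  qed
  then have "finite (cos ?G ?G)" by (rule finite_subset) simp
  then show ?case using sg_gen by (intro exI[of _ ?G]) auto
 next
  case (Suc n)
  then obtain H where "sg H" "H \<subseteq> ?G" "finite (cos ?G H)" "\<forall>i<n. H \<subseteq> Z i" by blast
  then show ?case using Z[of n] by (intro exI[of _ "H \<inter> Z n"]) (auto simp: sg_Int finite_cos_Int less_Suc_eq)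
 qed
 then obtain H where H: "sg H" "H \<subseteq> ?G" "finite (cos ?G H)" "\<forall>i<l. H \<subseteq> Z i" by blast
 obtain T R where T: "finite T" "finite R" "H = gen T" "\<forall>n. \<forall>x\<in>ball S n. \<exists>r\<in>R. \<exists>t\<in>ball T n. x = r + t"
  by (rule schreier[OF S(1) H(1,2,3)]) (rule that, assumption+)
 have slT: "slow T" by (rule slow_sub[OF S T(1)]) (use T(3) H(2) gen_base[of T] in blast)
 have dl: "dern l H = {0}" using dern_mono[OF H(2), of l] l sg_zero[OF sg_dern[OF H(1)]] by blast
 have step: "\<exists>n'. lcs H n' \<subseteq> D (Suc i)" if i: "i < l" and n: "lcs H n \<subseteq> D i" for i n
 proof -
  have nH: "nrm H (D i)" using nrm_sub[OF nD H(2)] .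
  have cW: "cm h x \<in> W i" if "h \<in> H" "x \<in> D i" for h x using H(4) i that by (auto simp: Z_def)
  have three: "3 dvd dif h \<phi> x" if h: "h \<in> H" and p: "hm \<phi> (D i)" and x: "x \<in> D i" for h \<phi> x
  proof -
   let ?K = "{z \<in> D i. 3 dvd \<phi> z}"
   have "sg ?K" by (rule sgI) (use sgD p in \<open>auto simp: sg_zero sg_add sg_neg hm_zero hm_neg hmD\<close>)
   moreover have "der (D i) \<union> nm (3 * e i) ` D i \<subseteq> ?K"
    using hm_int_der[OF p sgD] der_sub[OF sgD] sg_nm[OF sgD] hm_nm[OF p sgD] by (auto simp: nm_int)
   ultimately have "W i \<subseteq> ?K" unfolding W_def by (rule gen_least)
   then have "3 dvd \<phi> (cm h x)" using cW[OF h x] by blast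
   then show ?thesis using dif_cm[OF p sgD nH h x] by simp
  qed
  \<comment> \<open>Annihilation is carried from the trivial group \<open>dern l H\<close> upwards
    to \<open>H\<close>, one application of \<open>kolchin_step\<close> per derived
    subgroup.\<close>
  have "\<forall>\<psi>. hm \<psi> (D i) --> nule (D i) (dern j H) \<psi>" if "j \<le> l" for j
   using that
  proof (induction rule: inc_induct)
   case base
   have "nul (D i) (dern l H) (Suc 0) \<psi>" for \<psi> by (simp add: dl dif_def)
   then show ?case unfolding nule_def by blast
  next
   case (step j)
   obtain Yj where Yj: "finite Yj" "dern j H = gen Yj" using slow_dern_fg[OF T(1) slT, of j] T(3) by auto
   have jH: "dern j H \<subseteq> H" "sg (dern j H)" using dern_sub[OF H(1)] sg_dern[OF H(1)] by auto
   have nj: "nrm (dern j H) (D i)" using nrm_sub[OF nH jH(1)] .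
   show ?case
   proof (intro allI impI)
    fix \<psi> :: "'g \<Rightarrow> int" assume p: "hm \<psi> (D i)"
    then obtain m where m: "nul (D i) (der (dern j H)) m \<psi>" using step.IH unfolding nule_def dern_Suc by blast
    show "nule (D i) (dern j H) \<psi>"
    proof (rule kolchin_step[OF Yj(2,1) nj, of "{\<psi>. hm \<psi> (D i)}"])
     show "dif h \<psi> \<in> {\<psi>. hm \<psi> (D i)}" if "\<psi> \<in> {\<psi>. hm \<psi> (D i)}" "h \<in> dern j H" for \<psi> h
      using that hm_dif[OF _ nj] by blast
     show "\<exists>m. nul (D i) (dern j H) 0 ((dif h ^^ m) \<psi>)" if "\<psi> \<in> {\<psi>. hm \<psi> (D i)}" "h \<in> dern j H" for \<psi> h
      unfolding nul.simps
     proof (rule unipotent[OF S conjunct1[OF Y] conjunct2[OF Y] DG H(1,2) nH])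
      show "h \<in> H" "hm \<psi> (D i)" using that jH by auto
      then show "3 dvd dif h \<phi> x" if "hm \<phi> (D i)" "x \<in> D i" for \<phi> x using three that by blast
     qed
    qed (use p m in auto)
   qed
  qed
  from this[of 0] have ann: "nule (D i) H \<psi>" if "hm \<psi> (D i)" for \<psi> using that by simp
  have "\<exists>n'. lcs H n' \<subseteq> der (D i)"
   by (rule lcs_descend[OF nH sgD, of "\<Psi> i" "e i"]) (use sep[of i] cW ann n in \<open>auto simp: W_def\<close>)
  then show ?thesis by (simp add: D_def dern_Suc)
 qed
 have "\<exists>n. lcs H n \<subseteq> D i" if "i \<le> l" for i
  using that
 proof (induction i)
  case 0
  show ?case using H(2) by (intro exI[of _ 0]) (simp add: D_def)
 next
  case (Suc i)
  then show ?case using step[of i] by auto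
 qed
 then obtain c where "lcs H c \<subseteq> D l" by blast
 moreover have "sg (lcs H c)" by (cases c) (auto simp: H(1) sg_gen)
 ultimately have "lcs H c = {0}" using l sg_zero[of "lcs H c"] by (auto simp: D_def)
 then show ?thesis using H by blast
qed

section \<open>Polynomial growth of virtually nilpotent groups\<close>

lemma sg_lcs: "sg H ==> sg (lcs H n)" by (cases n) (auto simp: sg_gen)

lemma lcs_sub: assumes "sg H" shows "lcs H n \<subseteq> H \<and> nrm H (lcs H n)"
proof (induction n)
 case 0
 then show ?case using nrm_self[OF assms] by simp
next
 case (Suc n)
 have "nrm H (lcs H (Suc n))" unfolding lcs.simps
 proof (rule nrm_gen)
  fix k s assume k: "k \<in> H" and "s \<in> {cm x y | x y. x \<in> lcs H n \<and> y \<in> H}"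
  then obtain x y where s: "s = cm x y" "x \<in> lcs H n" "y \<in> H" by blast
  have "cm (k + x + - k) (k + y + - k) \<in> {cm x y | x y. x \<in> lcs H n \<and> y \<in> H}"
   using nrmD[of H "lcs H n" k x] nrmD[OF nrm_self[OF assms] k s(3)] Suc k s(2) by blast
  then show "k + s + - k \<in> gen {cm x y | x y. x \<in> lcs H n \<and> y \<in> H}"
   unfolding s(1) cj_cm by (rule subsetD[OF gen_base])
 qed
 moreover have "lcs H (Suc n) \<subseteq> H" unfolding lcs.simps
  by (rule gen_least[OF assms]) (use Suc sg_cm[OF assms] in blast)
 ultimately show ?case by blast
qed

lemma lcs_cm: assumes "sg H" "x \<in> lcs H n" "h \<in> H" shows "cm x h \<in> lcs H (Suc n)" "cm h x \<in> lcs H (Suc n)"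
proof -
 have "cm x h \<in> {cm x y | x y. x \<in> lcs H n \<and> y \<in> H}" using assms(2,3) by blast
 then show "cm x h \<in> lcs H (Suc n)" unfolding lcs.simps by (rule subsetD[OF gen_base])
 from sg_neg[OF sg_lcs[OF assms(1)] this] show "cm h x \<in> lcs H (Suc n)" by (simp only: neg_cm)
qed

lemma lcs_anti: assumes "sg H" shows "lcs H (Suc n) \<subseteq> lcs H n"
 unfolding lcs.simps by (rule gen_least[OF sg_lcs[OF assms]]) (use lcs_sub[OF assms, of n] nrm_cm'[OF sg_lcs[OF assms] _ assms] in blast)

text \<open>Modulo the next term, the commutator is bilinear, so commutators of generators of one
  factor with generators of \<open>H\<close> generate the next factor.\<close>

lemma lcs_generators:
 assumes "finite T" "H = gen T"
 shows "\<exists>F. finite F \<and> F \<subseteq> lcs H n \<and> lcs H n = gen (F \<union> lcs H (Suc n))"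
proof (induction n)
 case 0
 have sgH: "sg H" using assms sg_gen by simp
 have "gen (T \<union> lcs H (Suc 0)) = H"
 proof (rule gen_eqI[OF sgH])
  show "T \<union> lcs H (Suc 0) \<subseteq> H" using lcs_sub[OF sgH, of "Suc 0"] assms gen_base[of T] by auto
  show "H \<subseteq> gen (T \<union> lcs H (Suc 0))" unfolding assms(2) by (rule gen_mono) auto
 qed
 then show ?case using assms gen_base[of T] by (intro exI[of _ T]) simp
next
 case (Suc n)
 then obtain F where F: "finite F" "F \<subseteq> lcs H n" "lcs H n = gen (F \<union> lcs H (Suc n))" by blast
 have sgH: "sg H" using assms sg_gen by simp
 have TH: "T \<subseteq> H" using assms gen_base by blast
 let ?F = "(\<lambda>(f, t). cm f t) ` (F \<times> T)" and ?L = "lcs H (Suc (Suc n))"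
 let ?N = "gen (?F \<union> ?L)"
 have FL: "?F \<subseteq> lcs H (Suc n)"
 proof (rule image_subsetI)
  fix p assume "p \<in> F \<times> T"
  then have "fst p \<in> lcs H n" "snd p \<in> H" using F(2) TH by auto
  then show "(case p of (f, t) \<Rightarrow> cm f t) \<in> lcs H (Suc n)" unfolding case_prod_unfold by (rule lcs_cm(1)[OF sgH])
 qed
 have N: "?N \<subseteq> lcs H (Suc n)" by (rule gen_least[OF sg_lcs[OF sgH]]) (use FL lcs_anti[OF sgH, of "Suc n"] in blast)
 have LN: "?L \<subseteq> ?N" "?F \<subseteq> ?N" using gen_base[of "?F \<union> ?L"] by blast+
 have nN: "nrm H ?N" by (rule nrm_of_cm[OF sg_gen]) (use lcs_cm(2)[OF sgH] N LN in blast)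
 have nHF: "gen (F \<union> lcs H (Suc n)) \<subseteq> H" using F(3) lcs_sub[OF sgH, of n] by simp
 have "cm x y \<in> ?N" if xy: "x \<in> lcs H n" "y \<in> H" for x y
 proof (rule cm_gen_closed[OF sg_gen nrm_sub[OF nN nHF]])
  show "x \<in> gen (F \<union> lcs H (Suc n))" "y \<in> gen T" "nrm (gen T) ?N" using xy F(3) assms(2) nN by auto
  show "cm a b \<in> ?N" if "a \<in> F \<union> lcs H (Suc n)" "b \<in> T" for a b
   using that LN lcs_cm(1)[OF sgH, of a "Suc n" b] TH by (auto simp del: lcs.simps)
 qed
 then have "lcs H (Suc n) \<subseteq> ?N" unfolding lcs.simps(2)[of H n] by (intro gen_least[OF sg_gen]) blast
 then have "lcs H (Suc n) = ?N" using N by blast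
 then show ?case using F(1) assms(1) FL by (intro exI[of _ ?F]) (simp del: lcs.simps)
qed

text \<open>Generators refining a central series. Induction on the list replaces induction on the
  nilpotency class and adds one cyclic factor at a time.\<close>

primrec central_list :: "'g::group_add set \<Rightarrow> 'g list \<Rightarrow> bool" where
 "central_list H [] = True"
| "central_list H (t # ts) = (t \<in> H \<and> (\<forall>h\<in>H. cm h t \<in> gen (set ts)) \<and> central_list H ts)"

lemma central_list_append:
 "(\<And>f. f \<in> set fs ==> f \<in> H \<and> (\<forall>h\<in>H. cm h f \<in> gen (set ts))) ==> central_list H ts ==> central_list H (fs @ ts)"
proof (induction fs)
 case (Cons f fs)
 have "gen (set ts) \<subseteq> gen (set (fs @ ts))" by (rule gen_mono) auto
 then show ?case using Cons by auto
qed simp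

lemma ex_central_list:
 assumes "finite T" "H = gen T" "lcs H c = {0}" shows "\<exists>ts. gen (set ts) = H \<and> central_list H ts"
proof -
 have sgH: "sg H" using assms sg_gen by simp
 have "\<exists>ts. gen (set ts) = lcs H n \<and> central_list H ts" if "n \<le> c" for n
  using that
 proof (induction rule: inc_induct)
  case base
  then show ?case using assms(3) gen_empty by (intro exI[of _ "[]"]) simp
 next
  case (step n)
  then obtain ts where ts: "gen (set ts) = lcs H (Suc n)" "central_list H ts" by blast
  obtain F where F: "finite F" "F \<subseteq> lcs H n" "lcs H n = gen (F \<union> lcs H (Suc n))" using lcs_generators[OF assms(1,2)] by blast
  obtain fs where fs: "set fs = F" using F(1) finite_list by blast
  have "central_list H (fs @ ts)"
   by (rule central_list_append[OF _ ts(2)]) (use F(2) fs lcs_sub[OF sgH, of n] lcs_cm(2)[OF sgH] ts(1) in blast)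
  moreover have "gen (set (fs @ ts)) = lcs H n"
  proof (rule gen_eqI[OF sg_lcs[OF sgH]])
   show "set (fs @ ts) \<subseteq> lcs H n" using F(2) fs ts(1) gen_base[of "set ts"] lcs_anti[OF sgH, of n] by auto
   have "F \<union> lcs H (Suc n) \<subseteq> gen (set (fs @ ts))" using fs ts(1) gen_base[of "set (fs @ ts)"] gen_mono[of "set ts" "set (fs @ ts)"] by auto
   then show "lcs H n \<subseteq> gen (set (fs @ ts))" unfolding F(3) by (rule gen_least[OF sg_gen])
  qed
  ultimately show ?case by blast
 qed
 from this[of 0] show ?thesis by simp
qed

definition pbd :: "'g::group_add set \<Rightarrow> (nat \<Rightarrow> 'g) \<Rightarrow> bool"
 where "pbd T f \<longleftrightarrow> (\<exists>A d. \<forall>k. f k \<in> ball T (A * (k + 1) ^ d))"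

lemma poly_le: "A * (k + 1) ^ d + B * (k + 1) ^ e \<le> (A + B) * (k + 1 :: nat) ^ (d + e)"
proof -
 have "(k + 1) ^ d \<le> (k + 1) ^ (d + e)" "(k + 1) ^ e \<le> (k + 1) ^ (d + e)" by (intro power_increasing; simp)+
 then have "A * (k + 1) ^ d \<le> A * (k + 1) ^ (d + e)" "B * (k + 1) ^ e \<le> B * (k + 1) ^ (d + e)" by simp_all
 then show ?thesis by (simp only: distrib_right add_mono)
qed

lemma pbd_add: assumes "pbd T f" "pbd T g" shows "pbd T (\<lambda>k. f k + g k)"
proof -
 obtain A d B e where "\<forall>k. f k \<in> ball T (A * (k + 1) ^ d)" "\<forall>k. g k \<in> ball T (B * (k + 1) ^ e)" using assms by (auto simp: pbd_def)
 then have "f k + g k \<in> ball T ((A + B) * (k + 1) ^ (d + e))" for k using ball_addI[OF _ _ poly_le] by blast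
 then show ?thesis unfolding pbd_def by blast
qed

text \<open>Conjugating \<open>t\<close> by \<open>nm (Suc k) h\<close> differs from conjugating it
  by \<open>nm k h\<close> by a conjugate of \<open>cm h t\<close>, which lies in the subgroup of
  the shorter list. Summing polynomially long pieces raises the degree by one.\<close>

lemma conj_poly:
 assumes "sg H" "h \<in> H"
 shows "central_list H ts ==> x \<in> gen (set ts) ==> pbd (set ts) (\<lambda>k. cjp h k x)"
proof (induction ts arbitrary: x)
 case Nil
 then have "x = 0" by (simp add: gen_empty)
 then show ?case by (simp add: pbd_def ball_zero)
next
 case (Cons t ts)
 let ?T = "set (t # ts)" and ?K = "{x. pbd (set (t # ts)) (\<lambda>k. cjp h k x)}"
 have up: "pbd ?T f" if "pbd (set ts) f" for f using that ball_mono_set[of "set ts" ?T] unfolding pbd_def by (meson set_subset_Cons subsetD)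
 have "sg ?K"
 proof (rule sgI)
  show "0 \<in> ?K" by (simp add: pbd_def ball_zero)
  show "x + y \<in> ?K" if "x \<in> ?K" "y \<in> ?K" for x y
  proof -
   have "cjp h k (x + y) = cjp h k x + cjp h k y" for k by (simp add: add.assoc)
   then show ?thesis using pbd_add that by simp
  qed
  show "- x \<in> ?K" if x: "x \<in> ?K" for x
  proof -
   have "cjp h k (- x) = - cjp h k x" for k by (simp add: add.assoc minus_add)
   then show ?thesis using x ball_neg unfolding pbd_def mem_Collect_eq by metis
  qed
 qed
 moreover have "t \<in> ?K"
 proof -
  have "pbd ?T (\<lambda>k. cjp h k (cm h t))" using Cons assms(2) up by simp
  then obtain A d where A: "\<And>k. cjp h k (cm h t) \<in> ball ?T (A * (k + 1) ^ d)" by (auto simp: pbd_def)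
  have "cjp h k t \<in> ball ?T (1 + k * (A * (k + 1) ^ d))" for k
  proof (induction k)
   case 0
   then show ?case using ball_base[of t ?T] by simp
  next
   case (Suc k)
   have "cjp h (Suc k) t = cjp h k (cm h t) + cjp h k t" by (simp add: nm_Suc2 cm_def add.assoc minus_add)
   moreover have "A * (k + 1) ^ d \<le> A * (Suc k + 1) ^ d" by (intro mult_le_mono2 power_mono) auto
   then have "A * (k + 1) ^ d + (1 + k * (A * (k + 1) ^ d)) \<le> 1 + Suc k * (A * (Suc k + 1) ^ d)"
    using mult_le_mono2[of "A * (k + 1) ^ d" "A * (Suc k + 1) ^ d" k] unfolding mult_Suc by linarith
   ultimately show ?case using ball_addI[OF A Suc] by simp
  qed
  moreover have "1 + k * (A * (k + 1) ^ d) \<le> (A + 1) * (k + 1) ^ (d + 1)" for k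
  proof -
   have "k * (A * (k + 1) ^ d) \<le> A * (k + 1) ^ (d + 1)" by (simp add: algebra_simps)
   moreover have "1 \<le> (k + 1) ^ (d + 1)" by (rule one_le_power) simp
   ultimately show ?thesis by (simp only: distrib_right mult_1)
  qed
  ultimately have "cjp h k t \<in> ball ?T ((A + 1) * (k + 1) ^ (d + 1))" for k using ball_mono by blast
  then show ?thesis unfolding pbd_def by blast
 qed
 moreover have "set ts \<subseteq> ?K" using Cons up gen_base[of "set ts"] by auto
 ultimately have "gen ?T \<subseteq> ?K" by (intro gen_least) auto
 then show ?case using Cons by blast
qed

lemma pbd_uniform: "finite F ==> (\<And>s. s \<in> F ==> pbd T (f s)) ==> \<exists>A d. \<forall>s\<in>F. \<forall>k. f s k \<in> ball T (A * (k + 1) ^ d)"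
proof (induction F rule: finite_induct)
 case (insert s F)
 obtain A d where A: "\<forall>s\<in>F. \<forall>k. f s k \<in> ball T (A * (k + 1) ^ d)" using insert by blast
 obtain B e where B: "\<forall>k. f s k \<in> ball T (B * (k + 1) ^ e)" using insert.prems[of s] unfolding pbd_def by blast
 have le: "A * (k + 1) ^ d \<le> (A + B) * (k + 1) ^ (d + e)" "B * (k + 1) ^ e \<le> (A + B) * (k + 1) ^ (d + e)" for k
  using poly_le[of A k d B e] by linarith+
 have "f x k \<in> ball T ((A + B) * (k + 1) ^ (d + e))" if "x \<in> insert s F" for x k
 proof -
  have "f x k \<in> ball T (A * (k + 1) ^ d) \<or> f x k \<in> ball T (B * (k + 1) ^ e)" using that A B by blast
  then show ?thesis using ball_mono[OF le(1)[of k]] ball_mono[OF le(2)[of k]] by blast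
 qed
 then show ?case by blast
qed simp

definition poly_ball :: "'g::group_add set \<Rightarrow> bool"
 where "poly_ball T \<longleftrightarrow> (\<exists>A d. \<forall>n. card (ball T n) \<le> A * (n + 1) ^ d)"

text \<open>All letters \<open>t\<close> are collected on the left. A word of length
  \<open>n\<close> becomes \<open>zm i t + u\<close> with \<open>\<bar>i\<bar> \<le> n\<close>, and
  \<open>u\<close> is a sum of at most \<open>n\<close> polynomially long conjugates over the
  shorter list.\<close>

lemma central_list_growth: "sg H ==> central_list H ts ==> poly_ball (set ts)"
proof (induction ts)
 case Nil
 have "ball ({}::'a set) n \<subseteq> {0}" for n by (rule ball_sub_sg) (simp_all add: sg_def)
 then have "card (ball ({}::'a set) n) \<le> 1 * (n + 1) ^ 0" for n using card_mono[of "{0::'a}" "ball {} n"] by simp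
 then show ?case unfolding poly_ball_def list.set(1) by blast
next
 case (Cons t ts)
 then obtain A2 d2 where g: "\<And>n. card (ball (set ts) n) \<le> A2 * (n + 1) ^ d2" by (auto simp: poly_ball_def)
 have t: "t \<in> H" "- t \<in> H" using Cons sg_neg by auto
 have pb: "pbd (set ts) (\<lambda>k. cjp h k s)" if "h = t \<or> h = - t" "s \<in> set ts" for h s
  using conj_poly[OF Cons.prems(1), of h ts s] that t Cons.prems(2) gen_base[of "set ts"] by auto
 have "\<exists>A d. \<forall>p\<in>{t, - t} \<times> set ts. \<forall>k. cjp (fst p) k (snd p) \<in> ball (set ts) (A * (k + 1) ^ d)"
  by (rule pbd_uniform) (use pb in auto)
 then obtain A d where A: "\<And>h s k. h = t \<or> h = - t ==> s \<in> set ts ==> cjp h k s \<in> ball (set ts) (A * (k + 1) ^ d)" by fastforce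
 \<comment> \<open>The cost of moving a letter past \<open>i\<close> copies of \<open>t\<close>,
   uniform in \<open>\<bar>i\<bar> \<le> N\<close>.\<close>
 have cj: "- zm i t + s + zm i t \<in> ball (set ts) (A * (N + 1) ^ d)" if i: "\<bar>i\<bar> \<le> int N" and s: "s \<in> set ts \<union> uminus ` set ts" for i s N
 proof -
  have z: "\<exists>h k. (h = t \<or> h = - t) \<and> k \<le> N \<and> - zm i t = nm k h"
  proof (cases "i \<ge> 0")
   case True
   then show ?thesis using i by (intro exI[of _ "- t"] exI[of _ "nat i"]) (auto simp: zm_def nm_neg)
  next
   case False
   then show ?thesis using i by (intro exI[of _ t] exI[of _ "nat (- i)"]) (auto simp: zm_def)
  qed
  then obtain h k where h: "h = t \<or> h = - t" "k \<le> N" "- zm i t = nm k h" by blast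
  then have "zm i t = - nm k h" by (metis minus_minus)
  then have eq: "- zm i t + s + zm i t = cjp h k s" using h(3) by simp
  have "A * (k + 1) ^ d \<le> A * (N + 1) ^ d" using h(2) by (intro mult_le_mono2 power_mono) auto
  then have sub: "ball (set ts) (A * (k + 1) ^ d) \<subseteq> ball (set ts) (A * (N + 1) ^ d)" by (rule ball_mono)
  from s show ?thesis
  proof
   assume "s \<in> set ts"
   then show ?thesis unfolding eq using A[OF h(1)] sub by blast
  next
   assume "s \<in> uminus ` set ts"
   then obtain s' where s': "s' \<in> set ts" "s = - s'" by blast
   have "cjp h k s = - cjp h k s'" unfolding s'(2) by (simp add: add.assoc minus_add)
   then show ?thesis unfolding eq using A[OF h(1) s'(1)] sub ball_neg by (metis subsetD)
  qed
 qed
 have words: "\<exists>i u. sum_list ws = zm i t + u \<and> \<bar>i\<bar> \<le> int (length ws) \<and> u \<in> ball (set ts) (length ws * (A * (N + 1) ^ d))"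
  if "set ws \<subseteq> set (t # ts) \<union> uminus ` set (t # ts)" "length ws \<le> N" for ws N
  using that
 proof (induction ws)
  case Nil
  then show ?case by (intro exI[of _ 0]) (simp add: ball_zero)
 next
  case (Cons s ws)
  let ?b = "A * (N + 1) ^ d"
  obtain i u where u: "sum_list ws = zm i t + u" "\<bar>i\<bar> \<le> int (length ws)" "u \<in> ball (set ts) (length ws * ?b)" using Cons by auto
  have u': "u \<in> ball (set ts) (length (s # ws) * ?b)" using u(3) ball_mono[of "length ws * ?b" "length (s # ws) * ?b"] by auto
  consider j where "s = zm j t" "\<bar>j\<bar> = 1" | "s \<in> set ts \<union> uminus ` set ts"
  proof -
   have "s = zm 1 t \<or> s = zm (- 1) t \<or> s \<in> set ts \<union> uminus ` set ts" using Cons.prems(1) by (auto simp: zm_neg)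
   then show thesis using that by (metis abs_minus_cancel abs_one)
  qed
  then show ?case
  proof cases
   case 1
   have "sum_list (s # ws) = zm (j + i) t + u" using u(1) 1(1) by (simp add: zm_add add.assoc)
   then show ?thesis using u(2) u' 1(2) by (intro exI[of _ "j + i"] exI[of _ u]) auto
  next
   case 2
   have "\<bar>i\<bar> \<le> int N" using u(2) Cons.prems(2) by simp
   from ball_add[OF cj[OF this 2] u(3)] have "(- zm i t + s + zm i t) + u \<in> ball (set ts) (length (s # ws) * ?b)" by simp
   moreover have "sum_list (s # ws) = zm i t + ((- zm i t + s + zm i t) + u)" using u(1) by (simp add: add.assoc)
   ultimately show ?thesis using u(2) by (intro exI[of _ i] exI[of _ "(- zm i t + s + zm i t) + u"]) auto
  qed
 qed
 have "card (ball (set (t # ts)) n) \<le> (2 * A2 * (A + 1) ^ d2) * (n + 1) ^ (1 + (d + 1) * d2)" for n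
 proof -
  let ?m = "n * (A * (n + 1) ^ d)"
  have "ball (set (t # ts)) n \<subseteq> (\<lambda>(i, u). zm i t + u) ` ({- int n..int n} \<times> ball (set ts) ?m)"
  proof
   fix x assume "x \<in> ball (set (t # ts)) n"
   then obtain ws where ws: "set ws \<subseteq> set (t # ts) \<union> uminus ` set (t # ts)" "length ws \<le> n" "x = sum_list ws" by (auto simp: ball_def)
   obtain i u where u: "x = zm i t + u" "\<bar>i\<bar> \<le> int (length ws)" "u \<in> ball (set ts) (length ws * (A * (n + 1) ^ d))"
    using words[OF ws(1,2)] ws(3) by blast
   have "u \<in> ball (set ts) ?m" using u(3) ball_mono[OF mult_le_mono1[OF ws(2)]] by blast
   then show "x \<in> (\<lambda>(i, u). zm i t + u) ` ({- int n..int n} \<times> ball (set ts) ?m)"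
    using u(1,2) ws(2) by (intro image_eqI[of _ _ "(i, u)"]) auto
  qed
  then have "card (ball (set (t # ts)) n) \<le> card ({- int n..int n} \<times> ball (set ts) ?m)"
   by (intro surj_card_le) (auto intro: finite_ball)
  also have "\<dots> \<le> (2 * (n + 1)) * (A2 * (?m + 1) ^ d2)" unfolding card_cartesian_product using g[of ?m] by (intro mult_le_mono) auto
  also have "\<dots> \<le> (2 * (n + 1)) * (A2 * ((A + 1) * (n + 1) ^ (d + 1)) ^ d2)"
  proof (intro mult_le_mono2 power_mono)
   have "1 \<le> (n + 1) ^ (d + 1)" by (rule one_le_power) simp
   moreover have "?m \<le> A * (n + 1) ^ (d + 1)" by (simp add: algebra_simps)
   ultimately show "?m + 1 \<le> (A + 1) * (n + 1) ^ (d + 1)" by (simp only: distrib_right mult_1)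
  qed simp
  also have "\<dots> = (2 * A2 * (A + 1) ^ d2) * (n + 1) ^ (1 + (d + 1) * d2)"
   by (simp only: power_mult_distrib power_mult[of "n + 1" "d + 1" d2] power_add[of "n + 1" 1 "(d + 1) * d2"] power_one_right mult.assoc)
    (simp only: mult_ac)
  finally show ?thesis .
 qed
 then show ?case unfolding poly_ball_def by blast
qed

lemma poly_ball_sub: assumes "finite T" "finite S" "S \<subseteq> gen T" "poly_ball T" shows "poly_ball S"
proof -
 obtain L where L: "S \<subseteq> ball T L" using gen_finite_ball[OF assms(2,3)] by blast
 obtain A d where A: "\<And>n. card (ball T n) \<le> A * (n + 1) ^ d" using assms(4) by (auto simp: poly_ball_def)
 have "card (ball S n) \<le> (A * (L + 1) ^ d) * (n + 1) ^ d" for n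
 proof -
  have "card (ball S n) \<le> card (ball T (L * n))" by (intro card_mono finite_ball assms(1) ball_ball L)
  also have "\<dots> \<le> A * (L * n + 1) ^ d" by (rule A)
  also have "\<dots> \<le> A * ((L + 1) * (n + 1)) ^ d" by (intro mult_le_mono2 power_mono) auto
  finally show ?thesis by (simp only: power_mult_distrib mult.assoc)
 qed
 then show ?thesis unfolding poly_ball_def by blast
qed

theorem virtually_nilpotent_poly_ball:
 fixes S H :: "'g::group_add set"
 assumes S: "finite S" and H: "sg H" "H \<subseteq> gen S" "finite (cos (gen S) H)" "lcs H c = {0}"
 shows "poly_ball S"
proof -
 obtain T R where T: "finite T" "finite R" "H = gen T" "\<forall>n. \<forall>x\<in>ball S n. \<exists>r\<in>R. \<exists>t\<in>ball T n. x = r + t"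
  by (rule schreier[OF S H(1,2,3)]) (rule that, assumption+)
 obtain ts where ts: "gen (set ts) = H" "central_list H ts" using ex_central_list[OF T(1,3) H(4)] by blast
 have "poly_ball T" by (rule poly_ball_sub[OF _ T(1) _ central_list_growth[OF H(1) ts(2)]]) (use ts(1) T(3) gen_base[of T] in auto)
 then obtain A d where A: "\<And>n. card (ball T n) \<le> A * (n + 1) ^ d" by (auto simp: poly_ball_def)
 have "card (ball S n) \<le> (card R * A) * (n + 1) ^ d" for n
 proof -
  have "ball S n \<subseteq> (\<lambda>(r, t). r + t) ` (R \<times> ball T n)" using T(4) by fastforce
  then have "card (ball S n) \<le> card (R \<times> ball T n)" by (intro surj_card_le) (auto intro: finite_ball T)
  also have "\<dots> = card R * card (ball T n)" by (rule card_cartesian_product)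
  also have "\<dots> \<le> card R * (A * (n + 1) ^ d)" by (rule mult_le_mono2[OF A])
  finally show ?thesis by (simp only: mult.assoc)
 qed
 then show ?thesis unfolding poly_ball_def by blast
qed

subsection \<open>Groups of the algebra library\<close>

definition emb :: "('a, 'm) monoid_scheme \<Rightarrow> ('a \<Rightarrow> 'g::group_add) \<Rightarrow> bool" where
 "emb G \<phi> \<longleftrightarrow> group G \<and> inj_on \<phi> (carrier G) \<and> (\<forall>x\<in>carrier G. \<forall>y\<in>carrier G. \<phi> (x \<otimes>\<^bsub>G\<^esub> y) = \<phi> x + \<phi> y)"

text \<open>Left translation, extended by the identity outside the carrier to a permutation of the
  whole type; evaluation at the unit shows injectivity.\<close>

lemma cayley: assumes "group (G :: ('a, 'm) monoid_scheme)" obtains \<phi> :: "'a \<Rightarrow> 'a bijn" where "emb G \<phi>"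
proof -
 interpret G: group G by (rule assms)
 define t where "t g x = (if x \<in> carrier G then g \<otimes>\<^bsub>G\<^esub> x else x)" for g x
 have tt: "t g (t h x) = t (g \<otimes>\<^bsub>G\<^esub> h) x" if "g \<in> carrier G" "h \<in> carrier G" for g h x
  using that by (simp add: t_def G.m_assoc)
 have t1: "t \<one>\<^bsub>G\<^esub> x = x" for x by (simp add: t_def)
 have bij: "bij (t g)" if "g \<in> carrier G" for g
  by (rule o_bij[of "t (inv\<^bsub>G\<^esub> g)"]) (use that tt[of g "inv\<^bsub>G\<^esub> g"] tt[of "inv\<^bsub>G\<^esub> g" g] t1 in \<open>auto simp: fun_eq_iff\<close>)
 define \<phi> where "\<phi> g = Abs_bijn (t g)" for g
 have Rep: "Rep_bijn (\<phi> g) = t g" if "g \<in> carrier G" for g unfolding \<phi>_def using bij[OF that] by (simp add: Abs_bijn_inverse)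
 have "\<phi> (g \<otimes>\<^bsub>G\<^esub> h) = \<phi> g + \<phi> h" if "g \<in> carrier G" "h \<in> carrier G" for g h
 proof -
  have "Rep_bijn (\<phi> (g \<otimes>\<^bsub>G\<^esub> h)) = Rep_bijn (\<phi> g) \<circ> Rep_bijn (\<phi> h)" using that Rep tt[OF that] by (auto simp: fun_eq_iff)
  then show ?thesis by (simp add: plus_bijn.rep_eq flip: Rep_bijn_inject)
 qed
 moreover have "inj_on \<phi> (carrier G)"
 proof (rule inj_onI)
  fix g h assume gh: "g \<in> carrier G" "h \<in> carrier G" "\<phi> g = \<phi> h"
  then have "t g \<one>\<^bsub>G\<^esub> = t h \<one>\<^bsub>G\<^esub>" using Rep by metis
  then show "g = h" using gh by (simp add: t_def)
 qed
 ultimately show ?thesis using that[of \<phi>] assms unfolding emb_def by blast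
qed

lemma embD: assumes "emb G \<phi>"
 shows "group G" "inj_on \<phi> (carrier G)" "\<And>x y. x \<in> carrier G ==> y \<in> carrier G ==> \<phi> (x \<otimes>\<^bsub>G\<^esub> y) = \<phi> x + \<phi> y"
 using assms by (auto simp: emb_def)

lemma emb_one: assumes "emb G \<phi>" shows "\<phi> \<one>\<^bsub>G\<^esub> = 0"
proof -
 interpret G: group G by (rule embD[OF assms])
 have "\<phi> \<one>\<^bsub>G\<^esub> + \<phi> \<one>\<^bsub>G\<^esub> = \<phi> \<one>\<^bsub>G\<^esub> + 0" using embD(3)[OF assms, of "\<one>\<^bsub>G\<^esub>" "\<one>\<^bsub>G\<^esub>"] by simp
 then show ?thesis by (simp only: add_left_cancel)
qed

lemma emb_inv: assumes "emb G \<phi>" "x \<in> carrier G" shows "\<phi> (inv\<^bsub>G\<^esub> x) = - \<phi> x"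
proof -
 interpret G: group G by (rule embD[OF assms(1)])
 have "\<phi> x + \<phi> (inv\<^bsub>G\<^esub> x) = 0" using embD(3)[OF assms(1,2), of "inv\<^bsub>G\<^esub> x"] assms emb_one[OF assms(1)] by simp
 then show ?thesis by (metis minus_unique)
qed

lemma emb_subgroup: assumes "emb G \<phi>" "subgroup K G" shows "emb (G\<lparr>carrier := K\<rparr>) \<phi>"
proof -
 have "K \<subseteq> carrier G" using assms(2) by (simp add: subgroup.subset)
 moreover have "group (G\<lparr>carrier := K\<rparr>)" using subgroup.subgroup_is_group[OF assms(2) embD(1)[OF assms(1)]] .
 ultimately show ?thesis using embD[OF assms(1)] inj_on_subset[of \<phi> "carrier G" K] unfolding emb_def by auto
qed

lemma emb_image: assumes "emb G \<phi>" "subgroup K G" shows "sg (\<phi> ` K)"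
proof (rule sgI)
 have K: "K \<subseteq> carrier G" using assms(2) by (simp add: subgroup.subset)
 show "0 \<in> \<phi> ` K" using emb_one[OF assms(1)] subgroup.one_closed[OF assms(2)] by (metis image_eqI)
 show "x + y \<in> \<phi> ` K" if xy: "x \<in> \<phi> ` K" "y \<in> \<phi> ` K" for x y
 proof -
  obtain a b where "a \<in> K" "b \<in> K" "x = \<phi> a" "y = \<phi> b" using xy by blast
  then show ?thesis using embD(3)[OF assms(1), of a b] subgroup.m_closed[OF assms(2), of a b] K by (metis image_eqI subsetD)
 qed
 show "- x \<in> \<phi> ` K" if x: "x \<in> \<phi> ` K" for x
 proof -
  obtain a where "a \<in> K" "x = \<phi> a" using x by blast
  then show ?thesis using emb_inv[OF assms(1), of a] subgroup.m_inv_closed[OF assms(2), of a] K by (metis image_eqI subsetD)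
 qed
qed

lemma emb_sg: assumes "emb G \<phi>" shows "sg (\<phi> ` carrier G)"
 by (rule emb_image[OF assms group.subgroup_self[OF embD(1)[OF assms]]])

lemma emb_pre: assumes "emb G \<phi>" "sg H" "H \<subseteq> \<phi> ` carrier G"
 shows "subgroup {g \<in> carrier G. \<phi> g \<in> H} G" "\<phi> ` {g \<in> carrier G. \<phi> g \<in> H} = H"
proof -
 interpret G: group G by (rule embD[OF assms(1)])
 show "subgroup {g \<in> carrier G. \<phi> g \<in> H} G"
  by (rule G.subgroupI) (use emb_one[OF assms(1)] emb_inv[OF assms(1)] embD(3)[OF assms(1)] assms(2) in \<open>auto simp: sg_zero sg_add sg_neg\<close>)
 show "\<phi> ` {g \<in> carrier G. \<phi> g \<in> H} = H" using assms(3) by blast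
qed

lemma emb_generate: assumes "emb G \<phi>" "B \<subseteq> carrier G" shows "\<phi> ` generate G B = gen (\<phi> ` B)"
proof
 interpret G: group G by (rule embD[OF assms(1)])
 have "x \<in> carrier G \<and> \<phi> x \<in> gen (\<phi> ` B)" if "x \<in> generate G B" for x
  using that
 proof (induction rule: generate.induct)
  case one
  then show ?case using emb_one[OF assms(1)] sg_zero[OF sg_gen[of "\<phi> ` B"]] by simp
 next
  case (incl h)
  then show ?case using assms(2) gen_base[of "\<phi> ` B"] by blast
 next
  case (inv h)
  then have "h \<in> carrier G" "\<phi> h \<in> gen (\<phi> ` B)" using assms(2) gen_base[of "\<phi> ` B"] by blast+
  then show ?case using emb_inv[OF assms(1)] by (simp add: sg_neg sg_gen)
 next
  case (eng h1 h2)
  then show ?case using embD(3)[OF assms(1)] by (simp add: sg_add sg_gen)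
 qed
 then show "\<phi> ` generate G B \<subseteq> gen (\<phi> ` B)" by blast
 show "gen (\<phi> ` B) \<subseteq> \<phi> ` generate G B"
  by (rule gen_least[OF emb_image[OF assms(1) G.generate_is_subgroup[OF assms(2)]]]) (use generate.incl in fast)
qed

lemma emb_lcs: assumes "emb G \<phi>" shows "lower_central_series G n \<subseteq> carrier G \<and> \<phi> ` lower_central_series G n = lcs (\<phi> ` carrier G) n"
proof (induction n)
 case (Suc n)
 interpret G: group G by (rule embD[OF assms])
 let ?L = "lower_central_series G n"
 let ?B = "{x \<otimes>\<^bsub>G\<^esub> y \<otimes>\<^bsub>G\<^esub> inv\<^bsub>G\<^esub> x \<otimes>\<^bsub>G\<^esub> inv\<^bsub>G\<^esub> y | x y. x \<in> ?L \<and> y \<in> carrier G}"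
 have L: "?L \<subseteq> carrier G" "\<phi> ` ?L = lcs (\<phi> ` carrier G) n" using Suc by auto
 have B: "?B \<subseteq> carrier G" using L(1) by auto
 have c: "\<phi> (x \<otimes>\<^bsub>G\<^esub> y \<otimes>\<^bsub>G\<^esub> inv\<^bsub>G\<^esub> x \<otimes>\<^bsub>G\<^esub> inv\<^bsub>G\<^esub> y) = cm (\<phi> x) (\<phi> y)" if "x \<in> ?L" "y \<in> carrier G" for x y
  using that L(1) by (simp add: subset_iff embD(3)[OF assms] emb_inv[OF assms] cm_def)
 have "\<phi> ` ?B = {cm u v | u v. u \<in> lcs (\<phi> ` carrier G) n \<and> v \<in> \<phi> ` carrier G}"
  unfolding L(2)[symmetric]
 proof (intro equalityI subsetI)
  fix z assume "z \<in> \<phi> ` ?B"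
  then obtain x y where "x \<in> ?L" "y \<in> carrier G" "z = cm (\<phi> x) (\<phi> y)" using c by auto
  then show "z \<in> {cm u v | u v. u \<in> \<phi> ` ?L \<and> v \<in> \<phi> ` carrier G}" by blast
 next
  fix z assume "z \<in> {cm u v | u v. u \<in> \<phi> ` ?L \<and> v \<in> \<phi> ` carrier G}"
  then obtain x y where xy: "x \<in> ?L" "y \<in> carrier G" "z = cm (\<phi> x) (\<phi> y)" by auto
  then show "z \<in> \<phi> ` ?B" unfolding xy(3) c[OF xy(1,2), symmetric] by (intro imageI) blast
 qed
 then show ?case using emb_generate[OF assms B] G.generate_incl[OF B] by simp
qed simp

lemma emb_nilpotent: assumes "emb G \<phi>" shows "nilpotent_group G \<longleftrightarrow> (\<exists>n. lcs (\<phi> ` carrier G) n = {0})"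
proof -
 interpret G: group G by (rule embD[OF assms])
 have "lower_central_series G n = {\<one>\<^bsub>G\<^esub>} \<longleftrightarrow> lcs (\<phi> ` carrier G) n = {0}" for n
 proof -
  have "lower_central_series G n = {\<one>\<^bsub>G\<^esub>} \<longleftrightarrow> \<phi> ` lower_central_series G n = \<phi> ` {\<one>\<^bsub>G\<^esub>}"
   using inj_on_image_eq_iff[OF embD(2)[OF assms], of "lower_central_series G n" "{\<one>\<^bsub>G\<^esub>}"] emb_lcs[OF assms, of n] by simp
  then show ?thesis using emb_lcs[OF assms, of n] emb_one[OF assms] by simp
 qed
 then show ?thesis unfolding nilpotent_group_def using embD(1)[OF assms] by blast
qed

text \<open>Inversion exchanges the right cosets of the library with the left cosets of
  \<open>cos\<close>.\<close>

lemma emb_index: assumes "emb G \<phi>" "subgroup K G"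
 shows "finite (rcosets\<^bsub>G\<^esub> K) \<longleftrightarrow> finite (cos (\<phi> ` carrier G) (\<phi> ` K))"
proof -
 interpret G: group G by (rule embD[OF assms(1)])
 have K: "K \<subseteq> carrier G" using assms(2) by (simp add: subgroup.subset)
 have R: "rcosets\<^bsub>G\<^esub> K = (\<lambda>a. K #>\<^bsub>G\<^esub> a) ` carrier G" by (auto simp: RCOSETS_def)
 have "\<phi> a \<in> (\<lambda>a. \<phi> (inv\<^bsub>G\<^esub> a)) ` carrier G" if "a \<in> carrier G" for a
  using that by (intro image_eqI[of _ _ "inv\<^bsub>G\<^esub> a"]) auto
 then have "\<phi> ` carrier G = (\<lambda>a. \<phi> (inv\<^bsub>G\<^esub> a)) ` carrier G" by auto
 then have C: "cos (\<phi> ` carrier G) (\<phi> ` K) = (\<lambda>a. (+) (\<phi> (inv\<^bsub>G\<^esub> a)) ` \<phi> ` K) ` carrier G" by (auto simp: cos_def image_image)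
 have e: "K #>\<^bsub>G\<^esub> a = K #>\<^bsub>G\<^esub> b \<longleftrightarrow> (+) (\<phi> (inv\<^bsub>G\<^esub> a)) ` \<phi> ` K = (+) (\<phi> (inv\<^bsub>G\<^esub> b)) ` \<phi> ` K" if ab: "a \<in> carrier G" "b \<in> carrier G" for a b
 proof -
  have "(+) (\<phi> (inv\<^bsub>G\<^esub> a)) ` \<phi> ` K = (+) (\<phi> (inv\<^bsub>G\<^esub> b)) ` \<phi> ` K \<longleftrightarrow> \<phi> (a \<otimes>\<^bsub>G\<^esub> inv\<^bsub>G\<^esub> b) \<in> \<phi> ` K"
   unfolding coset_eq[OF emb_image[OF assms]] using ab by (simp add: emb_inv[OF assms(1)] embD(3)[OF assms(1)])
  also have "\<dots> \<longleftrightarrow> a \<otimes>\<^bsub>G\<^esub> inv\<^bsub>G\<^esub> b \<in> K" using inj_on_image_mem_iff[OF embD(2)[OF assms(1)] _ K] ab by simp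
  also have "\<dots> \<longleftrightarrow> a \<in> K #>\<^bsub>G\<^esub> b"
  proof
   assume "a \<otimes>\<^bsub>G\<^esub> inv\<^bsub>G\<^esub> b \<in> K"
   moreover have "a = (a \<otimes>\<^bsub>G\<^esub> inv\<^bsub>G\<^esub> b) \<otimes>\<^bsub>G\<^esub> b" using ab by (simp add: G.m_assoc)
   ultimately show "a \<in> K #>\<^bsub>G\<^esub> b" unfolding r_coset_def by blast
  next
   assume "a \<in> K #>\<^bsub>G\<^esub> b"
   then obtain k where "k \<in> K" "a = k \<otimes>\<^bsub>G\<^esub> b" by (auto simp: r_coset_def)
   then show "a \<otimes>\<^bsub>G\<^esub> inv\<^bsub>G\<^esub> b \<in> K" using ab K by (auto simp: G.m_assoc subset_iff)
  qed
  also have "\<dots> \<longleftrightarrow> K #>\<^bsub>G\<^esub> a = K #>\<^bsub>G\<^esub> b" using G.repr_independence[OF _ ab(2) assms(2)] G.rcos_self[OF ab(1) assms(2)] by metis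
  finally show ?thesis by blast
 qed
 show ?thesis unfolding R C
 proof
  assume "finite ((\<lambda>a. K #>\<^bsub>G\<^esub> a) ` carrier G)"
  then show "finite ((\<lambda>a. (+) (\<phi> (inv\<^bsub>G\<^esub> a)) ` \<phi> ` K) ` carrier G)" by (rule finite_image_factor) (use e in blast)
 next
  assume "finite ((\<lambda>a. (+) (\<phi> (inv\<^bsub>G\<^esub> a)) ` \<phi> ` K) ` carrier G)"
  then show "finite ((\<lambda>a. K #>\<^bsub>G\<^esub> a) ` carrier G)" by (rule finite_image_factor) (use e in blast)
 qed
qed

lemma emb_virtually_nilpotent: assumes "emb G \<phi>"
 shows "virtually_nilpotent G \<longleftrightarrow> (\<exists>H c. sg H \<and> H \<subseteq> \<phi> ` carrier G \<and> finite (cos (\<phi> ` carrier G) H) \<and> lcs H c = {0})"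
proof
 assume "virtually_nilpotent G"
 then obtain K where K: "subgroup K G" "finite (rcosets\<^bsub>G\<^esub> K)" "nilpotent_group (G\<lparr>carrier := K\<rparr>)"
  unfolding virtually_nilpotent_def by blast
 have "\<phi> ` K \<subseteq> \<phi> ` carrier G" using subgroup.subset[OF K(1)] by blast
 then show "\<exists>H c. sg H \<and> H \<subseteq> \<phi> ` carrier G \<and> finite (cos (\<phi> ` carrier G) H) \<and> lcs H c = {0}"
  using K emb_image[OF assms K(1)] emb_index[OF assms K(1)] emb_nilpotent[OF emb_subgroup[OF assms K(1)]] by auto
next
 assume "\<exists>H c. sg H \<and> H \<subseteq> \<phi> ` carrier G \<and> finite (cos (\<phi> ` carrier G) H) \<and> lcs H c = {0}"
 then obtain H c where H: "sg H" "H \<subseteq> \<phi> ` carrier G" "finite (cos (\<phi> ` carrier G) H)" "lcs H c = {0}" by blast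
 let ?K = "{g \<in> carrier G. \<phi> g \<in> H}"
 note K = emb_pre[OF assms H(1,2)]
 have "nilpotent_group (G\<lparr>carrier := ?K\<rparr>)" unfolding emb_nilpotent[OF emb_subgroup[OF assms K(1)]] using H(4) K(2) by auto
 then show "virtually_nilpotent G" unfolding virtually_nilpotent_def
  using embD(1)[OF assms] K emb_index[OF assms K(1)] H(3) by auto
qed

lemma emb_growth: assumes "emb G \<phi>" "finite_generating_set G A"
 shows "finite (\<phi> ` A)" "gen (\<phi> ` A) = \<phi> ` carrier G" "growth G A n = card (ball (\<phi> ` A) n)"
proof -
 interpret G: group G by (rule embD[OF assms(1)])
 have A: "finite A" "A \<subseteq> carrier G" "generate G A = carrier G" using assms(2) by (auto simp: finite_generating_set_def)
 show "finite (\<phi> ` A)" and gA: "gen (\<phi> ` A) = \<phi> ` carrier G" using A emb_generate[OF assms(1) A(2)] by auto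
 let ?A = "A \<union> m_inv G ` A"
 have AC: "?A \<subseteq> carrier G" using A(2) by auto
 have im: "\<phi> ` ?A = \<phi> ` A \<union> uminus ` \<phi> ` A" using emb_inv[OF assms(1)] A(2) by (force simp: image_Un image_image subset_iff)
 have fold: "foldr (\<otimes>\<^bsub>G\<^esub>) ws \<one>\<^bsub>G\<^esub> \<in> carrier G \<and> \<phi> (foldr (\<otimes>\<^bsub>G\<^esub>) ws \<one>\<^bsub>G\<^esub>) = sum_list (map \<phi> ws)" if "set ws \<subseteq> ?A" for ws
  using that
 proof (induction ws)
  case (Cons w ws)
  have "w \<in> carrier G" using Cons.prems AC by auto
  then show ?case using Cons embD(3)[OF assms(1), of w] by simp
 qed (simp add: emb_one[OF assms(1)])
 let ?w = "\<lambda>g n. \<exists>ws. set ws \<subseteq> ?A \<and> length ws = n \<and> foldr (\<otimes>\<^bsub>G\<^esub>) ws \<one>\<^bsub>G\<^esub> = g"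
 have lift: "\<exists>m\<le>n. ?w g m" if g: "g \<in> carrier G" "\<phi> g \<in> ball (\<phi> ` A) n" for g n
 proof -
  obtain vs where vs: "set vs \<subseteq> \<phi> ` ?A" "length vs \<le> n" "\<phi> g = sum_list vs" using g(2) unfolding ball_def im by blast
  have "vs \<in> map \<phi> ` lists ?A" unfolding lists_image[symmetric] in_lists_conv_set using vs(1) by blast
  then obtain ws where ws: "set ws \<subseteq> ?A" "vs = map \<phi> ws" by (auto simp: in_lists_conv_set)
  have "foldr (\<otimes>\<^bsub>G\<^esub>) ws \<one>\<^bsub>G\<^esub> = g" using fold[OF ws(1)] inj_onD[OF embD(2)[OF assms(1)] _ _ g(1)] vs(3) ws(2) by metis
  then show ?thesis using ws vs(2) by auto
 qed
 have wl: "word_length G A g \<le> n \<longleftrightarrow> \<phi> g \<in> ball (\<phi> ` A) n" if g: "g \<in> carrier G" for g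
 proof
  have "\<phi> g \<in> gen (\<phi> ` A)" using gA g by blast
  then obtain m where "\<phi> g \<in> ball (\<phi> ` A) m" by (auto simp: gen_def)
  then have "\<exists>m. ?w g m" using lift[OF g] by blast
  then have "?w g (word_length G A g)" unfolding word_length_def by (rule LeastI_ex)
  then obtain ws where ws: "set ws \<subseteq> ?A" "length ws = word_length G A g" "foldr (\<otimes>\<^bsub>G\<^esub>) ws \<one>\<^bsub>G\<^esub> = g" by blast
  assume "word_length G A g \<le> n"
  then show "\<phi> g \<in> ball (\<phi> ` A) n" unfolding ball_def im[symmetric] using fold[OF ws(1)] ws by (intro CollectI exI[of _ "map \<phi> ws"]) auto
 next
  assume "\<phi> g \<in> ball (\<phi> ` A) n"
  then obtain m where m: "m \<le> n" "?w g m" using lift[OF g] by blast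
  then show "word_length G A g \<le> n" unfolding word_length_def using Least_le[of "?w g" m] by simp
 qed
 have "\<phi> ` {g \<in> carrier G. word_length G A g \<le> n} = ball (\<phi> ` A) n"
 proof
  show "\<phi> ` {g \<in> carrier G. word_length G A g \<le> n} \<subseteq> ball (\<phi> ` A) n" using wl by auto
  show "ball (\<phi> ` A) n \<subseteq> \<phi> ` {g \<in> carrier G. word_length G A g \<le> n}"
  proof
   fix x assume x: "x \<in> ball (\<phi> ` A) n"
   then obtain g where "g \<in> carrier G" "x = \<phi> g" using gA ball_gen by blast
   then show "x \<in> \<phi> ` {g \<in> carrier G. word_length G A g \<le> n}" using x wl by auto
  qed
 qed
 moreover have "inj_on \<phi> {g \<in> carrier G. word_length G A g \<le> n}" by (rule inj_on_subset[OF embD(2)[OF assms(1)]]) auto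
 ultimately show "growth G A n = card (ball (\<phi> ` A) n)" unfolding growth_def by (simp only: card_image[symmetric])
qed

lemma emb_polynomial_growth: assumes "emb G \<phi>" "finite_generating_set G A"
 shows "poly_ball (\<phi> ` A) \<longleftrightarrow> polynomial_growth G A"
proof
 assume "poly_ball (\<phi> ` A)"
 then obtain B d where B: "\<And>n. growth G A n \<le> B * (n + 1) ^ d" unfolding poly_ball_def emb_growth(3)[OF assms] by blast
 \<comment> \<open>The estimate n + 1 <= 2 n costs the factor 2^d. The units added to constant and
   exponent make the inequality strict and both parameters positive.\<close>
 have "real (growth G A n) < real (B * 2 ^ d + 1) * real n powr real (d + 1)" if n: "n \<ge> 1" for n
 proof -
  have "B * (n + 1) ^ d \<le> B * (2 * n) ^ d" using n by (intro mult_le_mono2 power_mono) auto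
  also have "\<dots> \<le> (B * 2 ^ d) * n ^ (d + 1)" using n by (simp add: power_mult_distrib)
  also have "\<dots> < (B * 2 ^ d + 1) * n ^ (d + 1)" using n by simp
  finally have "growth G A n < (B * 2 ^ d + 1) * n ^ (d + 1)" using B[of n] by linarith
  then have "real (growth G A n) < real ((B * 2 ^ d + 1) * n ^ (d + 1))" by (simp only: of_nat_less_iff)
  then show ?thesis using n powr_realpow[of "real n" "d + 1"] by (simp add: algebra_simps)
 qed
 moreover have "0 < real (B * 2 ^ d + 1)" "0 < real (d + 1)" unfolding of_nat_0_less_iff by simp_all
 ultimately show "polynomial_growth G A" unfolding polynomial_growth_def by blast
next
 assume "polynomial_growth G A"
 then obtain C d :: real where C: "C > 0" "d > 0" "\<And>n. n \<ge> 1 ==> real (growth G A n) < C * real n powr d"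
  unfolding polynomial_growth_def by blast
 \<comment> \<open>The summand \<open>growth G A 0\<close> takes care of \<open>n = 0\<close>, where
   the definition of polynomial growth makes no claim.\<close>
 let ?B = "nat \<lceil>C\<rceil> + growth G A 0" and ?d = "nat \<lceil>d\<rceil>"
 have "growth G A n \<le> ?B * (n + 1) ^ ?d" for n
 proof (cases "n = 0")
  case False
  have "real n powr d \<le> real (n + 1) powr real ?d" using False C(2) by (intro powr_mono_both) (auto simp: real_nat_ceiling_ge)
  then have "C * real n powr d \<le> real ?B * real (n + 1) powr real ?d" using C(1) by (intro mult_mono order_trans[OF real_nat_ceiling_ge[of C]]) auto
  also have "\<dots> = real (?B * (n + 1) ^ ?d)" by (simp only: of_nat_mult of_nat_power powr_realpow of_nat_0_less_iff)
  finally show ?thesis using C(3)[of n] False by linarith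
 qed simp
 then show "poly_ball (\<phi> ` A)" unfolding poly_ball_def emb_growth(3)[OF assms, symmetric] by blast
qed

text \<open>From 1 <= x right invariance gives y <= xy, so the elements above the unit are closed
  under products; multiplying x <= 1 by the inverse of x shows that the inverse of a negative
  element is positive.\<close>

lemma emb_cone: assumes "emb G \<phi>" "right_orderable G" obtains P where "cone P (\<phi> ` carrier G)"
proof -
 interpret G: group G by (rule embD[OF assms(1)])
 obtain r where r: "linear_order_on (carrier G) r"
  "\<And>x y z. x \<in> carrier G ==> y \<in> carrier G ==> z \<in> carrier G ==> (x, y) \<in> r ==> (x \<otimes>\<^bsub>G\<^esub> z, y \<otimes>\<^bsub>G\<^esub> z) \<in> r"
  using assms(2) unfolding right_orderable_def by blast
 have o: "trans r" "antisym r" "total_on (carrier G) r"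
  using r(1) by (auto simp: linear_order_on_def partial_order_on_def preorder_on_def)
 let ?Q = "{x \<in> carrier G. x \<noteq> \<one>\<^bsub>G\<^esub> \<and> (\<one>\<^bsub>G\<^esub>, x) \<in> r}"
 have mult: "x \<otimes>\<^bsub>G\<^esub> y \<in> ?Q" if xy: "x \<in> ?Q" "y \<in> ?Q" for x y
 proof -
  have c: "x \<in> carrier G" "y \<in> carrier G" "(\<one>\<^bsub>G\<^esub>, y) \<in> r" "y \<noteq> \<one>\<^bsub>G\<^esub>" using xy by auto
  have s: "(y, x \<otimes>\<^bsub>G\<^esub> y) \<in> r" using r(2)[of "\<one>\<^bsub>G\<^esub>" x y] xy by simp
  have "x \<otimes>\<^bsub>G\<^esub> y \<noteq> \<one>\<^bsub>G\<^esub>" using s c(3,4) antisymD[OF o(2)] by metis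
  then show ?thesis using c transD[OF o(1) c(3) s] by simp
 qed
 have tot: "x = \<one>\<^bsub>G\<^esub> \<or> x \<in> ?Q \<or> inv\<^bsub>G\<^esub> x \<in> ?Q" if x: "x \<in> carrier G" for x
 proof -
  have "x = \<one>\<^bsub>G\<^esub> \<or> (\<one>\<^bsub>G\<^esub>, x) \<in> r \<or> (x, \<one>\<^bsub>G\<^esub>) \<in> r" using o(3) x unfolding total_on_def by auto
  moreover have "(\<one>\<^bsub>G\<^esub>, inv\<^bsub>G\<^esub> x) \<in> r" if "(x, \<one>\<^bsub>G\<^esub>) \<in> r" using r(2)[OF x _ _ that, of "inv\<^bsub>G\<^esub> x"] x by simp
  ultimately show ?thesis using x by (auto simp: G.inv_eq_1_iff)
 qed
 have "cone (\<phi> ` ?Q) (\<phi> ` carrier G)" unfolding cone_def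
 proof (intro conjI ballI)
  show "\<phi> ` ?Q \<subseteq> \<phi> ` carrier G" by auto
  show "0 \<notin> \<phi> ` ?Q"
  proof
   assume "0 \<in> \<phi> ` ?Q"
   then obtain a where a: "a \<in> ?Q" "\<phi> a = \<phi> \<one>\<^bsub>G\<^esub>" using emb_one[OF assms(1)] by auto
   then show False using inj_onD[OF embD(2)[OF assms(1)] a(2)] by simp
  qed
  show "x + y \<in> \<phi> ` ?Q" if xy: "x \<in> \<phi> ` ?Q" "y \<in> \<phi> ` ?Q" for x y
  proof -
   obtain a b where ab: "a \<in> ?Q" "b \<in> ?Q" "x = \<phi> a" "y = \<phi> b" using xy by blast
   then have "x + y = \<phi> (a \<otimes>\<^bsub>G\<^esub> b)" using embD(3)[OF assms(1), of a b] by simp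
   then show ?thesis using mult[OF ab(1,2)] by (simp only: imageI)
  qed
  show "x = 0 \<or> x \<in> \<phi> ` ?Q \<or> - x \<in> \<phi> ` ?Q" if x: "x \<in> \<phi> ` carrier G" for x
  proof -
   obtain a where a: "a \<in> carrier G" "x = \<phi> a" using x by blast
   have "- x = \<phi> (inv\<^bsub>G\<^esub> a)" using emb_inv[OF assms(1) a(1)] a(2) by simp
   then show ?thesis using tot[OF a(1)] emb_one[OF assms(1)] a(2) by (elim disjE) simp_all
  qed
 qed
 then show ?thesis by (rule that)
qed

text \<open>The exponent \<open>N\<close> is about \<open>2 n\<^bsup>1/k\<^esup>\<close>, and \<open>e < 4\<close>.\<close>

lemma thin_balls:
 assumes k: "k \<ge> 1" and g: "\<not> growth_le (\<lambda>n. exp (real n powr (1 / real k))) (\<lambda>n. real (card (ball S n)))" and S: "finite S"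
 shows "\<exists>N\<ge>1. card (ball S (L * N ^ k)) < 2 ^ N"
proof -
 \<comment> \<open>As \<open>N \<le> 3 * r\<close>, the radius \<open>L * N ^ k\<close> is at most
   \<open>L * 3 ^ k * n\<close>; the summand 2 keeps \<open>C\<close> above 1.\<close>
 define C where "C = L * 3 ^ k + 2"
 have "C > 1" by (simp add: C_def)
 then obtain n where n: "n \<ge> 1" "real (card (ball S (C * n))) < exp (real n powr (1 / real k))"
  using g unfolding growth_le_def by (meson not_le)
 define r where "r = real n powr (1 / real k)"
 have r: "r \<ge> 1" unfolding r_def using n(1) by (intro ge_one_powr_ge_zero) auto
 have rk: "r ^ k = real n" using n(1) k r by (simp add: r_def powr_powr flip: powr_realpow)
 \<comment> \<open>The factor 2 turns exp r into at most 4^r = 2^(2 r); since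
   \<open>r \<ge> 1\<close>, rounding up stays below \<open>3 * r\<close>.\<close>
 define N where "N = nat \<lceil>2 * r\<rceil>"
 have N: "2 * r \<le> real N" "real N \<le> 3 * r" using r unfolding N_def by linarith+
 then have N1: "N \<ge> 1" using r by linarith
 have "real (N ^ k) \<le> (3 * r) ^ k" using power_mono[OF N(2), of k] by simp
 also have "\<dots> = real (3 ^ k * n)" by (simp add: power_mult_distrib rk)
 finally have "N ^ k \<le> 3 ^ k * n" by (simp only: of_nat_le_iff)
 then have "L * N ^ k \<le> L * (3 ^ k * n)" by (rule mult_le_mono2)
 also have "\<dots> \<le> C * n" by (simp add: C_def algebra_simps)
 finally have "card (ball S (L * N ^ k)) \<le> card (ball S (C * n))" by (intro card_mono finite_ball S ball_mono)
 then have "real (card (ball S (L * N ^ k))) \<le> real (card (ball S (C * n)))" by simp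
 also have "\<dots> < exp r" using n(2) by (simp add: r_def)
 also have "exp r = exp 1 powr r" by (simp add: powr_def)
 also have "\<dots> \<le> (2 powr 2) powr r" using exp_le r by (intro powr_mono2) auto
 also have "\<dots> = 2 powr (2 * r)" by (simp only: powr_powr)
 also have "\<dots> \<le> 2 powr real N" using N(1) by (intro powr_mono) auto
 also have "\<dots> = real (2 ^ N)" by (simp add: powr_realpow)
 finally have "card (ball S (L * N ^ k)) < 2 ^ N" by (simp only: of_nat_less_iff)
 then show ?thesis using N1 by blast
qed

lemma slow_growth: "finite S ==> \<not> growth_le (\<lambda>n. exp (real n powr (1/2))) (\<lambda>n. real (card (ball S n))) ==> slow S"
 using thin_balls[of 2 S] unfolding slow_def by (simp add: power2_eq_square mult.assoc)

lemma slow6_growth: "finite S ==> \<not> growth_le (\<lambda>n. exp (real n powr (1/6))) (\<lambda>n. real (card (ball S n))) ==> slow6 S"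
 using thin_balls[of 6 S] unfolding slow6_def by simp

lemma solvable_case:
 assumes "emb G \<phi>" "finite_generating_set G A" "slow (\<phi> ` A)" "dern l (gen (\<phi> ` A)) = {0}"
 shows "virtually_nilpotent G \<and> polynomial_growth G A"
proof -
 note g = emb_growth[OF assms(1,2)]
 obtain H c where H: "sg H" "H \<subseteq> gen (\<phi> ` A)" "finite (cos (gen (\<phi> ` A)) H)" "lcs H c = {0}"
  using slow_solvable_virtually_nilpotent[OF g(1) assms(3,4)] by blast
 then show ?thesis
  using virtually_nilpotent_poly_ball[OF g(1) H] emb_polynomial_growth[OF assms(1,2)] emb_virtually_nilpotent[OF assms(1)] g(2) by auto
qed

lemma sixth_root_gap:
 assumes "group G" "finite_generating_set G A" "right_orderable G"
  "\<not> growth_le (\<lambda>n. exp (real n powr (1/6))) (\<lambda>n. real (growth G A n))"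
 shows "virtually_nilpotent G \<and> polynomial_growth G A"
proof -
 obtain \<phi> :: "'a \<Rightarrow> 'a bijn" where e: "emb G \<phi>" using cayley[OF assms(1)] by blast
 note g = emb_growth[OF e assms(2)]
 obtain P where "cone P (gen (\<phi> ` A))" using emb_cone[OF e assms(3)] g(2) by auto
 moreover have "slow6 (\<phi> ` A)" using slow6_growth[OF g(1)] assms(4) unfolding g(3) by blast
 ultimately show ?thesis using slow6_solvable[OF g(1)] slow6_slow[OF g(1)] solvable_case[OF e assms(2)] by blast
qed

subsection \<open>Residually polycyclic quotients\<close>

text \<open>The quotients live in types of permutations, whereas the class of residually polycyclic
  groups is taken over the naturals; countability allows the transfer.\<close>

lemma nat_copy:
 fixes V :: "'g::group_add set"
 assumes V: "sg V" "countable V"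
 obtains P :: "nat monoid" and \<phi> where "emb P \<phi>" "\<phi> ` carrier P = V"
proof -
 let ?n = "to_nat_on V" and ?i = "inv_into V (to_nat_on V)"
 have i: "?i (?n v) = v" if "v \<in> V" for v using inj_on_to_nat_on[OF V(2)] that by (rule inv_into_f_f)
 define P :: "nat monoid" where "P = \<lparr>carrier = ?n ` V, monoid.mult = (\<lambda>x y. ?n (?i x + ?i y)), monoid.one = ?n 0\<rparr>"
 note add = sg_add[OF V(1)] and zero = sg_zero[OF V(1)] and neg = sg_neg[OF V(1)]
 have "group P"
 proof (rule groupI)
  show "x \<otimes>\<^bsub>P\<^esub> y \<otimes>\<^bsub>P\<^esub> z = x \<otimes>\<^bsub>P\<^esub> (y \<otimes>\<^bsub>P\<^esub> z)" if "x \<in> carrier P" "y \<in> carrier P" "z \<in> carrier P" for x y z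
   using that add i by (auto simp: P_def add.assoc)
  show "\<exists>y\<in>carrier P. y \<otimes>\<^bsub>P\<^esub> x = \<one>\<^bsub>P\<^esub>" if x: "x \<in> carrier P" for x
  proof -
   obtain v where v: "v \<in> V" "x = ?n v" using x by (auto simp: P_def)
   then show ?thesis using neg[OF v(1)] i by (intro bexI[of _ "?n (- v)"]) (auto simp: P_def)
  qed
 qed (use add zero i in \<open>auto simp: P_def\<close>)
 then have "emb P ?i" unfolding emb_def using i add by (auto simp: P_def inj_on_def)
 moreover have "?i ` carrier P = V" using i by (auto simp: P_def image_image)
 ultimately show ?thesis by (rule that)
qed

lemma countable_gen: assumes "finite S" shows "countable (gen S)"
 unfolding gen_def by (rule countable_UN) (use finite_ball[OF assms] countable_finite in auto)

lemma polycyclic_step: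
 fixes R :: "'a monoid" and \<phi> :: "'a \<Rightarrow> 'g::group_add"
 assumes R: "emb R \<phi>" and H: "sg H" "H \<subseteq> \<phi> ` carrier R" and K: "sg K" "K \<subseteq> H"
  and ab: "\<And>a b. a \<in> H ==> b \<in> H ==> cm a b \<in> K" and y: "y \<in> H" "H = gen (insert y K)"
  and pc: "polycyclic_seq R {g \<in> carrier R. \<phi> g \<in> K}"
 shows "polycyclic_seq R {g \<in> carrier R. \<phi> g \<in> H}"
proof -
 let ?H = "{g \<in> carrier R. \<phi> g \<in> H}" and ?K = "{g \<in> carrier R. \<phi> g \<in> K}"
 note HH = emb_pre[OF R H]
 let ?R = "R\<lparr>carrier := ?H\<rparr>"
 have eR: "emb ?R \<phi>" by (rule emb_subgroup[OF R HH(1)])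
 interpret R: group ?R by (rule embD[OF eR])
 have cR: "carrier ?R = ?H" by simp
 have "K \<subseteq> \<phi> ` carrier ?R" using K(2) HH(2) by simp
 note KK = emb_pre[OF eR K(1) this]
 have Keq: "{g \<in> carrier ?R. \<phi> g \<in> K} = ?K" using K(2) by auto
 have nH: "nrm H K" by (rule nrm_of_cm[OF K(1)]) (use ab K(2) in blast)
 have n: "?K \<lhd> ?R" unfolding R.normal_inv_iff
 proof (intro conjI ballI)
  show "subgroup ?K ?R" using KK(1) unfolding Keq .
  fix x h assume x: "x \<in> carrier ?R" and h: "h \<in> ?K"
  have hR: "h \<in> carrier ?R" using h K(2) by auto
  have "\<phi> (x \<otimes>\<^bsub>?R\<^esub> h \<otimes>\<^bsub>?R\<^esub> inv\<^bsub>?R\<^esub> x) = \<phi> x + \<phi> h + - \<phi> x"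
   by (simp only: embD(3)[OF eR] emb_inv[OF eR] R.m_closed R.inv_closed x hR)
  moreover have "\<phi> x + \<phi> h + - \<phi> x \<in> K" using nrmD[OF nH] x h by simp
  moreover have "x \<otimes>\<^bsub>?R\<^esub> h \<otimes>\<^bsub>?R\<^esub> inv\<^bsub>?R\<^esub> x \<in> carrier ?R" by (intro R.m_closed R.inv_closed x hR)
  ultimately show "x \<otimes>\<^bsub>?R\<^esub> h \<otimes>\<^bsub>?R\<^esub> inv\<^bsub>?R\<^esub> x \<in> ?K" using cR by simp
 qed
 let ?Q = "?R Mod ?K"
 interpret N: normal ?K ?R by (rule n)
 interpret Q: group ?Q by (rule N.factorgroup_is_group)
 obtain y' where y': "y' \<in> ?H" "\<phi> y' = y" using y(1) HH(2) by (metis (mono_tags, lifting) imageE)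
 let ?c = "\<lambda>a. ?K #>\<^bsub>?R\<^esub> a"
 have hom: "?c \<in> hom ?R ?Q" by (rule N.r_coset_hom_Mod)
 interpret h: group_hom ?R ?Q ?c by unfold_locales (rule hom)
 have cy: "?c y' \<in> carrier ?Q" using h.hom_closed[of y'] y'(1) by simp
 let ?J = "{a \<in> carrier ?R. ?c a \<in> generate ?Q {?c y'}}"
 have gs: "subgroup (generate ?Q {?c y'}) ?Q" by (rule Q.generate_is_subgroup) (use cy in simp)
 have J: "subgroup ?J ?R"
 proof (rule R.subgroupI)
  have "\<one>\<^bsub>?R\<^esub> \<in> ?J" using h.hom_one subgroup.one_closed[OF gs] R.one_closed by (simp only: mem_Collect_eq)
  then show "?J \<noteq> {}" by blast
  show "inv\<^bsub>?R\<^esub> a \<in> ?J" if "a \<in> ?J" for a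
   using that h.hom_inv[of a] subgroup.m_inv_closed[OF gs, of "?c a"] by (simp only: mem_Collect_eq R.inv_closed)
  show "a \<otimes>\<^bsub>?R\<^esub> b \<in> ?J" if "a \<in> ?J" "b \<in> ?J" for a b
   using that h.hom_mult[of a b] subgroup.m_closed[OF gs, of "?c a" "?c b"] by (simp only: mem_Collect_eq R.m_closed)
 qed auto
 have "insert y K \<subseteq> \<phi> ` ?J"
 proof
  fix k assume "k \<in> insert y K"
  then consider "k = y" | "k \<in> K" by blast
  then show "k \<in> \<phi> ` ?J"
  proof cases
   case 1
   have "y' \<in> ?J" using y'(1) generate.incl[of "?c y'" "{?c y'}" ?Q] by simp
   then show ?thesis using 1 y'(2) by blast
  next
   case 2
   then obtain g where g: "g \<in> ?K" "k = \<phi> g" using KK(2) unfolding Keq by blast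
   have gR: "g \<in> carrier ?R" using g K(2) by auto
   have "?c g = \<one>\<^bsub>?Q\<^esub>" using R.coset_join2[OF gR N.subgroup_axioms g(1)] by (simp add: FactGroup_def)
   then have "g \<in> ?J" using gR subgroup.one_closed[OF gs] by simp
   then show ?thesis using g(2) by blast
  qed
 qed
 then have "gen (insert y K) \<subseteq> \<phi> ` ?J" by (rule gen_least[OF emb_image[OF eR J]])
 then have HJ: "H \<subseteq> \<phi> ` ?J" by (rule ord_eq_le_trans[OF y(2)])
 have "a \<in> ?J" if a: "a \<in> carrier ?R" for a
 proof -
  have "\<phi> a \<in> \<phi> ` ?J" using HJ a by auto
  then obtain b where "b \<in> ?J" "\<phi> a = \<phi> b" by blast
  then show ?thesis using inj_onD[OF embD(2)[OF eR] _ a] by (metis (mono_tags, lifting) mem_Collect_eq)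
 qed
 then have "carrier ?Q \<subseteq> generate ?Q {?c y'}" by (auto simp: FactGroup_def RCOSETS_def)
 then have "generate ?Q {?c y'} = carrier ?Q" using Q.generate_incl[of "{?c y'}"] cy by blast
 then have "subgroup_generated ?Q {?c y'} = ?Q" unfolding subgroup_generated_def using cy by (simp add: FactGroup_def)
 then have "cyclic_group ?Q" unfolding cyclic_group_def using cy by blast
 then show ?thesis by (rule polycyclic_seq.extension[OF pc n HH(1)])
qed

text \<open>Every factor of the derived series is abelian and finitely generated. Adding its
  generators one at a time refines the series to one with cyclic factors.\<close>

lemma polycyclic_of_dern:
 fixes R :: "'a monoid"
 assumes R: "emb R \<phi>" and fg: "\<And>j. \<exists>Y. finite Y \<and> dern j (\<phi> ` carrier R) = gen Y" and l: "dern l (\<phi> ` carrier R) = {0}"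
 shows "polycyclic R"
proof -
 interpret R: group R by (rule embD[OF R])
 let ?V = "\<phi> ` carrier R"
 have V: "sg ?V" by (rule emb_sg[OF R])
 have "polycyclic_seq R {g \<in> carrier R. \<phi> g \<in> dern j ?V}" if "j \<le> l" for j
  using that
 proof (induction rule: inc_induct)
  case base
  have "\<phi> g = 0 \<longleftrightarrow> g = \<one>\<^bsub>R\<^esub>" if "g \<in> carrier R" for g
   using inj_on_eq_iff[OF embD(2)[OF R] that R.one_closed] emb_one[OF R] by simp
  then have "{g \<in> carrier R. \<phi> g \<in> dern l ?V} = {\<one>\<^bsub>R\<^esub>}" unfolding l by auto
  then show ?case by (simp only: polycyclic_seq.unity)
 next
  case (step j)
  let ?D = "dern j ?V" and ?E = "dern (Suc j) ?V"
  have D: "sg ?D" "?D \<subseteq> ?V" "sg ?E" "?E \<subseteq> ?D" using sg_dern[OF V] dern_sub[OF V] dern_anti[OF V, of j "Suc j"] by auto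
  obtain Y where Y: "finite Y" "?D = gen Y" using fg by blast
  obtain ys where ys: "set ys = Y" using Y(1) finite_list by blast
  have "polycyclic_seq R {g \<in> carrier R. \<phi> g \<in> gen (?E \<union> set zs)}" if "set zs \<subseteq> ?D" for zs
   using that
  proof (induction zs)
   case Nil
   then show ?case using step.IH gen_sg[OF D(3)] by simp
  next
   case (Cons z zs)
   let ?H = "gen (?E \<union> set (z # zs))" and ?K = "gen (?E \<union> set zs)"
   have HD: "?H \<subseteq> ?D" by (rule gen_least[OF D(1)]) (use Cons.prems D(4) in blast)
   have KH: "?K \<subseteq> ?H" by (rule gen_mono) auto
   have EK: "?E \<subseteq> ?K" using gen_base[of "?E \<union> set zs"] by blast
   have zH: "z \<in> ?H" using gen_base[of "?E \<union> set (z # zs)"] by auto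
   show ?case
   proof (rule polycyclic_step[OF R sg_gen _ sg_gen KH _ zH])
    show "?H \<subseteq> ?V" using HD D(2) by blast
    show "cm a b \<in> ?K" if "a \<in> ?H" "b \<in> ?H" for a b using that HD der_cm[of a ?D b] EK by (auto simp: dern_Suc)
    show "?H = gen (insert z ?K)"
    proof
     show "?H \<subseteq> gen (insert z ?K)"
      by (rule gen_least[OF sg_gen]) (use gen_base[of "insert z ?K"] gen_base[of "?E \<union> set zs"] in auto)
     show "gen (insert z ?K) \<subseteq> ?H" by (rule gen_least[OF sg_gen]) (use zH KH in blast)
    qed
    show "polycyclic_seq R {g \<in> carrier R. \<phi> g \<in> ?K}" using Cons by auto
   qed
  qed
  from this[of ys] have "polycyclic_seq R {g \<in> carrier R. \<phi> g \<in> gen (?E \<union> Y)}" using ys Y(2) gen_base[of Y] by simp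
  moreover have "gen (?E \<union> Y) = ?D"
   by (rule gen_eqI[OF D(1)]) (use D(4) Y(2) gen_base[of Y] gen_mono[of Y "?E \<union> Y"] in auto)
  ultimately show ?case by simp
 qed
 moreover have "{g \<in> carrier R. \<phi> g \<in> dern 0 ?V} = carrier R" by auto
 ultimately have "polycyclic_seq R (carrier R)" by (metis le0)
 then show ?thesis unfolding polycyclic_def using R.is_group by blast
qed

text \<open>Every term of the derived series has an element of infinite order modulo the next one.
  Combinations of \<open>k\<close> such elements with coefficients from 0 to \<open>N\<close> differ
  modulo the \<open>k\<close>-th further term, and their length is linear in
  \<open>N\<close>.\<close>

lemma many_elements:
 fixes S :: "'g::group_add set"
 assumes S: "finite S" "slow S" and P: "cone P (gen S)" and ns: "\<And>l. dern l (gen S) \<noteq> {0}"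
 shows "\<exists>c. \<forall>N. \<exists>E. E \<subseteq> dern i (gen S) \<and> E \<subseteq> ball S (c * N) \<and> card E = (N + 1) ^ k \<and>
  (\<forall>u\<in>E. \<forall>v\<in>E. u \<noteq> v --> - u + v \<notin> dern (i + k) (gen S))"
proof (induction k arbitrary: i)
 case 0
 have "{0} \<subseteq> dern i (gen S)" "card {0} = 1" using sg_zero[OF sg_dern[OF sg_gen]] by auto
 then show ?case by (intro exI[of _ 0] allI exI[of _ "{0}"]) (auto simp: ball_zero)
next
 case (Suc k)
 let ?D = "\<lambda>i. dern i (gen S)"
 have sgD: "sg (?D i)" for i by (rule sg_dern[OF sg_gen])
 obtain T where T: "finite T" "?D i = gen T" using slow_dern_fg[OF S] by blast
 have TG: "gen T \<subseteq> gen S" using T(2) dern_sub[OF sg_gen, of i S] by simp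
 have "slow T" by (rule slow_sub[OF S T(1)]) (use TG gen_base[of T] in blast)
 moreover have "gen T \<noteq> {0}" using ns[of i] T(2) by simp
 ultimately obtain x where "x \<in> gen T" "\<And>n. n \<ge> 1 ==> nm n x \<notin> der (gen T)"
  using slow_nontorsion[OF T(1) _ cone_sub[OF P sg_gen TG]] by metis
 then have x: "x \<in> ?D i" "\<And>n. n \<ge> 1 ==> nm n x \<notin> ?D (Suc i)" by (simp_all add: T(2) dern_Suc)
 obtain c0 where c0: "x \<in> ball S c0" using x(1) T(2) TG unfolding gen_def by blast
 obtain c where c: "\<forall>N. \<exists>E. E \<subseteq> ?D (Suc i) \<and> E \<subseteq> ball S (c * N) \<and> card E = (N + 1) ^ k \<and>
  (\<forall>u\<in>E. \<forall>v\<in>E. u \<noteq> v --> - u + v \<notin> ?D (Suc i + k))" using Suc[of "Suc i"] by (elim exE) (rule that)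
 show ?case
 proof (intro exI[of _ "c0 + c"] allI)
  fix N
  obtain E where E: "E \<subseteq> ?D (Suc i)" "E \<subseteq> ball S (c * N)" "card E = (N + 1) ^ k"
   "\<forall>u\<in>E. \<forall>v\<in>E. u \<noteq> v --> - u + v \<notin> ?D (Suc i + k)" using spec[OF c, of N] by (elim exE conjE) (rule that)
  let ?h = "\<lambda>(a, u). nm a x + u" and ?A = "{..N} \<times> E"
  have less: "- (nm a x + u) + (nm b x + v) \<notin> ?D (Suc i)" if uv: "u \<in> E" "v \<in> E" "a < b" for a b u v
  proof
   assume *: "- (nm a x + u) + (nm b x + v) \<in> ?D (Suc i)"
   have "nm b x = nm a x + nm (b - a) x" using uv(3) nm_add[of a "b - a" x] by simp
   then have "- (nm a x + u) + (nm b x + v) = - u + (nm (b - a) x + v)" by (simp add: minus_add add.assoc)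
   then have "nm (b - a) x \<in> ?D (Suc i)"
    using * sg_add_left[OF sgD sg_neg[OF sgD]] sg_add_right[OF sgD] E(1) uv by (metis subsetD)
   then show False using x(2)[of "b - a"] uv(3) by simp
  qed
  have anti: "?D (i + Suc k) \<subseteq> ?D (Suc i)" by (rule dern_anti[OF sg_gen]) simp
  have sep: "- ?h p + ?h q \<notin> ?D (i + Suc k)" if pq: "p \<in> ?A" "q \<in> ?A" "p \<noteq> q" for p q
  proof -
   obtain a u b v where e: "p = (a, u)" "q = (b, v)" "u \<in> E" "v \<in> E" using pq by auto
   consider "a < b" | "b < a" | "a = b" "u \<noteq> v" using pq(3) e by fastforce
   then show ?thesis
   proof cases
    case 1
    then show ?thesis using less[OF e(3,4)] anti e by auto
   next
    case 2
    then have "- ?h q + ?h p \<notin> ?D (i + Suc k)" using less[OF e(4,3)] anti e by auto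
    moreover have "- ?h q + ?h p = - (- ?h p + ?h q)" by (simp add: minus_add)
    ultimately show ?thesis using sg_neg_iff[OF sgD] by metis
   next
    case 3
    then show ?thesis using E(4) e by (simp add: minus_add add.assoc)
   qed
  qed
  have "inj_on ?h ?A"
  proof (rule inj_onI, rule ccontr)
   fix p q assume pq: "p \<in> ?A" "q \<in> ?A" "?h p = ?h q" "p \<noteq> q"
   then show False using sep[OF pq(1,2,4)] sg_zero[OF sgD, of "i + Suc k"] by simp
  qed
  then have cd: "card (?h ` ?A) = (N + 1) ^ Suc k" using E(3) by (simp add: card_image card_cartesian_product)
  have mem: "?h p \<in> ?D i \<and> ?h p \<in> ball S ((c0 + c) * N)" if p: "p \<in> ?A" for p
  proof -
   obtain a u where e: "p = (a, u)" "a \<le> N" "u \<in> E" using p by auto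
   have "nm a x \<in> ball S (c0 * N)" using ball_nm[OF c0, of a] ball_mono[of "a * c0" "c0 * N" S] e(2) by (auto simp: mult.commute)
   then have "?h p \<in> ball S ((c0 + c) * N)" using ball_add[OF _ subsetD[OF E(2) e(3)]] e(1) by (simp add: add_mult_distrib)
   moreover have "u \<in> ?D i" using E(1) e(3) dern_anti[OF sg_gen, of i "Suc i" S] by auto
   ultimately show ?thesis using sg_add[OF sgD sg_nm[OF sgD x(1)]] e(1) by simp
  qed
  show "\<exists>E. E \<subseteq> ?D i \<and> E \<subseteq> ball S ((c0 + c) * N) \<and> card E = (N + 1) ^ Suc k \<and>
   (\<forall>u\<in>E. \<forall>v\<in>E. u \<noteq> v --> - u + v \<notin> ?D (i + Suc k))"
  proof (intro exI[of _ "?h ` ?A"] conjI ballI impI)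
   show "?h ` ?A \<subseteq> ?D i" by (rule image_subsetI) (use mem in blast)
   show "?h ` ?A \<subseteq> ball S ((c0 + c) * N)" by (rule image_subsetI) (use mem in blast)
   fix u v assume uv: "u \<in> ?h ` ?A" "v \<in> ?h ` ?A" "u \<noteq> v"
   then obtain p q where pq: "p \<in> ?A" "q \<in> ?A" "u = ?h p" "v = ?h q" by (elim imageE) (rule that)
   then have "p \<noteq> q" using uv(3) by metis
   from sep[OF pq(1,2) this] show "- u + v \<notin> ?D (i + Suc k)" unfolding pq(3,4) .
  qed (rule cd)
 qed
qed

text \<open>The quotient by the intersection \<open>K\<close> of the derived series maps onto the
  solvable quotients, which are polycyclic. The elements of \<open>many_elements\<close> are
  distinct modulo a derived subgroup, hence modulo \<open>K\<close>, so the quotient outgrows every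
  polynomial; a virtually nilpotent group could not.\<close>

lemma residually_polycyclic_quotient:
 fixes S :: "'g::group_add set"
 assumes S: "finite S" "slow S" and P: "cone P (gen S)" and ns: "\<And>l. dern l (gen S) \<noteq> {0}"
 obtains G :: "nat monoid" and A where "group G" "infinite (carrier G)" "finite_generating_set G A" "residually_polycyclic G"
  "\<not> polynomial_growth G A" "\<not> virtually_nilpotent G" "\<And>n. growth G A n \<le> card (ball S n)"
proof -
 let ?D = "\<lambda>i. dern i (gen S)"
 define K where "K = (\<Inter>i. ?D i)"
 have sgD: "sg (?D i)" "?D i \<subseteq> gen S" "nrm (gen S) (?D i)" for i
  by (rule sg_dern[OF sg_gen], rule dern_sub[OF sg_gen], rule nrm_dern[OF nrm_self[OF sg_gen]])
 have KD: "K \<subseteq> ?D i" for i by (auto simp: K_def)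
 have "sg K" by (rule sgI) (simp_all add: K_def sg_zero sg_add sg_neg sgD(1))
 moreover have "nrm (gen S) K" unfolding nrm_def K_def by (intro ballI INT_I nrmD[OF sgD(3)]) (assumption, erule INT_D, rule UNIV_I)
 ultimately have K: "sg K" "K \<subseteq> gen S" "nrm (gen S) K" "K \<subseteq> ?D i" for i using KD KD[of 0] by auto
 obtain f :: "'g \<Rightarrow> 'g set bijn" where f: "hm f (gen S)" "\<And>u. u \<in> gen S ==> f u = 0 \<longleftrightarrow> u \<in> K"
  using ex_quotient_hom[OF sg_gen K(1,2,3)] by blast
 let ?V = "f ` gen S"
 have Vg: "?V = gen (f ` S)" by (rule hm_gen[OF f(1) sg_gen gen_base])
 have V: "sg ?V" "countable ?V" using hm_sg_image[OF f(1) sg_gen sg_gen order_refl] countable_gen[OF S(1)] by auto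
 obtain G :: "nat monoid" and \<psi> where G: "emb G \<psi>" "\<psi> ` carrier G = ?V" using nat_copy[OF V] by blast
 interpret G: group G by (rule embD[OF G(1)])
 have feq: "- u + v \<in> K" if "u \<in> gen S" "v \<in> gen S" "f u = f v" for u v
 proof -
  have "f (- u + v) = 0" using hmD[OF f(1) sg_neg[OF sg_gen that(1)] that(2)] hm_neg[OF f(1) sg_gen that(1)] that(3) by simp
  then show ?thesis using f(2) sg_add[OF sg_gen sg_neg[OF sg_gen that(1)] that(2)] by blast
 qed
 define A where "A = {g \<in> carrier G. \<psi> g \<in> f ` S}"
 have "f ` S \<subseteq> \<psi> ` carrier G" unfolding G(2) by (rule image_mono[OF gen_base])
 have "f ` S \<subseteq> \<psi> ` A"
 proof
  fix v assume v: "v \<in> f ` S"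
  obtain g where "g \<in> carrier G" "v = \<psi> g" by (rule imageE[OF subsetD[OF \<open>f ` S \<subseteq> \<psi> ` carrier G\<close> v]])
  then show "v \<in> \<psi> ` A" using v by (simp add: A_def)
 qed
 moreover have "A \<subseteq> carrier G" "\<psi> ` A \<subseteq> f ` S" by (auto simp: A_def)
 ultimately have A: "A \<subseteq> carrier G" "\<psi> ` A = f ` S" by auto
 have fA: "finite A"
  by (rule finite_imageD[OF _ inj_on_subset[OF embD(2)[OF G(1)] A(1)]]) (use A(2) S(1) in simp)
 have "\<psi> ` generate G A = \<psi> ` carrier G" using emb_generate[OF G(1) A(1)] A(2) Vg G(2) by simp
 then have "generate G A = carrier G" using inj_on_image_eq_iff[OF embD(2)[OF G(1)] G.generate_incl[OF A(1)]] by blast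
 then have gs: "finite_generating_set G A" using fA A(1) by (simp add: finite_generating_set_def)
 note g = emb_growth[OF G(1) gs, unfolded A(2)]
 have ball: "ball (f ` S) n = f ` ball S n" for n using hm_ball[OF f(1) sg_gen gen_base] by simp
 have np: "\<not> poly_ball (f ` S)"
 proof
  assume "poly_ball (f ` S)"
  then obtain B d where B: "\<And>n. card (ball (f ` S) n) \<le> B * (n + 1) ^ d" by (auto simp: poly_ball_def)
  obtain c where c: "\<forall>N. \<exists>E. E \<subseteq> ?D 0 \<and> E \<subseteq> ball S (c * N) \<and> card E = (N + 1) ^ Suc d \<and>
   (\<forall>u\<in>E. \<forall>v\<in>E. u \<noteq> v --> - u + v \<notin> ?D (0 + Suc d))" using many_elements[OF S P ns, of 0 "Suc d"] by (elim exE) (rule that)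
  \<comment> \<open>Chosen so that polynomial growth of degree \<open>d\<close> would give
    \<open>(N + 1) ^ Suc d \<le> N * (N + 1) ^ d\<close>.\<close>
  define N where "N = B * (c + 1) ^ d"
  obtain E where E: "E \<subseteq> ?D 0" "E \<subseteq> ball S (c * N)" "card E = (N + 1) ^ Suc d"
   "\<forall>u\<in>E. \<forall>v\<in>E. u \<noteq> v --> - u + v \<notin> ?D (0 + Suc d)" using spec[OF c, of N] by (elim exE conjE) (rule that)
  have "inj_on f E" using feq E(1,4) K(4)[of "0 + Suc d"] unfolding inj_on_def by (metis dern_0 subsetD)
  then have "(N + 1) ^ Suc d = card (f ` E)" using E(3) by (simp add: card_image)
  also have "\<dots> \<le> card (ball (f ` S) (c * N))" unfolding ball by (intro card_mono finite_imageI finite_ball S image_mono E)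
  also have "\<dots> \<le> B * (c * N + 1) ^ d" by (rule B)
  also have "\<dots> \<le> B * ((c + 1) * (N + 1)) ^ d" by (intro mult_le_mono2 power_mono) auto
  also have "\<dots> = N * (N + 1) ^ d" by (simp only: power_mult_distrib N_def mult.assoc)
  finally show False by simp
 qed
 have "infinite (carrier G)"
 proof
  assume "finite (carrier G)"
  then have "finite ?V" using G(2) by (metis finite_imageI)
  then have "card (ball (f ` S) n) \<le> card ?V * (n + 1) ^ 0" for n using card_mono[of ?V "ball (f ` S) n"] ball_gen[of "f ` S" n] Vg by simp
  then show False using np unfolding poly_ball_def by blast
 qed
 moreover have "growth G A n \<le> card (ball S n)" for n unfolding g(3) ball by (intro card_image_le finite_ball S)
 moreover have "residually_polycyclic G" unfolding residually_polycyclic_def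
 proof (intro conjI ballI impI)
  fix x assume x: "x \<in> carrier G" "x \<noteq> \<one>\<^bsub>G\<^esub>"
  obtain u where u: "u \<in> gen S" "\<psi> x = f u" using G(2) x(1) by blast
  have "f u \<noteq> 0" using inj_onD[OF embD(2)[OF G(1)] _ x(1), of "\<one>\<^bsub>G\<^esub>"] emb_one[OF G(1)] u(2) x(2) by auto
  then obtain i where i: "u \<notin> ?D i" using f(2)[OF u(1)] by (auto simp: K_def)
  obtain q :: "'g \<Rightarrow> 'g set bijn" where q: "hm q (gen S)" "\<And>u. u \<in> gen S ==> q u = 0 \<longleftrightarrow> u \<in> ?D i"
   using ex_quotient_hom[OF sg_gen sgD] by blast
  have "sg (q ` gen S)" "countable (q ` gen S)" using hm_sg_image[OF q(1) sg_gen sg_gen order_refl] countable_gen[OF S(1)] by auto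
  then obtain R :: "nat monoid" and \<chi> where R: "emb R \<chi>" "\<chi> ` carrier R = q ` gen S" by (rule nat_copy)
  have "polycyclic R"
  proof (rule polycyclic_of_dern[OF R(1)])
   show "\<exists>Y. finite Y \<and> dern j (\<chi> ` carrier R) = gen Y" for j
   proof -
    obtain Y where Y: "finite Y" "?D j = gen Y" using slow_dern_fg[OF S] by blast
    have "Y \<subseteq> gen S" using Y(2) gen_base[of Y] sgD(2)[of j] by blast
    then have "q ` ?D j = gen (q ` Y)" using hm_gen[OF q(1) sg_gen] Y(2) by simp
    then show ?thesis using Y(1) hm_dern[OF q(1) sg_gen] R(2) by (metis finite_imageI)
   qed
   have "q ` ?D i = {0}" using q(2) sgD(2)[of i] sg_zero[OF sgD(1), of i] by force
   then show "dern i (\<chi> ` carrier R) = {0}" using hm_dern[OF q(1) sg_gen, of i] R(2) by simp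
  qed
  \<comment> \<open>The map induced by \<open>q\<close> on the image of \<open>f\<close>; it does
    not depend on the chosen preimage because \<open>K\<close> is contained in the kernel of
    \<open>q\<close>.\<close>
  define F where "F v = q (inv_into (gen S) f v)" for v
  have Ff: "F (f w) = q w" if w: "w \<in> gen S" for w
  proof -
   let ?s = "inv_into (gen S) f (f w)"
   have s: "?s \<in> gen S" "f ?s = f w" using w by (auto intro: inv_into_into f_inv_into_f)
   then have "- ?s + w \<in> ?D i" using feq[OF s(1) w] K(4) by blast
   then have "q (- ?s + w) = 0" using q(2) sg_add[OF sg_gen sg_neg[OF sg_gen s(1)] w] by blast
   then have "- q ?s + q w = 0" using hmD[OF q(1) sg_neg[OF sg_gen s(1)] w] hm_neg[OF q(1) sg_gen s(1)] by simp
   then show ?thesis unfolding F_def by (metis add.left_inverse add_left_cancel)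
  qed
  define h where "h x = inv_into (carrier R) \<chi> (F (\<psi> x))" for x
  have hx: "h x \<in> carrier R" "\<chi> (h x) = F (\<psi> x)" if "x \<in> carrier G" for x
  proof -
   obtain w where "w \<in> gen S" "\<psi> x = f w" using G(2) \<open>x \<in> carrier G\<close> by blast
   then have "F (\<psi> x) \<in> \<chi> ` carrier R" using Ff R(2) by auto
   then show "h x \<in> carrier R" "\<chi> (h x) = F (\<psi> x)" unfolding h_def by (rule inv_into_into, rule f_inv_into_f)
  qed
  interpret R: group R by (rule embD[OF R(1)])
  have "h \<in> hom G R"
  proof (rule homI)
   fix y z assume yz: "y \<in> carrier G" "z \<in> carrier G"
   obtain v w where vw: "v \<in> gen S" "w \<in> gen S" "\<psi> y = f v" "\<psi> z = f w" using G(2) yz by (metis imageE imageI)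
   have "\<chi> (h (y \<otimes>\<^bsub>G\<^esub> z)) = F (f (v + w))" using hx yz vw embD(3)[OF G(1) yz] hmD[OF f(1) vw(1,2)] by simp
   also have "\<dots> = \<chi> (h y) + \<chi> (h z)" using hx yz vw Ff hmD[OF q(1) vw(1,2)] sg_add[OF sg_gen vw(1,2)] by simp
   also have "\<dots> = \<chi> (h y \<otimes>\<^bsub>R\<^esub> h z)" using embD(3)[OF R(1)] hx yz by simp
   finally show "h (y \<otimes>\<^bsub>G\<^esub> z) = h y \<otimes>\<^bsub>R\<^esub> h z" using inj_onD[OF embD(2)[OF R(1)]] hx yz by simp
  qed (use hx in blast)
  moreover have "h x \<noteq> \<one>\<^bsub>R\<^esub>" using hx(2)[OF x(1)] u Ff q(2)[OF u(1)] i emb_one[OF R(1)] by auto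
  ultimately show "\<exists>(P :: nat monoid) h. polycyclic P \<and> h \<in> hom G P \<and> h x \<noteq> \<one>\<^bsub>P\<^esub>" using \<open>polycyclic R\<close> by blast
 qed (rule G.is_group)
 moreover have "\<not> polynomial_growth G A" using np emb_polynomial_growth[OF G(1) gs] A(2) by simp
 moreover have "\<not> virtually_nilpotent G"
 proof
  assume "virtually_nilpotent G"
  then obtain H c where "sg H" "H \<subseteq> gen (f ` S)" "finite (cos (gen (f ` S)) H)" "lcs H c = {0}"
   unfolding emb_virtually_nilpotent[OF G(1)] G(2) Vg by blast
  then show False using np virtually_nilpotent_poly_ball[of "f ` S"] S(1) by blast
 qed
 ultimately show ?thesis using that[of G A] G.is_group gs by blast
qed

lemma growth_le_trans_pointwise:
 "growth_le f g ==> (\<And>n. g n \<le> h n) ==> growth_le f h"  "(\<And>n. h n \<le> f n) ==> growth_le f g ==> growth_le h g"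
 unfolding growth_le_def by (meson order_trans)+

text \<open>One dichotomy serves both versions of the gap property: either the derived series
  terminates, or the quotient is a counterexample to both properties among residually polycyclic
  groups.\<close>

lemma square_root_gap:
 fixes G :: "'a monoid"
 assumes "group G" "finite_generating_set G A" "right_orderable G"
  and gap: "\<not> growth_le (\<lambda>n. exp (real n powr (1/2))) (\<lambda>n. real (growth G A n))"
 obtains "virtually_nilpotent G" "polynomial_growth G A"
 | Q :: "nat monoid" and B where "group Q" "infinite (carrier Q)" "finite_generating_set Q B" "residually_polycyclic Q"
  "\<not> polynomial_growth Q B" "\<not> virtually_nilpotent Q" "\<And>n. real (growth Q B n) \<le> real (growth G A n)"
proof -
 obtain \<phi> :: "'a \<Rightarrow> 'a bijn" where e: "emb G \<phi>" using cayley[OF assms(1)] by blast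
 note g = emb_growth[OF e assms(2)]
 have slow: "slow (\<phi> ` A)" using slow_growth[OF g(1)] gap unfolding g(3) by blast
 show thesis
 proof (cases "\<exists>l. dern l (gen (\<phi> ` A)) = {0}")
  case True
  then show ?thesis using solvable_case[OF e assms(2) slow] that(1) by blast
 next
  case False
  obtain P where P: "cone P (gen (\<phi> ` A))" using emb_cone[OF e assms(3)] g(2) by auto
  obtain Q :: "nat monoid" and B where "group Q" "infinite (carrier Q)" "finite_generating_set Q B" "residually_polycyclic Q"
   "\<not> polynomial_growth Q B" "\<not> virtually_nilpotent Q" "\<And>n. growth Q B n \<le> card (ball (\<phi> ` A) n)"
   by (rule residually_polycyclic_quotient[OF g(1) slow P]) (use False in blast, rule that, assumption+)
  then show ?thesis using that(2)[of Q B] by (simp add: g(3))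
 qed
qed

theorem theorem7p1:
  shows "(gap_property (1/6) (right_orderable :: 'a monoid \<Rightarrow> bool) \<and>
          strong_gap_property (1/6) (right_orderable :: 'a monoid \<Rightarrow> bool)) \<and>
         (gap_property (1/2) (residually_polycyclic :: nat monoid \<Rightarrow> bool) \<longrightarrow>
          gap_property (1/2) (right_orderable :: 'a monoid \<Rightarrow> bool)) \<and>
         (strong_gap_property (1/2) (residually_polycyclic :: nat monoid \<Rightarrow> bool) \<longrightarrow>
          strong_gap_property (1/2) (right_orderable :: 'a monoid \<Rightarrow> bool))"
proof (intro conjI impI)
  show "gap_property (1/6) (right_orderable :: 'a monoid \<Rightarrow> bool)"
    unfolding gap_property_def growth_less_def using sixth_root_gap by blast
  show "strong_gap_property (1/6) (right_orderable :: 'a monoid \<Rightarrow> bool)"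
    unfolding strong_gap_property_def using sixth_root_gap by blast
next
  assume gap: "gap_property (1/2) (residually_polycyclic :: nat monoid \<Rightarrow> bool)"
  show "gap_property (1/2) (right_orderable :: 'a monoid \<Rightarrow> bool)"
    unfolding gap_property_def growth_less_def
  proof (intro allI impI, elim conjE)
    fix G :: "'a monoid" and A
    assume G: "group G" "finite_generating_set G A" "right_orderable G"
      and up: "growth_le (\<lambda>n. real (growth G A n)) (\<lambda>n. exp (real n powr (1/2)))"
      and no: "\<not> growth_le (\<lambda>n. exp (real n powr (1/2))) (\<lambda>n. real (growth G A n))"
    show "polynomial_growth G A"
    proof (rule square_root_gap[OF G no])
      fix Q :: "nat monoid" and B
      assume Q: "group Q" "infinite (carrier Q)" "finite_generating_set Q B" "residually_polycyclic Q" "\<not> polynomial_growth Q B"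
        and le: "\<And>n. real (growth Q B n) \<le> real (growth G A n)"
      have tr: "growth_le f (\<lambda>n. real (growth G A n))" if "growth_le f (\<lambda>n. real (growth Q B n))" for f
        using that le by (rule growth_le_trans_pointwise(1))
      \<comment> \<open>The growth of the quotient is bounded by that of \<open>G\<close>, so it
        stays below exp(n^(1/2)); if it reached this function, so would the growth of
        \<open>G\<close>.\<close>
      have "growth_less (\<lambda>n. real (growth Q B n)) (\<lambda>n. exp (real n powr (1/2)))"
        unfolding growth_less_def using tr growth_le_trans_pointwise(2)[OF le up] no by blast
      then show ?thesis using gap Q unfolding gap_property_def by blast
    qed
  qed
next
  assume gap: "strong_gap_property (1/2) (residually_polycyclic :: nat monoid \<Rightarrow> bool)"
  show "strong_gap_property (1/2) (right_orderable :: 'a monoid \<Rightarrow> bool)"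
    unfolding strong_gap_property_def
  proof (intro allI impI, elim conjE, rule ccontr)
    fix G :: "'a monoid" and A
    assume G: "group G" "finite_generating_set G A" "right_orderable G" "\<not> virtually_nilpotent G"
      and no: "\<not> growth_le (\<lambda>n. exp (real n powr (1/2))) (\<lambda>n. real (growth G A n))"
    show False
    proof (rule square_root_gap[OF G(1,2,3) no])
      fix Q :: "nat monoid" and B
      assume Q: "group Q" "infinite (carrier Q)" "finite_generating_set Q B" "residually_polycyclic Q" "\<not> virtually_nilpotent Q"
        and le: "\<And>n. real (growth Q B n) \<le> real (growth G A n)"
      have "growth_le (\<lambda>n. exp (real n powr (1/2))) (\<lambda>n. real (growth Q B n))"
        using gap Q unfolding strong_gap_property_def by blast
      then have "growth_le (\<lambda>n. exp (real n powr (1/2))) (\<lambda>n. real (growth G A n))"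
        using le by (rule growth_le_trans_pointwise(1))
      then show ?thesis using no by blast
    qed (use G(4) in blast)
  qed
qed

end
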